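(* Let $n\ge2$, $N\ge2$, let $\Omega\subset\mathbb{R}^n$ be a bounded smooth domain, $p>1$ and $\beta\in(0,1)$. Let $\boldsymbol f=(f^1,\dots,f^N):\Omega\to\mathbb{R}^N$ satisfy $\boldsymbol f\in W^{1,1}_{loc}(\Omega)\cap C^{0,\beta}_{loc}(\Omega)$, and let $\boldsymbol u\in C^1(\Omega)$ be a weak solution of $$-\operatorname{\bf div}(|D\boldsymbol u|^{p-2}D\boldsymbol u)=\boldsymbol f(x)\ \text{ in }\Omega,\qquad\boldsymbol u=0\ \text{ on }\partial\Omega .$$ Then: (i) if $p>\frac32$, then $|D\boldsymbol u|^{p-2}D\boldsymbol u\in W^{1,2}_{loc}(\Omega)$; (ii) if $1<p<3$, then $\boldsymbol u\in W^{2,2}_{loc}(\Omega)$; (iii) if $p\ge3$ and for some $i\in\{1,\dots,N\}$ and some constant $\tau$ one has $f^i\ge\tau>0$ in $\Omega$, then $\boldsymbol u\in W^{2,q}_{loc}(\Omega)$ for every $1\le q<\frac{p-1}{p-2}$.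
   Context: Vector fields are $\boldsymbol u=(u^1,\dots,u^N):\Omega\to\mathbb{R}^N$, $D\boldsymbol u$ is the $N\times n$ Jacobian with rows $\nabla u^\ell$, $|D\boldsymbol u|$ is its Euclidean (Frobenius) norm, and $\mathcal M:\mathcal N=\sum_{i,j}\mathcal M^i_j\mathcal N^i_j$ for matrices. Function spaces of vector- or matrix-valued maps are understood componentwise. Weak solution: $\boldsymbol u\in W^{1,p}_0(\Omega;\mathbb{R}^N)$ and $$\int_\Omega|D\boldsymbol u|^{p-2}D\boldsymbol u:D\boldsymbol\varphi\,dx=\int_\Omega\langle\boldsymbol f,\boldsymbol\varphi\rangle\,dx\qquad\forall\,\boldsymbol\varphi\in W^{1,p}_0(\Omega;\mathbb{R}^N).$$ *)

theory Defs
  imports "HOL-Analysis.Analysis"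
begin

section \<open>Classical derivatives, smooth functions and smooth domains\<close>

definition partial_deriv ::
  "'n \<Rightarrow> (real ^ 'n::finite \<Rightarrow> 'b::real_normed_vector) \<Rightarrow> real ^ 'n \<Rightarrow> 'b" where
  "partial_deriv j f = (\<lambda>x. frechet_derivative f (at x) (axis j 1))"

text \<open>A multi-index is represented by a list of coordinate directions, its order being the length
  of the list; the order of the entries is immaterial for the smooth functions below.\<close>

primrec iter_deriv ::
  "'n list \<Rightarrow> (real ^ 'n::finite \<Rightarrow> 'b::real_normed_vector) \<Rightarrow> real ^ 'n \<Rightarrow> 'b" where
  "iter_deriv [] f = f"
| "iter_deriv (j # \<alpha>) f = partial_deriv j (iter_deriv \<alpha> f)"

text \<open>For open sets only.\<close>

definition Ck_on ::
  "nat \<Rightarrow> (real ^ 'n::finite) set \<Rightarrow> (real ^ 'n \<Rightarrow> 'b::real_normed_vector) set" where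
  "Ck_on k \<Omega> = {f.
     (\<forall>\<alpha>. length \<alpha> < k \<longrightarrow> (\<forall>x\<in>\<Omega>. iter_deriv \<alpha> f differentiable (at x))) \<and>
     (\<forall>\<alpha>. length \<alpha> \<le> k \<longrightarrow> continuous_on \<Omega> (iter_deriv \<alpha> f))}"

definition smooth_on ::
  "(real ^ 'n::finite) set \<Rightarrow> (real ^ 'n \<Rightarrow> 'b::real_normed_vector) set" where
  "smooth_on \<Omega> = (\<Inter>k. Ck_on k \<Omega>)"

definition test_functions :: "(real ^ 'n::finite) set \<Rightarrow> (real ^ 'n \<Rightarrow> real) set" where
  "test_functions \<Omega> = {\<phi>. \<phi> \<in> smooth_on UNIV \<and>
     compact (closure {x. \<phi> x \<noteq> 0}) \<and> closure {x. \<phi> x \<noteq> 0} \<subseteq> \<Omega>}"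

text \<open>The boundary is locally the graph of a smooth function over a coordinate hyperplane, with the
  set on one side of it. A function \<open>\<gamma>\<close> of the remaining \<open>n - 1\<close> coordinates is written as a function
  on the whole space that does not depend on the \<open>j\<close>-th coordinate; the sign \<open>s\<close> is the orientation
  of the \<open>j\<close>-th axis.\<close>

definition smooth_boundary :: "(real ^ 'n::finite) set \<Rightarrow> bool" where
  "smooth_boundary \<Omega> \<longleftrightarrow>
     (\<forall>x0\<in>frontier \<Omega>. \<exists>r>0. \<exists>j. \<exists>s\<in>{1, -1::real}. \<exists>\<gamma> :: real ^ 'n \<Rightarrow> real.
        \<gamma> \<in> smooth_on UNIV \<and> (\<forall>x t. \<gamma> (x + t *\<^sub>R axis j 1) = \<gamma> x) \<and>
        \<Omega> \<inter> ball x0 r = {x \<in> ball x0 r. s * x $ j > \<gamma> x})"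

definition bounded_smooth_domain :: "(real ^ 'n::finite) set \<Rightarrow> bool" where
  "bounded_smooth_domain \<Omega> \<longleftrightarrow>
     open \<Omega> \<and> connected \<Omega> \<and> \<Omega> \<noteq> {} \<and> bounded \<Omega> \<and> smooth_boundary \<Omega>"


section \<open>Function spaces of scalar functions\<close>

text \<open>Functions on \<open>\<Omega>\<close> are total functions whose values outside \<open>\<Omega>\<close> play no role; elements of
  Lebesgue and Sobolev spaces are functions rather than classes of functions equal almost
  everywhere, and membership is invariant under change on a null set.\<close>

definition holder_loc :: "real \<Rightarrow> (real ^ 'n::finite) set \<Rightarrow> (real ^ 'n \<Rightarrow> real) set" where
  "holder_loc \<beta> \<Omega> = {g. \<forall>K. compact K \<and> K \<subseteq> \<Omega> \<longrightarrow>
     (\<exists>C. \<forall>x\<in>K. \<forall>y\<in>K. \<bar>g x - g y\<bar> \<le> C * dist x y powr \<beta>)}"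

definition locally_integrable :: "(real ^ 'n::finite) set \<Rightarrow> (real ^ 'n \<Rightarrow> real) set" where
  "locally_integrable \<Omega> = {g. \<forall>K. compact K \<and> K \<subseteq> \<Omega> \<longrightarrow> g absolutely_integrable_on K}"

definition Lp :: "real \<Rightarrow> (real ^ 'n::finite) set \<Rightarrow> (real ^ 'n \<Rightarrow> real) set" where
  "Lp p \<Omega> = {g. g \<in> borel_measurable (lebesgue_on \<Omega>) \<and>
     integrable (lebesgue_on \<Omega>) (\<lambda>x. \<bar>g x\<bar> powr p)}"

definition has_weak_deriv ::
  "(real ^ 'n::finite) set \<Rightarrow> 'n list \<Rightarrow> (real ^ 'n \<Rightarrow> real) \<Rightarrow> (real ^ 'n \<Rightarrow> real) \<Rightarrow> bool" where
  "has_weak_deriv \<Omega> \<alpha> g h \<longleftrightarrow>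
     g \<in> locally_integrable \<Omega> \<and> h \<in> locally_integrable \<Omega> \<and>
     (\<forall>\<phi>\<in>test_functions \<Omega>.
        (LINT x|lebesgue_on \<Omega>. g x * iter_deriv \<alpha> \<phi> x)
          = (-1) ^ length \<alpha> * (LINT x|lebesgue_on \<Omega>. h x * \<phi> x))"

text \<open>Determined almost everywhere on \<open>\<Omega>\<close> if the weak derivative exists.\<close>

definition weak_deriv ::
  "(real ^ 'n::finite) set \<Rightarrow> 'n list \<Rightarrow> (real ^ 'n \<Rightarrow> real) \<Rightarrow> real ^ 'n \<Rightarrow> real" where
  "weak_deriv \<Omega> \<alpha> g = (SOME h. has_weak_deriv \<Omega> \<alpha> g h)"

definition sobolev ::
  "nat \<Rightarrow> real \<Rightarrow> (real ^ 'n::finite) set \<Rightarrow> (real ^ 'n \<Rightarrow> real) set" where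
  "sobolev k p \<Omega> = {g. \<forall>\<alpha>. length \<alpha> \<le> k \<longrightarrow> (\<exists>h\<in>Lp p \<Omega>. has_weak_deriv \<Omega> \<alpha> g h)}"

definition sobolev_loc ::
  "nat \<Rightarrow> real \<Rightarrow> (real ^ 'n::finite) set \<Rightarrow> (real ^ 'n \<Rightarrow> real) set" where
  "sobolev_loc k p \<Omega> = {g. \<forall>\<Omega>'. open \<Omega>' \<and> compact (closure \<Omega>') \<and> closure \<Omega>' \<subseteq> \<Omega> \<longrightarrow>
     g \<in> sobolev k p \<Omega>'}"

definition sobolev_norm ::
  "nat \<Rightarrow> real \<Rightarrow> (real ^ 'n::finite) set \<Rightarrow> (real ^ 'n \<Rightarrow> real) \<Rightarrow> real" where
  "sobolev_norm k p \<Omega> g =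
     (\<Sum>\<alpha> | length \<alpha> \<le> k. LINT x|lebesgue_on \<Omega>. \<bar>weak_deriv \<Omega> \<alpha> g x\<bar> powr p) powr (1 / p)"

text \<open>The closure of the test functions in the Sobolev norm.\<close>

definition sobolev0 ::
  "nat \<Rightarrow> real \<Rightarrow> (real ^ 'n::finite) set \<Rightarrow> (real ^ 'n \<Rightarrow> real) set" where
  "sobolev0 k p \<Omega> = {g \<in> sobolev k p \<Omega>.
     \<exists>\<phi>. (\<forall>i. \<phi> i \<in> test_functions \<Omega>) \<and>
         (\<lambda>i. sobolev_norm k p \<Omega> (\<lambda>x. \<phi> i x - g x)) \<longlonglongrightarrow> 0}"


section \<open>Vector fields and weak solutions\<close>

definition componentwise :: "('a \<Rightarrow> real) set \<Rightarrow> ('a \<Rightarrow> 'b::euclidean_space) set" where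
  "componentwise X = {f. \<forall>b\<in>Basis. (\<lambda>x. f x \<bullet> b) \<in> X}"

lemma componentwise_vec:
  fixes f :: "'a \<Rightarrow> real ^ 'm::finite"
  shows "f \<in> componentwise X \<longleftrightarrow> (\<forall>l. (\<lambda>x. f x $ l) \<in> X)"
  by (auto simp: componentwise_def Basis_vec_def inner_axis)

lemma componentwise_matrix:
  fixes f :: "'a \<Rightarrow> real ^ 'n::finite ^ 'm::finite"
  shows "f \<in> componentwise X \<longleftrightarrow> (\<forall>l j. (\<lambda>x. f x $ l $ j) \<in> X)"
  by (auto simp: componentwise_def Basis_vec_def inner_axis)

definition weak_jacobian ::
  "(real ^ 'n::finite) set \<Rightarrow> (real ^ 'n \<Rightarrow> real ^ 'm::finite) \<Rightarrow> real ^ 'n \<Rightarrow> real ^ 'n ^ 'm" where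
  "weak_jacobian \<Omega> u = (\<lambda>x. \<chi> l j. weak_deriv \<Omega> [j] (\<lambda>y. u y $ l) x)"

text \<open>On matrices, \<open>norm\<close> is the Frobenius norm and \<open>\<bullet>\<close> the associated inner product. The value at
  \<open>A = 0\<close> is \<open>0\<close> for every \<open>p\<close>.\<close>

definition p_flux :: "real \<Rightarrow> real ^ 'n::finite ^ 'm::finite \<Rightarrow> real ^ 'n ^ 'm" where
  "p_flux p A = norm A powr (p - 2) *\<^sub>R A"

text \<open>Weak solutions of the Dirichlet problem for the \<open>p\<close>-Laplace system. For merely locally bounded
  \<open>f\<close>, the right-hand side need not be integrable for every \<open>\<phi>\<close>; that it is meaningful is part of
  the identity. The left-hand side is always integrable, by Hoelder's inequality.\<close>

definition weak_solution ::
  "real \<Rightarrow> (real ^ 'n::finite) set \<Rightarrow> (real ^ 'n \<Rightarrow> real ^ 'm::finite) \<Rightarrow> (real ^ 'n \<Rightarrow> real ^ 'm) \<Rightarrow> bool"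
  where
  "weak_solution p \<Omega> f u \<longleftrightarrow>
     u \<in> componentwise (sobolev0 1 p \<Omega>) \<and>
     (\<forall>\<phi> \<in> componentwise (sobolev0 1 p \<Omega>).
        integrable (lebesgue_on \<Omega>) (\<lambda>x. f x \<bullet> \<phi> x) \<and>
        (LINT x|lebesgue_on \<Omega>. p_flux p (weak_jacobian \<Omega> u x) \<bullet> weak_jacobian \<Omega> \<phi> x)
          = (LINT x|lebesgue_on \<Omega>. f x \<bullet> \<phi> x))"

end

(*
Let P = Du, s = |P| and A(P) = |P|^(p-2) P. Difference quotients of the equation, tested with a
vector field Phi, are bounded by sup |Phi| times the L1 norm of Df, uniformly in the step; this is
all that f in W^{1,1} is used for.

Where P does not vanish the system is uniformly elliptic on compact sets. Testing with a cutoff times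
the difference of two difference quotients of u, which is uniformly small because u is C^1, shows
that the difference quotients of P form a Cauchy sequence in L2, so P has second derivatives G there.

Testing with psi^2 c(P) d_i u, where c is a truncation of s^(-alpha) near P = 0, and summing over i
gives the integrability of psi^2 s^(p-2-alpha) |G|^2 for 0 <= alpha < min(1, p-1): the derivative of
the weight produces a term that the symmetry of second derivatives allows to absorb. Here
alpha = max(0, 2-p) yields (i) and alpha = max(0, p-2) yields (ii). For (iii), testing the i-th
equation with psi^2 times a truncation of s^(-r), r < p-1, and using f^i >= tau bounds the integral
of s^(-r), and |G|^q <= s^(p-2-alpha) |G|^2 + s^(-r) with r = (p-2) q and alpha = (p-2)(q-1).

These derivatives are the weak ones on the whole domain since a truncation that vanishes near P = 0
can be removed in the integration by parts.
*)
theory Submission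
  imports Defs
begin

section \<open>Compactly supported continuously differentiable functions\<close>

text \<open>\<open>P = Du\<close> is merely continuous, so a C^1 test field cannot contain a
  nonlinear function of \<open>P\<close>. Weights are therefore evaluated at the matrix
  \<open>U n\<close> of difference quotients of u: it is C^1 because u is, it converges uniformly to
  \<open>P\<close>, and a weight that vanishes for small arguments keeps all these test fields
  inside one compact set on which \<open>P\<close> has no zero. Strong L2 convergence of the
  quotients of \<open>P\<close> is proved, rather than a bound, because flux and weights are
  nonlinear: a fast subsequence converges almost everywhere below an L2 majorant, and every later
  limit is dominated convergence. The test fields being only C^1, the analysis is done with
  compactly supported C^1 functions; mollification connects them with the smooth test functions in
  the definitions of weak derivatives and of \<open>sobolev0\<close>. The exponents come from the
  coercivity constant min(1, (p-1)(1-\<alpha>), p-1-\<alpha>) of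
  \<open>structure_inequality\<close>, positive exactly for \<alpha> < 1 and \<alpha> < p - 1. The
  value \<alpha> = 2 - p is admissible for p > 3/2, and \<alpha> = p - 2 for p < 3.\<close>

definition C1c :: "(real ^ 'n::finite) set \<Rightarrow> (real ^ 'n \<Rightarrow> real) \<Rightarrow> (real ^ 'n \<Rightarrow> real ^ 'n) \<Rightarrow> bool" where
  "C1c S \<phi> \<phi>' \<longleftrightarrow> (\<forall>x. (\<phi> has_derivative (\<lambda>v. \<phi>' x \<bullet> v)) (at x)) \<and> continuous_on UNIV \<phi>' \<and>
     (\<exists>K. compact K \<and> K \<subseteq> S \<and> (\<forall>x. x \<notin> K \<longrightarrow> \<phi> x = 0 \<and> \<phi>' x = 0))"

lemma C1cD:
  assumes "C1c S \<phi> \<phi>'"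
  shows "(\<phi> has_derivative (\<lambda>v. \<phi>' x \<bullet> v)) (at x)" "continuous_on UNIV \<phi>'" "continuous_on UNIV \<phi>"
  using assms by (auto simp: C1c_def intro!: continuous_at_imp_continuous_on has_derivative_continuous)

lemma C1cI:
  assumes "\<And>x. (\<phi> has_derivative (\<lambda>v. \<phi>' x \<bullet> v)) (at x)" "continuous_on UNIV \<phi>'" "compact K" "K \<subseteq> S"
    "\<And>x. x \<notin> K \<Longrightarrow> \<phi> x = 0" "\<And>x. x \<notin> K \<Longrightarrow> \<phi>' x = 0"
  shows "C1c S \<phi> \<phi>'"
  using assms unfolding C1c_def by blast

lemma C1c_support:
  assumes "C1c S \<phi> \<phi>'"
  obtains K where "compact K" "K \<subseteq> S" "\<And>x. x \<notin> K \<Longrightarrow> \<phi> x = 0" "\<And>x. x \<notin> K \<Longrightarrow> \<phi>' x = 0"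
  using assms by (auto simp: C1c_def)

lemma C1c_outside: "C1c S \<phi> \<phi>' \<Longrightarrow> x \<notin> S \<Longrightarrow> \<phi> x = 0" "C1c S \<phi> \<phi>' \<Longrightarrow> x \<notin> S \<Longrightarrow> \<phi>' x = 0"
  by (auto simp: C1c_def)

text \<open>A family whose supports lie in one compact set is described by \<open>C1c\<close> with
  that compact set as \<open>S\<close>; enlarging \<open>S\<close> then makes its members admissible
  on an open set.\<close>

lemma C1c_mono: "C1c S \<phi> \<phi>' \<Longrightarrow> S \<subseteq> T \<Longrightarrow> C1c T \<phi> \<phi>'"
  unfolding C1c_def by blast

lemma C1c_zero: "C1c S (\<lambda>x. 0) (\<lambda>x. 0)"
  by (rule C1cI[of _ _ "{}"]) (auto simp: inner_zero_left[abs_def])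

lemma C1c_add:
  assumes "C1c S \<phi> \<phi>'" "C1c S \<eta> \<eta>'"
  shows "C1c S (\<lambda>x. \<phi> x + \<eta> x) (\<lambda>x. \<phi>' x + \<eta>' x)"
proof -
  obtain K where K: "compact K" "K \<subseteq> S" "\<And>x. x \<notin> K \<Longrightarrow> \<phi> x = 0" "\<And>x. x \<notin> K \<Longrightarrow> \<phi>' x = 0"
    using C1c_support[OF assms(1)] by blast
  obtain L where L: "compact L" "L \<subseteq> S" "\<And>x. x \<notin> L \<Longrightarrow> \<eta> x = 0" "\<And>x. x \<notin> L \<Longrightarrow> \<eta>' x = 0"
    using C1c_support[OF assms(2)] by blast
  have "((\<lambda>x. \<phi> x + \<eta> x) has_derivative (\<lambda>v. (\<phi>' x + \<eta>' x) \<bullet> v)) (at x)" for x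
    by (rule has_derivative_eq_rhs[OF has_derivative_add[OF C1cD(1)[OF assms(1)] C1cD(1)[OF assms(2)]]])
      (simp add: inner_add_left)
  then show ?thesis
    using C1cD(2)[OF assms(1)] C1cD(2)[OF assms(2)] K L
    by (intro C1cI[of _ _ "K \<union> L"]) (auto intro!: continuous_on_add)
qed

lemma C1c_cmul:
  assumes "C1c S \<phi> \<phi>'"
  shows "C1c S (\<lambda>x. c * \<phi> x) (\<lambda>x. c *\<^sub>R \<phi>' x)"
proof -
  obtain K where K: "compact K" "K \<subseteq> S" "\<And>x. x \<notin> K \<Longrightarrow> \<phi> x = 0" "\<And>x. x \<notin> K \<Longrightarrow> \<phi>' x = 0"
    using C1c_support[OF assms(1)] by blast
  have "((\<lambda>x. c * \<phi> x) has_derivative (\<lambda>v. (c *\<^sub>R \<phi>' x) \<bullet> v)) (at x)" for x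
    by (rule has_derivative_eq_rhs[OF has_derivative_mult_right[OF C1cD(1)[OF assms(1)]]]) simp
  then show ?thesis
    using C1cD(2)[OF assms(1)] K by (intro C1cI[of _ _ K]) (auto intro!: continuous_intros)
qed

lemma C1c_sum:
  assumes "finite I" "\<And>i. i \<in> I \<Longrightarrow> C1c S (\<phi> i) (\<phi>' i)"
  shows "C1c S (\<lambda>x. \<Sum>i\<in>I. \<phi> i x) (\<lambda>x. \<Sum>i\<in>I. \<phi>' i x)"
  using assms by (induction I rule: finite_induct) (auto intro!: C1c_add C1c_zero)

text \<open>Off \<open>K\<close> the function is constantly zero, and the open sets \<open>U\<close>
  and \<open>- K\<close> cover the space.\<close>

lemma continuous_on_mult_outside:
  fixes \<psi> :: "'a::real_normed_vector \<Rightarrow> 'b::real_normed_vector"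
  assumes "open U" "closed K" "K \<subseteq> U" "continuous_on U g" "\<And>x. x \<notin> K \<Longrightarrow> g x = 0"
  shows "continuous_on UNIV (g :: 'a \<Rightarrow> 'b)"
proof -
  have "continuous_on (- K) g"
    by (rule continuous_on_eq[OF continuous_on_const[of _ 0]]) (auto simp: assms(5))
  with assms have "continuous_on (U \<union> - K) g"
    by (intro continuous_on_open_Un) auto
  moreover have "U \<union> - K = UNIV" using assms(3) by auto
  ultimately show ?thesis by simp
qed

text \<open>Off \<open>U\<close> the values of \<open>w\<close> are arbitrary. There the product
  vanishes in a whole neighbourhood, since the support of \<psi> is closed and contained in
  \<open>U\<close>. This is how a function that is C^1 only on \<Omega> is turned into one on the
  whole space.\<close>

lemma C1c_mult_local:
  assumes "C1c S \<psi> \<psi>'" "open U" "S \<subseteq> U"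
    and w: "\<And>x. x \<in> U \<Longrightarrow> (w has_derivative (\<lambda>v. w' x \<bullet> v)) (at x)" and w': "continuous_on U w'"
  shows "C1c S (\<lambda>x. \<psi> x * w x) (\<lambda>x. \<psi> x *\<^sub>R w' x + w x *\<^sub>R \<psi>' x)"
proof -
  obtain K where K: "compact K" "K \<subseteq> S" "\<And>x. x \<notin> K \<Longrightarrow> \<psi> x = 0" "\<And>x. x \<notin> K \<Longrightarrow> \<psi>' x = 0"
    using C1c_support[OF assms(1)] by blast
  note cK = compact_imp_closed[OF K(1)]
  have cw: "continuous_on U w"
    using w assms(2) by (meson continuous_at_imp_continuous_on has_derivative_continuous)
  have "((\<lambda>x. \<psi> x * w x) has_derivative (\<lambda>v. (\<psi> x *\<^sub>R w' x + w x *\<^sub>R \<psi>' x) \<bullet> v)) (at x)" for x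
  proof (cases "x \<in> U")
    case True
    show ?thesis
      by (rule has_derivative_eq_rhs[OF has_derivative_mult[OF C1cD(1)[OF assms(1)] w[OF True]]])
        (auto simp: inner_add_left algebra_simps)
  next
    case False
    then have x: "x \<in> - K" using K assms by auto
    have "((\<lambda>x. 0) has_derivative (\<lambda>v. (\<psi> x *\<^sub>R w' x + w x *\<^sub>R \<psi>' x) \<bullet> v)) (at x)"
      using K x by (auto simp: )
    then show ?thesis
      by (rule has_derivative_transform_within_open[of _ _ _ _ "- K"]) (use K x cK in auto)
  qed
  moreover have "continuous_on UNIV (\<lambda>x. \<psi> x *\<^sub>R w' x + w x *\<^sub>R \<psi>' x)"
  proof (rule continuous_on_mult_outside[OF assms(2) cK])
    show "K \<subseteq> U" using K assms by auto
    show "continuous_on U (\<lambda>x. \<psi> x *\<^sub>R w' x + w x *\<^sub>R \<psi>' x)"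
      using C1cD(2,3)[OF assms(1)] w' cw
      by (auto intro!: continuous_intros intro: continuous_on_subset)
  qed (use K in auto)
  ultimately show ?thesis
    using K by (intro C1cI[of _ _ K]) auto
qed

lemmas C1c_mult = C1c_mult_local[OF _ open_UNIV subset_UNIV]

lemma C1c_compose:
  assumes "C1c S \<phi> \<phi>'" "\<And>t. (s has_real_derivative s' t) (at t)" "continuous_on UNIV s'" "s 0 = 0"
  shows "C1c S (\<lambda>x. s (\<phi> x)) (\<lambda>x. s' (\<phi> x) *\<^sub>R \<phi>' x)"
proof -
  obtain K where K: "compact K" "K \<subseteq> S" "\<And>x. x \<notin> K \<Longrightarrow> \<phi> x = 0" "\<And>x. x \<notin> K \<Longrightarrow> \<phi>' x = 0"
    using C1c_support[OF assms(1)] by blast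
  have "((\<lambda>x. s (\<phi> x)) has_derivative (\<lambda>v. (s' (\<phi> x) *\<^sub>R \<phi>' x) \<bullet> v)) (at x)" for x
    by (rule has_derivative_eq_rhs[OF has_derivative_compose[OF C1cD(1)[OF assms(1)] 
       assms(2)[unfolded has_field_derivative_def]]]) (auto)
  moreover have "continuous_on UNIV (\<lambda>x. s' (\<phi> x) *\<^sub>R \<phi>' x)"
    using C1cD(2,3)[OF assms(1)] 
    by (auto intro!: continuous_intros continuous_on_compose2[OF assms(3)])
  ultimately show ?thesis using K assms(4) by (intro C1cI[of _ _ K]) auto
qed

text \<open>At 0 the difference quotient is bounded by \<open>\<bar>y\<bar>\<close>. The squared
  positive part is the elementary C^1 profile behind the bumps, the cutoffs and the truncated
  weights.\<close>

lemma max0_square_deriv: "((\<lambda>t::real. (max 0 t)\<^sup>2) has_real_derivative 2 * max 0 t) (at t)"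
proof -
  consider "t < 0" | "t > 0" | "t = 0" by linarith
  then show ?thesis
  proof cases
    case 1
    have "((\<lambda>t::real. 0) has_real_derivative 2 * max 0 t) (at t)" using 1 by auto
    then show ?thesis
      by (rule has_field_derivative_transform_within_open[of _ _ _ "{..<0}"]) (use 1 in auto)
  next
    case 2
    have "((\<lambda>t::real. t\<^sup>2) has_real_derivative 2 * max 0 t) (at t)" 
      using 2 by (auto intro!: derivative_eq_intros)
    then show ?thesis
      by (rule has_field_derivative_transform_within_open[of _ _ _ "{0<..}"]) (use 2 in auto)
  next
    case 3
    have "(\<lambda>y::real. (max 0 y)\<^sup>2 / y) \<midarrow>0\<rightarrow> 0"
    proof (rule Lim_null_comparison[where g="\<lambda>y. \<bar>y\<bar>"])
      show "\<forall>\<^sub>F y in at 0. norm ((max 0 y)\<^sup>2 / y) \<le> \<bar>y::real\<bar>"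
        by (auto simp: eventually_at_filter max_def power2_eq_square)
    qed (auto intro!: tendsto_eq_intros)
    then show ?thesis using 3 by (auto simp: has_field_derivative_iff)
  qed
qed

lemma C1c_bump:
  fixes c :: "real ^ 'n::finite"
  assumes "cball c r \<subseteq> U" "r \<ge> 0"
  shows "C1c U (\<lambda>x. (max 0 (r\<^sup>2 - (x - c) \<bullet> (x - c)))\<^sup>2)
           (\<lambda>x. (- 4 * max 0 (r\<^sup>2 - (x - c) \<bullet> (x - c))) *\<^sub>R (x - c))"
proof -
  have "((\<lambda>x. (max 0 (r\<^sup>2 - (x - c) \<bullet> (x - c)))\<^sup>2) has_derivative
     (\<lambda>v. ((- 4 * max 0 (r\<^sup>2 - (x - c) \<bullet> (x - c))) *\<^sub>R (x - c)) \<bullet> v)) (at x)" for x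
  proof -
    have "((\<lambda>x. r\<^sup>2 - (x - c) \<bullet> (x - c)) has_derivative (\<lambda>v. - 2 * ((x - c) \<bullet> v))) (at x)"
      by (auto intro!: derivative_eq_intros simp: inner_commute)
    from has_derivative_compose[OF this max0_square_deriv[unfolded has_field_derivative_def]]
    show ?thesis by (rule has_derivative_eq_rhs) (auto simp: mult_ac)
  qed
  moreover have "max 0 (r\<^sup>2 - (x - c) \<bullet> (x - c)) = 0" if "x \<notin> cball c r" for x
  proof -
    have "r \<le> norm (x - c)" using that by (simp add: dist_norm norm_minus_commute)
    then have "r\<^sup>2 \<le> (norm (x - c))\<^sup>2" using assms(2) by (intro power_mono)
    then show ?thesis by (simp add: power2_norm_eq_inner)
  qed
  ultimately show ?thesis
    using assms by (intro C1cI[of _ _ "cball c r"]) (auto intro!: continuous_intros)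
qed


text \<open>Finitely many balls cover \<open>K\<close>; the sum of their bumps is positive on
  \<open>K\<close>, hence bounded below there by a positive minimum, and a C^1 profile flattens all
  values above that minimum to 1.\<close>

lemma C1c_cutoff:
  fixes K :: "(real ^ 'n::finite) set"
  assumes "compact K" "open U" "K \<subseteq> U"
  obtains \<psi> \<psi>' where "C1c U \<psi> \<psi>'" "\<And>x. 0 \<le> \<psi> x" "\<And>x. \<psi> x \<le> 1" "\<And>x. x \<in> K \<Longrightarrow> \<psi> x = 1"
proof (cases "K = {}")
  case True
  then show ?thesis using that[OF C1c_zero] by auto
next
  case False
  have "\<forall>x\<in>K. \<exists>r>0. cball x r \<subseteq> U"
    using assms open_contains_cball by blast
  then obtain r where r: "\<And>x. x \<in> K \<Longrightarrow> r x > 0 \<and> cball x (r x) \<subseteq> U" by metis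
  have "K \<subseteq> \<Union> ((\<lambda>x. ball x (r x)) ` K)" using r by force
  then obtain J where J: "J \<subseteq> K" "finite J" "K \<subseteq> \<Union> ((\<lambda>x. ball x (r x)) ` J)"
    using compactE_image[OF assms(1), of K "\<lambda>x. ball x (r x)"] by auto
  define b where "b c = (\<lambda>x. (max 0 ((r c)\<^sup>2 - (x - c) \<bullet> (x - c)))\<^sup>2)" for c
  have bC: "\<exists>b'. C1c U (b c) b'" if "c \<in> J" for c
    unfolding b_def using C1c_bump[of c "r c" U] r[of c] that J(1) by (auto intro: less_imp_le)
  then obtain b' where b': "\<And>c. c \<in> J \<Longrightarrow> C1c U (b c) (b' c)" by metis
  define \<Psi> where "\<Psi> = (\<lambda>x. \<Sum>c\<in>J. b c x)"
  have \<Psi>C: "C1c U \<Psi> (\<lambda>x. \<Sum>c\<in>J. b' c x)" unfolding \<Psi>_def by (rule C1c_sum[OF J(2) b'])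
  have \<Psi>0: "\<Psi> x \<ge> 0" for x unfolding \<Psi>_def b_def by (intro sum_nonneg) auto
  have \<Psi>pos: "\<Psi> x > 0" if xK: "x \<in> K" for x
  proof -
    obtain c where c: "c \<in> J" "x \<in> ball c (r c)" using J(3) xK by blast
    have "norm (x - c) < r c" using c by (simp add: dist_norm norm_minus_commute)
    then have "(norm (x - c))\<^sup>2 < (r c)\<^sup>2" by (intro power_strict_mono) auto
    then have "b c x > 0" unfolding b_def by (simp add: power2_norm_eq_inner)
    then show ?thesis unfolding \<Psi>_def
      using sum_pos2[OF J(2) c(1), of "\<lambda>c. b c x"] by (simp add: b_def)
  qed
  obtain x0 where x0: "x0 \<in> K" "\<And>x. x \<in> K \<Longrightarrow> \<Psi> x0 \<le> \<Psi> x"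
    using continuous_attains_inf[OF assms(1) False, of \<Psi>] C1cD(3)[OF \<Psi>C] 
    by (meson continuous_on_subset subset_UNIV)
  \<comment> \<open>The profile is 0 at 0, which preserves the support, and equals 1 from the
    minimum \<open>\<Psi> x0\<close> on.\<close>
  define s where "s t = 1 - (max 0 (1 - t / \<Psi> x0))\<^sup>2" for t :: real
  define s' where "s' t = 2 * max 0 (1 - t / \<Psi> x0) / \<Psi> x0" for t :: real
  have p: "\<Psi> x0 > 0" using \<Psi>pos x0 by auto
  have "(s has_real_derivative s' t) (at t)" for t
  proof -
    have "((\<lambda>t. 1 - t / \<Psi> x0) has_real_derivative - 1 / \<Psi> x0) (at t)"
      using p by (auto intro!: derivative_eq_intros)
    from DERIV_chain2[OF max0_square_deriv this]
    have "((\<lambda>t. (max 0 (1 - t / \<Psi> x0))\<^sup>2) has_real_derivative - s' t) (at t)"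
      by (simp add: s'_def)
    from DERIV_diff[OF DERIV_const[of 1] this] show ?thesis unfolding s_def by simp
  qed
  then have "C1c U (\<lambda>x. s (\<Psi> x)) (\<lambda>x. s' (\<Psi> x) *\<^sub>R (\<Sum>c\<in>J. b' c x))"
  proof (rule C1c_compose[OF \<Psi>C])
    show "continuous_on UNIV s'" unfolding s'_def using p by (intro continuous_intros) auto
  qed (simp add: s_def)
  moreover have "s (\<Psi> x) \<ge> 0" for x
  proof -
    have "0 \<le> max 0 (1 - \<Psi> x / \<Psi> x0)" "max 0 (1 - \<Psi> x / \<Psi> x0) \<le> 1" using \<Psi>0[of x] p by auto
    then show ?thesis unfolding s_def by (simp add: power_le_one)
  qed
  moreover have "s (\<Psi> x) \<le> 1" for x by (simp add: s_def)
  moreover have "s (\<Psi> x) = 1" if "x \<in> K" for x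
    using x0(2)[OF that] p by (simp add: s_def max_def)
  ultimately show ?thesis using that by blast
qed

section \<open>Lebesgue integrals of compactly supported continuous functions and their
  translates\<close>

lemma integrable_lebesgue_cc:
  fixes f :: "'a::euclidean_space \<Rightarrow> 'b::euclidean_space"
  assumes "continuous_on UNIV f" "compact K" "\<And>x. x \<notin> K \<Longrightarrow> f x = 0"
  shows "integrable lebesgue f"
proof -
  have "integrable lborel (\<lambda>x. indicator K x *\<^sub>R f x)"
    using assms by (intro borel_integrable_compact) (auto intro: continuous_on_subset)
  also have "(\<lambda>x. indicator K x *\<^sub>R f x) = f" using assms(3) by (auto simp: indicator_def fun_eq_iff)
  finally show ?thesis by (simp add: integrable_completion assms(1) borel_measurable_continuous_onI)
qed

lemma measurable_lebesgue_continuous: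
  fixes f :: "'a::euclidean_space \<Rightarrow> 'b::euclidean_space"
  assumes "continuous_on UNIV f" shows "f \<in> borel_measurable lebesgue"
  using assms by (simp add: borel_measurable_continuous_onI measurable_completion)

lemma integral_lebesgue_translate:
  fixes f :: "'a::euclidean_space \<Rightarrow> 'b::euclidean_space"
  assumes "continuous_on UNIV f"
  shows "(LINT x|lebesgue. f (a + x)) = (LINT x|lebesgue. f x)"
proof -
  have m: "f \<in> borel_measurable borel" using assms by (rule borel_measurable_continuous_onI)
  have m2: "(\<lambda>x. f (a + x)) \<in> borel_measurable borel"
    by (rule borel_measurable_continuous_onI) (auto intro!: continuous_intros continuous_on_compose2[OF assms])
  have "(LINT x|lborel. f (a + x)) = (LINT x|distr lborel borel ((+) a). f x)"
    by (subst integral_distr) (auto simp: m)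
  then show ?thesis using m m2 by (simp add: integral_completion lborel_distr_plus)
qed

lemma integrable_lebesgue_translate:
  fixes f :: "'a::euclidean_space \<Rightarrow> 'b::euclidean_space"
  assumes "continuous_on UNIV f" "integrable lebesgue f"
  shows "integrable lebesgue (\<lambda>x. f (a + x))"
proof -
  have m: "f \<in> borel_measurable borel" using assms(1) by (rule borel_measurable_continuous_onI)
  have m2: "(\<lambda>x. f (a + x)) \<in> borel_measurable borel"
    by (rule borel_measurable_continuous_onI) (auto intro!: continuous_intros continuous_on_compose2[OF assms(1)])
  have "integrable (distr lborel borel ((+) a)) f \<longleftrightarrow> integrable lborel (\<lambda>x. f (a + x))"
    by (rule integrable_distr_eq) (auto simp: m)
  then show ?thesis using m m2 assms(2) by (simp add: integrable_completion lborel_distr_plus)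
qed

section \<open>Difference quotients and integration by parts\<close>

text \<open>The steps \<open>1 / real (Suc n)\<close> form a sequence, so subsequences and dominated
  convergence apply directly; they never exceed 1, so supports grow by at most a unit neighbourhood.
  The values may lie in any normed space, since the same quotient is taken of u, of its gradient, of
  the flux and of test functions.\<close>

definition DQ :: "nat \<Rightarrow> 'n::finite \<Rightarrow> (real ^ 'n \<Rightarrow> 'b::real_normed_vector) \<Rightarrow> real ^ 'n \<Rightarrow> 'b" where
  "DQ n i w x = real (Suc n) *\<^sub>R (w ((1 / real (Suc n)) *\<^sub>R axis i 1 + x) - w x)"

lemma continuous_on_DQ:
  assumes "continuous_on UNIV w" shows "continuous_on UNIV (DQ n i w)"
  unfolding DQ_def by (intro continuous_intros continuous_on_compose2[OF assms]) auto

lemma DQ_tendsto: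
  assumes "(w has_derivative w') (at x)"
  shows "(\<lambda>n. DQ n i w x) \<longlonglongrightarrow> w' (axis i 1)"
proof -
  interpret w': bounded_linear w' using assms by (rule has_derivative_bounded_linear)
  define h where "h n = (1 / real (Suc n)) *\<^sub>R (axis i 1 :: real ^ 'a)" for n
  have nh: "norm (h n) = 1 / real (Suc n)" for n by (simp add: h_def norm_axis_1)
  have "(\<lambda>h. norm (w (x + h) - w x - w' h) / norm h) \<midarrow>0\<rightarrow> 0"
    using assms by (simp add: has_derivative_at)
  moreover have "filterlim h (at 0) sequentially"
  proof -
    have "(\<lambda>n. norm (h n)) \<longlonglongrightarrow> 0" unfolding nh using LIMSEQ_Suc[OF lim_1_over_n] by simp
    moreover have "h n \<noteq> 0" for n using nh[of n] by auto
    ultimately show ?thesis by (simp add: filterlim_at tendsto_norm_zero_iff)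
  qed
  ultimately have "(\<lambda>n. norm (w (x + h n) - w x - w' (h n)) / norm (h n)) \<longlonglongrightarrow> 0"
    by (rule filterlim_compose)
  moreover have "norm (w (x + h n) - w x - w' (h n)) / norm (h n) = norm (DQ n i w x - w' (axis i 1))" for n
  proof -
    have "DQ n i w x - w' (axis i 1) = real (Suc n) *\<^sub>R (w (x + h n) - w x - w' (h n))"
      by (simp add: DQ_def h_def w'.scaleR algebra_simps del: of_nat_Suc)
    then show ?thesis by (simp add: nh del: of_nat_Suc)
  qed
  ultimately show ?thesis by (simp add: tendsto_norm_zero_iff LIM_zero_iff)
qed

lemma C1c_bounded:
  assumes "C1c S \<phi> \<phi>'"
  obtains B where "B > 0" "\<And>x. \<bar>\<phi> x\<bar> \<le> B" "\<And>x. norm (\<phi>' x) \<le> B"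
proof -
  obtain K where K: "compact K" "K \<subseteq> S" "\<And>x. x \<notin> K \<Longrightarrow> \<phi> x = 0" "\<And>x. x \<notin> K \<Longrightarrow> \<phi>' x = 0"
    using C1c_support[OF assms(1)] by blast
  have "compact ((\<lambda>x. (\<phi> x, \<phi>' x)) ` K)"
    using C1cD(2,3)[OF assms] K
    by (intro compact_continuous_image continuous_intros) (auto intro: continuous_on_subset)
  then have "\<exists>B>0. \<forall>x\<in>K. norm (\<phi> x, \<phi>' x) \<le> B"
    by (auto dest!: compact_imp_bounded simp: bounded_pos)
  then obtain B where B: "\<And>x. x \<in> K \<Longrightarrow> norm (\<phi> x, \<phi>' x) \<le> B" "B > 0" by blast
  have "\<bar>\<phi> x\<bar> \<le> B" "norm (\<phi>' x) \<le> B" for x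
    using B(1)[of x] B(2) K(3,4)[of x] norm_fst_le[of "\<phi> x" "\<phi>' x"] norm_snd_le[of "\<phi>' x" "\<phi> x"]
    by (cases "x \<in> K"; force)+
  with that B(2) show ?thesis by blast
qed

lemma DQ_bound:
  fixes w :: "real ^ 'n::finite \<Rightarrow> 'b::real_normed_vector"
  assumes "\<And>x. (w has_derivative w' x) (at x)" "\<And>x. onorm (w' x) \<le> B"
  shows "norm (DQ n i w x) \<le> B"
proof -
  have "norm (w ((1 / real (Suc n)) *\<^sub>R axis i 1 + x) - w x) \<le> B * norm (((1 / real (Suc n)) *\<^sub>R axis i 1 + x) - x)"
    using assms by (intro differentiable_bound[of UNIV w w']) auto
  also have "\<dots> = B / real (Suc n)" by (simp add: norm_axis_1)
  finally show ?thesis unfolding DQ_def norm_scaleR by (simp add: field_simps del: of_nat_Suc)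
qed

lemma C1c_DQ_bound:
  assumes "C1c S \<phi> \<phi>'" "\<And>x. norm (\<phi>' x) \<le> B" shows "\<bar>DQ n i \<phi> x\<bar> \<le> B"
proof -
  have B: "B \<ge> 0" using assms(2)[of undefined] norm_ge_zero order_trans by blast
  have "onorm (\<lambda>v. \<phi>' x \<bullet> v) \<le> B" for x
    using B assms(2)[of x] by (intro onorm_bound)
      (auto intro!: order_trans[OF Cauchy_Schwarz_ineq2] mult_right_mono)
  with DQ_bound[of \<phi> "\<lambda>x v. \<phi>' x \<bullet> v" B n i x, OF C1cD(1)[OF assms(1)]] show ?thesis by simp
qed

lemma compact_thicken:
  fixes K :: "'a::euclidean_space set"
  assumes "compact K"
  shows "compact {x + y |x y. x \<in> K \<and> y \<in> cball 0 d}"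
  by (rule compact_sums[OF assms compact_cball])

lemma DQ_outside:
  assumes "\<And>x. x \<notin> K \<Longrightarrow> w x = 0" "x \<notin> {x + y |x y. x \<in> K \<and> y \<in> cball 0 1}"
  shows "DQ n i w x = 0"
proof -
  have "x \<notin> K" using assms(2) by force
  moreover have "(1 / real (Suc n)) *\<^sub>R axis i 1 + x \<notin> K"
  proof
    assume a: "(1 / real (Suc n)) *\<^sub>R axis i 1 + x \<in> K"
    have "x = ((1 / real (Suc n)) *\<^sub>R axis i 1 + x) + (- (1 / real (Suc n)) *\<^sub>R axis i 1)" by simp
    moreover have "(- (1 / real (Suc n)) *\<^sub>R axis i 1) \<in> cball (0 :: real ^ 'a) 1" by (simp add: norm_axis_1)
    ultimately show False using assms(2) a by blast
  qed
  ultimately show ?thesis using assms(1) by (simp add: DQ_def)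
qed

text \<open>By translation invariance every difference quotient of \<phi> has integral zero, and
  dominated convergence carries this over to the partial derivative. All integrations by parts rest
  on this fact together with the product rule.\<close>

lemma integral_partial_C1c:
  assumes "C1c S \<phi> \<phi>'"
  shows "(LINT x|lebesgue. \<phi>' x $ i) = 0"
proof -
  obtain K where K: "compact K" "K \<subseteq> S" "\<And>x. x \<notin> K \<Longrightarrow> \<phi> x = 0" "\<And>x. x \<notin> K \<Longrightarrow> \<phi>' x = 0"
    using C1c_support[OF assms(1)] by blast
  obtain B where B: "B > 0" "\<And>x. norm (\<phi>' x) \<le> B" using C1c_bounded[OF assms] by metis
  define L where "L = {x + y |x y. x \<in> K \<and> y \<in> cball 0 1}"
  have L: "compact L" unfolding L_def by (rule compact_thicken[OF K(1)])
  have c: "continuous_on UNIV \<phi>" by (rule C1cD(3)[OF assms])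
  have i1: "integrable lebesgue \<phi>" by (rule integrable_lebesgue_cc[OF c K(1,3)])
  have "(\<lambda>n. LINT x|lebesgue. DQ n i \<phi> x) \<longlonglongrightarrow> (LINT x|lebesgue. \<phi>' x $ i)"
  proof (rule integral_dominated_convergence[where w="\<lambda>x. indicator L x * B"])
    show "(\<lambda>x. \<phi>' x $ i) \<in> borel_measurable lebesgue"
      by (intro measurable_lebesgue_continuous continuous_intros C1cD(2)[OF assms])
    show "DQ n i \<phi> \<in> borel_measurable lebesgue" for n
      by (intro measurable_lebesgue_continuous continuous_on_DQ c)
    show "integrable lebesgue (\<lambda>x. indicator L x * B)"
      by (intro integrable_mult_left integrable_real_indicator)
        (use L in \<open>auto simp: fmeasurable_def dest!: lmeasurable_compact\<close>)
    show "AE x in lebesgue. (\<lambda>n. DQ n i \<phi> x) \<longlonglongrightarrow> \<phi>' x $ i"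
      using DQ_tendsto[OF C1cD(1)[OF assms], of i] by (simp add: inner_axis)
    show "AE x in lebesgue. norm (DQ n i \<phi> x) \<le> indicator L x * B" for n
    proof (rule AE_I2)
      fix x show "norm (DQ n i \<phi> x) \<le> indicator L x * B"
        using C1c_DQ_bound[OF assms B(2), of n i x] DQ_outside[of K \<phi> x n i, OF K(3), folded L_def]
        by (cases "x \<in> L") (simp_all add: L_def[symmetric])
    qed
  qed
  moreover have "(LINT x|lebesgue. DQ n i \<phi> x) = 0" for n
  proof -
    have "integrable lebesgue (\<lambda>x. \<phi> ((1 / real (Suc n)) *\<^sub>R axis i 1 + x))"
      by (rule integrable_lebesgue_translate[OF c i1])
    then show ?thesis
      unfolding DQ_def using i1 by (simp add: integral_lebesgue_translate[OF c] del: of_nat_Suc)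
  qed
  ultimately show ?thesis by (simp add: LIMSEQ_const_iff)
qed

lemma tendsto_inverse_Suc: "(\<lambda>n. 1 / real (Suc n)) \<longlonglongrightarrow> 0"
  by (rule LIMSEQ_Suc[OF lim_1_over_n])

lemma C1c_integrable:
  assumes "C1c S \<phi> \<phi>'"
  shows "integrable lebesgue \<phi>" "integrable lebesgue \<phi>'" "integrable lebesgue (\<lambda>x. \<phi>' x $ i)"
proof -
  obtain K where K: "compact K" "K \<subseteq> S" "\<And>x. x \<notin> K \<Longrightarrow> \<phi> x = 0" "\<And>x. x \<notin> K \<Longrightarrow> \<phi>' x = 0"
    using C1c_support[OF assms(1)] by blast
  show "integrable lebesgue \<phi>" "integrable lebesgue \<phi>'" "integrable lebesgue (\<lambda>x. \<phi>' x $ i)"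
    using K C1cD[OF assms] by (auto intro!: integrable_lebesgue_cc[where K=K] continuous_intros)
qed

lemma C1c_borel:
  assumes "C1c S \<phi> \<phi>'"
  shows "\<phi> \<in> borel_measurable lebesgue" "\<phi>' \<in> borel_measurable lebesgue" "(\<lambda>x. \<phi>' x $ i) \<in> borel_measurable lebesgue"
  using C1c_integrable[OF assms] by (auto intro: borel_measurable_integrable)

lemma integrable_mult_cc:
  fixes h :: "'a::euclidean_space \<Rightarrow> real" and \<phi> :: "'a \<Rightarrow> 'b::euclidean_space"
  assumes "integrable lebesgue (\<lambda>x. indicator K x * h x)" "continuous_on UNIV \<phi>" "compact K" "\<And>x. x \<notin> K \<Longrightarrow> \<phi> x = 0"
  shows "integrable lebesgue (\<lambda>x. h x *\<^sub>R \<phi> x)"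
proof -
  have "compact (\<phi> ` K)" using assms by (intro compact_continuous_image) (auto intro: continuous_on_subset)
  then have "\<exists>B>0. \<forall>x\<in>K. norm (\<phi> x) \<le> B" by (auto dest!: compact_imp_bounded simp: bounded_pos)
  then obtain B where B: "B > 0" "\<And>x. x \<in> K \<Longrightarrow> norm (\<phi> x) \<le> B" by blast
  have eq: "h x *\<^sub>R \<phi> x = (indicator K x * h x) *\<^sub>R \<phi> x" for x using assms(4)[of x] by (auto simp: indicator_def)
  show ?thesis
    unfolding eq
  proof (rule Bochner_Integration.integrable_bound[where f="\<lambda>x. B * (indicator K x * h x)"])
    show "integrable lebesgue (\<lambda>x. B * (indicator K x * h x))" using assms(1) by simp
    show "(\<lambda>x. (indicator K x * h x) *\<^sub>R \<phi> x) \<in> borel_measurable lebesgue"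
      using borel_measurable_integrable[OF assms(1)] measurable_lebesgue_continuous[OF assms(2)] by measurable
    show "AE x in lebesgue. norm ((indicator K x * h x) *\<^sub>R \<phi> x) \<le> norm (B * (indicator K x * h x))"
    proof (rule AE_I2)
      fix x show "norm ((indicator K x * h x) *\<^sub>R \<phi> x) \<le> norm (B * (indicator K x * h x))"
        using B by (cases "x \<in> K") (auto simp: abs_mult mult.commute[of B] intro!: mult_left_mono)
    qed
  qed
qed

section \<open>The fundamental lemma of the calculus of variations\<close>

text \<open>Inner regularity: the set where \<open>h\<close> is positive is exhausted, up to measure
  \<open>e\<close>, by a closed and hence compact subset. There a positive function has integral
  zero, so the subset is a null set.\<close>

lemma AE_nonpos_of_integral_compact_zero:
  fixes h :: "'a::euclidean_space \<Rightarrow> real"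
  assumes C: "compact C" and int: "integrable lebesgue (\<lambda>x. indicator C x * h x)"
    and zero: "\<And>K. compact K \<Longrightarrow> K \<subseteq> C \<Longrightarrow> (LINT x|lebesgue. indicator K x * h x) = 0"
  shows "AE x in lebesgue. x \<in> C \<longrightarrow> h x \<le> 0"
proof -
  define P where "P = {x \<in> space lebesgue. indicator C x * h x > 0}"
  have P: "P \<in> sets lebesgue"
    unfolding P_def using borel_measurable_integrable[OF int] by measurable
  have PC: "P \<subseteq> C" by (auto simp: P_def indicator_def split: if_splits)
  have small: "emeasure lebesgue P \<le> ennreal e" if e: "e > 0" for e
  proof -
    obtain T where T: "closed T" "T \<subseteq> P" "P - T \<in> lmeasurable" "emeasure lebesgue (P - T) < ennreal e"
      using sets_lebesgue_inner_closed[OF P e] by metis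
    have "compact T" using T PC C by (metis closed_subset compact_Int_closed inf.absorb_iff2 order_trans)
    have Tm: "T \<in> sets lebesgue" using T(1) by auto
    have i: "integrable lebesgue (\<lambda>x. indicator T x * h x)"
    proof -
      have eq: "(\<lambda>x. indicator T x * h x) = (\<lambda>x. indicator T x *\<^sub>R (indicator C x * h x))"
        using subset_trans[OF T(2) PC] by (auto simp: indicator_def fun_eq_iff)
      show ?thesis unfolding eq by (rule integrable_mult_indicator[OF Tm int])
    qed
    have "(LINT x|lebesgue. indicator T x * h x) = 0" using zero \<open>compact T\<close> T PC by blast
    moreover have pos: "x \<in> T \<Longrightarrow> h x > 0" for x
      using T(2) subset_trans[OF T(2) PC] by (force simp: P_def indicator_def)
    ultimately have "AE x in lebesgue. indicator T x * h x = 0"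
      using integral_nonneg_eq_0_iff_AE[OF i] by (force simp: indicator_def less_imp_le)
    then have "AE x in lebesgue. x \<notin> T" by eventually_elim (metis indicator_simps(1) less_irrefl mult_1 pos)
    then have "emeasure lebesgue T = 0" using Tm by (simp add: AE_iff_null_sets[symmetric] null_setsD1)
    have "emeasure lebesgue P \<le> emeasure lebesgue (T \<union> (P - T))"
      using P T Tm by (intro emeasure_mono) auto
    also have "\<dots> \<le> emeasure lebesgue T + emeasure lebesgue (P - T)"
      using P Tm by (intro emeasure_subadditive) auto
    also have "\<dots> \<le> ennreal e" using T(4) \<open>emeasure lebesgue T = 0\<close> by simp
    finally show ?thesis .
  qed
  have "emeasure lebesgue P \<le> 0"
    by (rule ennreal_le_epsilon) (use small in auto)
  then have "P \<in> null_sets lebesgue" using P by auto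
  then have "AE x in lebesgue. x \<notin> P" by (rule AE_not_in)
  then show ?thesis by eventually_elim (auto simp: P_def indicator_def)
qed

lemma AE_zero_of_integral_compact_zero:
  fixes h :: "'a::euclidean_space \<Rightarrow> real"
  assumes "open U" 
    and int: "\<And>K. compact K \<Longrightarrow> K \<subseteq> U \<Longrightarrow> integrable lebesgue (\<lambda>x. indicator K x * h x)"
    and zero: "\<And>K. compact K \<Longrightarrow> K \<subseteq> U \<Longrightarrow> (LINT x|lebesgue. indicator K x * h x) = 0"
  shows "AE x in lebesgue. x \<in> U \<longrightarrow> h x = 0"
proof -
  obtain C where C: "\<And>n::nat. compact (C n)" "\<And>n. C n \<subseteq> U" "\<Union> (range C) = (U :: 'a set)"
    using open_Union_compact_subsets[OF assms(1)] by metis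
  have 1: "AE x in lebesgue. \<forall>n. x \<in> C n \<longrightarrow> h x \<le> 0"
    unfolding AE_all_countable
  proof (intro allI AE_nonpos_of_integral_compact_zero[OF C(1)])
    show "integrable lebesgue (\<lambda>x. indicator (C n) x * h x)" for n using int C by blast
    show "(LINT x|lebesgue. indicator K x * h x) = 0" if "compact K" "K \<subseteq> C n" for n K
      using zero[OF that(1)] that(2) C(2)[of n] by blast
  qed
  have 2: "AE x in lebesgue. \<forall>n. x \<in> C n \<longrightarrow> - h x \<le> 0"
    unfolding AE_all_countable
  proof (intro allI AE_nonpos_of_integral_compact_zero[OF C(1)])
    show "integrable lebesgue (\<lambda>x. indicator (C n) x * - h x)" for n using int C by simp
    show "(LINT x|lebesgue. indicator K x * - h x) = 0" if "compact K" "K \<subseteq> C n" for n K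
    proof -
      have "(LINT x|lebesgue. indicator K x * h x) = 0" using zero[OF that(1)] that(2) C(2)[of n] by blast
      then show ?thesis by simp
    qed
  qed
  from 1 2 show ?thesis
  proof eventually_elim
    case (elim x)
    show ?case
    proof
      assume "x \<in> U"
      then obtain n where "x \<in> C n" unfolding C(3)[symmetric] by (rule UN_E)
      then have "h x \<le> 0" "- h x \<le> 0" using elim(1)[rule_format, of n] elim(2)[rule_format, of n] by simp_all
      then show "h x = 0" by simp
    qed
  qed
qed

text \<open>Compact sets are limits of cutoff functions, so testing with those suffices.\<close>

lemma fundamental_lemma_C1c:
  fixes h :: "real ^ 'n::finite \<Rightarrow> real"
  assumes U: "open U" 
    and int: "\<And>K. compact K \<Longrightarrow> K \<subseteq> U \<Longrightarrow> integrable lebesgue (\<lambda>x. indicator K x * h x)"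
    and zero: "\<And>\<phi> \<phi>'. C1c U \<phi> \<phi>' \<Longrightarrow> (LINT x|lebesgue. h x * \<phi> x) = 0"
  shows "AE x in lebesgue. x \<in> U \<longrightarrow> h x = 0"
proof (rule AE_zero_of_integral_compact_zero[OF U int])
  fix K assume K: "compact K" "K \<subseteq> U"
  obtain L where L: "compact L" "K \<subseteq> interior L" "L \<subseteq> U"
  proof -
    obtain C where C: "\<And>n. compact (C n)" "\<And>n. C n \<subseteq> U" "\<And>n. C n \<subseteq> interior (C (Suc n))"
       "\<And>K. compact K \<Longrightarrow> K \<subseteq> U \<Longrightarrow> \<exists>N. \<forall>n\<ge>N. K \<subseteq> C n"
      using open_Union_compact_subsets[OF U] by metis
    obtain N where "K \<subseteq> C N" using C(4)[OF K] by blast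
    then have "K \<subseteq> interior (C (Suc N))" using C(3)[of N] by (rule subset_trans)
    then show ?thesis by (rule that[OF C(1) _ C(2)])
  qed
  \<comment> \<open>The neighbourhoods shrink to \<open>K\<close>, which makes the cutoffs converge
    to its indicator; intersecting with \<open>interior L\<close> provides the common majorant
    \<open>\<bar>indicator L x * h x\<bar>\<close>.\<close>
  define V where "V n = {x. infdist x K < 1 / real (Suc n)} \<inter> interior L" for n
  show "(LINT x|lebesgue. indicator K x * h x) = 0"
  proof (cases "K = {}")
    case True then show ?thesis by simp
  next
    case ne: False
    have "\<exists>\<psi>. (\<exists>\<psi>'. C1c (V n) \<psi> \<psi>') \<and> (\<forall>x. 0 \<le> \<psi> x) \<and> (\<forall>x. \<psi> x \<le> 1) \<and> (\<forall>x\<in>K. \<psi> x = 1)" for n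
    proof -
      have "open (V n)" unfolding V_def
        by (intro open_Int open_interior open_Collect_less continuous_intros)
      moreover have "K \<subseteq> V n" using L by (auto simp: V_def)
      ultimately show ?thesis using C1c_cutoff[OF K(1), of "V n"] by metis
    qed
    then obtain \<psi> where \<psi>: "\<And>n::nat. \<exists>\<psi>'. C1c (V n) (\<psi> n) \<psi>'" "\<And>n x. 0 \<le> \<psi> n x" "\<And>n x. \<psi> n x \<le> 1"
        "\<And>n x. x \<in> K \<Longrightarrow> \<psi> n x = 1" by metis
    have VL: "V n \<subseteq> L" for n using interior_subset by (auto simp: V_def)
    have out: "x \<notin> V n \<Longrightarrow> \<psi> n x = 0" for x n using \<psi>(1)[of n] C1c_outside by blast
    have il: "integrable lebesgue (\<lambda>x. indicator L x * h x)" using int L by blast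
    have eq: "h x * \<psi> n x = indicator L x * h x * \<psi> n x" for x n
      using out[of x n] VL[of n] by (auto simp: indicator_def)
    have lim: "(\<lambda>n. \<psi> n x) \<longlonglongrightarrow> indicator K x" for x
    proof (cases "x \<in> K")
      case True then show ?thesis using \<psi>(4) by simp
    next
      case False
      then have "infdist x K > 0"
        using K(1) ne by (metis compact_imp_closed in_closed_iff_infdist_zero infdist_nonneg less_eq_real_def)
      then have "\<forall>\<^sub>F n in sequentially. 1 / real (Suc n) < infdist x K"
        by (rule order_tendstoD(2)[OF tendsto_inverse_Suc])
      then have "\<forall>\<^sub>F n in sequentially. \<psi> n x = 0"
        by eventually_elim (auto intro!: out simp: V_def)
      then show ?thesis using False by (simp add: tendsto_eventually)
    qed
    have "(\<lambda>n. LINT x|lebesgue. h x * \<psi> n x) \<longlonglongrightarrow> (LINT x|lebesgue. indicator L x * h x * indicator K x)"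
      unfolding eq
    proof (rule integral_dominated_convergence[where w="\<lambda>x. \<bar>indicator L x * h x\<bar>"])
      show "(\<lambda>x. indicator L x * h x * indicator K x) \<in> borel_measurable lebesgue"
        by (rule borel_measurable_times[OF borel_measurable_integrable[OF il] 
              borel_measurable_indicator[OF fmeasurableD[OF lmeasurable_compact[OF K(1)]]]])
      show "(\<lambda>x. indicator L x * h x * \<psi> n x) \<in> borel_measurable lebesgue" for n
        using borel_measurable_integrable[OF il] \<psi>(1)[of n] C1c_borel(1) by (auto intro!: borel_measurable_times)
      show "integrable lebesgue (\<lambda>x. \<bar>indicator L x * h x\<bar>)" using il by simp
      show "AE x in lebesgue. (\<lambda>n. indicator L x * h x * \<psi> n x) \<longlonglongrightarrow> indicator L x * h x * indicator K x"
        by (intro AE_I2 tendsto_intros lim)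
      show "AE x in lebesgue. norm (indicator L x * h x * \<psi> n x) \<le> \<bar>indicator L x * h x\<bar>" for n
        using \<psi>(2,3) by (intro AE_I2) (simp add: abs_mult mult_left_le)
    qed
    moreover have "(LINT x|lebesgue. h x * \<psi> n x) = 0" for n
    proof -
      have "V n \<subseteq> U" using VL L(3) by blast
      then show ?thesis using \<psi>(1)[of n] zero C1c_mono by blast
    qed
    moreover have "indicator L x * h x * indicator K x = indicator K x * h x" for x
      using L(2) interior_subset[of L] by (auto simp: indicator_def)
    ultimately show ?thesis by (simp add: LIMSEQ_const_iff)
  qed
qed

section \<open>Mollification\<close>

text \<open>This family is closed under differentiation up to polynomial factors, which makes the functions
  generated from it smooth without any computation of higher derivatives.\<close>

definition exp_bump :: "nat \<Rightarrow> real \<Rightarrow> real" where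
  "exp_bump k t = (if t > 0 then (1 / t) ^ k * exp (- (1 / t)) else 0)"

text \<open>A single term of the exponential series at s = 1/t gives
  \<open>s ^ Suc k \<le> fact (Suc k) * exp s\<close>. The linear bound in \<open>t\<close> is what
  the derivative at 0 requires.\<close>

lemma exp_bump_bound: "\<bar>exp_bump k t\<bar> \<le> fact (Suc k) * \<bar>t\<bar>"
proof (cases "t > 0")
  case True
  define s where "s = 1 / t"
  have s: "s > 0" "t = 1 / s" using True by (auto simp: s_def)
  have "s ^ Suc k / fact (Suc k) \<le> (\<Sum>n. s ^ n / fact n)"
    using s sum_le_suminf[OF summable_exp_generic[of s, unfolded inverse_eq_divide, simplified], of "{Suc k}"] 
    by (simp add: divide_inverse mult.commute scaleR_conv_of_real) 
  also have "\<dots> = exp s" by (simp add: exp_def divide_inverse mult.commute)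
  finally have "s ^ Suc k \<le> fact (Suc k) * exp s"
    by (subst (asm) pos_divide_le_eq) (simp_all add: mult.commute del: fact_Suc)
  then have "s ^ k * exp (- s) \<le> fact (Suc k) * (1 / s)"
    using s by (simp add: exp_minus field_simps)
  then show ?thesis using True s by (simp add: exp_bump_def)
next
  case False
  have "0 \<le> fact (Suc k) * \<bar>t\<bar>" by (intro mult_nonneg_nonneg) auto
  then show ?thesis using False unfolding exp_bump_def by auto
qed

text \<open>For y > 0 the quotient \<open>exp_bump k y / y\<close> is
  \<open>exp_bump (Suc k) y\<close>, so the linear bound for the next member of the family settles
  differentiability at 0.\<close>

lemma exp_bump_deriv:
  "(exp_bump k has_real_derivative (exp_bump (k + 2) t - real k * exp_bump (Suc k) t)) (at t)"
proof -
  consider "t < 0" | "t > 0" | "t = 0" by linarith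
  then show ?thesis
  proof cases
    case 1
    have "((\<lambda>t::real. 0) has_real_derivative (exp_bump (k + 2) t - real k * exp_bump (Suc k) t)) (at t)"
      using 1 by (auto simp: exp_bump_def)
    then show ?thesis
      by (rule has_field_derivative_transform_within_open[of _ _ _ "{..<0}"]) (use 1 in \<open>auto simp: exp_bump_def\<close>)
  next
    case 2
    have "((\<lambda>t::real. (1 / t) ^ k * exp (- (1 / t))) has_real_derivative (exp_bump (k + 2) t - real k * exp_bump (Suc k) t)) (at t)"
    proof -
      define s where "s = 1 / t"
      have d: "((\<lambda>t::real. 1 / t) has_real_derivative - (s\<^sup>2)) (at t)"
        using 2 by (auto intro!: derivative_eq_intros simp: s_def power2_eq_square)
      have "((\<lambda>t::real. (1 / t) ^ k * exp (- (1 / t))) has_real_derivative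
           real k * s ^ (k - 1) * - (s\<^sup>2) * exp (- s) + exp (- s) * (s\<^sup>2) * s ^ k) (at t)"
        using DERIV_mult[OF DERIV_power[OF d, of k] DERIV_chain2[OF DERIV_exp DERIV_minus[OF d]]]
        by (simp add: s_def[symmetric] mult_ac)
      moreover have "real k * s ^ (k - 1) * - (s\<^sup>2) * exp (- s) + exp (- s) * (s\<^sup>2) * s ^ k
          = exp_bump (k + 2) t - real k * exp_bump (Suc k) t"
        using 2 by (cases k) (simp_all add: exp_bump_def s_def[symmetric] power2_eq_square algebra_simps)
      ultimately show ?thesis by simp
    qed
    then show ?thesis
      by (rule has_field_derivative_transform_within_open[of _ _ _ "{0<..}"]) (use 2 in \<open>auto simp: exp_bump_def\<close>)
  next
    case 3
    have "(\<lambda>y::real. exp_bump k y / y) \<midarrow>0\<rightarrow> 0"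
    proof (rule Lim_null_comparison[where g="\<lambda>y. fact (Suc (Suc k)) * \<bar>y\<bar>"])
      have "norm (exp_bump k y / y) \<le> fact (Suc (Suc k)) * \<bar>y\<bar>" for y
      proof (cases "y > 0")
        case True
        then have "exp_bump k y / y = exp_bump (Suc k) y" by (simp add: exp_bump_def)
        then show ?thesis using exp_bump_bound[of "Suc k" y] by simp
      next
        case False
        have "0 \<le> fact (Suc (Suc k)) * \<bar>y\<bar>" by (intro mult_nonneg_nonneg) auto
        then show ?thesis using False unfolding exp_bump_def by auto
      qed
      then show "\<forall>\<^sub>F y in at 0. norm (exp_bump k y / y) \<le> fact (Suc (Suc k)) * \<bar>y\<bar>"
        by (intro always_eventually allI)
      show "((\<lambda>y. fact (Suc (Suc k)) * \<bar>y\<bar>) \<longlongrightarrow> 0) (at (0::real))" 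
        by (rule tendsto_mult_right_zero[OF tendsto_rabs_zero[OF tendsto_ident_at]])
    qed
    then show ?thesis using 3 by (simp add: has_field_derivative_iff) (simp add: exp_bump_def)
  qed
qed


inductive elementary_smooth :: "(real ^ 'n::finite \<Rightarrow> real) \<Rightarrow> bool" where
  const: "elementary_smooth (\<lambda>x. c)"
| coord: "elementary_smooth (\<lambda>x. x $ j)"
| add: "elementary_smooth f \<Longrightarrow> elementary_smooth g \<Longrightarrow> elementary_smooth (\<lambda>x. f x + g x)"
| mult: "elementary_smooth f \<Longrightarrow> elementary_smooth g \<Longrightarrow> elementary_smooth (\<lambda>x. f x * g x)"
| bump: "elementary_smooth (\<lambda>x. exp_bump k (r - x \<bullet> x))"

text \<open>The gradient stays in the class componentwise. With this closure property,
  differentiability of the class already yields derivatives of all orders.\<close>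

lemma elementary_smooth_gradient:
  "elementary_smooth f \<Longrightarrow> \<exists>g. (\<forall>x. (f has_derivative (\<lambda>v. g x \<bullet> v)) (at x)) \<and> (\<forall>j. elementary_smooth (\<lambda>x. g x $ j))"
proof (induction rule: elementary_smooth.induct)
  case (const c)
  show ?case by (rule exI[of _ "\<lambda>x. 0"]) (auto simp: inner_zero_left[abs_def] intro: elementary_smooth.const)
next
  case (coord j)
  have "((\<lambda>x. x $ j) has_derivative (\<lambda>v. axis j 1 \<bullet> v)) (at x)" for x :: "real ^ 'a"
    by (auto simp: inner_axis' intro!: derivative_eq_intros bounded_linear_imp_has_derivative)
  then show ?case by (intro exI[of _ "\<lambda>x. axis j 1"]) (auto intro: elementary_smooth.const)
next
  case (add f g)
  then obtain f' g' where *: "\<And>x. (f has_derivative (\<lambda>v. f' x \<bullet> v)) (at x)" "\<And>j. elementary_smooth (\<lambda>x. f' x $ j)"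
    "\<And>x. (g has_derivative (\<lambda>v. g' x \<bullet> v)) (at x)" "\<And>j. elementary_smooth (\<lambda>x. g' x $ j)" by blast
  have "((\<lambda>x. f x + g x) has_derivative (\<lambda>v. (f' x + g' x) \<bullet> v)) (at x)" for x
    by (rule has_derivative_eq_rhs[OF has_derivative_add[OF *(1) *(3)]]) (simp add: inner_add_left)
  with *(2,4) show ?case
    by (intro exI[of _ "\<lambda>x. f' x + g' x"]) (auto intro: elementary_smooth.add)
next
  case (mult f g)
  then obtain f' g' where *: "\<And>x. (f has_derivative (\<lambda>v. f' x \<bullet> v)) (at x)" "\<And>j. elementary_smooth (\<lambda>x. f' x $ j)"
    "\<And>x. (g has_derivative (\<lambda>v. g' x \<bullet> v)) (at x)" "\<And>j. elementary_smooth (\<lambda>x. g' x $ j)" by blast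
  have "((\<lambda>x. f x * g x) has_derivative (\<lambda>v. (f x *\<^sub>R g' x + g x *\<^sub>R f' x) \<bullet> v)) (at x)" for x
    by (rule has_derivative_eq_rhs[OF has_derivative_mult[OF *(1) *(3)]]) (simp add: inner_add_left algebra_simps)
  moreover have "elementary_smooth (\<lambda>x. (f x *\<^sub>R g' x + g x *\<^sub>R f' x) $ j)" for j
    using elementary_smooth.add[OF elementary_smooth.mult[OF mult.hyps(1) *(4)[of j]] elementary_smooth.mult[OF mult.hyps(2) *(2)[of j]]]
    by simp
  ultimately show ?case
    by (intro exI[of _ "\<lambda>x. f x *\<^sub>R g' x + g x *\<^sub>R f' x"]) auto
next
  case (bump k r)
  define d where "d x = exp_bump (k + 2) (r - x \<bullet> x) + (- real k) * exp_bump (Suc k) (r - x \<bullet> x)" for x :: "real ^ 'a"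
  have "((\<lambda>x. exp_bump k (r - x \<bullet> x)) has_derivative (\<lambda>v. ((-2 * d x) *\<^sub>R x) \<bullet> v)) (at x)" for x
  proof -
    have "((\<lambda>x. r - x \<bullet> x) has_derivative (\<lambda>v. - 2 * (x \<bullet> v))) (at x)"
      by (auto intro!: derivative_eq_intros simp: inner_commute)
    from has_derivative_compose[OF this exp_bump_deriv[unfolded has_field_derivative_def]]
    show ?thesis by (rule has_derivative_eq_rhs) (auto simp: d_def algebra_simps)
  qed
  moreover have "elementary_smooth (\<lambda>x. ((-2 * d x) *\<^sub>R x) $ j)" for j
    unfolding d_def vector_scaleR_component real_scaleR_def by (intro elementary_smooth.intros)
  ultimately show ?case by (intro exI[of _ "\<lambda>x. (-2 * d x) *\<^sub>R x"]) auto
qed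

lemma elementary_smooth_continuous: "elementary_smooth f \<Longrightarrow> continuous_on UNIV f"
  using elementary_smooth_gradient[of f] 
  by (blast intro: continuous_at_imp_continuous_on has_derivative_continuous)

lemma partial_deriv_eq: "(f has_derivative f') (at x) \<Longrightarrow> partial_deriv j f x = f' (axis j 1)"
  by (metis frechet_derivative_at partial_deriv_def)

lemma Ck_onD:
  assumes "f \<in> Ck_on k \<Omega>"
  shows "length \<alpha> < k \<Longrightarrow> x \<in> \<Omega> \<Longrightarrow> iter_deriv \<alpha> f differentiable (at x)"
    "length \<alpha> \<le> k \<Longrightarrow> continuous_on \<Omega> (iter_deriv \<alpha> f)"
  using assms by (auto simp: Ck_on_def)

text \<open>Every iterated derivative of a member of \<open>X\<close> is again in \<open>X\<close>,
  hence differentiable and in particular continuous.\<close>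

lemma smooth_on_UNIV_coinduct:
  assumes "f \<in> X" and X: "\<And>f. f \<in> X \<Longrightarrow> (\<forall>x. f differentiable (at x)) \<and> (\<forall>j. partial_deriv j f \<in> X)"
  shows "f \<in> smooth_on UNIV"
proof -
  have "iter_deriv \<alpha> f \<in> X" for \<alpha> by (induction \<alpha>) (use assms in auto)
  then show ?thesis using X
    by (auto simp: smooth_on_def Ck_on_def intro!: continuous_at_imp_continuous_on differentiable_imp_continuous_within)
qed

text \<open>Over a compact box, joint continuity of the differentiated integrand suffices for
  differentiation under the integral sign. The derivative first appears as an integral of bounded
  linear maps, whose components are then read off.\<close>

lemma has_derivative_convolution:
  fixes \<sigma> :: "real ^ 'n::finite \<Rightarrow> real"
  assumes s: "\<And>x. (\<sigma> has_derivative (\<lambda>v. \<sigma>' x \<bullet> v)) (at x)" "continuous_on UNIV \<sigma>'"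
    and w: "continuous_on UNIV w"
  shows "((\<lambda>x. integral (cbox a b) (\<lambda>y. \<sigma> (x - y) * w y)) has_derivative
     (\<lambda>v. (\<chi> j. integral (cbox a b) (\<lambda>y. \<sigma>' (x - y) $ j * w y)) \<bullet> v)) (at x)"
proof -
  define D where "D x y = blinfun_inner_left (w y *\<^sub>R \<sigma>' (x - y))" for x y
  have cs: "continuous_on UNIV \<sigma>" 
    using s(1) by (meson continuous_at_imp_continuous_on has_derivative_continuous)
  have cD: "continuous_on (UNIV \<times> cbox a b) (\<lambda>(x, y). D x y)"
    unfolding D_def split_beta
    by (intro continuous_intros continuous_on_compose2[OF s(2)] continuous_on_compose2[OF w]) auto
  have "((\<lambda>x. integral (cbox a b) (\<lambda>y. \<sigma> (x - y) * w y)) has_derivative 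
     blinfun_apply (integral (cbox a b) (D x))) (at x within UNIV)"
  proof (rule leibniz_rule[OF _ _ cD])
    fix x y
    have "((\<lambda>x. \<sigma> (x - y)) has_derivative (\<lambda>v. \<sigma>' (x - y) \<bullet> v)) (at x)"
      by (rule has_derivative_compose[where f="\<lambda>x. x - y", OF _ s(1), simplified]) 
        (auto intro!: derivative_eq_intros)
    from has_derivative_mult_left[OF this, of "w y"]
    show "((\<lambda>x. \<sigma> (x - y) * w y) has_derivative blinfun_apply (D x y)) (at x within UNIV)"
      by (rule has_derivative_eq_rhs) (simp add: D_def fun_eq_iff inner_commute mult.commute)
  next
    show "(\<lambda>y. \<sigma> (x - y) * w y) integrable_on cbox a b" for x
      by (intro integrable_continuous continuous_intros continuous_on_compose2[OF cs] continuous_on_compose2[OF w]) auto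
  qed auto
  moreover have "blinfun_apply (integral (cbox a b) (D x)) v = 
      (\<chi> j. integral (cbox a b) (\<lambda>y. \<sigma>' (x - y) $ j * w y)) \<bullet> v" for v
  proof -
    have i: "D x integrable_on cbox a b"
      unfolding D_def
      by (intro integrable_continuous continuous_intros continuous_on_compose2[OF s(2)] continuous_on_compose2[OF w]) auto
    have "blinfun_apply (integral (cbox a b) (D x)) v = integral (cbox a b) (\<lambda>y. D x y v)"
      by (rule blinfun_apply_integral[OF i])
    also have "\<dots> = integral (cbox a b) (\<lambda>y. \<Sum>j\<in>UNIV. (\<sigma>' (x - y) $ j * w y) * v $ j)"
      by (simp add: D_def inner_vec_def sum_distrib_left sum_distrib_right mult_ac)
    also have "\<dots> = (\<Sum>j\<in>UNIV. integral (cbox a b) (\<lambda>y. (\<sigma>' (x - y) $ j * w y) * v $ j))"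
      by (intro Henstock_Kurzweil_Integration.integral_sum integrable_continuous continuous_intros
          continuous_on_compose2[OF s(2)] continuous_on_compose2[OF w]) auto
    also have "\<dots> = (\<chi> j. integral (cbox a b) (\<lambda>y. \<sigma>' (x - y) $ j * w y)) \<bullet> v"
      by (simp add: inner_vec_def)
    finally show ?thesis .
  qed
  then have "blinfun_apply (integral (cbox a b) (D x)) = 
      (\<lambda>v. (\<chi> j. integral (cbox a b) (\<lambda>y. \<sigma>' (x - y) $ j * w y)) \<bullet> v)" by (rule ext)
  ultimately show ?thesis by simp
qed

text \<open>The derivative falls on the kernel, so convolutions of the fixed function
  \<open>w\<close> with elementary kernels form a class that is closed under partial
  derivatives.\<close>

lemma convolution_smooth:
  fixes \<sigma> :: "real ^ 'n::finite \<Rightarrow> real"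
  assumes "elementary_smooth \<sigma>" "continuous_on UNIV w"
  shows "(\<lambda>x. integral (cbox a b) (\<lambda>y. \<sigma> (x - y) * w y)) \<in> smooth_on UNIV"
proof -
  define X where "X = {(\<lambda>x. integral (cbox a b) (\<lambda>y. \<sigma> (x - y) * w y)) |\<sigma> :: real ^ 'n \<Rightarrow> real. elementary_smooth \<sigma>}"
  show ?thesis
  proof (rule smooth_on_UNIV_coinduct[where X=X])
    fix f assume "f \<in> X"
    then obtain \<sigma> where \<sigma>: "elementary_smooth \<sigma>" "f = (\<lambda>x. integral (cbox a b) (\<lambda>y. \<sigma> (x - y) * w y))" 
      by (auto simp: X_def)
    obtain \<sigma>' where \<sigma>': "\<And>x. (\<sigma> has_derivative (\<lambda>v. \<sigma>' x \<bullet> v)) (at x)" "\<And>j. elementary_smooth (\<lambda>x. \<sigma>' x $ j)"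
      using elementary_smooth_gradient[OF \<sigma>(1)] by blast
    have "continuous_on UNIV (\<lambda>x. \<chi> j. \<sigma>' x $ j)"
      by (intro continuous_on_vec_lambda elementary_smooth_continuous \<sigma>'(2))
    then have c': "continuous_on UNIV \<sigma>'" by (simp add: vec_lambda_eta)
    note d = has_derivative_convolution[OF \<sigma>'(1) c' assms(2), of a b, folded \<sigma>(2)]
    have "partial_deriv j f = (\<lambda>x. integral (cbox a b) (\<lambda>y. \<sigma>' (x - y) $ j * w y))" for j
      using partial_deriv_eq[OF d] by (simp add: fun_eq_iff inner_axis)
    moreover have "(\<lambda>x. integral (cbox a b) (\<lambda>y. \<sigma>' (x - y) $ j * w y)) \<in> X" for j
      unfolding X_def by (rule CollectI, rule exI[of _ "\<lambda>x. \<sigma>' x $ j"]) (use \<sigma>'(2)[of j] in simp)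
    ultimately have "partial_deriv j f \<in> X" for j by simp
    with d show "(\<forall>x. f differentiable (at x)) \<and> (\<forall>j. partial_deriv j f \<in> X)"
      by (auto simp: differentiable_def)
  qed (use assms(1) in \<open>auto simp: X_def\<close>)
qed


lemma elementary_smooth_partial:
  assumes "elementary_smooth \<sigma>"
  obtains \<sigma>' where "\<And>x. (\<sigma> has_derivative (\<lambda>v. \<sigma>' x \<bullet> v)) (at x)" "continuous_on UNIV \<sigma>'"
proof -
  obtain \<sigma>' where \<sigma>': "\<And>x. (\<sigma> has_derivative (\<lambda>v. \<sigma>' x \<bullet> v)) (at x)" "\<And>j. elementary_smooth (\<lambda>x. \<sigma>' x $ j)"
    using elementary_smooth_gradient[OF assms] by blast
  have "continuous_on UNIV (\<lambda>x. \<chi> j. \<sigma>' x $ j)"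
    by (intro continuous_on_vec_lambda elementary_smooth_continuous \<sigma>'(2))
  then have "continuous_on UNIV \<sigma>'" by (simp add: vec_lambda_eta)
  with \<sigma>'(1) that show ?thesis by blast
qed

lemma mollifier_exists:
  assumes "\<delta> > 0"
  obtains \<rho> :: "real ^ 'n::finite \<Rightarrow> real" where "elementary_smooth \<rho>" "\<And>x. \<rho> x \<ge> 0" "\<And>x. \<rho> (- x) = \<rho> x"
    "\<And>x. norm x \<ge> \<delta> \<Longrightarrow> \<rho> x = 0" "(LINT x|lebesgue. \<rho> x) = 1"
proof -
  define b where "b x = exp_bump 0 (\<delta>\<^sup>2 - x \<bullet> x)" for x :: "real ^ 'n"
  have es: "elementary_smooth b" unfolding b_def by (rule elementary_smooth.bump)
  have cb: "continuous_on UNIV b" by (rule elementary_smooth_continuous[OF es])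
  have nn: "b x \<ge> 0" for x by (simp add: b_def exp_bump_def)
  have out: "b x = 0" if "norm x \<ge> \<delta>" for x
  proof -
    have "\<delta>\<^sup>2 \<le> (norm x)\<^sup>2" using that assms by (intro power_mono) auto
    then show ?thesis by (simp add: b_def exp_bump_def power2_norm_eq_inner)
  qed
  have int: "integrable lebesgue b"
    by (rule integrable_lebesgue_cc[OF cb compact_cball[of 0 \<delta>]]) (use out in auto)
  define c where "c = (LINT x|lebesgue. b x)"
  have "c \<noteq> 0"
  proof
    assume "c = 0"
    then have AE0: "AE x in lebesgue. b x = 0"
      using integral_nonneg_eq_0_iff_AE[OF int] nn by (simp add: c_def)
    have pos: "b x \<noteq> 0" if "x \<in> ball 0 \<delta>" for x
    proof -
      have "(norm x)\<^sup>2 < \<delta>\<^sup>2" using that by (intro power_strict_mono) auto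
      then show ?thesis by (simp add: b_def exp_bump_def power2_norm_eq_inner)
    qed
    have "AE x in lebesgue. x \<notin> ball (0 :: real ^ 'n) \<delta>"
      using AE0 by (rule eventually_mono) (use pos in blast)
    then have "ball (0 :: real ^ 'n) \<delta> \<in> null_sets lebesgue" by (subst AE_iff_null_sets) auto
    then have "negligible (ball (0 :: real ^ 'n) \<delta>)" by (simp add: negligible_iff_null_sets)
    then show False using open_not_negligible[of "ball (0 :: real ^ 'n) \<delta>"] assms by simp
  qed
  moreover have "c \<ge> 0" unfolding c_def using nn by (intro integral_nonneg_AE) auto
  ultimately have c: "c > 0" by simp
  show ?thesis
  proof (rule that[of "\<lambda>x. (1 / c) * b x"])
    show "elementary_smooth (\<lambda>x. (1 / c) * b x)" by (intro elementary_smooth.mult es elementary_smooth.const)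
    show "(LINT x|lebesgue. (1 / c) * b x) = 1" using c by (simp add: c_def[symmetric])
  qed (use c nn out in \<open>auto simp: b_def\<close>)
qed

lemma mollifier_integrable:
  fixes \<rho> :: "real ^ 'n::finite \<Rightarrow> real"
  assumes "continuous_on UNIV \<rho>" "\<And>x. norm x \<ge> \<delta> \<Longrightarrow> \<rho> x = 0" "continuous_on UNIV w"
  shows "integrable lebesgue (\<lambda>y. \<rho> (x - y) * (w y :: real))"
  by (rule integrable_lebesgue_cc[OF _ compact_cball[of x \<delta>]])
    (auto simp: dist_norm intro!: continuous_intros assms continuous_on_compose2[OF assms(1)])

lemma mollifier_close:
  fixes \<rho> :: "real ^ 'n::finite \<Rightarrow> real"
  assumes "continuous_on UNIV \<rho>" "\<And>x. \<rho> x \<ge> 0" "\<And>x. \<rho> (- x) = \<rho> x" "\<And>x. norm x \<ge> \<delta> \<Longrightarrow> \<rho> x = 0"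
    "(LINT x|lebesgue. \<rho> x) = 1" 
    and w: "continuous_on UNIV w" "\<And>y. dist y x < \<delta> \<Longrightarrow> \<bar>w y - w x\<bar> \<le> \<epsilon>"
  shows "\<bar>(LINT y|lebesgue. \<rho> (x - y) * w y) - w x\<bar> \<le> \<epsilon>"
proof -
  \<comment> \<open>Evenness turns the reflected kernel into a translated one, so translation
    invariance alone gives its integral.\<close>
  have eq: "\<rho> (x - y) = \<rho> (- x + y)" for y using assms(3)[of "x - y"] by simp
  have one: "(LINT y|lebesgue. \<rho> (x - y)) = 1"
    unfolding eq using integral_lebesgue_translate[OF assms(1), of "- x"] assms(5) by simp
  have i: "integrable lebesgue (\<lambda>y. \<rho> (x - y) * w y)" if "continuous_on UNIV w" for w
    by (rule mollifier_integrable[OF assms(1) _ that]) (rule assms(4))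
  have i1: "integrable lebesgue (\<lambda>y. \<rho> (x - y))" using i[OF continuous_on_const[of UNIV 1]] by simp
  have "(LINT y|lebesgue. \<rho> (x - y) * w y) - w x = (LINT y|lebesgue. \<rho> (x - y) * w y) - (LINT y|lebesgue. \<rho> (x - y) * w x)"
    by (simp add: one)
  also have "\<dots> = (LINT y|lebesgue. \<rho> (x - y) * w y - \<rho> (x - y) * w x)"
    using i[OF w(1)] i1 by (intro Bochner_Integration.integral_diff[symmetric]) auto
  also have "\<bar>\<dots>\<bar> \<le> (LINT y|lebesgue. \<rho> (x - y) * \<epsilon>)"
  proof (rule integral_abs_bound_integral)
    show "integrable lebesgue (\<lambda>y. \<rho> (x - y) * w y - \<rho> (x - y) * w x)" using i[OF w(1)] i1 by auto
    show "integrable lebesgue (\<lambda>y. \<rho> (x - y) * \<epsilon>)" using i1 by simp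
    fix y
    show "\<bar>\<rho> (x - y) * w y - \<rho> (x - y) * w x\<bar> \<le> \<rho> (x - y) * \<epsilon>"
    proof (cases "norm (x - y) < \<delta>")
      case True
      then have "\<bar>w y - w x\<bar> \<le> \<epsilon>" using w(2) by (simp add: dist_norm norm_minus_commute)
      then show ?thesis using assms(2)[of "x - y"]
        by (simp add: right_diff_distrib[symmetric] abs_mult mult_left_mono)
    qed (use assms(4)[of "x - y"] in simp)
  qed
  also have "\<dots> = \<epsilon>" by (simp add: one)
  finally show ?thesis .
qed

lemma compact_if_closed_subset: "compact L \<Longrightarrow> closed C \<Longrightarrow> C \<subseteq> L \<Longrightarrow> compact C"
  for L :: "'a::t2_space set"
  by (metis compact_Int_closed inf.absorb_iff2)

text \<open>If one of two points at distance less than 1 lies in \<open>K\<close>, both lie in its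
  compact unit neighbourhood, where continuity is uniform; otherwise both values are zero.\<close>

lemma uniformly_continuous_cc:
  fixes w :: "'a::euclidean_space \<Rightarrow> 'b::real_normed_vector"
  assumes "continuous_on UNIV w" "compact K" "\<And>x. x \<notin> K \<Longrightarrow> w x = 0" "\<epsilon> > 0"
  obtains \<delta> where "\<delta> > 0" "\<And>x y. dist y x < \<delta> \<Longrightarrow> norm (w y - w x) < \<epsilon>"
proof -
  define L where "L = {x + y |x y. x \<in> K \<and> y \<in> cball 0 (1::real)}"
  have "uniformly_continuous_on L w"
    unfolding L_def by (intro compact_uniformly_continuous compact_thicken assms(2) continuous_on_subset[OF assms(1)]) auto
  then obtain d where d: "d > 0" "\<And>x y. x \<in> L \<Longrightarrow> y \<in> L \<Longrightarrow> dist y x < d \<Longrightarrow> dist (w y) (w x) < \<epsilon>"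
    using assms(4) unfolding uniformly_continuous_on_def by metis
  have L: "y \<in> L" if "x \<in> K" "dist y x < 1" for x y
  proof -
    have "y = x + (y - x)" "y - x \<in> cball 0 1" using that by (auto simp: dist_norm norm_minus_commute)
    then show ?thesis using that(1) unfolding L_def by blast
  qed
  have "norm (w y - w x) < \<epsilon>" if "dist y x < min d 1" for x y
  proof (cases "x \<in> K \<or> y \<in> K")
    case True
    then have "x \<in> L" "y \<in> L" using L[of x x] L[of x y] L[of y y] L[of y x] that by (auto simp: dist_commute)
    then show ?thesis using d(2)[of x y] that by (simp add: dist_norm)
  qed (use assms(3,4) in auto)
  then show ?thesis using that[of "min d 1"] d(1) by simp
qed

lemma C1c_uniformly_continuous:
  assumes "C1c S \<phi> \<phi>'" "\<epsilon> > 0"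
  obtains \<delta> where "\<delta> > 0" "\<And>x y. dist y x < \<delta> \<Longrightarrow> \<bar>\<phi> y - \<phi> x\<bar> \<le> \<epsilon>" "\<And>x y. dist y x < \<delta> \<Longrightarrow> norm (\<phi>' y - \<phi>' x) \<le> \<epsilon>"
proof -
  obtain K where K: "compact K" "K \<subseteq> S" "\<And>x. x \<notin> K \<Longrightarrow> \<phi> x = 0" "\<And>x. x \<notin> K \<Longrightarrow> \<phi>' x = 0"
    using C1c_support[OF assms(1)] by blast
  obtain d1 where d1: "d1 > 0" "\<And>x y. dist y x < d1 \<Longrightarrow> norm (\<phi> y - \<phi> x) < \<epsilon>"
    using uniformly_continuous_cc[OF C1cD(3)[OF assms(1)] K(1,3) assms(2)] by metis
  obtain d2 where d2: "d2 > 0" "\<And>x y. dist y x < d2 \<Longrightarrow> norm (\<phi>' y - \<phi>' x) < \<epsilon>"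
    using uniformly_continuous_cc[OF C1cD(2)[OF assms(1)] K(1,4) assms(2)] by metis
  show ?thesis
    by (rule that[of "min d1 d2"]) (use d1 d2 in \<open>auto intro: less_imp_le\<close>)
qed

text \<open>Mollification, with uniform convergence of values and gradients and with supports in one
  compact set. It transfers every identity that is linear and of first order in the test function
  from smooth to C^1 test functions.\<close>

lemma C1c_approx:
  fixes S :: "(real ^ 'n::finite) set"
  assumes "open S" "C1c S \<phi> \<phi>'"
  obtains \<eta> \<eta>' L where "compact L" "L \<subseteq> S" "\<And>k::nat. \<eta> k \<in> test_functions S" "\<And>k. C1c L (\<eta> k) (\<eta>' k)"
    "\<And>k x. \<bar>\<eta> k x - \<phi> x\<bar> \<le> 1 / real (Suc k)" "\<And>k x. norm (\<eta>' k x - \<phi>' x) \<le> 1 / real (Suc k)"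
proof -
  obtain K where K: "compact K" "K \<subseteq> S" "\<And>x. x \<notin> K \<Longrightarrow> \<phi> x = 0" "\<And>x. x \<notin> K \<Longrightarrow> \<phi>' x = 0"
    using C1c_support[OF assms(2)] by blast
  obtain a b where ab: "K \<subseteq> cbox a b" using K(1) by (meson bounded_subset_cbox_symmetric compact_imp_bounded)
  obtain e where e: "e > 0" "{x + y |x y. x \<in> K \<and> y \<in> cball 0 e} \<subseteq> S" 
  proof -
    obtain e where e: "e > 0" "(\<Union>x\<in>K. ball x e) \<subseteq> S"
      using compact_subset_open_imp_ball_epsilon_subset[OF K(1) assms(1) K(2)] by metis
    have "x + y \<in> S" if "x \<in> K" "norm y \<le> e / 2" for x y
    proof -
      have "x + y \<in> ball x e" using that e(1) by (simp add: dist_norm)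
      then show ?thesis using e(2) that(1) by blast
    qed
    then show ?thesis using that[of "e / 2"] e(1) by auto
  qed
  define L where "L = {x + y |x y. x \<in> K \<and> y \<in> cball 0 e}"
  have L: "compact L" "L \<subseteq> S" unfolding L_def using compact_thicken[OF K(1)] e by auto
  have "\<exists>\<eta> \<eta>'. \<eta> \<in> test_functions S \<and> C1c L \<eta> \<eta>' \<and> (\<forall>x. \<bar>\<eta> x - \<phi> x\<bar> \<le> 1 / real (Suc k)) 
     \<and> (\<forall>x. norm (\<eta>' x - \<phi>' x) \<le> 1 / real (Suc k))" for k
  proof -
    \<comment> \<open>Dividing the accuracy by the dimension lets the bounds for the components of
      the gradient add up to \<open>1 / real (Suc k)\<close>.\<close>
    define N where "N = real CARD('n)"
    have N: "N \<ge> 1" unfolding N_def by simp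
    have "1 / real (Suc k) / N > 0" using N by simp
    then obtain \<delta>0 where d0: "\<delta>0 > 0" "\<And>x y. dist y x < \<delta>0 \<Longrightarrow> \<bar>\<phi> y - \<phi> x\<bar> \<le> 1 / real (Suc k) / N"
       "\<And>x y. dist y x < \<delta>0 \<Longrightarrow> norm (\<phi>' y - \<phi>' x) \<le> 1 / real (Suc k) / N"
      using C1c_uniformly_continuous[OF assms(2)] by metis
    define \<delta> where "\<delta> = min \<delta>0 e"
    have d: "\<delta> > 0" using d0 e by (simp add: \<delta>_def)
    obtain \<rho> :: "real ^ 'n \<Rightarrow> real" where r: "elementary_smooth \<rho>" "\<And>x. \<rho> x \<ge> 0" "\<And>x. \<rho> (- x) = \<rho> x"
      "\<And>x. norm x \<ge> \<delta> \<Longrightarrow> \<rho> x = 0" "(LINT x|lebesgue. \<rho> x) = 1"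
      using mollifier_exists[OF d] by metis
    note cr = elementary_smooth_continuous[OF r(1)]
    obtain \<rho>' where r': "\<And>x. (\<rho> has_derivative (\<lambda>v. \<rho>' x \<bullet> v)) (at x)" "continuous_on UNIV \<rho>'"
      using elementary_smooth_partial[OF r(1)] by metis
    define \<eta> where "\<eta> x = integral (cbox a b) (\<lambda>y. \<rho> (x - y) * \<phi> y)" for x
    define \<eta>' where "\<eta>' x = (\<chi> j. integral (cbox a b) (\<lambda>y. \<rho>' (x - y) $ j * \<phi> y))" for x
    have c\<phi>: "continuous_on UNIV \<phi>" "continuous_on UNIV \<phi>'" using C1cD[OF assms(2)] by auto
    have d\<eta>: "(\<eta> has_derivative (\<lambda>v. \<eta>' x \<bullet> v)) (at x)" for x
      unfolding \<eta>_def \<eta>'_def by (rule has_derivative_convolution[OF r' c\<phi>(1)])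
    have smooth: "\<eta> \<in> smooth_on UNIV"
      using convolution_smooth[OF r(1) c\<phi>(1), of a b] by (simp add: \<eta>_def[abs_def])
    \<comment> \<open>Differentiation under the integral uses a box, the estimates use the whole
      space; the two integrals agree because \<phi> vanishes off the box.\<close>
    have box: "integral (cbox a b) (\<lambda>y. g y * \<phi> y) = (LINT y|lebesgue. g y * \<phi> y)" if "continuous_on UNIV g" for g
    proof -
      have "integral (cbox a b) (\<lambda>y. g y * \<phi> y) = integral UNIV (\<lambda>y. g y * \<phi> y)"
      proof -
        have "(if y \<in> cbox a b then g y * \<phi> y else 0) = g y * \<phi> y" for y
          using ab K(3)[of y] by (cases "y \<in> K") auto
        then show ?thesis using integral_restrict_UNIV[of "cbox a b" "\<lambda>y. g y * \<phi> y"] by simp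
      qed
      also have "\<dots> = (LINT y|lebesgue. g y * \<phi> y)"
        using K(1,3) that c\<phi>
        by (subst lebesgue_on_UNIV_eq[symmetric], intro lebesgue_integral_eq_integral[symmetric])
          (auto simp: lebesgue_on_UNIV_eq intro!: integrable_lebesgue_cc[where K=K] continuous_intros)
      finally show ?thesis .
    qed
    have \<eta>_eq: "\<eta> x = (LINT y|lebesgue. \<rho> (x - y) * \<phi> y)" for x
      unfolding \<eta>_def by (rule box) (intro continuous_intros continuous_on_compose2[OF cr]; simp)
    \<comment> \<open>Integration by parts moves the derivative from the kernel to \<phi>: the
      gradient of the mollification is the mollification of the gradient, so the same closeness
      lemma applies to both.\<close>
    have \<eta>'_eq: "\<eta>' x $ j = (LINT y|lebesgue. \<rho> (x - y) * \<phi>' y $ j)" for x j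
    proof -
      have "C1c S (\<lambda>y. \<phi> y * \<rho> (x - y)) (\<lambda>y. \<phi> y *\<^sub>R (- \<rho>' (x - y)) + \<rho> (x - y) *\<^sub>R \<phi>' y)"
      proof (rule C1c_mult[OF assms(2)])
        fix y
        show "((\<lambda>y. \<rho> (x - y)) has_derivative (\<lambda>v. (- \<rho>' (x - y)) \<bullet> v)) (at y)"
          by (rule has_derivative_eq_rhs[OF has_derivative_compose[where f="\<lambda>y. x - y", OF _ r'(1)]])
             (auto intro!: derivative_eq_intros)
        show "continuous_on UNIV (\<lambda>y. - \<rho>' (x - y))"
          by (intro continuous_intros continuous_on_compose2[OF r'(2)]) auto
      qed
      from integral_partial_C1c[OF this, of j]
      have 0: "(LINT y|lebesgue. - (\<rho>' (x - y) $ j * \<phi> y) + \<rho> (x - y) * \<phi>' y $ j) = 0"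
        by (simp add: mult.commute)
      have i1: "integrable lebesgue (\<lambda>y. \<rho>' (x - y) $ j * \<phi> y)"
        by (rule integrable_lebesgue_cc[OF _ K(1)])
          (auto simp: K(3) intro!: continuous_intros c\<phi> continuous_on_compose2[OF r'(2)])
      have i2: "integrable lebesgue (\<lambda>y. \<rho> (x - y) * \<phi>' y $ j)"
        by (rule mollifier_integrable[OF cr r(4)], assumption) (auto intro!: continuous_intros c\<phi>)
      have "\<eta>' x $ j = (LINT y|lebesgue. \<rho>' (x - y) $ j * \<phi> y)"
        unfolding \<eta>'_def vec_lambda_beta
        by (rule box) (auto intro!: continuous_intros continuous_on_compose2[OF r'(2)])
      then show ?thesis using 0 i1 i2 by simp
    qed
    have out: "\<eta> x = 0 \<and> \<eta>' x = 0" if "x \<notin> L" for x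
    proof -
      have "\<rho> (x - y) = 0" if "y \<in> K" for y
      proof (rule r(4), rule ccontr)
        assume "\<not> \<delta> \<le> norm (x - y)"
        then have "x = y + (x - y)" "x - y \<in> cball 0 e" by (auto simp: \<delta>_def)
        then show False using that \<open>x \<notin> L\<close> unfolding L_def by blast
      qed
      then have z: "\<rho> (x - y) * \<phi> y = 0" "\<rho> (x - y) * \<phi>' y $ j = 0" for y j
        using K(3,4)[of y] by (cases "y \<in> K"; simp)+
      show ?thesis unfolding \<eta>_eq vec_eq_iff \<eta>'_eq z by simp
    qed
    have cl: "closure {x. \<eta> x \<noteq> 0} \<subseteq> L"
      using out by (intro closure_minimal compact_imp_closed[OF L(1)]) auto
    have "\<eta> \<in> test_functions S"
      unfolding test_functions_def using smooth cl L compact_if_closed_subset[OF L(1) closed_closure cl] by auto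
    moreover have "C1c L \<eta> \<eta>'"
    proof (rule C1cI[OF d\<eta> _ L(1)])
      have "partial_deriv j \<eta> = (\<lambda>x. \<eta>' x $ j)" for j
        using partial_deriv_eq[OF d\<eta>] by (simp add: fun_eq_iff inner_axis)
      moreover have "continuous_on UNIV (iter_deriv [j] \<eta>)" for j
        using smooth by (intro Ck_onD(2)[where k=1]) (auto simp: smooth_on_def)
      ultimately have "continuous_on UNIV (\<lambda>x. \<chi> j. \<eta>' x $ j)"
        by (intro continuous_on_vec_lambda) simp
      then show "continuous_on UNIV \<eta>'" by (simp add: vec_lambda_eta)
    qed (use out in auto)
    moreover have "\<bar>\<eta> x - \<phi> x\<bar> \<le> 1 / real (Suc k)" for x
    proof -
      have "\<bar>\<eta> x - \<phi> x\<bar> \<le> 1 / real (Suc k) / N"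
        unfolding \<eta>_eq by (rule mollifier_close[where \<delta>=\<delta>, OF cr r(2-5) c\<phi>(1)]) (use d0 in \<open>auto simp: \<delta>_def\<close>)
      also have "\<dots> \<le> 1 / real (Suc k)" 
        using divide_left_mono[of 1 N "1 / real (Suc k)"] N by simp
      finally show ?thesis .
    qed
    moreover have "norm (\<eta>' x - \<phi>' x) \<le> 1 / real (Suc k)" for x
    proof -
      have "\<bar>(\<eta>' x - \<phi>' x) $ j\<bar> \<le> 1 / real (Suc k) / N" for j
        unfolding vector_minus_component \<eta>'_eq
      proof (rule mollifier_close[where \<delta>=\<delta>, OF cr r(2-5), where w="\<lambda>y. \<phi>' y $ j"])
        fix y assume "dist y x < \<delta>"
        then have "norm (\<phi>' y - \<phi>' x) \<le> 1 / real (Suc k) / N" using d0 by (simp add: \<delta>_def)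
        then show "\<bar>\<phi>' y $ j - \<phi>' x $ j\<bar> \<le> 1 / real (Suc k) / N"
          using component_le_norm_cart[of "\<phi>' y - \<phi>' x" j] by simp
      qed (auto intro!: continuous_intros c\<phi>)
      then have "(\<Sum>j\<in>UNIV. \<bar>(\<eta>' x - \<phi>' x) $ j\<bar>) \<le> (\<Sum>j\<in>(UNIV::'n set). 1 / real (Suc k) / N)"
        by (intro sum_mono)
      also have "\<dots> = 1 / real (Suc k)" using N by (simp add: N_def)
      finally show ?thesis using norm_le_l1_cart order_trans by blast
    qed
    ultimately show ?thesis by blast
  qed
  then obtain \<eta> \<eta>' where "\<And>k. \<eta> k \<in> test_functions S \<and> C1c L (\<eta> k) (\<eta>' k) \<and> (\<forall>x. \<bar>\<eta> k x - \<phi> x\<bar> \<le> 1 / real (Suc k)) 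
     \<and> (\<forall>x. norm (\<eta>' k x - \<phi>' x) \<le> 1 / real (Suc k))" by metis
  then show ?thesis using that[OF L, of \<eta> \<eta>'] by blast
qed

section \<open>Weak derivatives and weak solutions\<close>

lemma integral_lebesgue_on_eq:
  fixes w :: "'a::euclidean_space \<Rightarrow> 'b::euclidean_space"
  assumes "S \<in> sets lebesgue" "\<And>x. x \<notin> S \<Longrightarrow> w x = 0"
  shows "(LINT x|lebesgue_on S. w x) = (LINT x|lebesgue. w x)" 
    "integrable (lebesgue_on S) w \<longleftrightarrow> integrable lebesgue w"
proof -
  have "(\<lambda>x. indicator S x *\<^sub>R w x) = w" using assms(2) by (auto simp: indicator_def fun_eq_iff)
  then show "(LINT x|lebesgue_on S. w x) = (LINT x|lebesgue. w x)" 
    "integrable (lebesgue_on S) w \<longleftrightarrow> integrable lebesgue w"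
    using assms(1) by (simp_all add: integral_restrict_space integrable_restrict_space)
qed

lemma locally_integrableD:
  assumes "g \<in> locally_integrable \<Omega>" "compact K" "K \<subseteq> \<Omega>"
  shows "integrable lebesgue (\<lambda>x. indicator K x * g x)"
  using assms unfolding locally_integrable_def set_integrable_def by auto

lemma locally_integrableI:
  assumes "\<And>K. compact K \<Longrightarrow> K \<subseteq> \<Omega> \<Longrightarrow> integrable lebesgue (\<lambda>x. indicator K x * g x)"
  shows "g \<in> locally_integrable \<Omega>"
  using assms unfolding locally_integrable_def set_integrable_def by auto

lemma continuous_locally_integrable:
  assumes "continuous_on \<Omega> g" shows "g \<in> locally_integrable \<Omega>"
proof (rule locally_integrableI)
  fix K assume K: "compact K" "K \<subseteq> \<Omega>"
  have "integrable lborel (\<lambda>x. indicator K x *\<^sub>R g x)"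
    using K assms by (intro borel_integrable_compact) (auto intro: continuous_on_subset)
  then show "integrable lebesgue (\<lambda>x. indicator K x * g x)"
    by (simp add: integrable_completion borel_measurable_integrable)
qed

lemma integrable_mult_C1c:
  assumes "g \<in> locally_integrable \<Omega>" "C1c \<Omega> \<phi> \<phi>'"
  shows "integrable lebesgue (\<lambda>x. g x * \<phi> x)" "integrable lebesgue (\<lambda>x. g x * \<phi>' x $ j)"
proof -
  obtain K where K: "compact K" "K \<subseteq> \<Omega>" "\<And>x. x \<notin> K \<Longrightarrow> \<phi> x = 0" "\<And>x. x \<notin> K \<Longrightarrow> \<phi>' x = 0"
    using C1c_support[OF assms(2)] by blast
  show "integrable lebesgue (\<lambda>x. g x * \<phi> x)"
    using integrable_mult_cc[OF locally_integrableD[OF assms(1) K(1,2)] C1cD(3)[OF assms(2)] K(1,3)] by simp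
  show "integrable lebesgue (\<lambda>x. g x * \<phi>' x $ j)"
    using integrable_mult_cc[OF locally_integrableD[OF assms(1) K(1,2)] _ K(1), of "\<lambda>x. \<phi>' x $ j"] K(4)
      C1cD(2)[OF assms(2)] by (auto intro!: continuous_intros)
qed

lemma test_function_support:
  fixes x :: "real ^ 'n::finite"
  assumes "\<phi> \<in> test_functions S" "x \<notin> closure {x. \<phi> x \<noteq> 0}"
  shows "\<phi> x = 0" "partial_deriv j \<phi> x = 0"
proof -
  have out: "\<phi> y = 0" if "y \<notin> closure {x. \<phi> x \<noteq> 0}" for y
    using that closure_subset[of "{x. \<phi> x \<noteq> 0}"] by auto
  show "\<phi> x = 0" using assms(2) by (rule out)
  have "((\<lambda>x. 0 :: real) has_derivative (\<lambda>v. 0)) (at x)" by simp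
  then have "(\<phi> has_derivative (\<lambda>v. 0)) (at x)"
    by (rule has_derivative_transform_within_open[of _ _ _ _ "- closure {x. \<phi> x \<noteq> 0}"])
      (use assms(2) in \<open>auto intro: out\<close>)
  then show "partial_deriv j \<phi> x = 0" by (rule partial_deriv_eq[of _ "\<lambda>v. 0"])
qed

lemma frechet_derivative_inner_partial:
  fixes \<phi> :: "real ^ 'n::finite \<Rightarrow> real"
  assumes "\<phi> differentiable (at x)"
  shows "(\<phi> has_derivative (\<lambda>v. (\<chi> j. partial_deriv j \<phi> x) \<bullet> v)) (at x)"
proof -
  have d: "(\<phi> has_derivative frechet_derivative \<phi> (at x)) (at x)"
    using assms frechet_derivative_works by blast
  interpret D: linear "frechet_derivative \<phi> (at x)" by (rule has_derivative_linear[OF d])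
  have "frechet_derivative \<phi> (at x) v = (\<chi> j. partial_deriv j \<phi> x) \<bullet> v" for v
  proof -
    have "v = (\<Sum>j\<in>UNIV. v $ j *\<^sub>R axis j 1)" by (simp add: vec_eq_iff axis_def if_distrib cong: if_cong)
    then have "frechet_derivative \<phi> (at x) v = (\<Sum>j\<in>UNIV. v $ j *\<^sub>R frechet_derivative \<phi> (at x) (axis j 1))"
      by (metis (no_types, lifting) D.scaleR D.sum sum.cong)
    then show ?thesis by (simp add: inner_vec_def partial_deriv_def mult.commute)
  qed
  then have "frechet_derivative \<phi> (at x) = (\<lambda>v. (\<chi> j. partial_deriv j \<phi> x) \<bullet> v)" by (rule ext)
  from d[unfolded this] show ?thesis .
qed

lemma test_function_C1c:
  assumes "\<phi> \<in> test_functions S"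
  shows "C1c S \<phi> (\<lambda>x. \<chi> j. iter_deriv [j] \<phi> x)"
proof (rule C1cI[where K = "closure {x. \<phi> x \<noteq> 0}"])
  have s: "\<phi> \<in> Ck_on 1 UNIV" using assms by (auto simp: test_functions_def smooth_on_def)
  then have "\<phi> differentiable (at x)" for x using Ck_onD(1)[OF s, of "[]"] by simp
  then show "(\<phi> has_derivative (\<lambda>v. (\<chi> j. iter_deriv [j] \<phi> x) \<bullet> v)) (at x)" for x
    using frechet_derivative_inner_partial[of \<phi> x] by simp
  have "continuous_on UNIV (iter_deriv [j] \<phi>)" for j using Ck_onD(2)[OF s, of "[j]"] by simp
  then show "continuous_on UNIV (\<lambda>x. \<chi> j. iter_deriv [j] \<phi> x)"
    by (intro continuous_on_vec_lambda) simp
  show "(\<chi> j. iter_deriv [j] \<phi> x) = 0" if "x \<notin> closure {x. \<phi> x \<noteq> 0}" for x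
    using test_function_support(2)[OF assms that] by (simp add: vec_eq_iff)
qed (use assms in \<open>auto simp: test_functions_def intro: test_function_support(1)[OF assms]\<close>)

lemma iter_deriv_append: "iter_deriv (\<alpha> @ \<beta>) f = iter_deriv \<alpha> (iter_deriv \<beta> f)"
  by (induction \<alpha>) auto

lemma test_function_partial:
  assumes "\<phi> \<in> test_functions S"
  shows "partial_deriv j \<phi> \<in> test_functions S"
proof -
  have sub: "{x. partial_deriv j \<phi> x \<noteq> 0} \<subseteq> closure {x. \<phi> x \<noteq> 0}"
    using test_function_support(2)[OF assms] by blast
  then have cl: "closure {x. partial_deriv j \<phi> x \<noteq> 0} \<subseteq> closure {x. \<phi> x \<noteq> 0}"
    by (rule closure_minimal) simp
  have "partial_deriv j \<phi> \<in> Ck_on k UNIV" for k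
  proof -
    have s: "\<phi> \<in> Ck_on (Suc k) UNIV" using assms by (auto simp: test_functions_def smooth_on_def)
    have "iter_deriv \<alpha> (partial_deriv j \<phi>) = iter_deriv (\<alpha> @ [j]) \<phi>" for \<alpha> by (simp add: iter_deriv_append)
    then show ?thesis using s unfolding Ck_on_def by auto
  qed
  moreover have "compact (closure {x. partial_deriv j \<phi> x \<noteq> 0})"
    using assms by (intro compact_if_closed_subset[OF _ closed_closure cl]) (auto simp: test_functions_def)
  ultimately show ?thesis using assms cl by (auto simp: test_functions_def smooth_on_def)
qed

lemma integral_C1c_limit:
  assumes g: "g \<in> locally_integrable \<Omega>" and L: "compact L" "L \<subseteq> \<Omega>"
    and n: "\<And>k::nat. C1c L (\<eta> k) (\<eta>' k)" and \<phi>: "C1c \<Omega> \<phi> \<phi>'"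
    "\<And>k x. \<bar>\<eta> k x - \<phi> x\<bar> \<le> 1 / real (Suc k)" "\<And>k x. norm (\<eta>' k x - \<phi>' x) \<le> 1 / real (Suc k)"
  shows "(\<lambda>k. LINT x|lebesgue. g x * \<eta> k x) \<longlonglongrightarrow> (LINT x|lebesgue. g x * \<phi> x)"
    "(\<lambda>k. LINT x|lebesgue. g x * \<eta>' k x $ j) \<longlonglongrightarrow> (LINT x|lebesgue. g x * \<phi>' x $ j)"
proof -
  have gen: "(\<lambda>k. LINT x|lebesgue. g x * w k x) \<longlonglongrightarrow> (LINT x|lebesgue. g x * v x)"
    if iw: "\<And>k. integrable lebesgue (\<lambda>x. g x * w k x)" and iv: "integrable lebesgue (\<lambda>x. g x * v x)"
      and out: "\<And>k x. x \<notin> L \<Longrightarrow> w k x = 0" and close: "\<And>k x. \<bar>w k x - v x\<bar> \<le> 1 / real (Suc k)"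
    for w v
  \<comment> \<open>Closeness within \<open>1 / real (Suc k) \<le> 1\<close> gives
    \<open>\<bar>w k x\<bar> \<le> \<bar>v x\<bar> + 1\<close> on the common support
    \<open>L\<close>, whence the majorant.\<close>
  proof (rule integral_dominated_convergence[where w="\<lambda>x. \<bar>g x * v x\<bar> + \<bar>indicator L x * g x\<bar>"])
    show "(\<lambda>x. g x * v x) \<in> borel_measurable lebesgue" using iv by auto
    show "(\<lambda>x. g x * w k x) \<in> borel_measurable lebesgue" for k using iw by auto
    show "integrable lebesgue (\<lambda>x. \<bar>g x * v x\<bar> + \<bar>indicator L x * g x\<bar>)"
      using iv locally_integrableD[OF g L] by auto
    show "AE x in lebesgue. (\<lambda>k. g x * w k x) \<longlonglongrightarrow> g x * v x"
    proof (intro AE_I2 tendsto_mult tendsto_const)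
      fix x show "(\<lambda>k. w k x) \<longlonglongrightarrow> v x"
        by (rule LIM_zero_cancel, rule Lim_null_comparison[OF _ tendsto_inverse_Suc]) (use close in auto)
    qed
    show "AE x in lebesgue. norm (g x * w k x) \<le> \<bar>g x * v x\<bar> + \<bar>indicator L x * g x\<bar>" for k
    proof (rule AE_I2)
      fix x
      show "norm (g x * w k x) \<le> \<bar>g x * v x\<bar> + \<bar>indicator L x * g x\<bar>"
      proof (cases "x \<in> L")
        case True
        have "1 / real (Suc k) \<le> 1" by simp
        then have "\<bar>w k x\<bar> \<le> \<bar>v x\<bar> + 1" using close[of k x] by linarith
        then have "\<bar>g x\<bar> * \<bar>w k x\<bar> \<le> \<bar>g x\<bar> * (\<bar>v x\<bar> + 1)" by (intro mult_left_mono) auto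
        then show ?thesis using True by (simp add: abs_mult algebra_simps)
      qed (simp add: out)
    qed
  qed
  have n': "C1c \<Omega> (\<eta> k) (\<eta>' k)" for k by (rule C1c_mono[OF n L(2)])
  show "(\<lambda>k. LINT x|lebesgue. g x * \<eta> k x) \<longlonglongrightarrow> (LINT x|lebesgue. g x * \<phi> x)"
    by (rule gen) (use integrable_mult_C1c[OF g n'] integrable_mult_C1c[OF g \<phi>(1)] C1c_outside[OF n] \<phi>(2) in auto)
  show "(\<lambda>k. LINT x|lebesgue. g x * \<eta>' k x $ j) \<longlonglongrightarrow> (LINT x|lebesgue. g x * \<phi>' x $ j)"
  proof (rule gen)
    show "\<bar>\<eta>' k x $ j - \<phi>' x $ j\<bar> \<le> 1 / real (Suc k)" for k x
      using component_le_norm_cart[of "\<eta>' k x - \<phi>' x" j] \<phi>(3)[of k x] by simp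
  qed (use integrable_mult_C1c[OF g n'] integrable_mult_C1c[OF g \<phi>(1)] C1c_outside[OF n] in auto)
qed

lemma fundamental_lemma:
  fixes h :: "real ^ 'n::finite \<Rightarrow> real"
  assumes U: "open U" and h: "h \<in> locally_integrable U"
    and zero: "\<And>\<phi>. \<phi> \<in> test_functions U \<Longrightarrow> (LINT x|lebesgue. h x * \<phi> x) = 0"
  shows "AE x in lebesgue. x \<in> U \<longrightarrow> h x = 0"
proof (rule fundamental_lemma_C1c[OF U])
  fix \<phi> \<phi>' assume c: "C1c U \<phi> \<phi>'"
  obtain \<eta> \<eta>' L where n: "compact L" "L \<subseteq> U" "\<And>k::nat. \<eta> k \<in> test_functions U" "\<And>k. C1c L (\<eta> k) (\<eta>' k)"
    "\<And>k x. \<bar>\<eta> k x - \<phi> x\<bar> \<le> 1 / real (Suc k)" "\<And>k x. norm (\<eta>' k x - \<phi>' x) \<le> 1 / real (Suc k)"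
    using C1c_approx[OF U c] by metis
  have "(\<lambda>k. LINT x|lebesgue. h x * \<eta> k x) \<longlonglongrightarrow> (LINT x|lebesgue. h x * \<phi> x)"
    by (rule integral_C1c_limit[OF h n(1,2,4) c n(5,6)])
  then show "(LINT x|lebesgue. h x * \<phi> x) = 0" using zero[OF n(3)] by (simp add: LIMSEQ_const_iff)
qed (use locally_integrableD[OF h] in auto)

lemma open_lebesgue [simp]: "open (S :: 'a::euclidean_space set) \<Longrightarrow> S \<in> sets lebesgue" by auto

lemma has_weak_deriv_unique:
  assumes "open \<Omega>" "has_weak_deriv \<Omega> \<alpha> g h" "has_weak_deriv \<Omega> \<alpha> g h'"
  shows "AE x in lebesgue. x \<in> \<Omega> \<longrightarrow> h x = h' x"
proof -
  have l: "h \<in> locally_integrable \<Omega>" "h' \<in> locally_integrable \<Omega>"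
    using assms by (auto simp: has_weak_deriv_def)
  have l2: "(\<lambda>x. h x - h' x) \<in> locally_integrable \<Omega>"
    by (rule locally_integrableI) (simp add: right_diff_distrib locally_integrableD[OF l(1)] locally_integrableD[OF l(2)])
  have "AE x in lebesgue. x \<in> \<Omega> \<longrightarrow> h x - h' x = 0"
  proof (rule fundamental_lemma[OF assms(1) l2])
    fix \<phi> assume t: "\<phi> \<in> test_functions \<Omega>"
    note c = test_function_C1c[OF t]
    have "(LINT x|lebesgue_on \<Omega>. h x * \<phi> x) = (LINT x|lebesgue_on \<Omega>. h' x * \<phi> x)"
      using assms(2,3) t unfolding has_weak_deriv_def by (cases "even (length \<alpha>)") auto
    then have "(LINT x|lebesgue. h x * \<phi> x) = (LINT x|lebesgue. h' x * \<phi> x)"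
      using assms(1) C1c_outside(1)[OF c] by (simp add: integral_lebesgue_on_eq)
    then show "(LINT x|lebesgue. (h x - h' x) * \<phi> x) = 0"
      using integrable_mult_C1c(1)[OF l(1) c] integrable_mult_C1c(1)[OF l(2) c] by (simp add: left_diff_distrib)
  qed
  then show ?thesis by eventually_elim auto
qed

text \<open>Both sides of the defining identity pass to the limit along the approximation by smooth
  test functions, so weak derivatives may be tested with C^1 functions.\<close>

lemma has_weak_deriv_C1c:
  assumes "open \<Omega>" "has_weak_deriv \<Omega> [j] g h" "C1c \<Omega> \<phi> \<phi>'"
  shows "(LINT x|lebesgue. g x * \<phi>' x $ j) = - (LINT x|lebesgue. h x * \<phi> x)"
proof -
  have l: "g \<in> locally_integrable \<Omega>" "h \<in> locally_integrable \<Omega>"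
    using assms by (auto simp: has_weak_deriv_def)
  obtain \<eta> \<eta>' L where n: "compact L" "L \<subseteq> \<Omega>" "\<And>k::nat. \<eta> k \<in> test_functions \<Omega>" "\<And>k. C1c L (\<eta> k) (\<eta>' k)"
    "\<And>k x. \<bar>\<eta> k x - \<phi> x\<bar> \<le> 1 / real (Suc k)" "\<And>k x. norm (\<eta>' k x - \<phi>' x) \<le> 1 / real (Suc k)"
    using C1c_approx[OF assms(1,3)] by metis
  have eq: "(LINT x|lebesgue. g x * \<eta>' k x $ j) = - (LINT x|lebesgue. h x * \<eta> k x)" for k
  proof -
    note c = test_function_C1c[OF n(3)[of k]]
    have d: "iter_deriv [j] (\<eta> k) x = \<eta>' k x $ j" for x
      using partial_deriv_eq[OF C1cD(1)[OF n(4)]] by (simp add: inner_axis)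
    have "(LINT x|lebesgue_on \<Omega>. g x * iter_deriv [j] (\<eta> k) x) = - (LINT x|lebesgue_on \<Omega>. h x * \<eta> k x)"
      using assms(2) n(3)[of k] unfolding has_weak_deriv_def by auto
    then show ?thesis unfolding d
      using assms(1) C1c_outside[OF C1c_mono[OF n(4) n(2)]] by (simp add: integral_lebesgue_on_eq)
  qed
  note lim = integral_C1c_limit[OF _ n(1,2,4) assms(3) n(5,6)]
  have "(\<lambda>k. LINT x|lebesgue. g x * \<eta>' k x $ j) \<longlonglongrightarrow> (LINT x|lebesgue. g x * \<phi>' x $ j)"
    by (rule lim(2)[OF l(1)])
  moreover have "(\<lambda>k. - (LINT x|lebesgue. h x * \<eta> k x)) \<longlonglongrightarrow> - (LINT x|lebesgue. h x * \<phi> x)"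
    by (intro tendsto_minus lim(1)[OF l(2)])
  ultimately show ?thesis unfolding eq by (rule LIMSEQ_unique)
qed

lemma has_weak_deriv_self:
  assumes "g \<in> locally_integrable \<Omega>" shows "has_weak_deriv \<Omega> [] g g"
  using assms by (simp add: has_weak_deriv_def)

lemma integral_by_parts_C1c:
  assumes "C1c \<Omega> \<phi> \<phi>'" "open \<Omega>" "\<And>x. x \<in> \<Omega> \<Longrightarrow> (g has_derivative (\<lambda>v. g' x \<bullet> v)) (at x)" "continuous_on \<Omega> g'"
  shows "(LINT x|lebesgue. g x * \<phi>' x $ j) = - (LINT x|lebesgue. g' x $ j * \<phi> x)"
proof -
  have cg: "continuous_on \<Omega> g"
    using assms(2,3) by (meson continuous_at_imp_continuous_on has_derivative_continuous)
  have l: "g \<in> locally_integrable \<Omega>" "(\<lambda>x. g' x $ j) \<in> locally_integrable \<Omega>"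
    using cg assms(4) by (auto intro!: continuous_locally_integrable continuous_intros)
  have "C1c \<Omega> (\<lambda>x. \<phi> x * g x) (\<lambda>x. \<phi> x *\<^sub>R g' x + g x *\<^sub>R \<phi>' x)"
    by (rule C1c_mult_local[OF assms(1,2) order_refl assms(3,4)])
  from integral_partial_C1c[OF this, of j] 
  have "(LINT x|lebesgue. g' x $ j * \<phi> x + g x * \<phi>' x $ j) = 0" by (simp add: mult.commute)
  then show ?thesis
    using integrable_mult_C1c(1)[OF l(2) assms(1)] integrable_mult_C1c(2)[OF l(1) assms(1)] by simp
qed

lemma has_weak_deriv_C1:
  assumes "open \<Omega>" "\<And>x. x \<in> \<Omega> \<Longrightarrow> (g has_derivative (\<lambda>v. g' x \<bullet> v)) (at x)" "continuous_on \<Omega> g'"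
  shows "has_weak_deriv \<Omega> [j] g (\<lambda>x. g' x $ j)"
proof -
  have cg: "continuous_on \<Omega> g"
    using assms(1,2) by (meson continuous_at_imp_continuous_on has_derivative_continuous)
  have "(LINT x|lebesgue_on \<Omega>. g x * partial_deriv j \<phi> x) = - (LINT x|lebesgue_on \<Omega>. g' x $ j * \<phi> x)"
    if t: "\<phi> \<in> test_functions \<Omega>" for \<phi>
  proof -
    note c = test_function_C1c[OF t]
    have "partial_deriv j \<phi> x = 0" if "x \<notin> \<Omega>" for x
      using C1c_outside(2)[OF c that] by (simp add: vec_eq_iff)
    then show ?thesis
      using integral_by_parts_C1c[OF c assms, of j] assms(1) C1c_outside(1)[OF c] 
      by (simp add: integral_lebesgue_on_eq)
  qed
  then show ?thesis
    unfolding has_weak_deriv_def using cg assms(3)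
    by (auto intro!: continuous_locally_integrable continuous_intros)
qed

lemma weak_deriv_AE:
  assumes "open \<Omega>" "has_weak_deriv \<Omega> \<alpha> g h"
  shows "AE x in lebesgue. x \<in> \<Omega> \<longrightarrow> weak_deriv \<Omega> \<alpha> g x = h x"
  using has_weak_deriv_unique[OF assms(1) someI[of "has_weak_deriv \<Omega> \<alpha> g", OF assms(2)] assms(2)]
  by (simp add: weak_deriv_def)

lemma C1c_Lp:
  assumes "continuous_on UNIV g" "compact K" "K \<subseteq> \<Omega>" "open \<Omega>" "\<And>x. x \<notin> K \<Longrightarrow> g x = 0" "p > 0"
  shows "g \<in> Lp p \<Omega>"
proof -
  have "continuous_on UNIV (\<lambda>x. \<bar>g x\<bar> powr p)" 
    using assms(1,6) by (intro continuous_on_powr' continuous_intros) auto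
  then have "integrable lebesgue (\<lambda>x. \<bar>g x\<bar> powr p)"
    by (rule integrable_lebesgue_cc[OF _ assms(2)]) (simp add: assms(5))
  moreover have "\<bar>g x\<bar> powr p = 0" if "x \<notin> \<Omega>" for x using that assms(3,5) by auto
  ultimately have "integrable (lebesgue_on \<Omega>) (\<lambda>x. \<bar>g x\<bar> powr p)"
    using assms(4) by (subst integral_lebesgue_on_eq(2)) auto
  moreover have "g \<in> borel_measurable (lebesgue_on \<Omega>)"
    using measurable_lebesgue_continuous[OF assms(1)] by (rule measurable_restrict_space1)
  ultimately show ?thesis by (simp add: Lp_def)
qed

lemma length_le_1_cases: "length \<alpha> \<le> 1 \<Longrightarrow> (\<alpha> = [] \<Longrightarrow> P) \<Longrightarrow> (\<And>j. \<alpha> = [j] \<Longrightarrow> P) \<Longrightarrow> P"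
  by (cases \<alpha>) auto

lemma C1c_weak_deriv:
  fixes \<phi> :: "real ^ 'n::finite \<Rightarrow> real"
  assumes "open \<Omega>" "C1c \<Omega> \<phi> \<phi>'"
  shows "has_weak_deriv \<Omega> [] \<phi> \<phi>" "has_weak_deriv \<Omega> [j] \<phi> (\<lambda>x. \<phi>' x $ j)"
proof -
  show "has_weak_deriv \<Omega> [] \<phi> \<phi>"
    using C1cD(3)[OF assms(2)] by (intro has_weak_deriv_self continuous_locally_integrable) (auto intro: continuous_on_subset)
  show "has_weak_deriv \<Omega> [j] \<phi> (\<lambda>x. \<phi>' x $ j)"
    by (rule has_weak_deriv_C1[OF assms(1) C1cD(1)[OF assms(2)]]) 
      (use C1cD(2)[OF assms(2)] in \<open>auto intro: continuous_on_subset\<close>)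
qed

text \<open>Admits C^1 test fields in the weak equation. The approximants converge uniformly
  together with their gradients inside one compact set, which is stronger than convergence in the
  Sobolev norm.\<close>

lemma C1c_sobolev0:
  fixes \<phi> :: "real ^ 'n::finite \<Rightarrow> real"
  assumes "open \<Omega>" "C1c \<Omega> \<phi> \<phi>'" "p > 0"
  shows "\<phi> \<in> sobolev0 1 p \<Omega>"
proof -
  obtain K where K: "compact K" "K \<subseteq> \<Omega>" "\<And>x. x \<notin> K \<Longrightarrow> \<phi> x = 0" "\<And>x. x \<notin> K \<Longrightarrow> \<phi>' x = 0"
    using C1c_support[OF assms(2)] by blast
  note w = C1c_weak_deriv[OF assms(1,2)]
  have "\<phi> \<in> sobolev 1 p \<Omega>"
    unfolding sobolev_def
  proof (intro CollectI allI impI)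
    fix \<alpha> :: "'n list" assume "length \<alpha> \<le> 1"
    then show "\<exists>h\<in>Lp p \<Omega>. has_weak_deriv \<Omega> \<alpha> \<phi> h"
    proof (rule length_le_1_cases)
      assume "\<alpha> = []"
      then show ?thesis using w(1) C1c_Lp[OF C1cD(3)[OF assms(2)] K(1,2) assms(1) K(3) assms(3)] by auto
    next
      fix j assume "\<alpha> = [j]"
      moreover have "(\<lambda>x. \<phi>' x $ j) \<in> Lp p \<Omega>"
        by (rule C1c_Lp[OF _ K(1,2) assms(1) _ assms(3)]) (auto intro!: continuous_intros C1cD(2)[OF assms(2)] simp: K(4))
      ultimately show ?thesis using w(2)[of j] by auto
    qed
  qed
  moreover obtain \<eta> \<eta>' L where n: "compact L" "L \<subseteq> \<Omega>" "\<And>k::nat. \<eta> k \<in> test_functions \<Omega>" "\<And>k. C1c L (\<eta> k) (\<eta>' k)"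
    "\<And>k x. \<bar>\<eta> k x - \<phi> x\<bar> \<le> 1 / real (Suc k)" "\<And>k x. norm (\<eta>' k x - \<phi>' x) \<le> 1 / real (Suc k)"
    using C1c_approx[OF assms(1,2)] by metis
  have "(\<lambda>i. sobolev_norm 1 p \<Omega> (\<lambda>x. \<eta> i x - \<phi> x)) \<longlonglongrightarrow> 0"
  proof -
    have cd: "C1c (L \<union> K) (\<lambda>x. \<eta> i x - \<phi> x) (\<lambda>x. \<eta>' i x - \<phi>' x)" for i
    proof -
      have "C1c K \<phi> \<phi>'" using K assms(2) by (intro C1cI[of _ _ K]) (auto dest: C1cD)
      from C1c_add[OF C1c_mono[OF n(4)[of i]] C1c_mono[OF C1c_cmul[OF this, of "-1"]], of "L \<union> K"]
      show ?thesis by simp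
    qed
    have LK: "L \<union> K \<subseteq> \<Omega>" "compact (L \<union> K)" using n K by auto
    have bound: "\<bar>LINT x|lebesgue_on \<Omega>. \<bar>weak_deriv \<Omega> \<alpha> (\<lambda>x. \<eta> i x - \<phi> x) x\<bar> powr p\<bar>
        \<le> (1 / real (Suc i)) powr p * measure lebesgue (L \<union> K)" if a: "length \<alpha> \<le> 1" for \<alpha> i
    proof -
      have "\<exists>h. has_weak_deriv \<Omega> \<alpha> (\<lambda>x. \<eta> i x - \<phi> x) h \<and> (\<forall>x. \<bar>h x\<bar> \<le> 1 / real (Suc i)) \<and> (\<forall>x. x \<notin> L \<union> K \<longrightarrow> h x = 0) \<and> continuous_on UNIV h"
        using a
      proof (rule length_le_1_cases)
        assume "\<alpha> = []"
        then show ?thesis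
          using C1c_weak_deriv(1)[OF assms(1) C1c_mono[OF cd LK(1)]] n(5) C1cD(3)[OF cd] C1c_outside(1)[OF cd]
          by blast
      next
        fix j assume "\<alpha> = [j]"
        moreover have "\<bar>(\<eta>' i x - \<phi>' x) $ j\<bar> \<le> 1 / real (Suc i)" for x
          using component_le_norm_cart[of "\<eta>' i x - \<phi>' x" j] n(6)[of i x] by linarith
        moreover have "continuous_on UNIV (\<lambda>x. (\<eta>' i x - \<phi>' x) $ j)"
          using C1cD(2)[OF cd] by (rule continuous_on_component)
        moreover have "x \<notin> L \<union> K \<Longrightarrow> (\<eta>' i x - \<phi>' x) $ j = 0" for x
          using C1c_outside(2)[OF cd] by (simp add: vec_eq_iff)
        ultimately show ?thesis
          using C1c_weak_deriv(2)[OF assms(1) C1c_mono[OF cd LK(1)]] by blast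
      qed
      then obtain h where h: "has_weak_deriv \<Omega> \<alpha> (\<lambda>x. \<eta> i x - \<phi> x) h" "\<And>x. \<bar>h x\<bar> \<le> 1 / real (Suc i)" 
        "\<And>x. x \<notin> L \<union> K \<Longrightarrow> h x = 0" "continuous_on UNIV h" by blast
      have ch: "continuous_on UNIV (\<lambda>x. \<bar>h x\<bar> powr p)"
        using assms(3) h(4) by (intro continuous_on_powr' continuous_intros) auto
      have hl: "integrable lebesgue (\<lambda>x. \<bar>h x\<bar> powr p)"
        by (rule integrable_lebesgue_cc[OF ch LK(2)]) (simp add: h(3))
      \<comment> \<open>The norm is formed with a chosen weak derivative, which agrees with the
        classical one only almost everywhere.\<close>
      have wm: "AE x in lebesgue. indicator \<Omega> x *\<^sub>R \<bar>weak_deriv \<Omega> \<alpha> (\<lambda>x. \<eta> i x - \<phi> x) x\<bar> powr p = \<bar>h x\<bar> powr p"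
        using weak_deriv_AE[OF assms(1) h(1)]
      proof eventually_elim
        case (elim x)
        then show ?case using h(3)[of x] LK(1) by (cases "x \<in> \<Omega>") (auto simp: indicator_def)
      qed
      have "(LINT x|lebesgue_on \<Omega>. \<bar>weak_deriv \<Omega> \<alpha> (\<lambda>x. \<eta> i x - \<phi> x) x\<bar> powr p) 
          = (LINT x|lebesgue. indicator \<Omega> x *\<^sub>R \<bar>weak_deriv \<Omega> \<alpha> (\<lambda>x. \<eta> i x - \<phi> x) x\<bar> powr p)"
        using assms(1) by (intro integral_restrict_space) auto
      also have "\<dots> = (LINT x|lebesgue. \<bar>h x\<bar> powr p)"
      proof (rule integral_cong_AE[OF _ _ wm])
        show m: "(\<lambda>x. \<bar>h x\<bar> powr p) \<in> borel_measurable lebesgue" by (rule measurable_lebesgue_continuous[OF ch])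
        have "AE x in lebesgue. \<bar>h x\<bar> powr p = indicator \<Omega> x *\<^sub>R \<bar>weak_deriv \<Omega> \<alpha> (\<lambda>x. \<eta> i x - \<phi> x) x\<bar> powr p"
          using wm by eventually_elim simp
        with m show "(\<lambda>x. indicator \<Omega> x *\<^sub>R \<bar>weak_deriv \<Omega> \<alpha> (\<lambda>x. \<eta> i x - \<phi> x) x\<bar> powr p) \<in> borel_measurable lebesgue"
          by (rule borel_measurable_AE)
      qed
      finally have eq: "(LINT x|lebesgue_on \<Omega>. \<bar>weak_deriv \<Omega> \<alpha> (\<lambda>x. \<eta> i x - \<phi> x) x\<bar> powr p) = (LINT x|lebesgue. \<bar>h x\<bar> powr p)" .
      have "\<bar>LINT x|lebesgue. \<bar>h x\<bar> powr p\<bar> \<le> (LINT x|lebesgue. indicator (L \<union> K) x * (1 / real (Suc i)) powr p)"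
      proof (rule integral_abs_bound_integral[OF hl])
        show "integrable lebesgue (\<lambda>x. indicator (L \<union> K) x * (1 / real (Suc i)) powr p)"
          by (intro integrable_mult_left integrable_real_indicator)
            (use LK(2) in \<open>auto simp: fmeasurable_def dest!: lmeasurable_compact\<close>)
        show "\<bar>\<bar>h x\<bar> powr p\<bar> \<le> indicator (L \<union> K) x * (1 / real (Suc i)) powr p" for x
          using h(2)[of x] h(3)[of x] assms(3) powr_mono2[of p "\<bar>h x\<bar>" "1 / real (Suc i)"] by (cases "x \<in> L \<union> K") auto
      qed
      also have "\<dots> = (1 / real (Suc i)) powr p * measure lebesgue (L \<union> K)"
        using LK(2) by (simp add: lmeasurable_compact fmeasurableD)
      finally show ?thesis unfolding eq .
    qed
    have lim0: "(\<lambda>i. (1 / real (Suc i)) powr p * measure lebesgue (L \<union> K)) \<longlonglongrightarrow> 0"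
      using tendsto_zero_powrI[OF tendsto_inverse_Suc tendsto_const[of p]] assms(3)
      by (intro tendsto_mult_left_zero) simp
    have fin: "finite {\<alpha> :: 'n list. length \<alpha> \<le> 1}"
      using finite_lists_length_le[of "UNIV :: 'n set" 1] by simp
    have "(\<lambda>i. \<Sum>\<alpha> | length \<alpha> \<le> 1. LINT x|lebesgue_on \<Omega>. \<bar>weak_deriv \<Omega> \<alpha> (\<lambda>x. \<eta> i x - \<phi> x) x\<bar> powr p) \<longlonglongrightarrow> 0"
    proof (rule tendsto_null_sum)
      fix \<alpha> :: "'n list" assume "\<alpha> \<in> {\<alpha>. length \<alpha> \<le> 1}"
      then show "(\<lambda>i. LINT x|lebesgue_on \<Omega>. \<bar>weak_deriv \<Omega> \<alpha> (\<lambda>x. \<eta> i x - \<phi> x) x\<bar> powr p) \<longlonglongrightarrow> 0"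
        by (intro Lim_null_comparison[OF _ lim0] always_eventually allI) (use bound in auto)
    qed
    then show ?thesis
      unfolding sobolev_norm_def
      by (rule tendsto_zero_powrI[OF _ tendsto_const]) (use assms(3) in \<open>auto intro!: always_eventually sum_nonneg\<close>)
  qed
  ultimately show ?thesis using n(3) by (auto simp: sobolev0_def)
qed


section \<open>The weak equation, row by row, with the classical Jacobian\<close>

lemma integral_lebesgue_cong_AE:
  fixes f g :: "'a::euclidean_space \<Rightarrow> 'b::euclidean_space"
  assumes "f \<in> borel_measurable lebesgue" "AE x in lebesgue. g x = f x"
  shows "(LINT x|lebesgue. g x) = (LINT x|lebesgue. f x)"
proof (rule integral_cong_AE[OF _ assms])
  have "AE x in lebesgue. f x = g x" using assms(2) by eventually_elim simp
  then show "g \<in> borel_measurable lebesgue" by (rule borel_measurable_AE[OF assms(1)])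
qed

lemma norm_p_flux: "norm (p_flux p A) = norm A powr (p - 1)"
proof (cases "A = 0")
  case False
  then show ?thesis by (simp add: p_flux_def powr_diff[of _ _ 1] powr_diff[of _ p 2] power2_eq_square)
qed (simp add: p_flux_def)

text \<open>For p < 2 the scalar factor is unbounded near 0, but the norm of the flux is
  \<open>norm A powr (p - 1)\<close>, which tends to 0 because p > 1.\<close>

lemma continuous_on_p_flux:
  assumes "p > 1"
  shows "continuous_on UNIV (p_flux p :: real ^ 'n::finite ^ 'm::finite \<Rightarrow> _)"
proof -
  have "isCont (p_flux p) A" for A :: "real ^ 'n ^ 'm"
  proof (cases "A = 0")
    case True
    have "((\<lambda>B :: real ^ 'n ^ 'm. norm B powr (p - 1)) \<longlongrightarrow> 0) (at 0)"
      by (rule tendsto_zero_powrI[OF _ tendsto_const]) (use assms in \<open>auto intro!: tendsto_norm_zero\<close>)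
    then have "((\<lambda>B :: real ^ 'n ^ 'm. norm (p_flux p B)) \<longlongrightarrow> 0) (at 0)" by (simp add: norm_p_flux)
    then have "((p_flux p :: real ^ 'n ^ 'm \<Rightarrow> _) \<longlongrightarrow> 0) (at 0)" by (rule tendsto_norm_zero_cancel)
    then show ?thesis using True by (simp add: isCont_def p_flux_def[of p 0])
  next
    case False
    then show ?thesis unfolding p_flux_def[abs_def] by (intro continuous_intros) auto
  qed
  then show ?thesis by (simp add: continuous_at_imp_continuous_on)
qed

lemma Ck_on_1_jacobian:
  fixes u :: "real ^ 'n::finite \<Rightarrow> real ^ 'm::finite"
  assumes "u \<in> Ck_on 1 \<Omega>"
  shows "x \<in> \<Omega> \<Longrightarrow> (u has_derivative (\<lambda>v. jacobian u (at x) *v v)) (at x)"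
    "continuous_on \<Omega> (\<lambda>x. jacobian u (at x))"
proof -
  have d: "u differentiable (at x)" if "x \<in> \<Omega>" for x using Ck_onD(1)[OF assms, of "[]"] that by simp
  then show "x \<in> \<Omega> \<Longrightarrow> (u has_derivative (\<lambda>v. jacobian u (at x) *v v)) (at x)"
    using jacobian_works by blast
  have "jacobian u (at x) = (\<chi> l j. partial_deriv j u x $ l)" for x
    by (simp add: jacobian_def matrix_def partial_deriv_def)
  moreover have "continuous_on \<Omega> (partial_deriv j u)" for j
    using Ck_onD(2)[OF assms, of "[j]"] by simp
  ultimately show "continuous_on \<Omega> (\<lambda>x. jacobian u (at x))"
    by (auto intro!: continuous_on_vec_lambda continuous_intros)
qed

lemma has_derivative_matrix_row:
  fixes u :: "real ^ 'n::finite \<Rightarrow> real ^ 'm::finite"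
  assumes "(u has_derivative (\<lambda>v. P *v v)) F"
  shows "((\<lambda>y. u y $ l) has_derivative (\<lambda>v. P $ l \<bullet> v)) F"
  using bounded_linear.has_derivative[OF bounded_linear_vec_nth assms, of l]
  by (simp add: matrix_vector_mul_component)

lemma weak_jacobian_AE:
  fixes u :: "real ^ 'n::finite \<Rightarrow> real ^ 'm::finite"
  assumes "open \<Omega>" "\<And>x. x \<in> \<Omega> \<Longrightarrow> (u has_derivative (\<lambda>v. P x *v v)) (at x)" "continuous_on \<Omega> P"
  shows "AE x in lebesgue. x \<in> \<Omega> \<longrightarrow> weak_jacobian \<Omega> u x = P x"
proof -
  have "AE x in lebesgue. \<forall>l j. x \<in> \<Omega> \<longrightarrow> weak_deriv \<Omega> [j] (\<lambda>y. u y $ l) x = P x $ l $ j"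
  proof (intro AE_all_countable[THEN iffD2] allI)
    fix l j
    show "AE x in lebesgue. x \<in> \<Omega> \<longrightarrow> weak_deriv \<Omega> [j] (\<lambda>y. u y $ l) x = P x $ l $ j"
      by (intro weak_deriv_AE[OF assms(1)] has_weak_deriv_C1[where g'="\<lambda>x. P x $ l"] assms(1)
          has_derivative_matrix_row assms(2) continuous_on_component assms(3))
  qed
  then show ?thesis by eventually_elim (simp add: weak_jacobian_def vec_eq_iff)
qed

text \<open>The field \<phi> times the \<open>l\<close>-th unit vector isolates one equation of the
  system. Weak and classical Jacobians agree almost everywhere, so from here on the equation
  involves neither weak derivatives nor Sobolev spaces.\<close>

lemma weak_solution_C1c:
  fixes u f :: "real ^ 'n::finite \<Rightarrow> real ^ 'm::finite"
  assumes "open \<Omega>" "u \<in> Ck_on 1 \<Omega>" "weak_solution p \<Omega> f u" "p > 1" "C1c \<Omega> \<phi> \<phi>'"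
  shows "integrable lebesgue (\<lambda>x. f x $ l * \<phi> x)"
    "(LINT x|lebesgue. p_flux p (jacobian u (at x)) $ l \<bullet> \<phi>' x) = (LINT x|lebesgue. f x $ l * \<phi> x)"
proof -
  define \<Phi> :: "real ^ 'n \<Rightarrow> real ^ 'm" where "\<Phi> x = \<phi> x *\<^sub>R axis l 1" for x
  define \<Phi>' :: "real ^ 'n \<Rightarrow> real ^ 'n ^ 'm" where "\<Phi>' x = axis l (\<phi>' x)" for x
  have \<Phi>_nth: "(\<lambda>x. \<Phi> x $ k) = (if k = l then \<phi> else (\<lambda>x. 0))" for k
    by (auto simp: \<Phi>_def axis_def)
  have "(\<lambda>x. \<Phi> x $ k) \<in> sobolev0 1 p \<Omega>" for k
    using C1c_sobolev0[OF assms(1,5)] C1c_sobolev0[OF assms(1) C1c_zero] assms(4) by (simp add: \<Phi>_nth)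
  then have "\<Phi> \<in> componentwise (sobolev0 1 p \<Omega>)" by (simp add: componentwise_vec)
  then have w: "integrable (lebesgue_on \<Omega>) (\<lambda>x. f x \<bullet> \<Phi> x)"
     "(LINT x|lebesgue_on \<Omega>. p_flux p (weak_jacobian \<Omega> u x) \<bullet> weak_jacobian \<Omega> \<Phi> x)
          = (LINT x|lebesgue_on \<Omega>. f x \<bullet> \<Phi> x)"
    using assms(3) by (auto simp: weak_solution_def)
  have f\<Phi>: "f x \<bullet> \<Phi> x = f x $ l * \<phi> x" for x by (simp add: \<Phi>_def inner_axis mult.commute)
  have out: "f x $ l * \<phi> x = 0" if "x \<notin> \<Omega>" for x using C1c_outside(1)[OF assms(5) that] by simp
  show "integrable lebesgue (\<lambda>x. f x $ l * \<phi> x)"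
    using w(1) out assms(1) unfolding f\<Phi> by (subst integral_lebesgue_on_eq(2)[symmetric]) auto
  obtain K where K: "compact K" "K \<subseteq> \<Omega>" "\<And>x. x \<notin> K \<Longrightarrow> \<phi> x = 0" "\<And>x. x \<notin> K \<Longrightarrow> \<phi>' x = 0"
    using C1c_support[OF assms(5)] by blast
  have d\<Phi>: "(\<Phi> has_derivative (\<lambda>v. \<Phi>' x *v v)) (at x)" for x
  proof (rule has_derivative_eq_rhs)
    show "(\<Phi> has_derivative (\<lambda>v. (\<phi>' x \<bullet> v) *\<^sub>R axis l 1)) (at x)"
      unfolding \<Phi>_def by (rule has_derivative_scaleR_left[OF C1cD(1)[OF assms(5)]])
    show "(\<lambda>v. (\<phi>' x \<bullet> v) *\<^sub>R axis l 1) = (\<lambda>v. \<Phi>' x *v v)"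
      by (auto simp: fun_eq_iff vec_eq_iff \<Phi>'_def axis_def matrix_vector_mul_component)
  qed
  have c\<Phi>: "continuous_on \<Omega> \<Phi>'"
  proof -
    have "continuous_on \<Omega> (\<lambda>x. \<chi> k. if k = l then \<phi>' x else 0)"
      using continuous_on_subset[OF C1cD(2)[OF assms(5)] subset_UNIV]
      by (intro continuous_on_vec_lambda, rename_tac k, case_tac "k = l") auto
    then show ?thesis by (simp add: \<Phi>'_def[abs_def] axis_def)
  qed
  have AEu: "AE x in lebesgue. x \<in> \<Omega> \<longrightarrow> weak_jacobian \<Omega> u x = jacobian u (at x)"
    by (intro weak_jacobian_AE assms(1) Ck_on_1_jacobian[OF assms(2)])
  have AE: "AE x in lebesgue. indicator \<Omega> x *\<^sub>R (p_flux p (weak_jacobian \<Omega> u x) \<bullet> weak_jacobian \<Omega> \<Phi> x) 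
      = p_flux p (jacobian u (at x)) $ l \<bullet> \<phi>' x"
    using AEu weak_jacobian_AE[OF assms(1) d\<Phi> c\<Phi>]
  proof eventually_elim
    case (elim x)
    show ?case
    proof (cases "x \<in> \<Omega>")
      case True
      then show ?thesis using elim by (simp add: \<Phi>'_def inner_axis)
    qed (use C1c_outside(2)[OF assms(5)] in simp)
  qed
  have m: "(\<lambda>x. p_flux p (jacobian u (at x)) $ l \<bullet> \<phi>' x) \<in> borel_measurable lebesgue"
  proof (rule measurable_lebesgue_continuous, rule continuous_on_mult_outside[OF assms(1) compact_imp_closed[OF K(1)] K(2)])
    show "continuous_on \<Omega> (\<lambda>x. p_flux p (jacobian u (at x)) $ l \<bullet> \<phi>' x)"
      using C1cD(2)[OF assms(5)] 
      by (intro continuous_intros continuous_on_compose2[OF continuous_on_p_flux[OF assms(4)]] Ck_on_1_jacobian(2)[OF assms(2)])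
        (auto intro: continuous_on_subset)
  qed (simp add: K(4))
  have "(LINT x|lebesgue. p_flux p (jacobian u (at x)) $ l \<bullet> \<phi>' x) 
      = (LINT x|lebesgue. indicator \<Omega> x *\<^sub>R (p_flux p (weak_jacobian \<Omega> u x) \<bullet> weak_jacobian \<Omega> \<Phi> x))"
    by (rule integral_lebesgue_cong_AE[OF m AE, symmetric])
  also have "\<dots> = (LINT x|lebesgue_on \<Omega>. p_flux p (weak_jacobian \<Omega> u x) \<bullet> weak_jacobian \<Omega> \<Phi> x)"
    using assms(1) by (subst integral_restrict_space) auto
  also have "\<dots> = (LINT x|lebesgue. f x $ l * \<phi> x)"
    using w(2) out assms(1) unfolding f\<Phi> by (simp add: integral_lebesgue_on_eq)
  finally show "(LINT x|lebesgue. p_flux p (jacobian u (at x)) $ l \<bullet> \<phi>' x) = (LINT x|lebesgue. f x $ l * \<phi> x)" .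
qed

section \<open>The flux and truncated weights\<close>

lemma has_derivative_norm_powr:
  fixes P :: "'a::euclidean_space"
  assumes "P \<noteq> 0"
  shows "((\<lambda>P. norm P powr b) has_derivative (\<lambda>Y. b * norm P powr (b - 2) * (P \<bullet> Y))) (at P)"
proof -
  have pos: "P \<bullet> P > 0" using assms by simp
  have eq: "norm Q powr b = (Q \<bullet> Q) powr (b / 2)" for Q :: 'a and b
    by (simp add: power2_norm_eq_inner[symmetric] powr_numeral[symmetric] powr_powr del: powr_numeral)
  have "((\<lambda>P. P \<bullet> P) has_derivative (\<lambda>Y. 2 * (P \<bullet> Y))) (at P)"
    by (auto intro!: derivative_eq_intros simp: inner_commute)
  moreover have "((\<lambda>t. t powr (b / 2)) has_derivative (\<lambda>t. (b / 2 * (P \<bullet> P) powr (b / 2 - 1)) * t)) (at (P \<bullet> P))"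
    by (rule has_real_derivative_powr[OF pos, unfolded has_field_derivative_def])
  ultimately have d: "((\<lambda>P. (P \<bullet> P) powr (b / 2)) has_derivative (\<lambda>Y. (b / 2 * (P \<bullet> P) powr (b / 2 - 1)) * (2 * (P \<bullet> Y)))) (at P)"
    by (rule has_derivative_compose)
  show ?thesis
    unfolding eq by (rule has_derivative_eq_rhs[OF d]) (simp add: diff_divide_distrib fun_eq_iff mult_ac)
qed

definition dflux :: "real \<Rightarrow> real ^ 'n::finite ^ 'm::finite \<Rightarrow> real ^ 'n ^ 'm \<Rightarrow> real ^ 'n ^ 'm" where
  "dflux p P Y = norm P powr (p - 2) *\<^sub>R Y + ((p - 2) * norm P powr (p - 4) * (P \<bullet> Y)) *\<^sub>R P"

lemma bounded_linear_dflux: "bounded_linear (dflux p P)"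
  unfolding dflux_def[abs_def]
  by (intro bounded_linear_add bounded_linear_scaleR_right bounded_linear_scaleR_const bounded_linear_mult_const
      bounded_linear_const_mult bounded_linear_inner_right bounded_linear_ident bounded_linear_inner_right_comp
      bounded_linear_scaleR_left) 

lemma has_derivative_p_flux:
  assumes "P \<noteq> 0"
  shows "(p_flux p has_derivative dflux p P) (at P)"
  unfolding p_flux_def[abs_def]
  by (rule has_derivative_eq_rhs[OF has_derivative_scaleR[OF has_derivative_norm_powr[OF assms] has_derivative_ident]])
    (simp add: dflux_def fun_eq_iff mult_ac)

lemma norm_powr_minus_4: "P \<noteq> 0 \<Longrightarrow> norm P powr (a - 4) * (norm P)\<^sup>2 = norm P powr (a - 2)" for P :: "'a::euclidean_space"
  by (simp add: powr_numeral[symmetric] powr_add[symmetric] del: powr_numeral)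

text \<open>For p < 2 the second term of the form is negative; by Cauchy-Schwarz it costs at most
  the fraction 2 - p of the first one, which leaves p - 1.\<close>

lemma dflux_coercive:
  fixes P Y :: "real ^ 'n::finite ^ 'm::finite"
  assumes "P \<noteq> 0" "p > 1"
  shows "dflux p P Y \<bullet> Y \<ge> min 1 (p - 1) * norm P powr (p - 2) * (norm Y)\<^sup>2"
proof -
  define a where "a = norm P powr (p - 2)"
  define b where "b = norm P powr (p - 4) * (P \<bullet> Y)\<^sup>2"
  have a: "a \<ge> 0" by (simp add: a_def)
  have b0: "b \<ge> 0" by (simp add: b_def)
  have "(P \<bullet> Y)\<^sup>2 \<le> (norm P)\<^sup>2 * (norm Y)\<^sup>2"
    by (metis Cauchy_Schwarz_ineq power2_norm_eq_inner)
  then have "b \<le> norm P powr (p - 4) * ((norm P)\<^sup>2 * (norm Y)\<^sup>2)"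
    unfolding b_def by (intro mult_left_mono) auto
  also have "\<dots> = a * (norm Y)\<^sup>2" using norm_powr_minus_4[OF assms(1), of p] by (simp add: a_def mult.assoc[symmetric])
  finally have b: "b \<le> a * (norm Y)\<^sup>2" .
  have eq: "dflux p P Y \<bullet> Y = a * (norm Y)\<^sup>2 + (p - 2) * b"
    by (simp add: dflux_def a_def b_def inner_add_left dot_square_norm power2_eq_square[of "P \<bullet> Y"] mult_ac)
  show ?thesis
  proof (cases "p \<ge> 2")
    case True
    then show ?thesis using b0 by (simp add: eq a_def[symmetric] min_def)
  next
    case False
    have "(2 - p) * b \<le> (2 - p) * (a * (norm Y)\<^sup>2)" using b False by (intro mult_left_mono) auto
    then show ?thesis using False by (simp add: eq a_def[symmetric] min_def algebra_simps)
  qed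
qed

lemma norm_dflux:
  fixes P Y :: "real ^ 'n::finite ^ 'm::finite"
  shows "norm (dflux p P Y) \<le> (1 + \<bar>p - 2\<bar>) * norm P powr (p - 2) * norm Y"
proof (cases "P = 0")
  case False
  have "norm (((p - 2) * norm P powr (p - 4) * (P \<bullet> Y)) *\<^sub>R P) \<le> \<bar>p - 2\<bar> * norm P powr (p - 4) * (norm P * norm Y) * norm P"
    by (auto simp: abs_mult intro!: mult_mono Cauchy_Schwarz_ineq2)
  also have "\<dots> = \<bar>p - 2\<bar> * (norm P powr (p - 4) * (norm P)\<^sup>2) * norm Y" by (simp add: power2_eq_square)
  also have "\<dots> = \<bar>p - 2\<bar> * norm P powr (p - 2) * norm Y" by (simp add: norm_powr_minus_4[OF False])
  finally have "norm (dflux p P Y) \<le> norm (norm P powr (p - 2) *\<^sub>R Y) + \<bar>p - 2\<bar> * norm P powr (p - 2) * norm Y"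
    unfolding dflux_def by (intro norm_triangle_le add_left_mono)
  then show ?thesis by (simp add: distrib_right)
qed (simp add: dflux_def)

lemma continuous_on_dflux:
  "continuous_on ((- {0}) \<times> UNIV) (\<lambda>z. dflux p (fst z) (snd z :: real ^ 'n::finite ^ 'm::finite))"
  unfolding dflux_def by (intro continuous_intros) auto

text \<open>First-order expansion with an error that is uniform on an annulus. It follows from the
  uniform continuity of the differential there, tested on unit directions because
  \<open>dflux p P\<close> is linear in its second argument.\<close>

lemma p_flux_linearization:
  fixes \<epsilon> M \<kappa> p :: real
  assumes "\<epsilon> > 0" "\<kappa> > 0"
  obtains \<delta> where "\<delta> > 0" "\<And>P Q :: real ^ 'n::finite ^ 'm::finite. \<epsilon> \<le> norm P \<Longrightarrow> norm P \<le> M \<Longrightarrow> norm (Q - P) < \<delta> \<Longrightarrow>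
     norm (p_flux p Q - p_flux p P - dflux p P (Q - P)) \<le> \<kappa> * norm (Q - P)"
proof -
  \<comment> \<open>The annulus is widened by margins that contain the segment from \<open>P\<close>
    to \<open>Q\<close>, whose length will be less than \<open>\<epsilon> / 2\<close>; in particular
    the segment avoids 0.\<close>
  define K where "K = cball (0 :: real ^ 'n ^ 'm) (M + \<epsilon>) - ball 0 (\<epsilon> / 2)"
  have K: "compact K" unfolding K_def by (intro compact_diff) auto
  have uc: "uniformly_continuous_on (K \<times> cball 0 1) (\<lambda>z. dflux p (fst z) (snd z :: real ^ 'n ^ 'm))"
    by (intro compact_uniformly_continuous continuous_on_subset[OF continuous_on_dflux] compact_Times K compact_cball)
      (use assms in \<open>auto simp: K_def\<close>)
  obtain d where d: "d > 0" "\<And>z z'. z \<in> K \<times> cball 0 1 \<Longrightarrow> z' \<in> K \<times> cball 0 1 \<Longrightarrow> dist z' z < d \<Longrightarrow>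
      dist (dflux p (fst z') (snd z')) (dflux p (fst z) (snd z :: real ^ 'n ^ 'm)) < \<kappa>"
    by (rule uniformly_continuous_onE[OF uc assms(2)], rule that)
  show ?thesis
  proof (rule that[of "min d (\<epsilon> / 2)"])
    show "min d (\<epsilon> / 2) > 0" using d assms by simp
    fix P Q :: "real ^ 'n ^ 'm" assume P: "\<epsilon> \<le> norm P" "norm P \<le> M" and Q: "norm (Q - P) < min d (\<epsilon> / 2)"
    define S where "S = ball P (min d (\<epsilon> / 2))"
    have SK: "R \<in> K \<and> R \<noteq> 0 \<and> dist R P < d" if "R \<in> S" for R
    proof -
      have "norm (R - P) < \<epsilon> / 2" "norm (R - P) < d" using that by (auto simp: S_def dist_norm norm_minus_commute)
      moreover have "norm P - norm R \<le> norm (R - P)" "norm R - norm P \<le> norm (R - P)"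
        using norm_triangle_ineq2[of P R] norm_triangle_ineq2[of R P] by (auto simp: norm_minus_commute)
      ultimately show ?thesis using P assms(1) norm_ge_zero[of P] by (auto simp: K_def dist_norm simp del: norm_ge_zero)
    qed
    have PS: "P \<in> S" "Q \<in> S" using assms(1) d(1) Q by (auto simp: S_def dist_norm norm_minus_commute)
    have on: "onorm (\<lambda>Y. dflux p R Y - dflux p P Y) \<le> \<kappa>" if R: "R \<in> S" for R
    proof (rule onorm_bound)
      fix Y
      interpret R: bounded_linear "dflux p R" by (rule bounded_linear_dflux)
      interpret P: bounded_linear "dflux p P" by (rule bounded_linear_dflux)
      show "norm (dflux p R Y - dflux p P Y) \<le> \<kappa> * norm Y"
      proof (cases "Y = 0")
        case False
        define Z where "Z = Y /\<^sub>R norm Y"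
        have "Z \<in> cball 0 1" using False by (simp add: Z_def)
        then have "dist (dflux p R Z) (dflux p P Z) < \<kappa>"
          using d(2)[of "(P, Z)" "(R, Z)"] SK[OF R] SK[OF PS(1)] by (auto simp: dist_prod_def)
        then have "norm (dflux p R Z - dflux p P Z) \<le> \<kappa>" by (simp add: dist_norm)
        moreover have "dflux p R Y - dflux p P Y = norm Y *\<^sub>R (dflux p R Z - dflux p P Z)"
          using False by (simp add: Z_def R.scaleR P.scaleR scaleR_diff_right)
        ultimately show ?thesis by (simp add: mult.commute[of \<kappa>] mult_left_mono)
      qed (simp add: R.zero P.zero)
    qed (use assms in simp)
    have "norm (p_flux p Q - p_flux p P - dflux p P (Q - P)) \<le> norm (Q - P) * \<kappa>"
    proof (rule differentiable_bound_linearization[where S=S and f="p_flux p" and f'="dflux p"])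
      show "P + t *\<^sub>R (Q - P) \<in> S" if "t \<in> {0..1}" for t
      proof -
        have "convex S" unfolding S_def by (rule convex_ball)
        from convexD_alt[OF this PS, of t] that show ?thesis by (simp add: algebra_simps)
      qed
      show "(p_flux p has_derivative dflux p R) (at R within S)" if "R \<in> S" for R
        using has_derivative_p_flux SK[OF that] has_derivative_at_withinI by blast
      show "onorm (dflux p R - dflux p P) \<le> \<kappa>" if "R \<in> S" for R
        using on[OF that] by (simp add: fun_diff_def)
    qed (rule PS)
    then show "norm (p_flux p Q - p_flux p P - dflux p P (Q - P)) \<le> \<kappa> * norm (Q - P)" by (simp add: mult.commute)
  qed
qed

text \<open>A continuously differentiable truncation of \<open>norm P powr (- r)\<close> that vanishes for \<open>norm P \<le> \<epsilon>\<close>.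
  The factor is a square so that the truncation term in its radial derivative, which has the good
  sign, is controlled by the square root of the truncation.\<close>

definition tcut :: "real \<Rightarrow> real \<Rightarrow> 'a::euclidean_space \<Rightarrow> real" where
  "tcut r \<epsilon> P = norm P powr (- r) * (max 0 (1 - \<epsilon> / norm P))\<^sup>2"

text \<open>This is \<open>norm P\<close> times the radial derivative of
  \<open>tcut r \<epsilon>\<close>, a quantity of the same homogeneity as the weight itself.\<close>

definition cut_slope :: "real \<Rightarrow> real \<Rightarrow> 'a::euclidean_space \<Rightarrow> real" where
  "cut_slope r \<epsilon> P = norm P powr (- r) * (2 * max 0 (1 - \<epsilon> / norm P) * (\<epsilon> / norm P) - r * (max 0 (1 - \<epsilon> / norm P))\<^sup>2)"

definition cut_grad :: "real \<Rightarrow> real \<Rightarrow> 'a::euclidean_space \<Rightarrow> 'a" where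
  "cut_grad r \<epsilon> P = (cut_slope r \<epsilon> P / (norm P)\<^sup>2) *\<^sub>R P"

lemma cut_nonneg: "tcut r \<epsilon> P \<ge> 0" by (simp add: tcut_def)

lemma max0_le1: "\<epsilon> > 0 \<Longrightarrow> max 0 (1 - \<epsilon> / norm P) \<le> 1" by simp

lemma cut_le: "\<epsilon> > 0 \<Longrightarrow> tcut r \<epsilon> P \<le> norm P powr (- r)"
  unfolding tcut_def using max0_le1[of \<epsilon> P] by (intro mult_right_le_one_le power_le_one) auto

lemma cut_zero:
  assumes "\<epsilon> > 0" "norm P \<le> \<epsilon>"
  shows "tcut r \<epsilon> P = 0" "cut_slope r \<epsilon> P = 0" "cut_grad r \<epsilon> P = 0"
proof -
  have "P = 0 \<or> max 0 (1 - \<epsilon> / norm P) = 0"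
  proof (cases "P = 0")
    case False
    then have "1 \<le> \<epsilon> / norm P" using assms by (simp add: le_divide_eq)
    then show ?thesis by (intro disjI2 max_absorb1) linarith
  qed simp
  then show "tcut r \<epsilon> P = 0" "cut_slope r \<epsilon> P = 0" "cut_grad r \<epsilon> P = 0"
    by (auto simp: tcut_def cut_slope_def cut_grad_def)
qed

text \<open>The truncation contributes a nonnegative term. Hence the weight can be treated as if it
  were the pure power of exponent \<open>- r\<close>, with a bound that does not see
  \<epsilon>.\<close>

lemma cut_slope_ge:
  assumes "\<epsilon> > 0" shows "cut_slope r \<epsilon> P \<ge> - r * tcut r \<epsilon> P"
proof -
  have "0 \<le> norm P powr (- r) * (2 * max 0 (1 - \<epsilon> / norm P) * (\<epsilon> / norm P))"
    using assms by (intro mult_nonneg_nonneg) auto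
  then show ?thesis by (simp add: cut_slope_def tcut_def algebra_simps)
qed

text \<open>Both terms of the slope contain the factor
  \<open>max 0 (1 - \<epsilon> / norm P)\<close>, so its square contains the full truncation factor
  of \<open>tcut\<close>. The constants come from (a - b)^2 \<le> 2 a^2 + 2 b^2, where \<epsilon> /
  norm P is at most 1.\<close>

lemma cut_slope_square:
  assumes "\<epsilon> > 0"
  shows "(cut_slope r \<epsilon> P)\<^sup>2 \<le> (8 + 2 * r\<^sup>2) * norm P powr (- r) * tcut r \<epsilon> P"
proof (cases "norm P \<le> \<epsilon>")
  case True then show ?thesis using cut_zero[OF assms True] by simp
next
  case False
  define t where "t = \<epsilon> / norm P"
  define m where "m = max 0 (1 - t)"
  have m: "0 \<le> m" "m \<le> 1" using max0_le1[OF assms] by (auto simp: m_def t_def)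
  have "0 < norm P" using False assms by linarith
  then have t: "0 \<le> t" "t \<le> 1" using False assms by (auto simp: t_def)
  have "(2 * m * t - r * m\<^sup>2)\<^sup>2 \<le> 2 * ((2 * m * t)\<^sup>2 + (r * m\<^sup>2)\<^sup>2)"
    using zero_le_power2[of "2 * m * t + r * m\<^sup>2"] by (simp add: power2_eq_square algebra_simps)
  also have "\<dots> = (8 * t\<^sup>2 + 2 * r\<^sup>2 * m\<^sup>2) * m\<^sup>2" by (simp add: power2_eq_square algebra_simps)
  also have "\<dots> \<le> (8 * 1 + 2 * r\<^sup>2 * 1) * m\<^sup>2"
    using m t by (intro mult_right_mono add_mono mult_left_mono power_le_one) auto
  finally have "norm P powr (- r) * norm P powr (- r) * (2 * m * t - r * m\<^sup>2)\<^sup>2 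
      \<le> norm P powr (- r) * norm P powr (- r) * ((8 + 2 * r\<^sup>2) * m\<^sup>2)"
    by (intro mult_left_mono) auto
  then show ?thesis
    by (simp add: cut_slope_def tcut_def t_def[symmetric] m_def[symmetric] power_mult_distrib power2_eq_square[of "norm P powr (- r)"] mult_ac)
qed

lemma cut_slope_bound:
  assumes "\<epsilon> > 0"
  shows "\<bar>cut_slope r \<epsilon> P\<bar> \<le> (2 + \<bar>r\<bar>) * norm P powr (- r)"
proof (cases "norm P \<le> \<epsilon>")
  case True then show ?thesis using cut_zero[OF assms True] by simp
next
  case False
  define t where "t = \<epsilon> / norm P"
  define m where "m = max 0 (1 - t)"
  have m: "0 \<le> m" "m \<le> 1" using max0_le1[OF assms] by (auto simp: m_def t_def)
  have "0 < norm P" using False assms by linarith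
  then have t: "0 \<le> t" "t \<le> 1" using False assms by (auto simp: t_def)
  have "\<bar>2 * m * t - r * m\<^sup>2\<bar> \<le> \<bar>2 * m * t\<bar> + \<bar>r * m\<^sup>2\<bar>" by (rule abs_triangle_ineq4)
  also have "\<dots> \<le> 2 * 1 * 1 + \<bar>r\<bar> * 1"
    unfolding abs_mult using m t by (intro add_mono mult_mono) (auto intro: power_le_one)
  finally have "norm P powr (- r) * \<bar>2 * m * t - r * m\<^sup>2\<bar> \<le> norm P powr (- r) * (2 + \<bar>r\<bar>)"
    by (intro mult_left_mono) auto
  then show ?thesis by (simp add: cut_slope_def t_def[symmetric] m_def[symmetric] abs_mult mult.commute)
qed

lemma norm_cut_grad: "norm (cut_grad r \<epsilon> P) * norm P = \<bar>cut_slope r \<epsilon> P\<bar>"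
  by (cases "P = 0") (auto simp: cut_grad_def cut_slope_def power2_eq_square field_simps)

lemma has_derivative_cut:
  fixes P :: "'a::euclidean_space"
  assumes "\<epsilon> > 0"
  shows "(tcut r \<epsilon> has_derivative (\<lambda>Y. cut_grad r \<epsilon> P \<bullet> Y)) (at P)"
proof (cases "P = 0")
  case True
  have "((\<lambda>P. 0) has_derivative (\<lambda>Y. 0)) (at P)" by simp
  then have "(tcut r \<epsilon> has_derivative (\<lambda>Y. 0)) (at P)"
    by (rule has_derivative_transform_within_open[of _ _ _ _ "ball 0 \<epsilon>"])
      (use assms True in \<open>auto simp: cut_zero\<close>)
  then show ?thesis using True by (simp add: cut_grad_def)
next
  case False
  have n1: "norm Q powr - 1 = 1 / norm Q" for Q :: 'a
    by (cases "Q = 0") (simp_all add: powr_minus divide_inverse)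
  have "((\<lambda>P. 1 - \<epsilon> * norm P powr - 1) has_derivative (\<lambda>Y. - \<epsilon> * (- 1 * norm P powr (- 1 - 2) * (P \<bullet> Y)))) (at P)"
    by (rule has_derivative_eq_rhs[OF has_derivative_diff[OF has_derivative_const 
         has_derivative_mult_right[OF has_derivative_norm_powr[OF False]]]]) auto
  note d = has_derivative_compose[OF this max0_square_deriv[unfolded has_field_derivative_def]]
  have eq: "(\<lambda>P :: 'a. (max 0 (1 - \<epsilon> / norm P))\<^sup>2) = (\<lambda>P. (max 0 (1 - \<epsilon> * norm P powr - 1))\<^sup>2)" by (simp add: n1)
  have "((\<lambda>P. (max 0 (1 - \<epsilon> / norm P))\<^sup>2) has_derivative 
      (\<lambda>Y. 2 * max 0 (1 - \<epsilon> / norm P) * (\<epsilon> * norm P powr (- 3) * (P \<bullet> Y)))) (at P)"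
    unfolding eq by (rule has_derivative_eq_rhs[OF d]) (simp add: n1 fun_eq_iff)
  from has_derivative_mult[OF has_derivative_norm_powr[OF False, of "- r"] this]
  have "(tcut r \<epsilon> has_derivative (\<lambda>Y. norm P powr (- r) * (2 * max 0 (1 - \<epsilon> / norm P) * (\<epsilon> * norm P powr (- 3) * (P \<bullet> Y)))
      + (- r * norm P powr (- r - 2) * (P \<bullet> Y)) * (max 0 (1 - \<epsilon> / norm P))\<^sup>2)) (at P)"
    by (simp add: tcut_def[abs_def])
  note d2 = this
  have pw: "norm P powr (- r - 2) = norm P powr (- r) / (norm P)\<^sup>2" "norm P powr (- 3) = 1 / (norm P) ^ 3"
    using False by (simp_all add: powr_diff powr_minus divide_inverse)
  have key: "N * (2 * m * (\<epsilon> * (1 / n ^ 3) * c)) + (- r * (N / n\<^sup>2) * c) * m\<^sup>2 = (N * (2 * m * (\<epsilon> / n) - r * m\<^sup>2) / n\<^sup>2) * c"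
    if "n \<noteq> 0" for N m n c :: real
    using that by (simp add: field_simps power3_eq_cube power2_eq_square)
  show ?thesis
    by (rule has_derivative_eq_rhs[OF d2], rule ext, simp only: pw cut_grad_def cut_slope_def inner_scaleR_left, rule key)
      (use False in simp)
qed

lemma continuous_on_cut_grad:
  assumes "\<epsilon> > 0"
  shows "continuous_on UNIV (cut_grad r \<epsilon> :: 'a::euclidean_space \<Rightarrow> 'a)"
proof -
  have "continuous_on (- {0}) (cut_grad r \<epsilon> :: 'a \<Rightarrow> 'a)"
    unfolding cut_grad_def cut_slope_def by (intro continuous_intros) auto
  moreover have "continuous_on (ball 0 \<epsilon>) (cut_grad r \<epsilon> :: 'a \<Rightarrow> 'a)"
    by (rule continuous_on_eq[OF continuous_on_const[of _ 0]]) (use assms in \<open>auto simp: cut_zero\<close>)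
  ultimately have "continuous_on (- {0} \<union> ball 0 \<epsilon>) (cut_grad r \<epsilon> :: 'a \<Rightarrow> 'a)"
    by (intro continuous_on_open_Un) auto
  moreover have "- {0} \<union> ball 0 \<epsilon> = (UNIV :: 'a set)" using assms by auto
  ultimately show ?thesis by simp
qed

lemma cut_tendsto:
  assumes "P \<noteq> 0"
  shows "(\<lambda>k. tcut r (1 / real (Suc k)) P) \<longlonglongrightarrow> norm P powr (- r)"
proof -
  have "(\<lambda>k. norm P powr (- r) * (max 0 (1 - (1 / real (Suc k)) / norm P))\<^sup>2) \<longlonglongrightarrow> norm P powr (- r) * (max 0 (1 - 0 / norm P))\<^sup>2"
    by (intro tendsto_intros tendsto_inverse_Suc) (use assms in auto)
  then show ?thesis by (simp add: tcut_def)
qed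

section \<open>Local L2 limits and Fatou's lemma\<close>

lemma integrable_indicator_continuous:
  fixes f :: "'a::euclidean_space \<Rightarrow> real"
  assumes "continuous_on UNIV f" "compact K"
  shows "integrable lebesgue (\<lambda>x. indicator K x * f x)"
proof -
  have "integrable lborel (\<lambda>x. indicator K x *\<^sub>R f x)"
    using assms by (intro borel_integrable_compact) (auto intro: continuous_on_subset)
  then show ?thesis by (simp add: integrable_completion borel_measurable_integrable)
qed

lemma compact_sets_lebesgue: "compact K \<Longrightarrow> K \<in> sets lebesgue" for K :: "'a::euclidean_space set"
  using fmeasurableD[OF lmeasurable_compact] .


lemma power2_sum_le: "(a + b)\<^sup>2 \<le> 2 * a\<^sup>2 + 2 * b\<^sup>2" for a b :: real
  using zero_le_power2[of "a - b"] by (simp add: power2_eq_square algebra_simps)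

text \<open>Riesz--Fischer, with one fast subsequence for all compact subsets. It is dominated as well as
  convergent, so that limits can be passed to by dominated convergence.\<close>

lemma L2_local_limit:
  fixes X :: "nat \<Rightarrow> 'a::euclidean_space \<Rightarrow> 'b::euclidean_space"
  assumes U: "open U" and cont: "\<And>n. continuous_on UNIV (X n)"
    and cauchy: "\<And>K e. compact K \<Longrightarrow> K \<subseteq> U \<Longrightarrow> e > 0 \<Longrightarrow>
      \<exists>N. \<forall>a\<ge>N. \<forall>b\<ge>N. (LINT x|lebesgue. indicator K x * (norm (X a x - X b x))\<^sup>2) \<le> e"
  obtains r G where "strict_mono (r :: nat \<Rightarrow> nat)" "G \<in> borel_measurable lebesgue"
    "\<And>K. compact K \<Longrightarrow> K \<subseteq> U \<Longrightarrow> \<exists>H k0. H \<in> borel_measurable lebesgue \<and> integrable lebesgue (\<lambda>x. indicator K x * (H x)\<^sup>2) \<and>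
       (AE x in lebesgue. x \<in> K \<longrightarrow> (\<lambda>k. X (r k) x) \<longlonglongrightarrow> G x \<and> (\<forall>k\<ge>k0. norm (X (r k) x) \<le> H x))"
proof -
  obtain C where C: "\<And>n::nat. compact (C n)" "\<And>n. C n \<subseteq> U" "\<And>n. C n \<subseteq> interior (C (Suc n))"
     "\<And>K. compact K \<Longrightarrow> K \<subseteq> U \<Longrightarrow> \<exists>N. \<forall>n\<ge>N. K \<subseteq> C n"
    using open_Union_compact_subsets[OF U] by metis
  have Cmono: "C m \<subseteq> C n" if "m \<le> n" for m n
    using lift_Suc_mono_le[of C, OF _ that] C(3) interior_subset by blast
  \<comment> \<open>The rate 1/8 leaves a summable 1/2 after multiplication by the weight 4^k, and
    the square root of that weight gives the pointwise geometric factor 2^k.\<close>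
  have "\<forall>k. \<exists>N. \<forall>a\<ge>N. \<forall>b\<ge>N. (LINT x|lebesgue. indicator (C k) x * (norm (X a x - X b x))\<^sup>2) \<le> (1 / 8) ^ k"
    by (intro allI cauchy C) simp
  then obtain N where N: "\<And>k a b. a \<ge> N k \<Longrightarrow> b \<ge> N k \<Longrightarrow> (LINT x|lebesgue. indicator (C k) x * (norm (X a x - X b x))\<^sup>2) \<le> (1 / 8) ^ k"
    by metis
  \<comment> \<open>Partial sums of \<open>Suc (N j)\<close> increase strictly and dominate each
    threshold \<open>N k\<close>.\<close>
  define r where "r k = (\<Sum>j\<le>k. Suc (N j))" for k
  have r: "strict_mono r" by (rule strict_monoI_Suc) (simp add: r_def)
  have rN: "N k \<le> r k" for k
  proof -
    have "Suc (N k) \<le> r k" unfolding r_def by (rule member_le_sum) auto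
    then show ?thesis by simp
  qed
  define G where "G x = lim (\<lambda>k. X (r k) x)" for x
  have Gm: "G \<in> borel_measurable lebesgue"
    unfolding G_def by (intro borel_measurable_lim_metric measurable_lebesgue_continuous cont)
  define a where "a k x = norm (X (r (Suc k)) x - X (r k) x)" for k x
  have ca: "continuous_on UNIV (a k)" for k unfolding a_def by (intro continuous_intros cont)
  show ?thesis
  proof (rule that[OF r Gm])
    fix K assume K: "compact K" "K \<subseteq> U"
    obtain m where m: "K \<subseteq> C m" using C(4)[OF K] by blast
    \<comment> \<open>The index is shifted by \<open>m\<close> because the L2 control on the fixed
      set \<open>C m\<close> is available only from the \<open>m\<close>-th stage of the exhaustion
      on.\<close>
    define g where "g k x = indicator (C m) x * (4 ^ (k + m) * (a (k + m) x)\<^sup>2)" for k x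
    define S where "S x = (\<Sum>k. g k x)" for x
    have g0: "g k x \<ge> 0" for k x by (simp add: g_def)
    have gi: "integrable lebesgue (g k)" for k
      unfolding g_def[abs_def] by (intro integrable_indicator_continuous C continuous_intros ca)
    have gI: "(LINT x|lebesgue. g k x) \<le> (1 / 2) ^ k" for k
    proof -
      have "(LINT x|lebesgue. indicator (C m) x * (a (k + m) x)\<^sup>2) \<le> (LINT x|lebesgue. indicator (C (k + m)) x * (a (k + m) x)\<^sup>2)"
      proof (rule integral_mono)
        show "indicator (C m) x * (a (k + m) x)\<^sup>2 \<le> indicator (C (k + m)) x * (a (k + m) x)\<^sup>2" for x
          using Cmono[of m "k + m"] by (auto simp: indicator_def)
      qed (intro integrable_indicator_continuous C continuous_intros ca)+
      also have "\<dots> \<le> (1 / 8) ^ (k + m)"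
        unfolding a_def using rN[of "k + m"] strict_mono_less_eq[OF r, of "k + m" "Suc (k + m)"]
        by (intro N) auto
      finally have "4 ^ (k + m) * (LINT x|lebesgue. indicator (C m) x * (a (k + m) x)\<^sup>2) \<le> 4 ^ (k + m) * (1 / 8) ^ (k + m)"
        by (intro mult_left_mono) auto
      also have "\<dots> = (1 / 2) ^ (k + m)" by (simp add: power_mult_distrib[symmetric])
      also have "\<dots> \<le> (1 / 2) ^ k" by (intro power_decreasing) auto
      finally have "4 ^ (k + m) * (LINT x|lebesgue. indicator (C m) x * (a (k + m) x)\<^sup>2) \<le> (1 / 2) ^ k" .
      moreover have "(LINT x|lebesgue. g k x) = 4 ^ (k + m) * (LINT x|lebesgue. indicator (C m) x * (a (k + m) x)\<^sup>2)"
        unfolding g_def by (subst integral_mult_right_zero[symmetric]) (simp add: mult_ac)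
      ultimately show ?thesis by simp
    qed
    have AEs: "AE x in lebesgue. summable (\<lambda>k. g k x)"
    proof -
      have "(\<integral>\<^sup>+x. (\<Sum>k. ennreal (g k x)) \<partial>lebesgue) = (\<Sum>k. \<integral>\<^sup>+x. ennreal (g k x) \<partial>lebesgue)"
        using borel_measurable_integrable[OF gi] by (intro nn_integral_suminf) simp
      also have "\<dots> = (\<Sum>k. ennreal (LINT x|lebesgue. g k x))"
        using gi g0 by (simp add: nn_integral_eq_integral)
      also have "\<dots> \<le> (\<Sum>k. ennreal ((1 / 2) ^ k))"
        by (intro suminf_le ennreal_leI gI summableI)
      also have "\<dots> = ennreal (\<Sum>k. (1 / 2) ^ k)"
        by (intro suminf_ennreal2 summable_geometric) auto
      also have "\<dots> < \<infinity>" by simp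
      finally have "AE x in lebesgue. (\<Sum>k. ennreal (g k x)) \<noteq> \<infinity>"
        using borel_measurable_integrable[OF gi] by (intro nn_integral_PInf_AE) auto
      then show ?thesis
        by eventually_elim (use g0 summable_suminf_not_top in auto)
    qed
    have Si: "integrable lebesgue S"
      unfolding S_def
    proof (rule integrable_suminf[OF gi])
      show "AE x in lebesgue. summable (\<lambda>k. norm (g k x))" using AEs g0 by simp
      show "summable (\<lambda>k. LINT x|lebesgue. norm (g k x))"
        by (rule summable_comparison_test'[OF summable_geometric[of "1 / 2 :: real"], of 0]) (use g0 gI in auto)
    qed
    \<comment> \<open>The telescoping increments after index \<open>m\<close> are at most
      \<open>(1 / 2) ^ k * sqrt (S x)\<close>, and the geometric series sums to 2.\<close>
    define H where "H x = norm (X (r m) x) + 2 * sqrt (S x)" for x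
    have Hm: "H \<in> borel_measurable lebesgue"
      unfolding H_def using measurable_lebesgue_continuous[OF cont] borel_measurable_integrable[OF Si] by measurable
    have S0: "S x \<ge> 0" if "summable (\<lambda>k. g k x)" for x unfolding S_def using that g0 by (rule suminf_nonneg)
    have Hi: "integrable lebesgue (\<lambda>x. indicator K x * (H x)\<^sup>2)"
    proof (rule Bochner_Integration.integrable_bound[where f="\<lambda>x. indicator K x * (2 * (norm (X (r m) x))\<^sup>2) + 8 * S x"])
      show "integrable lebesgue (\<lambda>x. indicator K x * (2 * (norm (X (r m) x))\<^sup>2) + 8 * S x)"
        by (intro Bochner_Integration.integrable_add integrable_indicator_continuous K continuous_intros cont 
             integrable_mult_right Si)
      show "(\<lambda>x. indicator K x * (H x)\<^sup>2) \<in> borel_measurable lebesgue"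
        by (intro borel_measurable_times borel_measurable_indicator compact_sets_lebesgue K borel_measurable_power Hm)
      show "AE x in lebesgue. norm (indicator K x * (H x)\<^sup>2) \<le> norm (indicator K x * (2 * (norm (X (r m) x))\<^sup>2) + 8 * S x)"
        using AEs
      proof eventually_elim
        case (elim x)
        have "(H x)\<^sup>2 \<le> 2 * (norm (X (r m) x))\<^sup>2 + 2 * (2 * sqrt (S x))\<^sup>2"
          unfolding H_def by (rule power2_sum_le)
        also have "(2 * sqrt (S x))\<^sup>2 = 4 * S x" using S0[OF elim] by (simp add: power_mult_distrib)
        finally show ?case using S0[OF elim] by (cases "x \<in> K") auto
      qed
    qed
    have "AE x in lebesgue. x \<in> K \<longrightarrow> (\<lambda>k. X (r k) x) \<longlonglongrightarrow> G x \<and> (\<forall>k\<ge>m. norm (X (r k) x) \<le> H x)"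
      using AEs
    proof eventually_elim
      case (elim x)
      show ?case
      proof
        assume "x \<in> K"
        then have x: "x \<in> C m" using m by blast
        note S0 = S0[OF elim]
        have ab: "a (k + m) x \<le> (1 / 2) ^ k * sqrt (S x)" for k
        proof -
          have "g k x \<le> S x" unfolding S_def using sum_le_suminf[OF elim, of "{k}"] g0 by auto
          moreover have "((2 :: real) ^ (k + m))\<^sup>2 = 4 ^ (k + m)"
            by (simp add: power2_eq_square power_mult_distrib[symmetric])
          ultimately have "(2 ^ (k + m) * a (k + m) x)\<^sup>2 \<le> S x"
            using x by (simp add: g_def power_mult_distrib)
          then have "2 ^ (k + m) * a (k + m) x \<le> sqrt (S x)" by (rule real_le_rsqrt)
          moreover have "2 ^ k * a (k + m) x \<le> 2 ^ (k + m) * a (k + m) x"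
            by (intro mult_right_mono power_increasing) (auto simp: a_def)
          ultimately have "2 ^ k * a (k + m) x \<le> sqrt (S x)" by linarith
          then show ?thesis by (simp add: power_divide field_simps)
        qed
        define d where "d k = X (r (Suc k + m)) x - X (r (k + m)) x" for k
        have da: "norm (d k) \<le> (1 / 2) ^ k * sqrt (S x)" for k using ab[of k] by (simp add: d_def a_def)
        have sg: "summable (\<lambda>k. (1 / 2) ^ k * sqrt (S x))" by (intro summable_mult2 summable_geometric) simp
        have tel: "X (r (k + m)) x = X (r m) x + (\<Sum>j<k. d j)" for k
          by (induction k) (auto simp: d_def)
        have "summable d" by (rule summable_comparison_test'[OF sg, of 0]) (use da in auto)
        then have "(\<lambda>k. X (r (k + m)) x) \<longlonglongrightarrow> X (r m) x + suminf d"
          unfolding tel by (intro tendsto_add tendsto_const summable_LIMSEQ)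
        then have "convergent (\<lambda>k. X (r k) x)"
          by (intro convergentI LIMSEQ_offset[of "\<lambda>k. X (r k) x" m])
        then have "(\<lambda>k. X (r k) x) \<longlonglongrightarrow> G x" unfolding G_def by (simp add: convergent_LIMSEQ_iff)
        moreover have "norm (X (r k) x) \<le> H x" if "k \<ge> m" for k
        proof -
          have j: "k = (k - m) + m" using that by simp
          define j where "j = k - m"
          have "norm (\<Sum>i<j. d i) \<le> (\<Sum>i<j. (1 / 2) ^ i * sqrt (S x))"
            using da by (intro order_trans[OF norm_sum] sum_mono)
          also have "\<dots> \<le> (\<Sum>i. (1 / 2) ^ i * sqrt (S x))"
            using S0 by (intro sum_le_suminf sg) auto
          also have "\<dots> = (\<Sum>i. (1 / 2) ^ i) * sqrt (S x)"
            by (intro suminf_mult2[symmetric] summable_geometric) simp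
          also have "\<dots> = 2 * sqrt (S x)" by (simp add: suminf_geometric)
          finally show ?thesis unfolding j[folded j_def] tel H_def by (intro norm_triangle_le add_left_mono)
        qed
        ultimately show "(\<lambda>k. X (r k) x) \<longlonglongrightarrow> G x \<and> (\<forall>k\<ge>m. norm (X (r k) x) \<le> H x)" by blast
      qed
    qed
    with Hm Hi show "\<exists>H k0. H \<in> borel_measurable lebesgue \<and> integrable lebesgue (\<lambda>x. indicator K x * (H x)\<^sup>2) \<and>
       (AE x in lebesgue. x \<in> K \<longrightarrow> (\<lambda>k. X (r k) x) \<longlonglongrightarrow> G x \<and> (\<forall>k\<ge>k0. norm (X (r k) x) \<le> H x))"
      by blast
  qed
qed

text \<open>Fatou's lemma in the form that removes a truncation from an estimate whose bound is
  independent of it.\<close>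

lemma integrable_of_bounded_liminf:
  fixes F :: "nat \<Rightarrow> 'a \<Rightarrow> real"
  assumes "\<And>k. integrable M (F k)" "\<And>k x. F k x \<ge> 0" "\<And>k. (LINT x|M. F k x) \<le> B"
    and "F0 \<in> borel_measurable M" "AE x in M. (\<lambda>k. F k x) \<longlonglongrightarrow> F0 x"
  shows "integrable M F0"
proof (rule integrableI_bounded)
  have "(\<integral>\<^sup>+x. ennreal (norm (F0 x)) \<partial>M) = (\<integral>\<^sup>+x. liminf (\<lambda>k. ennreal (F k x)) \<partial>M)"
  proof (rule nn_integral_cong_AE)
    show "AE x in M. ennreal (norm (F0 x)) = liminf (\<lambda>k. ennreal (F k x))"
      using assms(5)
    proof eventually_elim
      case (elim x)
      have "F0 x \<ge> 0" using elim assms(2) by (intro LIMSEQ_le_const) auto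
      moreover have "liminf (\<lambda>k. ennreal (F k x)) = ennreal (F0 x)" 
        by (rule lim_imp_Liminf[OF sequentially_bot tendsto_ennrealI[OF elim]])
      ultimately show ?case by simp
    qed
  qed
  also have "\<dots> \<le> liminf (\<lambda>k. \<integral>\<^sup>+x. ennreal (F k x) \<partial>M)"
    using assms(1) by (intro nn_integral_liminf) auto
  also have "\<dots> \<le> liminf (\<lambda>k. ennreal B)"
    using assms(1-3) by (intro Liminf_mono always_eventually allI) (simp add: nn_integral_eq_integral ennreal_leI)
  also have "\<dots> < \<infinity>" by (simp add: Liminf_const)
  finally show "(\<integral>\<^sup>+x. ennreal (norm (F0 x)) \<partial>M) < \<infinity>" .
qed (rule assms(4))

section \<open>Convergence of difference quotients off the critical set\<close>

definition outer :: "real ^ 'm::finite \<Rightarrow> real ^ 'n::finite \<Rightarrow> real ^ 'n ^ 'm" where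
  "outer a b = (\<chi> l. a $ l *\<^sub>R b)"

lemma inner_outer: "M \<bullet> outer a b = a \<bullet> (M *v b)"
  by (simp add: outer_def inner_vec_def[of M] inner_vec_def[of a] matrix_vector_mul_component)

lemma norm_matrix_vector_le: "norm (M *v v) \<le> norm M * norm v" for M :: "real ^ 'n::finite ^ 'm::finite"
proof -
  have "norm (M *v v) = L2_set (\<lambda>l. \<bar>M $ l \<bullet> v\<bar>) UNIV" by (simp add: norm_vec_def matrix_vector_mul_component)
  also have "\<dots> \<le> L2_set (\<lambda>l. norm (M $ l) * norm v) UNIV"
    by (intro L2_set_mono Cauchy_Schwarz_ineq2) auto
  also have "\<dots> = norm M * norm v" by (simp add: L2_set_left_distrib norm_vec_def[of M])
  finally show ?thesis .
qed

lemma abs_inner_outer_le: "\<bar>M \<bullet> outer a b\<bar> \<le> norm a * norm M * norm b"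
proof -
  have "\<bar>M \<bullet> outer a b\<bar> \<le> norm a * norm (M *v b)" unfolding inner_outer by (rule Cauchy_Schwarz_ineq2)
  also have "\<dots> \<le> norm a * (norm M * norm b)" by (intro mult_left_mono norm_matrix_vector_le) auto
  finally show ?thesis by (simp add: mult.assoc)
qed

lemma bounded_bilinear_outer: "bounded_bilinear (outer :: real ^ 'm::finite \<Rightarrow> real ^ 'n::finite \<Rightarrow> _)"
proof
  show "\<exists>K. \<forall>(a :: real ^ 'm) (b :: real ^ 'n). norm (outer a b) \<le> norm a * norm b * K"
  proof (intro exI allI)
    fix a :: "real ^ 'm" and b :: "real ^ 'n"
    have "norm (outer a b) = L2_set (\<lambda>l. norm (a $ l) * norm b) UNIV"
      unfolding norm_vec_def[of "outer a b"] by (simp add: outer_def)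
    also have "\<dots> = norm a * norm b" by (simp add: L2_set_left_distrib norm_vec_def[of a])
    finally show "norm (outer a b) \<le> norm a * norm b * 1" by simp
  qed
qed (auto simp: outer_def vec_eq_iff algebra_simps)

lemmas tendsto_outer = bounded_bilinear.tendsto[OF bounded_bilinear_outer]

lemma two_mult_le: "2 * x * y \<le> (\<eta> / 2) * x\<^sup>2 + (2 / \<eta>) * y\<^sup>2" if "\<eta> > 0" for x y \<eta> :: real
proof -
  have "0 \<le> (\<eta> * x - 2 * y)\<^sup>2" by simp
  then have "4 * \<eta> * x * y \<le> \<eta>\<^sup>2 * x\<^sup>2 + 4 * y\<^sup>2" by (simp add: power2_eq_square algebra_simps)
  then show ?thesis using that by (simp add: field_simps power2_eq_square)
qed

text \<open>Two uses are treated at once: \<open>s = 0\<close> bounds one difference quotient,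
  \<open>s = 1\<close> compares two. Here \<open>X1\<close>, \<open>X2\<close> stand for quotients
  of the gradient, \<open>F1\<close>, \<open>F2\<close> for those of the flux, and \<open>L\<close>
  for the differential of the flux at one fixed point. Since \<open>L\<close> is the same for both,
  coercivity applies to the difference; it is perturbed only by the linearization error \<kappa>, by
  Young's parameter \<eta>, and by a cutoff term that carries the square of the size
  \<open>d\<close> of the test field.\<close>

lemma energy_pointwise:
  fixes F1 F2 X1 X2 :: "real ^ 'n::finite ^ 'm::finite"
  assumes s: "s = 0 \<or> s = 1" and \<eta>: "\<eta> > 0" and "linear L"
    and L: "norm (F1 - L X1) \<le> \<kappa> * norm X1" "norm (F2 - L X2) \<le> \<kappa> * norm X2" 
    and Y: "Y = X1 - s *\<^sub>R X2" and c: "L Y \<bullet> Y \<ge> c * (norm Y)\<^sup>2"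
    and F: "norm F1 \<le> C * norm X1" "norm F2 \<le> C * norm X2" and w: "norm w \<le> d" and "\<kappa> \<ge> 0" "C \<ge> 0"
  shows "c * (\<psi>\<^sup>2 * (norm Y)\<^sup>2) \<le> (F1 - s *\<^sub>R F2) \<bullet> (\<psi>\<^sup>2 *\<^sub>R Y + outer w ((2 * \<psi>) *\<^sub>R \<psi>'))
     + (2 * \<kappa> + \<eta>) * (\<psi>\<^sup>2 * ((norm X1)\<^sup>2 + s * (norm X2)\<^sup>2)) + (2 * C\<^sup>2 / \<eta>) * d\<^sup>2 * (norm \<psi>')\<^sup>2"
proof -
  interpret L: linear L by fact
  define F where "F = F1 - s *\<^sub>R F2"
  define t where "t = norm X1 + s * norm X2"
  define q where "q = (norm X1)\<^sup>2 + s * (norm X2)\<^sup>2"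
  have s0: "s \<ge> 0" "s\<^sup>2 = s" using s by auto
  have t0: "t \<ge> 0" using s0 by (simp add: t_def)
  have d0: "d \<ge> 0" using w norm_ge_zero order_trans by blast
  have Yt: "norm Y \<le> t" unfolding Y t_def using norm_triangle_ineq4[of X1 "s *\<^sub>R X2"] s0 by simp
  have tq: "t\<^sup>2 \<le> 2 * q"
    using s zero_le_power2[of "norm X1 - norm X2"] by (auto simp: t_def q_def power2_eq_square algebra_simps)
  have "F - L Y = (F1 - L X1) - s *\<^sub>R (F2 - L X2)" unfolding F_def Y L.diff L.scaleR by (simp add: algebra_simps)
  then have "norm (F - L Y) \<le> norm (F1 - L X1) + s * norm (F2 - L X2)"
    using norm_triangle_ineq4[of "F1 - L X1" "s *\<^sub>R (F2 - L X2)"] s0 by simp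
  also have "\<dots> \<le> \<kappa> * norm X1 + s * (\<kappa> * norm X2)" using L s0 by (intro add_mono mult_left_mono) auto
  finally have FL: "norm (F - L Y) \<le> \<kappa> * t" by (simp add: t_def algebra_simps)
  have "\<bar>(F - L Y) \<bullet> Y\<bar> \<le> (\<kappa> * t) * t"
    using FL Yt t0 assms(11) by (intro order_trans[OF Cauchy_Schwarz_ineq2] mult_mono) auto
  also have "\<dots> \<le> \<kappa> * (2 * q)" using tq assms(11) by (simp add: mult.assoc power2_eq_square[symmetric] mult_left_mono)
  finally have "(F - L Y) \<bullet> Y \<ge> - (2 * \<kappa> * q)" by simp
  then have FY: "F \<bullet> Y \<ge> c * (norm Y)\<^sup>2 - 2 * \<kappa> * q" using c by (simp add: inner_diff_left)
  have "norm F \<le> C * norm X1 + s * (C * norm X2)"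
    unfolding F_def using norm_triangle_ineq4[of F1 "s *\<^sub>R F2"] F s0
    by (smt (verit) mult_left_mono norm_scaleR abs_of_nonneg)
  then have Ft: "norm F \<le> C * t" by (simp add: t_def algebra_simps)
  have "\<bar>F \<bullet> outer w ((2 * \<psi>) *\<^sub>R \<psi>')\<bar> \<le> norm w * norm F * norm ((2 * \<psi>) *\<^sub>R \<psi>')"
    by (rule abs_inner_outer_le)
  also have "\<dots> \<le> d * (C * t) * norm ((2 * \<psi>) *\<^sub>R \<psi>')"
    using w Ft d0 by (intro mult_right_mono mult_mono) auto
  also have "\<dots> = 2 * (\<bar>\<psi>\<bar> * t) * (C * d * norm \<psi>')" by (simp add: abs_mult)
  also have "\<dots> \<le> (\<eta> / 2) * (\<bar>\<psi>\<bar> * t)\<^sup>2 + (2 / \<eta>) * (C * d * norm \<psi>')\<^sup>2" by (rule two_mult_le[OF \<eta>])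
  also have "\<dots> = \<psi>\<^sup>2 * ((\<eta> / 2) * t\<^sup>2) + (2 * C\<^sup>2 / \<eta>) * d\<^sup>2 * (norm \<psi>')\<^sup>2"
    by (simp add: power_mult_distrib mult_ac)
  also have "\<dots> \<le> \<psi>\<^sup>2 * ((\<eta> / 2) * (2 * q)) + (2 * C\<^sup>2 / \<eta>) * d\<^sup>2 * (norm \<psi>')\<^sup>2"
    using tq \<eta> by (intro add_right_mono mult_left_mono) auto
  finally have 2: "F \<bullet> outer w ((2 * \<psi>) *\<^sub>R \<psi>') \<ge> - (\<eta> * (\<psi>\<^sup>2 * q) + (2 * C\<^sup>2 / \<eta>) * d\<^sup>2 * (norm \<psi>')\<^sup>2)"
    by (simp add: mult_ac)
  have "\<psi>\<^sup>2 * (F \<bullet> Y) \<ge> \<psi>\<^sup>2 * (c * (norm Y)\<^sup>2 - 2 * \<kappa> * q)" using FY by (intro mult_left_mono) auto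
  with 2 show ?thesis
    unfolding F_def[symmetric] q_def[symmetric] inner_add_right inner_scaleR_right by (simp add: algebra_simps)
qed

definition C1cv :: "(real ^ 'n::finite) set \<Rightarrow> (real ^ 'n \<Rightarrow> real ^ 'm::finite) \<Rightarrow> (real ^ 'n \<Rightarrow> real ^ 'n ^ 'm) \<Rightarrow> bool" where
  "C1cv S \<Phi> \<Phi>' \<longleftrightarrow> (\<forall>l. C1c S (\<lambda>x. \<Phi> x $ l) (\<lambda>x. \<Phi>' x $ l))"

lemma C1cv_scaleR:
  assumes "C1c S \<psi> \<psi>'" "\<And>x. (w has_derivative (\<lambda>v. Q x *v v)) (at x)" "continuous_on UNIV Q"
  shows "C1cv S (\<lambda>x. \<psi> x *\<^sub>R w x) (\<lambda>x. \<psi> x *\<^sub>R Q x + outer (w x) (\<psi>' x))"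
  unfolding C1cv_def
proof
  fix l
  have "C1c S (\<lambda>x. \<psi> x * w x $ l) (\<lambda>x. \<psi> x *\<^sub>R Q x $ l + w x $ l *\<^sub>R \<psi>' x)"
    by (intro C1c_mult assms(1) has_derivative_matrix_row assms(2) continuous_on_component assms(3))
  then show "C1c S (\<lambda>x. (\<psi> x *\<^sub>R w x) $ l) (\<lambda>x. (\<psi> x *\<^sub>R Q x + outer (w x) (\<psi>' x)) $ l)"
    by (simp add: outer_def)
qed

lemma C1cv_continuous:
  assumes "C1cv S \<Phi> \<Phi>'"
  shows "continuous_on UNIV \<Phi>" "continuous_on UNIV \<Phi>'"
proof -
  have c: "C1c S (\<lambda>x. \<Phi> x $ l) (\<lambda>x. \<Phi>' x $ l)" for l using assms by (simp add: C1cv_def)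
  have "continuous_on UNIV (\<lambda>x. \<chi> l. \<Phi> x $ l)" "continuous_on UNIV (\<lambda>x. \<chi> l. \<Phi>' x $ l)"
    by (intro continuous_on_vec_lambda C1cD(3)[OF c], intro continuous_on_vec_lambda C1cD(2)[OF c])
  then show "continuous_on UNIV \<Phi>" "continuous_on UNIV \<Phi>'" by (simp_all add: vec_lambda_eta)
qed

lemma C1cv_outside: "C1cv S \<Phi> \<Phi>' \<Longrightarrow> x \<notin> S \<Longrightarrow> \<Phi> x = 0 \<and> \<Phi>' x = 0"
  using C1c_outside by (fastforce simp: C1cv_def vec_eq_iff)

lemma C1cv_uminus: "C1cv S \<Phi> \<Phi>' \<Longrightarrow> C1cv S (\<lambda>x. - \<Phi> x) (\<lambda>x. - \<Phi>' x)"
  using C1c_cmul[where c="-1"] by (fastforce simp: C1cv_def)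

lemma has_derivative_DQ:
  assumes "\<And>x. (u has_derivative (\<lambda>v. P x *v v)) (at x)"
  shows "(DQ n i u has_derivative (\<lambda>v. DQ n i P x *v v)) (at x)"
proof -
  have 1: "((\<lambda>x. u (h + x)) has_derivative (\<lambda>v. P (h + x) *v v)) (at x)" for h
    by (rule has_derivative_eq_rhs[OF has_derivative_compose[where f="\<lambda>x. h + x", OF _ assms]])
      (auto intro!: derivative_eq_intros)
  show ?thesis
    unfolding DQ_def
    by (rule has_derivative_eq_rhs[OF has_derivative_scaleR_right[OF has_derivative_diff[OF 1 assms]]])
      (simp add: matrix_vector_mult_diff_rdistrib scaleR_matrix_vector_assoc[symmetric] fun_eq_iff del: of_nat_Suc)
qed

lemma C1c_square: "C1c S \<psi> \<psi>' \<Longrightarrow> C1c S (\<lambda>x. (\<psi> x)\<^sup>2) (\<lambda>x. (2 * \<psi> x) *\<^sub>R \<psi>' x)"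
  using C1c_mult[of S \<psi> \<psi>' \<psi> \<psi>'] C1cD[of S \<psi> \<psi>'] by (simp add: power2_eq_square scaleR_add_left[symmetric])

lemma column_matrix_axis: "(P :: real ^ 'n::finite ^ 'm::finite) *v axis i 1 = column i P"
  by (rule matrix_vector_mult_basis)

lemma norm_column_le: "norm (column i P) \<le> norm P" for P :: "real ^ 'n::finite ^ 'm::finite"
  using norm_matrix_vector_le[of P "axis i 1"] by (simp add: column_matrix_axis norm_axis_1)

text \<open>The assumption \<open>test\<close> is the differentiated system with \<open>\<Gamma>\<close> in the role of the \<open>L\<^sup>1\<close> norm of
  \<open>Df\<close>; it involves neither \<open>f\<close> nor weak derivatives.\<close>

locale flux_core =
  fixes p :: real and W Ku :: "(real ^ 'n::finite) set" and u :: "real ^ 'n \<Rightarrow> real ^ 'm::finite" 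
    and P :: "real ^ 'n \<Rightarrow> real ^ 'n ^ 'm" and \<Gamma> :: real
  assumes p: "p > 1" and W: "open W"
    and du: "\<And>x. (u has_derivative (\<lambda>v. P x *v v)) (at x)" and cP: "continuous_on UNIV P"
    and Ku: "compact Ku" "\<And>x. x \<notin> Ku \<Longrightarrow> P x = 0"
    and \<Gamma>: "\<Gamma> \<ge> 0"
    and test: "\<And>K. compact K \<Longrightarrow> K \<subseteq> W \<Longrightarrow> \<exists>N. \<forall>n\<ge>N. \<forall>i \<Phi> \<Phi>' B. C1cv K \<Phi> \<Phi>' \<longrightarrow> (\<forall>x. norm (\<Phi> x) \<le> B) \<longrightarrow>
        (LINT x|lebesgue. DQ n i (\<lambda>x. p_flux p (P x)) x \<bullet> \<Phi>' x) \<le> B * \<Gamma>"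
begin

definition "A x = p_flux p (P x)"
definition "Reg = {x \<in> W. P x \<noteq> 0}"

lemma Reg: "open Reg" "Reg \<subseteq> W"
proof -
  have "open {x. P x \<noteq> 0}" by (intro open_Collect_neq cP continuous_on_const)
  then have "open (W \<inter> {x. P x \<noteq> 0})" using W by blast
  then show "open Reg" "Reg \<subseteq> W" by (auto simp: Reg_def Int_def)
qed

lemma cA: "continuous_on UNIV A"
  unfolding A_def by (intro continuous_on_compose2[OF continuous_on_p_flux[OF p] cP]) auto

lemma P_bounded: obtains M where "M > 0" "\<And>x. norm (P x) \<le> M"
proof -
  have "compact (P ` Ku)" using Ku cP by (intro compact_continuous_image) (auto intro: continuous_on_subset)
  then have "\<exists>B>0. \<forall>x\<in>Ku. norm (P x) \<le> B" by (auto dest!: compact_imp_bounded simp: bounded_pos)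
  then obtain B where B: "B > 0" "\<And>x. x \<in> Ku \<Longrightarrow> norm (P x) \<le> B" by blast
  have "norm (P x) \<le> B" for x using B Ku(2)[of x] by (cases "x \<in> Ku") auto
  with B(1) that show ?thesis by blast
qed

lemma inverse_Suc_less: "d > 0 \<Longrightarrow> \<exists>N. \<forall>n\<ge>N. 1 / real (Suc n) < d"
  using order_tendstoD(2)[OF tendsto_inverse_Suc] by (simp add: eventually_sequentially)

lemma P_shift: 
  assumes "e > 0"
  shows "\<exists>N. \<forall>n\<ge>N. \<forall>i x. norm (P ((1 / real (Suc n)) *\<^sub>R axis i 1 + x) - P x) < e"
proof -
  obtain d where d: "d > 0" "\<And>x y. dist y x < d \<Longrightarrow> norm (P y - P x) < e"
    using uniformly_continuous_cc[OF cP Ku assms] by metis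
  obtain N where N: "\<And>n. n \<ge> N \<Longrightarrow> 1 / real (Suc n) < d" using inverse_Suc_less[OF d(1)] by blast
  have "norm (P ((1 / real (Suc n)) *\<^sub>R axis i 1 + x) - P x) < e" if "n \<ge> N" for n i x
    using d(2)[of "(1 / real (Suc n)) *\<^sub>R axis i 1 + x" x] N[OF that] by (simp add: dist_norm norm_axis_1)
  then show ?thesis by blast
qed

text \<open>The uniform continuity of \<open>P\<close> makes the convergence uniform in
  \<open>x\<close>, so two quotients with small steps differ by little in the sup norm. That is the
  smallness required of the test field.\<close>

lemma DQu_conv:
  assumes "e > 0"
  shows "\<exists>N. \<forall>n\<ge>N. \<forall>i x. norm (DQ n i u x - column i (P x)) \<le> e"
proof -
  obtain d where d: "d > 0" "\<And>x y. dist y x < d \<Longrightarrow> norm (P y - P x) < e"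
    using uniformly_continuous_cc[OF cP Ku assms] by metis
  obtain N where N: "\<And>n. n \<ge> N \<Longrightarrow> 1 / real (Suc n) < d" using inverse_Suc_less[OF d(1)] by blast
  have "norm (DQ n i u x - column i (P x)) \<le> e" if n: "n \<ge> N" for n i x
  proof -
    define h where "h = (1 / real (Suc n)) *\<^sub>R (axis i 1 :: real ^ 'n)"
    have nh: "norm h = 1 / real (Suc n)" by (simp add: h_def norm_axis_1)
    have "norm (u (h + x) - u x - P x *v (h + x - x)) \<le> norm (h + x - x) * e"
    proof (rule differentiable_bound_linearization[where S="ball x d" and f=u and f'="\<lambda>x v. P x *v v"])
      show "x + t *\<^sub>R (h + x - x) \<in> ball x d" if "t \<in> {0..1}" for t
      proof -
        have "\<bar>t\<bar> * norm h \<le> 1 * norm h" using that by (intro mult_right_mono) auto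
        then show ?thesis using N[OF n] nh by (simp add: dist_norm)
      qed
      show "(u has_derivative (\<lambda>v. P y *v v)) (at y within ball x d)" for y by (rule has_derivative_at_withinI[OF du])
      show "onorm ((\<lambda>v. P y *v v) - (\<lambda>v. P x *v v)) \<le> e" if "y \<in> ball x d" for y
      proof (rule onorm_bound)
        fix v :: "real ^ 'n"
        have "norm (P y - P x) \<le> e" using d(2)[of y x] that by (simp add: dist_commute less_imp_le)
        then have "norm (P y - P x) * norm v \<le> e * norm v" by (intro mult_right_mono) auto
        then show "norm (((\<lambda>v. P y *v v) - (\<lambda>v. P x *v v)) v) \<le> e * norm v"
          using norm_matrix_vector_le[of "P y - P x" v] by (simp add: matrix_vector_mult_diff_rdistrib)
      qed (use assms in simp)
    qed (use d in simp)
    then have "norm (u (h + x) - u x - P x *v h) \<le> e / real (Suc n)" by (simp add: nh)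
    moreover have "DQ n i u x - column i (P x) = real (Suc n) *\<^sub>R (u (h + x) - u x - P x *v h)"
      by (simp add: DQ_def h_def column_matrix_axis[symmetric] matrix_vector_mult_scaleR scaleR_diff_right del: of_nat_Suc)
    ultimately have "norm (DQ n i u x - column i (P x)) \<le> real (Suc n) * (e / real (Suc n))"
      by (simp only: norm_scaleR abs_of_nat) (intro mult_left_mono; simp)
    then show ?thesis by simp
  qed
  then show ?thesis by blast
qed

lemma DQu_bounded: obtains M where "M > 0" "\<And>n i x. norm (DQ n i u x) \<le> M"
proof -
  obtain M where M: "M > 0" "\<And>x. norm (P x) \<le> M" using P_bounded by metis
  have "norm (DQ n i u x) \<le> M" for n i x
  proof (rule DQ_bound[OF du])
    fix x show "onorm (\<lambda>v. P x *v v) \<le> M"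
      using M(1) order_trans[OF norm_matrix_vector_le mult_right_mono[OF M(2) norm_ge_zero]] by (intro onorm_bound) auto
  qed
  with M(1) that show ?thesis by blast
qed

lemma test_abs:
  assumes "compact K" "K \<subseteq> W"
  shows "\<exists>N. \<forall>n\<ge>N. \<forall>i \<Phi> \<Phi>' B. C1cv K \<Phi> \<Phi>' \<longrightarrow> (\<forall>x. norm (\<Phi> x) \<le> B) \<longrightarrow>
        \<bar>LINT x|lebesgue. DQ n i A x \<bullet> \<Phi>' x\<bar> \<le> B * \<Gamma>"
proof -
  obtain N where N: "\<And>n i \<Phi> \<Phi>' B. n \<ge> N \<Longrightarrow> C1cv K \<Phi> \<Phi>' \<Longrightarrow> (\<forall>x. norm (\<Phi> x) \<le> B) \<Longrightarrow>
        (LINT x|lebesgue. DQ n i A x \<bullet> \<Phi>' x) \<le> B * \<Gamma>"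
    using test[OF assms] unfolding A_def[abs_def, symmetric] by blast
  have "\<bar>LINT x|lebesgue. DQ n i A x \<bullet> \<Phi>' x\<bar> \<le> B * \<Gamma>"
    if "n \<ge> N" "C1cv K \<Phi> \<Phi>'" "\<forall>x. norm (\<Phi> x) \<le> B" for n i \<Phi> \<Phi>' B
    using N[OF that] N[OF that(1) C1cv_uminus[OF that(2)]] that(3) by (simp add: abs_le_iff)
  then show ?thesis by blast
qed

text \<open>On a compact part of \<open>Reg\<close> the norm of \<open>P\<close> stays between
  positive constants, so the linearized system is uniformly elliptic. The expansion of the flux is
  uniform as soon as a shift by the step changes \<open>P\<close> by less than its radius of
  validity.\<close>

lemma DQ_flux:
  assumes "compact K" "K \<subseteq> Reg"
  obtains c C where "c > 0" "C > 0" "\<And>x Y. x \<in> K \<Longrightarrow> dflux p (P x) Y \<bullet> Y \<ge> c * (norm Y)\<^sup>2"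
    "\<And>x Y. x \<in> K \<Longrightarrow> norm (dflux p (P x) Y) \<le> C * norm Y"
    "\<And>\<kappa>. 0 < \<kappa> \<Longrightarrow> \<exists>N. \<forall>n\<ge>N. \<forall>i. \<forall>x\<in>K. norm (DQ n i A x - dflux p (P x) (DQ n i P x)) \<le> \<kappa> * norm (DQ n i P x)"
proof (cases "K = {}")
  case True
  then show ?thesis using that[of 1 1] by simp
next
  case False
  obtain M where M: "M > 0" "\<And>x. norm (P x) \<le> M" using P_bounded by metis
  have "continuous_on K (\<lambda>x. norm (P x))" by (intro continuous_intros continuous_on_subset[OF cP]) auto
  then obtain x0 where x0: "x0 \<in> K" "\<And>x. x \<in> K \<Longrightarrow> norm (P x0) \<le> norm (P x)"
    using continuous_attains_inf[OF assms(1) False] by metis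
  define e where "e = norm (P x0)"
  have e: "e > 0" using x0(1) assms(2) by (auto simp: e_def Reg_def)
  have eM: "e \<le> M" using M by (simp add: e_def)
  have P0: "P x \<noteq> 0" if "x \<in> K" for x using that assms(2) by (auto simp: Reg_def)
  \<comment> \<open>The power with exponent p - 2 may increase or decrease; minimum and maximum over
    both ends of the range cover both signs.\<close>
  define m where "m = min (e powr (p - 2)) (M powr (p - 2))"
  define m' where "m' = max (e powr (p - 2)) (M powr (p - 2))"
  have m: "m > 0" using e M by (simp add: m_def)
  have pw: "m \<le> norm (P x) powr (p - 2)" "norm (P x) powr (p - 2) \<le> m'" if "x \<in> K" for x
  proof -
    have 1: "e \<le> norm (P x)" "norm (P x) \<le> M" using x0(2)[OF that] M by (auto simp: e_def)
    show "m \<le> norm (P x) powr (p - 2)" "norm (P x) powr (p - 2) \<le> m'"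
      using powr_mono2[of "p - 2" e "norm (P x)"] powr_mono2[of "p - 2" "norm (P x)" M]
        powr_mono2'[of "p - 2" e "norm (P x)"] powr_mono2'[of "p - 2" "norm (P x)" M] 1 e
      by (cases "p \<ge> 2"; force simp: m_def m'_def)+
  qed
  show ?thesis
  proof (rule that[of "min 1 (p - 1) * m" "(1 + \<bar>p - 2\<bar>) * m'"])
    show "min 1 (p - 1) * m > 0" using p m by simp
    show "(1 + \<bar>p - 2\<bar>) * m' > 0" using e by (auto simp: m'_def max_def intro!: mult_pos_pos)
    fix x and Y :: "real ^ 'n ^ 'm" assume x: "x \<in> K"
    have "min 1 (p - 1) * m * (norm Y)\<^sup>2 \<le> min 1 (p - 1) * norm (P x) powr (p - 2) * (norm Y)\<^sup>2"
      using pw[OF x] p by (intro mult_right_mono mult_left_mono) auto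
    with dflux_coercive[OF P0[OF x] p, of Y] show "min 1 (p - 1) * m * (norm Y)\<^sup>2 \<le> dflux p (P x) Y \<bullet> Y" by linarith
    have "(1 + \<bar>p - 2\<bar>) * norm (P x) powr (p - 2) * norm Y \<le> (1 + \<bar>p - 2\<bar>) * m' * norm Y"
      using pw[OF x] by (intro mult_right_mono mult_left_mono) auto
    with norm_dflux[of p "P x" Y] show "norm (dflux p (P x) Y) \<le> (1 + \<bar>p - 2\<bar>) * m' * norm Y" by linarith
  next
    fix \<kappa> :: real assume \<kappa>: "\<kappa> > 0"
    obtain \<delta> where d: "\<delta> > 0" "\<And>P Q :: real ^ 'n ^ 'm. e \<le> norm P \<Longrightarrow> norm P \<le> M \<Longrightarrow> norm (Q - P) < \<delta> \<Longrightarrow>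
       norm (p_flux p Q - p_flux p P - dflux p P (Q - P)) \<le> \<kappa> * norm (Q - P)"
      using p_flux_linearization[OF e \<kappa>, of M p] by metis
    obtain N where N: "\<And>n i x. n \<ge> N \<Longrightarrow> norm (P ((1 / real (Suc n)) *\<^sub>R axis i 1 + x) - P x) < \<delta>"
      using P_shift[OF d(1)] by blast
    have "norm (DQ n i A x - dflux p (P x) (DQ n i P x)) \<le> \<kappa> * norm (DQ n i P x)" if n: "n \<ge> N" and x: "x \<in> K" for n i x
    proof -
      interpret D: bounded_linear "dflux p (P x)" by (rule bounded_linear_dflux)
      define Q where "Q = P ((1 / real (Suc n)) *\<^sub>R axis i 1 + x)"
      have "norm (p_flux p Q - p_flux p (P x) - dflux p (P x) (Q - P x)) \<le> \<kappa> * norm (Q - P x)"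
        using d(2)[of "P x" Q] x0(2)[OF x] M(2)[of x] N[OF n] by (simp add: Q_def e_def)
      then have "real (Suc n) * norm (p_flux p Q - p_flux p (P x) - dflux p (P x) (Q - P x)) \<le> real (Suc n) * (\<kappa> * norm (Q - P x))"
        by (intro mult_left_mono) auto
      moreover have "DQ n i A x - dflux p (P x) (DQ n i P x) = real (Suc n) *\<^sub>R (p_flux p Q - p_flux p (P x) - dflux p (P x) (Q - P x))"
        by (simp only: DQ_def A_def Q_def D.scaleR D.diff scaleR_diff_right)
      moreover have "norm (DQ n i P x) = real (Suc n) * norm (Q - P x)" by (simp add: DQ_def Q_def)
      ultimately show ?thesis by (simp add: mult.left_commute del: of_nat_Suc)
    qed
    then show "\<exists>N. \<forall>n\<ge>N. \<forall>i. \<forall>x\<in>K. norm (DQ n i A x - dflux p (P x) (DQ n i P x)) \<le> \<kappa> * norm (DQ n i P x)" by blast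
  qed
qed

end

context flux_core
begin

text \<open>The pointwise inequality is integrated for the test field \<psi>^2 w, where w is a
  quotient of u or a difference of two. The differentiated equation at each of the indices involved
  costs at most \<open>B * d * \<Gamma>\<close>, whence the factor \<open>1 + s\<close>.\<close>

lemma energy:
  assumes K: "compact K" "K \<subseteq> Reg" and \<psi>: "C1c K \<psi> \<psi>'" and B: "\<And>x. (\<psi> x)\<^sup>2 \<le> B"
  obtains c C where "c > 0" "C > 0"
    "\<And>\<kappa> \<eta>. 0 < \<kappa> \<Longrightarrow> \<kappa> \<le> 1 \<Longrightarrow> 0 < \<eta> \<Longrightarrow> \<exists>N. \<forall>a\<ge>N. \<forall>b\<ge>N. \<forall>i s d. (s = 0 \<or> s = 1) \<longrightarrow>
      (\<forall>x. norm (DQ a i u x - s *\<^sub>R DQ b i u x) \<le> d) \<longrightarrow>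
      c * (LINT x|lebesgue. (\<psi> x)\<^sup>2 * (norm (DQ a i P x - s *\<^sub>R DQ b i P x))\<^sup>2) \<le>
      (2 * \<kappa> + \<eta>) * ((LINT x|lebesgue. (\<psi> x)\<^sup>2 * (norm (DQ a i P x))\<^sup>2) + s * (LINT x|lebesgue. (\<psi> x)\<^sup>2 * (norm (DQ b i P x))\<^sup>2))
      + (2 * C\<^sup>2 / \<eta>) * d\<^sup>2 * (LINT x|lebesgue. (norm (\<psi>' x))\<^sup>2) + (1 + s) * (B * d * \<Gamma>)"
proof -
  obtain c C where c: "c > 0" "C > 0" "\<And>x Y. x \<in> K \<Longrightarrow> dflux p (P x) Y \<bullet> Y \<ge> c * (norm Y)\<^sup>2"
    "\<And>x Y. x \<in> K \<Longrightarrow> norm (dflux p (P x) Y) \<le> C * norm Y"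
    "\<And>\<kappa>. 0 < \<kappa> \<Longrightarrow> \<exists>N. \<forall>n\<ge>N. \<forall>i. \<forall>x\<in>K. norm (DQ n i A x - dflux p (P x) (DQ n i P x)) \<le> \<kappa> * norm (DQ n i P x)"
    using DQ_flux[OF K] by metis
  note cont = C1cD(2,3)[OF \<psi>] continuous_on_DQ[OF cA] continuous_on_DQ[OF cP]
  have out: "\<psi> x = 0" "\<psi>' x = 0" if "x \<notin> K" for x using C1c_outside[OF \<psi> that] by auto
  have i: "integrable lebesgue (\<lambda>x. (\<psi> x)\<^sup>2 * (norm (DQ a i P x - s *\<^sub>R DQ b i P x))\<^sup>2)"
    "integrable lebesgue (\<lambda>x. (\<psi> x)\<^sup>2 * (norm (DQ a i P x))\<^sup>2)"
    "integrable lebesgue (\<lambda>x. (norm (\<psi>' x))\<^sup>2)" for a b i s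
    by (rule integrable_lebesgue_cc[OF _ K(1)]; use out in \<open>auto intro!: continuous_intros cont\<close>)+
  show ?thesis
  \<comment> \<open>The flux quotient is bounded by \<open>C\<close> times the quotient of
    \<open>P\<close> for the linear part, plus \<kappa> \<le> 1 times it for the remainder.\<close>
  proof (rule that[of c "C + 1"])
    fix \<kappa> \<eta> :: real assume k: "0 < \<kappa>" "\<kappa> \<le> 1" and \<eta>: "0 < \<eta>"
    obtain N1 where N1: "\<And>n i x. n \<ge> N1 \<Longrightarrow> x \<in> K \<Longrightarrow> norm (DQ n i A x - dflux p (P x) (DQ n i P x)) \<le> \<kappa> * norm (DQ n i P x)"
      using c(5)[OF k(1)] by blast
    obtain N2 where N2: "\<And>n i \<Phi> \<Phi>' B. n \<ge> N2 \<Longrightarrow> C1cv K \<Phi> \<Phi>' \<Longrightarrow> (\<And>x. norm (\<Phi> x) \<le> B) \<Longrightarrow>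
        \<bar>LINT x|lebesgue. DQ n i A x \<bullet> \<Phi>' x\<bar> \<le> B * \<Gamma>"
      using test_abs[OF K(1) order_trans[OF K(2) Reg(2)]] by blast
    have "c * (LINT x|lebesgue. (\<psi> x)\<^sup>2 * (norm (DQ a i P x - s *\<^sub>R DQ b i P x))\<^sup>2) \<le>
      (2 * \<kappa> + \<eta>) * ((LINT x|lebesgue. (\<psi> x)\<^sup>2 * (norm (DQ a i P x))\<^sup>2) + s * (LINT x|lebesgue. (\<psi> x)\<^sup>2 * (norm (DQ b i P x))\<^sup>2))
      + (2 * (C + 1)\<^sup>2 / \<eta>) * d\<^sup>2 * (LINT x|lebesgue. (norm (\<psi>' x))\<^sup>2) + (1 + s) * (B * d * \<Gamma>)"
      if ab: "a \<ge> max N1 N2" "b \<ge> max N1 N2" and s: "s = 0 \<or> s = 1"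
        and d: "\<And>x. norm (DQ a i u x - s *\<^sub>R DQ b i u x) \<le> d" for a b i s d
    proof -
      define w where "w x = DQ a i u x - s *\<^sub>R DQ b i u x" for x
      define Y where "Y x = DQ a i P x - s *\<^sub>R DQ b i P x" for x
      define \<Phi>' where "\<Phi>' x = (\<psi> x)\<^sup>2 *\<^sub>R Y x + outer (w x) ((2 * \<psi> x) *\<^sub>R \<psi>' x)" for x
      have dw: "(w has_derivative (\<lambda>v. Y x *v v)) (at x)" for x
        unfolding w_def Y_def
        by (rule has_derivative_eq_rhs[OF has_derivative_diff[OF has_derivative_DQ[OF du] has_derivative_scaleR_right[OF has_derivative_DQ[OF du]]]])
          (simp add: matrix_vector_mult_diff_rdistrib scaleR_matrix_vector_assoc)
      have cY: "continuous_on UNIV Y" unfolding Y_def by (intro continuous_intros cont)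
      have C: "C1cv K (\<lambda>x. (\<psi> x)\<^sup>2 *\<^sub>R w x) \<Phi>'"
        unfolding \<Phi>'_def by (rule C1cv_scaleR[OF C1c_square[OF \<psi>] dw cY])
      have B0: "B \<ge> 0" using B[of undefined] zero_le_power2 order_trans by blast
      have \<Phi>B: "norm ((\<psi> x)\<^sup>2 *\<^sub>R w x) \<le> B * d" for x
        using B[of x] d[of x] B0 by (auto simp: w_def intro!: mult_mono)
      note c\<Phi>' = C1cv_continuous(2)[OF C]
      have \<Phi>'0: "\<Phi>' x = 0" if "x \<notin> K" for x using C1cv_outside[OF C that] by simp
      have iE: "integrable lebesgue (\<lambda>x. DQ n i A x \<bullet> \<Phi>' x)" for n
        by (rule integrable_lebesgue_cc[OF _ K(1)]) (use \<Phi>'0 in \<open>auto intro!: continuous_intros cont c\<Phi>'\<close>)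
      have pw: "c * ((\<psi> x)\<^sup>2 * (norm (Y x))\<^sup>2) \<le> (DQ a i A x - s *\<^sub>R DQ b i A x) \<bullet> \<Phi>' x
        + (2 * \<kappa> + \<eta>) * ((\<psi> x)\<^sup>2 * ((norm (DQ a i P x))\<^sup>2 + s * (norm (DQ b i P x))\<^sup>2)) + (2 * (C + 1)\<^sup>2 / \<eta>) * d\<^sup>2 * (norm (\<psi>' x))\<^sup>2" for x
      proof (cases "x \<in> K")
        case True
        have lin: "linear (dflux p (P x))" using bounded_linear_dflux bounded_linear.linear by blast
        have F: "norm (DQ n i A x) \<le> (C + 1) * norm (DQ n i P x)" if "n \<ge> N1" for n
        proof -
          have "norm (DQ n i A x) \<le> norm (dflux p (P x) (DQ n i P x)) + norm (DQ n i A x - dflux p (P x) (DQ n i P x))"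
            by (rule norm_triangle_sub)
          also have "\<dots> \<le> C * norm (DQ n i P x) + \<kappa> * norm (DQ n i P x)"
            by (intro add_mono c(4) N1 True that)
          also have "\<dots> \<le> C * norm (DQ n i P x) + 1 * norm (DQ n i P x)"
            using k by (intro add_left_mono mult_right_mono) auto
          finally show ?thesis by (simp add: algebra_simps)
        qed
        show ?thesis
          unfolding \<Phi>'_def
          by (rule energy_pointwise[OF s \<eta> lin N1 N1 Y_def c(3)[OF True] F F]) (use ab k c True d in \<open>auto simp: w_def\<close>)
      next
        case False
        then show ?thesis using out[OF False] \<Phi>'0[OF False] by simp
      qed
      have "c * (LINT x|lebesgue. (\<psi> x)\<^sup>2 * (norm (Y x))\<^sup>2) = (LINT x|lebesgue. c * ((\<psi> x)\<^sup>2 * (norm (Y x))\<^sup>2))" by simp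
      also have "\<dots> \<le> (LINT x|lebesgue. (DQ a i A x \<bullet> \<Phi>' x - s * (DQ b i A x \<bullet> \<Phi>' x))
        + (2 * \<kappa> + \<eta>) * ((\<psi> x)\<^sup>2 * (norm (DQ a i P x))\<^sup>2 + s * ((\<psi> x)\<^sup>2 * (norm (DQ b i P x))\<^sup>2)) + (2 * (C + 1)\<^sup>2 / \<eta>) * d\<^sup>2 * (norm (\<psi>' x))\<^sup>2)"
      proof (rule integral_mono)
        show "integrable lebesgue (\<lambda>x. c * ((\<psi> x)\<^sup>2 * (norm (Y x))\<^sup>2))" unfolding Y_def using i(1) by simp
        show "integrable lebesgue (\<lambda>x. (DQ a i A x \<bullet> \<Phi>' x - s * (DQ b i A x \<bullet> \<Phi>' x))
        + (2 * \<kappa> + \<eta>) * ((\<psi> x)\<^sup>2 * (norm (DQ a i P x))\<^sup>2 + s * ((\<psi> x)\<^sup>2 * (norm (DQ b i P x))\<^sup>2)) + (2 * (C + 1)\<^sup>2 / \<eta>) * d\<^sup>2 * (norm (\<psi>' x))\<^sup>2)"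
          by (intro Bochner_Integration.integrable_add Bochner_Integration.integrable_diff integrable_mult_right iE i)
        show "c * ((\<psi> x)\<^sup>2 * (norm (Y x))\<^sup>2) \<le> (DQ a i A x \<bullet> \<Phi>' x - s * (DQ b i A x \<bullet> \<Phi>' x))
        + (2 * \<kappa> + \<eta>) * ((\<psi> x)\<^sup>2 * (norm (DQ a i P x))\<^sup>2 + s * ((\<psi> x)\<^sup>2 * (norm (DQ b i P x))\<^sup>2)) + (2 * (C + 1)\<^sup>2 / \<eta>) * d\<^sup>2 * (norm (\<psi>' x))\<^sup>2" for x
          using pw[of x] by (simp add: inner_diff_left algebra_simps)
      qed
      also have "\<dots> = ((LINT x|lebesgue. DQ a i A x \<bullet> \<Phi>' x) - s * (LINT x|lebesgue. DQ b i A x \<bullet> \<Phi>' x)) +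
         (2 * \<kappa> + \<eta>) * ((LINT x|lebesgue. (\<psi> x)\<^sup>2 * (norm (DQ a i P x))\<^sup>2) + s * (LINT x|lebesgue. (\<psi> x)\<^sup>2 * (norm (DQ b i P x))\<^sup>2))
         + (2 * (C + 1)\<^sup>2 / \<eta>) * d\<^sup>2 * (LINT x|lebesgue. (norm (\<psi>' x))\<^sup>2)"
        using iE i by simp
      also have "(LINT x|lebesgue. DQ a i A x \<bullet> \<Phi>' x) - s * (LINT x|lebesgue. DQ b i A x \<bullet> \<Phi>' x) \<le> (1 + s) * (B * d * \<Gamma>)"
        using N2[OF _ C \<Phi>B, of a i] N2[OF _ C \<Phi>B, of b i] ab s by (auto simp: abs_le_iff)
      finally show ?thesis unfolding Y_def by simp
    qed
    then show "\<exists>N. \<forall>a\<ge>N. \<forall>b\<ge>N. \<forall>i s d. (s = 0 \<or> s = 1) \<longrightarrow>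
      (\<forall>x. norm (DQ a i u x - s *\<^sub>R DQ b i u x) \<le> d) \<longrightarrow>
      c * (LINT x|lebesgue. (\<psi> x)\<^sup>2 * (norm (DQ a i P x - s *\<^sub>R DQ b i P x))\<^sup>2) \<le>
      (2 * \<kappa> + \<eta>) * ((LINT x|lebesgue. (\<psi> x)\<^sup>2 * (norm (DQ a i P x))\<^sup>2) + s * (LINT x|lebesgue. (\<psi> x)\<^sup>2 * (norm (DQ b i P x))\<^sup>2))
      + (2 * (C + 1)\<^sup>2 / \<eta>) * d\<^sup>2 * (LINT x|lebesgue. (norm (\<psi>' x))\<^sup>2) + (1 + s) * (B * d * \<Gamma>)"
      by blast
  qed (use c in auto)
qed

text \<open>The estimate is used twice: \<open>s = 0\<close> gives a bound \<open>J\<close> on the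
  energies of single quotients, and \<open>s = 1\<close>, with parameters small relative to
  \<open>J\<close> and a test field small in the sup norm, gives the Cauchy property.\<close>

lemma DQ_cauchy:
  assumes K: "compact K" "K \<subseteq> Reg" and e: "e > 0"
  shows "\<exists>N. \<forall>a\<ge>N. \<forall>b\<ge>N. \<forall>i. (LINT x|lebesgue. indicator K x * (norm (DQ a i P x - DQ b i P x))\<^sup>2) \<le> e"
proof -
  obtain \<psi> \<psi>' where \<psi>: "C1c Reg \<psi> \<psi>'" "\<And>x. 0 \<le> \<psi> x" "\<And>x. \<psi> x \<le> 1" "\<And>x. x \<in> K \<Longrightarrow> \<psi> x = 1"
    using C1c_cutoff[OF K(1) Reg(1) K(2)] by metis
  obtain L where L: "compact L" "L \<subseteq> Reg" "\<And>x. x \<notin> L \<Longrightarrow> \<psi> x = 0" "\<And>x. x \<notin> L \<Longrightarrow> \<psi>' x = 0"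
    using C1c_support[OF \<psi>(1)] by blast
  have \<psi>L: "C1c L \<psi> \<psi>'" using L \<psi>(1) by (intro C1cI[of _ _ L]) (auto dest: C1cD)
  have \<psi>1: "(\<psi> x)\<^sup>2 \<le> 1" for x using \<psi>(2,3) by (simp add: power_le_one)
  define I where "I a i = (LINT x|lebesgue. (\<psi> x)\<^sup>2 * (norm (DQ a i P x))\<^sup>2)" for a i
  define D where "D = (LINT x|lebesgue. (norm (\<psi>' x))\<^sup>2)"
  obtain c C where cC: "c > 0" "C > 0"
    "\<And>\<kappa> \<eta>. 0 < \<kappa> \<Longrightarrow> \<kappa> \<le> 1 \<Longrightarrow> 0 < \<eta> \<Longrightarrow> \<exists>N. \<forall>a\<ge>N. \<forall>b\<ge>N. \<forall>i s d. (s = 0 \<or> s = 1) \<longrightarrow>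
      (\<forall>x. norm (DQ a i u x - s *\<^sub>R DQ b i u x) \<le> d) \<longrightarrow>
      c * (LINT x|lebesgue. (\<psi> x)\<^sup>2 * (norm (DQ a i P x - s *\<^sub>R DQ b i P x))\<^sup>2) \<le>
      (2 * \<kappa> + \<eta>) * (I a i + s * I b i) + (2 * C\<^sup>2 / \<eta>) * d\<^sup>2 * D + (1 + s) * (1 * d * \<Gamma>)"
    by (rule energy[OF L(1,2) \<psi>L \<psi>1, folded I_def D_def], rule that)
  obtain M where M: "M > 0" "\<And>n i x. norm (DQ n i u x) \<le> M" using DQu_bounded by metis
  have D0: "D \<ge> 0" unfolding D_def by (intro integral_nonneg_AE) auto
  \<comment> \<open>With \<eta> = c/4 and \<kappa> \<le> c/8 the factor 2 \<kappa> + \<eta> is at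
    most c/2, so half of the left side is absorbed and \<open>(c / 2) * I a i \<le> R\<close>
    remains.\<close>
  define R where "R = (2 * C\<^sup>2 / (c / 4)) * M\<^sup>2 * D + M * \<Gamma>"
  define J where "J = (2 / c) * R"
  have J0: "J \<ge> 0" unfolding J_def R_def using cC D0 M \<Gamma> by simp
  have "0 < min 1 (c / 8)" "min 1 (c / 8) \<le> 1" "0 < c / 4" using cC by auto
  from cC(3)[OF this] obtain N1 where N1: "\<And>a i s d. a \<ge> N1 \<Longrightarrow> s = 0 \<or> s = 1 \<Longrightarrow> (\<And>x. norm (DQ a i u x - s *\<^sub>R DQ a i u x) \<le> d) \<Longrightarrow>
      c * (LINT x|lebesgue. (\<psi> x)\<^sup>2 * (norm (DQ a i P x - s *\<^sub>R DQ a i P x))\<^sup>2) \<le>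
      (2 * min 1 (c / 8) + c / 4) * (I a i + s * I a i) + (2 * C\<^sup>2 / (c / 4)) * d\<^sup>2 * D + (1 + s) * (1 * d * \<Gamma>)"
    by blast
  have I0: "I a i \<ge> 0" for a i unfolding I_def by (intro integral_nonneg_AE) auto
  have IJ: "I a i \<le> J" if "a \<ge> N1" for a i
  proof -
    have "c * I a i \<le> (2 * min 1 (c / 8) + c / 4) * I a i + R"
      using N1[OF that, of 0 i M] M(2) by (simp add: I_def[symmetric] R_def)
    also have "(2 * min 1 (c / 8) + c / 4) * I a i \<le> (c / 2) * I a i" 
      using I0 by (intro mult_right_mono) auto
    finally have "(c / 2) * I a i \<le> R" by simp
    then have "(2 / c) * ((c / 2) * I a i) \<le> J" unfolding J_def using cC(1) by (intro mult_left_mono) auto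
    then show ?thesis using cC(1) by simp
  qed
  \<comment> \<open>Since 2 \<kappa> \<le> \<eta>, the energy term is at most (2 \<eta>)(2 J) \<le>
    4 \<eta> (J + 1) = c e / 3, within its share c e / 2. The summand 1 keeps the denominator
    positive.\<close>
  define \<eta> where "\<eta> = c * e / (12 * (J + 1))"
  have \<eta>: "\<eta> > 0" using cC e J0 by (simp add: \<eta>_def)
  define \<kappa> where "\<kappa> = min 1 (\<eta> / 2)"
  have \<kappa>: "\<kappa> > 0" "\<kappa> \<le> 1" "2 * \<kappa> \<le> \<eta>" using \<eta> by (auto simp: \<kappa>_def)
  obtain N2 where N2: "\<And>a b i s d. a \<ge> N2 \<Longrightarrow> b \<ge> N2 \<Longrightarrow> s = 0 \<or> s = 1 \<Longrightarrow> (\<And>x. norm (DQ a i u x - s *\<^sub>R DQ b i u x) \<le> d) \<Longrightarrow>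
      c * (LINT x|lebesgue. (\<psi> x)\<^sup>2 * (norm (DQ a i P x - s *\<^sub>R DQ b i P x))\<^sup>2) \<le>
      (2 * \<kappa> + \<eta>) * (I a i + s * I b i) + (2 * C\<^sup>2 / \<eta>) * d\<^sup>2 * D + (1 + s) * (1 * d * \<Gamma>)"
    using cC(3)[OF \<kappa>(1,2) \<eta>] by blast
  define Q where "Q = (2 * C\<^sup>2 / \<eta>) * D + 2 * \<Gamma> + 1"
  have Q: "Q > 0" unfolding Q_def using \<eta> D0 \<Gamma> by (simp add: add_nonneg_pos)
  \<comment> \<open>As d \<le> 1, the quadratic term in \<open>d\<close> is dominated by a linear
    one; together the remaining terms are at most d Q \<le> c e / 2.\<close>
  define d where "d = min 1 (c * e / (2 * Q))"
  have d: "d > 0" "d \<le> 1" using cC e Q by (auto simp: d_def)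
  obtain N3 where N3: "\<And>n i x. n \<ge> N3 \<Longrightarrow> norm (DQ n i u x - column i (P x)) \<le> d / 2"
    using DQu_conv[of "d / 2"] d(1) by auto
  have "(LINT x|lebesgue. indicator K x * (norm (DQ a i P x - DQ b i P x))\<^sup>2) \<le> e"
    if ab: "a \<ge> max N1 (max N2 N3)" "b \<ge> max N1 (max N2 N3)" for a b i
  proof -
    have dd: "norm (DQ a i u x - DQ b i u x) \<le> d" for x
      using N3[of a i x] N3[of b i x] ab norm_triangle_ineq4[of "DQ a i u x - column i (P x)" "DQ b i u x - column i (P x)"]
      by simp
    have "c * (LINT x|lebesgue. (\<psi> x)\<^sup>2 * (norm (DQ a i P x - DQ b i P x))\<^sup>2) \<le>
      (2 * \<kappa> + \<eta>) * (I a i + I b i) + (2 * C\<^sup>2 / \<eta>) * d\<^sup>2 * D + 2 * (d * \<Gamma>)"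
      using N2[of a b 1 i d] dd ab by simp
    also have "(2 * \<kappa> + \<eta>) * (I a i + I b i) \<le> (\<eta> + \<eta>) * (J + J)"
      using IJ[of a i] IJ[of b i] ab I0[of a i] I0[of b i] \<kappa> \<eta> by (intro mult_mono add_mono) auto
    also have "\<dots> \<le> c * e / 2"
    proof -
      have "(\<eta> + \<eta>) * (J + J) \<le> 4 * (\<eta> * (J + 1))" using \<eta> by (simp add: algebra_simps)
      also have "\<eta> * (J + 1) = c * e / 12"
      proof -
        have "c * e / (12 * j) * j = c * e / 12" if "j \<noteq> 0" for j :: real using that by simp
        from this[of "J + 1"] show ?thesis unfolding \<eta>_def using J0 by linarith
      qed
      also have "4 * (c * e / 12) \<le> c * e / 2" using cC e by simp
      finally show ?thesis .
    qed
    also have "(2 * C\<^sup>2 / \<eta>) * d\<^sup>2 * D \<le> (2 * C\<^sup>2 / \<eta>) * d * D"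
      using d \<eta> D0 by (intro mult_right_mono mult_left_mono) (auto simp: power2_eq_square mult_le_cancel_left1)
    finally have "c * (LINT x|lebesgue. (\<psi> x)\<^sup>2 * (norm (DQ a i P x - DQ b i P x))\<^sup>2) \<le> c * e / 2 + d * ((2 * C\<^sup>2 / \<eta>) * D + 2 * \<Gamma>)"
      by (simp add: algebra_simps)
    also have "d * ((2 * C\<^sup>2 / \<eta>) * D + 2 * \<Gamma>) \<le> d * Q" using d by (intro mult_left_mono) (auto simp: Q_def)
    also have "\<dots> \<le> c * e / (2 * Q) * Q" using Q by (intro mult_right_mono) (auto simp: d_def)
    also have "\<dots> = c * e / 2" using Q by simp
    finally have "(LINT x|lebesgue. (\<psi> x)\<^sup>2 * (norm (DQ a i P x - DQ b i P x))\<^sup>2) \<le> e" using cC(1) by simp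
    moreover have "(LINT x|lebesgue. indicator K x * (norm (DQ a i P x - DQ b i P x))\<^sup>2) \<le> 
       (LINT x|lebesgue. (\<psi> x)\<^sup>2 * (norm (DQ a i P x - DQ b i P x))\<^sup>2)"
    proof (rule integral_mono)
      show "integrable lebesgue (\<lambda>x. indicator K x * (norm (DQ a i P x - DQ b i P x))\<^sup>2)"
        by (intro integrable_indicator_continuous K continuous_intros continuous_on_DQ cP)
      show "integrable lebesgue (\<lambda>x. (\<psi> x)\<^sup>2 * (norm (DQ a i P x - DQ b i P x))\<^sup>2)"
        by (rule integrable_lebesgue_cc[OF _ L(1)]) (use L(3) in \<open>auto intro!: continuous_intros continuous_on_DQ cP C1cD(3)[OF \<psi>L]\<close>)
      show "indicator K x * (norm (DQ a i P x - DQ b i P x))\<^sup>2 \<le> (\<psi> x)\<^sup>2 * (norm (DQ a i P x - DQ b i P x))\<^sup>2" for x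
        using \<psi>(4)[of x] by (cases "x \<in> K") auto
    qed
    ultimately show ?thesis by linarith
  qed
  then show ?thesis by blast
qed

text \<open>All directions are collected in one array so that a single subsequence serves all of
  them.\<close>

definition X :: "nat \<Rightarrow> real ^ 'n \<Rightarrow> real ^ 'n ^ 'm ^ 'n" where
  "X n x = (\<chi> i. DQ n i P x)"

lemma cX: "continuous_on UNIV (X n)"
  unfolding X_def by (intro continuous_on_vec_lambda continuous_on_DQ cP)

lemma norm2_vec: "(norm (x :: 'a::euclidean_space ^ 'b::finite))\<^sup>2 = (\<Sum>i\<in>UNIV. (norm (x $ i))\<^sup>2)"
  by (simp add: norm_vec_def L2_set_def sum_nonneg)

lemma X_cauchy:
  assumes K: "compact K" "K \<subseteq> Reg" and e: "e > 0"
  shows "\<exists>N. \<forall>a\<ge>N. \<forall>b\<ge>N. (LINT x|lebesgue. indicator K x * (norm (X a x - X b x))\<^sup>2) \<le> e"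
proof -
  have "e / CARD('n) > 0" using e by simp
  then obtain N where N: "\<And>a b i. a \<ge> N \<Longrightarrow> b \<ge> N \<Longrightarrow> (LINT x|lebesgue. indicator K x * (norm (DQ a i P x - DQ b i P x))\<^sup>2) \<le> e / CARD('n)"
    using DQ_cauchy[OF K] by blast
  have "(LINT x|lebesgue. indicator K x * (norm (X a x - X b x))\<^sup>2) \<le> e" if "a \<ge> N" "b \<ge> N" for a b
  proof -
    have "(LINT x|lebesgue. indicator K x * (norm (X a x - X b x))\<^sup>2) 
        = (LINT x|lebesgue. (\<Sum>i\<in>UNIV. indicator K x * (norm (DQ a i P x - DQ b i P x))\<^sup>2))"
      by (simp add: norm2_vec X_def sum_distrib_left)
    also have "\<dots> = (\<Sum>i\<in>UNIV. LINT x|lebesgue. indicator K x * (norm (DQ a i P x - DQ b i P x))\<^sup>2)"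
      by (intro Bochner_Integration.integral_sum integrable_indicator_continuous K continuous_intros continuous_on_DQ cP)
    also have "\<dots> \<le> (\<Sum>i\<in>(UNIV :: 'n set). e / CARD('n))" using N that by (intro sum_mono) auto
    also have "\<dots> = e" by simp
    finally show ?thesis .
  qed
  then show ?thesis by blast
qed

end

section \<open>Second derivatives on the regular set\<close>

lemma integral_DQ_zero:
  fixes f :: "real ^ 'n::finite \<Rightarrow> real"
  assumes c: "continuous_on UNIV f" and K: "compact K" "\<And>x. x \<notin> K \<Longrightarrow> f x = 0"
  shows "(LINT x|lebesgue. DQ n i f x) = 0"
proof -
  have i: "integrable lebesgue f" by (rule integrable_lebesgue_cc[OF c K])
  show ?thesis
    unfolding DQ_def using i integrable_lebesgue_translate[OF c i]
    by (simp add: integral_lebesgue_translate[OF c] del: of_nat_Suc)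
qed

text \<open>Discrete integration by parts: the quotient of the product \<open>w x * \<eta> x\<close>
  has integral zero, and the discrete product rule throws the quotient on \<eta> at the price of a
  shift in \<open>w\<close>, which disappears in the limit by continuity.\<close>

lemma integral_DQ_limit:
  fixes w \<eta> :: "real ^ 'n::finite \<Rightarrow> real"
  assumes w: "continuous_on UNIV w" "\<And>x. \<bar>w x\<bar> \<le> M" and e: "C1c S \<eta> \<eta>'"
  shows "(\<lambda>n. LINT x|lebesgue. DQ n i w x * \<eta> x) \<longlonglongrightarrow> - (LINT x|lebesgue. w x * \<eta>' x $ i)"
proof -
  obtain K where K: "compact K" "K \<subseteq> S" "\<And>x. x \<notin> K \<Longrightarrow> \<eta> x = 0" "\<And>x. x \<notin> K \<Longrightarrow> \<eta>' x = 0"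
    using C1c_support[OF e] by blast
  obtain B where B: "B > 0" "\<And>x. norm (\<eta>' x) \<le> B" using C1c_bounded[OF e] by metis
  define L where "L = {x + y |x y. x \<in> K \<and> y \<in> cball 0 (1::real)}"
  have L: "compact L" unfolding L_def by (rule compact_thicken[OF K(1)])
  note c = C1cD(3)[OF e] C1cD(2)[OF e] w(1)
  define h where "h n = (1 / real (Suc n)) *\<^sub>R (axis i 1 :: real ^ 'n)" for n
  have h0: "(\<lambda>n. h n + x) \<longlonglongrightarrow> x" for x
    using tendsto_add[OF tendsto_scaleR[OF tendsto_inverse_Suc tendsto_const[of "axis i 1"]] tendsto_const[of x]]
    by (simp add: h_def)
  have ch: "continuous_on UNIV (\<lambda>x. w (h n + x))" for n
    by (intro continuous_on_compose2[OF w(1)] continuous_intros) auto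
  have eq: "(LINT x|lebesgue. DQ n i w x * \<eta> x) = - (LINT x|lebesgue. w (h n + x) * DQ n i \<eta> x)" for n
  proof -
    have "DQ n i (\<lambda>x. w x * \<eta> x) x = DQ n i w x * \<eta> x + w (h n + x) * DQ n i \<eta> x" for x
      by (simp add: DQ_def h_def algebra_simps del: of_nat_Suc)
    moreover have "(LINT x|lebesgue. DQ n i (\<lambda>x. w x * \<eta> x) x) = 0"
      by (rule integral_DQ_zero[OF _ K(1)]) (auto intro!: continuous_intros c simp: K(3))
    moreover have "integrable lebesgue (\<lambda>x. DQ n i w x * \<eta> x)"
      by (rule integrable_lebesgue_cc[OF _ K(1)]) (auto intro!: continuous_intros c continuous_on_DQ simp: K(3))
    moreover have "integrable lebesgue (\<lambda>x. w (h n + x) * DQ n i \<eta> x)"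
      by (rule integrable_lebesgue_cc[OF _ L])
        (use DQ_outside[of K \<eta>, OF K(3)] in \<open>auto intro!: continuous_intros c ch continuous_on_DQ simp: L_def simp del: mem_cball\<close>)
    ultimately show ?thesis by simp
  qed
  have "(\<lambda>n. LINT x|lebesgue. w (h n + x) * DQ n i \<eta> x) \<longlonglongrightarrow> (LINT x|lebesgue. w x * \<eta>' x $ i)"
  proof (rule integral_dominated_convergence[where w="\<lambda>x. indicator L x * (M * B)"])
    show "(\<lambda>x. w x * \<eta>' x $ i) \<in> borel_measurable lebesgue"
      by (intro measurable_lebesgue_continuous continuous_intros c)
    show "(\<lambda>x. w (h n + x) * DQ n i \<eta> x) \<in> borel_measurable lebesgue" for n
      by (intro measurable_lebesgue_continuous continuous_intros c ch continuous_on_DQ)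
    show "integrable lebesgue (\<lambda>x. indicator L x * (M * B))"
      by (rule integrable_indicator_continuous[OF continuous_on_const L])
    show "AE x in lebesgue. (\<lambda>n. w (h n + x) * DQ n i \<eta> x) \<longlonglongrightarrow> w x * \<eta>' x $ i"
    proof (intro AE_I2 tendsto_mult)
      fix x
      show "(\<lambda>n. w (h n + x)) \<longlonglongrightarrow> w x"
        by (rule isCont_tendsto_compose[OF _ h0]) (use w(1) in \<open>simp add: continuous_on_eq_continuous_at\<close>)
      show "(\<lambda>n. DQ n i \<eta> x) \<longlonglongrightarrow> \<eta>' x $ i" using DQ_tendsto[OF C1cD(1)[OF e], of i] by (simp add: inner_axis)
    qed
    show "AE x in lebesgue. norm (w (h n + x) * DQ n i \<eta> x) \<le> indicator L x * (M * B)" for n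
    proof (rule AE_I2)
      fix x
      show "norm (w (h n + x) * DQ n i \<eta> x) \<le> indicator L x * (M * B)"
      proof (cases "x \<in> L")
        case True
        have "M \<ge> 0" using w(2)[of x] abs_ge_zero[of "w x"] by linarith
        with True show ?thesis
          using w(2)[of "h n + x"] C1c_DQ_bound[OF e B(2), of n i x] by (auto simp: abs_mult intro!: mult_mono)
      qed (use DQ_outside[of K \<eta>, OF K(3), folded L_def] in auto)
    qed
  qed
  then show ?thesis unfolding eq by (rule tendsto_minus)
qed

lemma integrable_indicator_of_square:
  fixes f :: "'a::euclidean_space \<Rightarrow> 'b::euclidean_space" and g :: "'a \<Rightarrow> real"
  assumes K: "compact K" and f: "f \<in> borel_measurable lebesgue" "integrable lebesgue (\<lambda>x. indicator K x * (norm (f x))\<^sup>2)"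
    and g: "g \<in> borel_measurable lebesgue" "\<And>x. \<bar>g x\<bar> \<le> norm (f x)"
  shows "integrable lebesgue (\<lambda>x. indicator K x * g x)"
proof (rule Bochner_Integration.integrable_bound[where f="\<lambda>x. indicator K x * 1 + indicator K x * (norm (f x))\<^sup>2"])
  show "integrable lebesgue (\<lambda>x. indicator K x * 1 + indicator K x * (norm (f x))\<^sup>2)"
    using integrable_indicator_continuous[OF continuous_on_const K] f(2) by (intro Bochner_Integration.integrable_add)
  show "(\<lambda>x. indicator K x * g x) \<in> borel_measurable lebesgue"
    by (intro borel_measurable_times borel_measurable_indicator compact_sets_lebesgue K g)
  show "AE x in lebesgue. norm (indicator K x * g x) \<le> norm (indicator K x * 1 + indicator K x * (norm (f x))\<^sup>2)"
  proof (rule AE_I2)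
    fix x
    have "norm (f x) \<le> 1 + (norm (f x))\<^sup>2"
      using zero_le_power2[of "norm (f x) - 1 / 2"] by (simp add: power2_eq_square algebra_simps)
    then show "norm (indicator K x * g x) \<le> norm (indicator K x * 1 + indicator K x * (norm (f x))\<^sup>2)"
      using g(2)[of x] by (auto simp: indicator_def)
  qed
qed

text \<open>\<open>G x $ i\<close> is the limit of the quotients of \<open>P\<close> in direction i,
  so \<open>G x $ i $ l $ j\<close> stands for the derivative in directions i and j of the l-th
  component of u. Its values are meaningful on \<open>Reg\<close> only. Each compact part of
  \<open>Reg\<close> comes with its own majorant \<open>H\<close>, but the subsequence
  \<open>r\<close> is common to all.\<close>

locale flux_limit = flux_core p W Ku u P \<Gamma>
  for p :: real and W Ku :: "(real ^ 'n::finite) set" and u :: "real ^ 'n \<Rightarrow> real ^ 'm::finite" 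
    and P :: "real ^ 'n \<Rightarrow> real ^ 'n ^ 'm" and \<Gamma> :: real +
  fixes r :: "nat \<Rightarrow> nat" and G :: "real ^ 'n \<Rightarrow> real ^ 'n ^ 'm ^ 'n"
  assumes r: "strict_mono r" and Gm: "G \<in> borel_measurable lebesgue"
    and Glim: "\<And>K. compact K \<Longrightarrow> K \<subseteq> Reg \<Longrightarrow> \<exists>H k0. H \<in> borel_measurable lebesgue \<and> integrable lebesgue (\<lambda>x. indicator K x * (H x)\<^sup>2) \<and>
       (AE x in lebesgue. x \<in> K \<longrightarrow> (\<lambda>k. X (r k) x) \<longlonglongrightarrow> G x \<and> (\<forall>k\<ge>k0. norm (X (r k) x) \<le> H x))"

lemma (in flux_core) flux_limit_exists: "\<exists>r G. flux_limit p W Ku u P \<Gamma> r G"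
proof -
  obtain r G where *: "strict_mono (r :: nat \<Rightarrow> nat)" "G \<in> borel_measurable lebesgue"
    "\<And>K. compact K \<Longrightarrow> K \<subseteq> Reg \<Longrightarrow> \<exists>H k0. H \<in> borel_measurable lebesgue \<and> integrable lebesgue (\<lambda>x. indicator K x * (H x)\<^sup>2) \<and>
       (AE x in lebesgue. x \<in> K \<longrightarrow> (\<lambda>k. X (r k) x) \<longlonglongrightarrow> G x \<and> (\<forall>k\<ge>k0. norm (X (r k) x) \<le> H x))"
    by (rule L2_local_limit[OF Reg(1) cX X_cauchy], assumption+, rule that)
  have "flux_limit p W Ku u P \<Gamma> r G" by unfold_locales (use * in auto)
  then show ?thesis by blast
qed

context flux_limit
begin

lemma G_limit:
  assumes K: "compact K" "K \<subseteq> Reg"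
  obtains H k0 where "H \<in> borel_measurable lebesgue" "\<And>x. H x \<ge> 0" "integrable lebesgue (\<lambda>x. indicator K x * (H x)\<^sup>2)"
    "AE x in lebesgue. x \<in> K \<longrightarrow> (\<forall>i. (\<lambda>k. DQ (r k) i P x) \<longlonglongrightarrow> G x $ i) \<and> (\<forall>k\<ge>k0. \<forall>i. norm (DQ (r k) i P x) \<le> H x) \<and> norm (G x) \<le> H x"
proof -
  obtain H k0 where H: "H \<in> borel_measurable lebesgue" "integrable lebesgue (\<lambda>x. indicator K x * (H x)\<^sup>2)"
       "AE x in lebesgue. x \<in> K \<longrightarrow> (\<lambda>k. X (r k) x) \<longlonglongrightarrow> G x \<and> (\<forall>k\<ge>k0. norm (X (r k) x) \<le> H x)"
    using Glim[OF K] by blast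
  show ?thesis
  proof (rule that[of "\<lambda>x. \<bar>H x\<bar>" k0])
    show "AE x in lebesgue. x \<in> K \<longrightarrow> (\<forall>i. (\<lambda>k. DQ (r k) i P x) \<longlonglongrightarrow> G x $ i) \<and> (\<forall>k\<ge>k0. \<forall>i. norm (DQ (r k) i P x) \<le> \<bar>H x\<bar>) \<and> norm (G x) \<le> \<bar>H x\<bar>"
      using H(3)
    proof eventually_elim
      case (elim x)
      show ?case
      proof (intro impI conjI allI)
        assume "x \<in> K"
        then have l: "(\<lambda>k. X (r k) x) \<longlonglongrightarrow> G x" and b: "\<And>k. k \<ge> k0 \<Longrightarrow> norm (X (r k) x) \<le> H x" using elim by auto
        show "(\<lambda>k. DQ (r k) i P x) \<longlonglongrightarrow> G x $ i" for i
          using tendsto_vec_nth[OF l, of i] by (simp add: X_def)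
        show "norm (DQ (r k) i P x) \<le> \<bar>H x\<bar>" if "k \<ge> k0" for k i
          using b[OF that] Finite_Cartesian_Product.norm_nth_le[of "X (r k) x" i] by (simp add: X_def)
        have "norm (G x) \<le> H x"
          by (rule LIMSEQ_le_const2[OF tendsto_norm[OF l]]) (use b in blast)
        then show "norm (G x) \<le> \<bar>H x\<bar>" by simp
      qed
    qed
  qed (use H in auto)
qed

lemma G_square_integrable:
  assumes K: "compact K" "K \<subseteq> Reg"
  shows "integrable lebesgue (\<lambda>x. indicator K x * (norm (G x))\<^sup>2)"
proof -
  obtain H k0 where H: "H \<in> borel_measurable lebesgue" "\<And>x. H x \<ge> 0" "integrable lebesgue (\<lambda>x. indicator K x * (H x)\<^sup>2)"
    "AE x in lebesgue. x \<in> K \<longrightarrow> (\<forall>i. (\<lambda>k. DQ (r k) i P x) \<longlonglongrightarrow> G x $ i) \<and> (\<forall>k\<ge>k0. \<forall>i. norm (DQ (r k) i P x) \<le> H x) \<and> norm (G x) \<le> H x"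
    by (rule G_limit[OF K], rule that)
  show ?thesis
  proof (rule Bochner_Integration.integrable_bound[OF H(3)])
    show "(\<lambda>x. indicator K x * (norm (G x))\<^sup>2) \<in> borel_measurable lebesgue"
      by (intro borel_measurable_times borel_measurable_indicator compact_sets_lebesgue K borel_measurable_power
          measurable_compose[OF Gm borel_measurable_norm])
    show "AE x in lebesgue. norm (indicator K x * (norm (G x))\<^sup>2) \<le> norm (indicator K x * (H x)\<^sup>2)"
      using H(4)
    proof eventually_elim
      case (elim x)
      then show ?case using H(2)[of x] power_mono[of "norm (G x)" "H x" 2] by (cases "x \<in> K") auto
    qed
  qed
qed

lemma G_component_measurable: "(\<lambda>x. G x $ i $ l $ j) \<in> borel_measurable lebesgue"
proof -
  have "(\<lambda>A :: real ^ 'n ^ 'm ^ 'n. A $ i $ l $ j) \<in> borel_measurable borel"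
    by (intro borel_measurable_continuous_onI continuous_intros)
  from measurable_compose[OF Gm this] show ?thesis .
qed

lemma abs_G_component: "\<bar>G x $ i $ l $ j\<bar> \<le> norm (G x)"
  using Finite_Cartesian_Product.norm_nth_le[of "G x" i] Finite_Cartesian_Product.norm_nth_le[of "G x $ i" l] Finite_Cartesian_Product.norm_nth_le[of "G x $ i $ l" j] by simp

lemma integral_G:
  assumes e: "C1c Reg \<eta> \<eta>'"
  shows "(\<lambda>k. LINT x|lebesgue. DQ (r k) i P x $ l $ j * \<eta> x) \<longlonglongrightarrow> (LINT x|lebesgue. G x $ i $ l $ j * \<eta> x)"
proof -
  obtain K where K: "compact K" "K \<subseteq> Reg" "\<And>x. x \<notin> K \<Longrightarrow> \<eta> x = 0" "\<And>x. x \<notin> K \<Longrightarrow> \<eta>' x = 0"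
    using C1c_support[OF e] by blast
  obtain B where B: "B > 0" "\<And>x. \<bar>\<eta> x\<bar> \<le> B" using C1c_bounded[OF e] by metis
  obtain H k0 where H: "H \<in> borel_measurable lebesgue" "\<And>x. H x \<ge> 0" "integrable lebesgue (\<lambda>x. indicator K x * (H x)\<^sup>2)"
    "AE x in lebesgue. x \<in> K \<longrightarrow> (\<forall>i. (\<lambda>k. DQ (r k) i P x) \<longlonglongrightarrow> G x $ i) \<and> (\<forall>k\<ge>k0. \<forall>i. norm (DQ (r k) i P x) \<le> H x) \<and> norm (G x) \<le> H x"
    by (rule G_limit[OF K(1,2)], rule that)
  have "integrable lebesgue (\<lambda>x. indicator K x * H x)"
    by (rule integrable_indicator_of_square[OF K(1) H(1)]) (use H in auto)
  have "(\<lambda>k. LINT x|lebesgue. DQ (r (k + k0)) i P x $ l $ j * \<eta> x) \<longlonglongrightarrow> (LINT x|lebesgue. G x $ i $ l $ j * \<eta> x)"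
  proof (rule integral_dominated_convergence[where w="\<lambda>x. B * (indicator K x * H x)"])
    show "(\<lambda>x. G x $ i $ l $ j * \<eta> x) \<in> borel_measurable lebesgue"
      using C1c_borel(1)[OF e] G_component_measurable by (intro borel_measurable_times)
    show "(\<lambda>x. DQ (r (k + k0)) i P x $ l $ j * \<eta> x) \<in> borel_measurable lebesgue" for k
      by (intro measurable_lebesgue_continuous continuous_intros continuous_on_DQ cP C1cD(3)[OF e])
    show "integrable lebesgue (\<lambda>x. B * (indicator K x * H x))" using \<open>integrable lebesgue (\<lambda>x. indicator K x * H x)\<close> by simp
    show "AE x in lebesgue. (\<lambda>k. DQ (r (k + k0)) i P x $ l $ j * \<eta> x) \<longlonglongrightarrow> G x $ i $ l $ j * \<eta> x"
      using H(4)
    proof eventually_elim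
      case (elim x)
      show ?case
      proof (cases "x \<in> K")
        case True
        then have "(\<lambda>k. DQ (r k) i P x) \<longlonglongrightarrow> G x $ i" using elim by blast
        from LIMSEQ_ignore_initial_segment[OF this, of k0]
        show ?thesis by (intro tendsto_intros)
      qed (simp add: K(3))
    qed
    show "AE x in lebesgue. norm (DQ (r (k + k0)) i P x $ l $ j * \<eta> x) \<le> B * (indicator K x * H x)" for k
      using H(4)
    proof eventually_elim
      case (elim x)
      show ?case
      proof (cases "x \<in> K")
        case True
        then have "norm (DQ (r (k + k0)) i P x) \<le> H x" using elim by simp
        then have "\<bar>DQ (r (k + k0)) i P x $ l $ j\<bar> \<le> H x"
          using Finite_Cartesian_Product.norm_nth_le[of "DQ (r (k + k0)) i P x" l] Finite_Cartesian_Product.norm_nth_le[of "DQ (r (k + k0)) i P x $ l" j] by simp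
        then show ?thesis using True B(2)[of x] H(2)[of x] B(1) by (simp add: abs_mult mult.commute[of B] mult_mono)
      qed (simp add: K(3))
    qed
  qed
  then show ?thesis by (rule LIMSEQ_offset)
qed

text \<open>The same integral is computed in two ways. Discrete integration by parts in direction i
  leaves the entry (l, j) of \<open>P\<close> against the i-th derivative of \<eta>. On the other
  hand the quotient of \<open>P\<close> is a classical derivative of the quotient of u, and
  integrating that by parts leaves the entry (l, i) against the j-th derivative. Exchanging i and j
  and applying the fundamental lemma gives the symmetry.\<close>

lemma G_symmetric: "AE x in lebesgue. x \<in> Reg \<longrightarrow> (\<forall>i l j. G x $ i $ l $ j = G x $ j $ l $ i)"
proof -
  have weak: "(LINT x|lebesgue. G x $ i $ l $ j * \<eta> x) = - (LINT x|lebesgue. P x $ l $ j * \<eta>' x $ i)"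
     "(LINT x|lebesgue. G x $ i $ l $ j * \<eta> x) = - (LINT x|lebesgue. P x $ l $ i * \<eta>' x $ j)" if e: "C1c Reg \<eta> \<eta>'" for \<eta> \<eta>' i l j
  proof -
    obtain M where M: "M > 0" "\<And>x. norm (P x) \<le> M" using P_bounded by metis
    obtain K where K: "compact K" "K \<subseteq> Reg" "\<And>x. x \<notin> K \<Longrightarrow> \<eta> x = 0" "\<And>x. x \<notin> K \<Longrightarrow> \<eta>' x = 0"
      using C1c_support[OF e] by blast
    have Pc: "\<bar>P x $ l $ j\<bar> \<le> M" for x l j
      using M(2)[of x] Finite_Cartesian_Product.norm_nth_le[of "P x" l] Finite_Cartesian_Product.norm_nth_le[of "P x $ l" j] by simp
    have cPc: "continuous_on UNIV (\<lambda>x. P x $ l $ j)" for l j by (intro continuous_intros cP)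
    have eq: "DQ n i P x $ l $ j = DQ n i (\<lambda>x. P x $ l $ j) x" for n x by (simp add: DQ_def)
    have "(\<lambda>k. LINT x|lebesgue. DQ (r k) i P x $ l $ j * \<eta> x) \<longlonglongrightarrow> - (LINT x|lebesgue. P x $ l $ j * \<eta>' x $ i)"
      unfolding eq using LIMSEQ_subseq_LIMSEQ[OF integral_DQ_limit[OF cPc Pc e] r] by (simp add: o_def)
    with integral_G[OF e] show "(LINT x|lebesgue. G x $ i $ l $ j * \<eta> x) = - (LINT x|lebesgue. P x $ l $ j * \<eta>' x $ i)"
      by (rule LIMSEQ_unique)
    have cU: "continuous_on UNIV u" using du by (meson continuous_at_imp_continuous_on has_derivative_continuous)
    have ibp: "(LINT x|lebesgue. DQ n i P x $ l $ j * \<eta> x) = - (LINT x|lebesgue. DQ n i u x $ l * \<eta>' x $ j)" for n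
      using integral_by_parts_C1c[OF C1c_mono[OF e subset_UNIV] open_UNIV has_derivative_matrix_row[OF has_derivative_DQ[OF du]]
          continuous_on_component[OF continuous_on_DQ[OF cP]], of n i l j] by simp
    obtain MU where MU: "MU > 0" "\<And>n i x. norm (DQ n i u x) \<le> MU" using DQu_bounded by metis
    obtain B where B: "B > 0" "\<And>x. norm (\<eta>' x) \<le> B" using C1c_bounded[OF e] by metis
    have "(\<lambda>n. LINT x|lebesgue. DQ n i u x $ l * \<eta>' x $ j) \<longlonglongrightarrow> (LINT x|lebesgue. P x $ l $ i * \<eta>' x $ j)"
    proof (rule integral_dominated_convergence[where w="\<lambda>x. indicator K x * (MU * B)"])
      show "(\<lambda>x. P x $ l $ i * \<eta>' x $ j) \<in> borel_measurable lebesgue"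
        by (intro measurable_lebesgue_continuous continuous_intros cP C1cD(2)[OF e])
      show "(\<lambda>x. DQ n i u x $ l * \<eta>' x $ j) \<in> borel_measurable lebesgue" for n
        by (intro measurable_lebesgue_continuous continuous_intros continuous_on_DQ cU C1cD(2)[OF e])
      show "integrable lebesgue (\<lambda>x. indicator K x * (MU * B))"
        by (rule integrable_indicator_continuous[OF continuous_on_const K(1)])
      show "AE x in lebesgue. (\<lambda>n. DQ n i u x $ l * \<eta>' x $ j) \<longlonglongrightarrow> P x $ l $ i * \<eta>' x $ j"
      proof (intro AE_I2 tendsto_mult tendsto_const)
        fix x show "(\<lambda>n. DQ n i u x $ l) \<longlonglongrightarrow> P x $ l $ i"
          using tendsto_vec_nth[OF DQ_tendsto[OF du], of i x l] by (simp add: column_matrix_axis column_def)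
      qed
      show "AE x in lebesgue. norm (DQ n i u x $ l * \<eta>' x $ j) \<le> indicator K x * (MU * B)" for n
      proof (rule AE_I2)
        fix x show "norm (DQ n i u x $ l * \<eta>' x $ j) \<le> indicator K x * (MU * B)"
          using MU(2)[of n i x] Finite_Cartesian_Product.norm_nth_le[of "DQ n i u x" l] B(2)[of x] Finite_Cartesian_Product.norm_nth_le[of "\<eta>' x" j] MU(1) K(4)[of x]
          by (cases "x \<in> K") (auto simp: abs_mult intro!: mult_mono)
      qed
    qed
    from tendsto_minus[OF LIMSEQ_subseq_LIMSEQ[OF this r]]
    have "(\<lambda>k. LINT x|lebesgue. DQ (r k) i P x $ l $ j * \<eta> x) \<longlonglongrightarrow> - (LINT x|lebesgue. P x $ l $ i * \<eta>' x $ j)"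
      by (simp add: ibp o_def)
    with integral_G[OF e] show "(LINT x|lebesgue. G x $ i $ l $ j * \<eta> x) = - (LINT x|lebesgue. P x $ l $ i * \<eta>' x $ j)"
      by (rule LIMSEQ_unique)
  qed
  have loc: "integrable lebesgue (\<lambda>x. indicator K x * G x $ i $ l $ j)" if "compact K" "K \<subseteq> Reg" for K i l j
    by (rule integrable_indicator_of_square[OF that(1) Gm G_square_integrable[OF that] G_component_measurable abs_G_component])
  have "AE x in lebesgue. x \<in> Reg \<longrightarrow> G x $ i $ l $ j - G x $ j $ l $ i = 0" for i l j
  proof (rule fundamental_lemma_C1c[OF Reg(1)])
    show "integrable lebesgue (\<lambda>x. indicator K x * (G x $ i $ l $ j - G x $ j $ l $ i))" if "compact K" "K \<subseteq> Reg" for K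
      using loc[OF that] by (simp add: right_diff_distrib)
    fix \<eta> \<eta>' assume e: "C1c Reg \<eta> \<eta>'"
    have li: "(\<lambda>x. G x $ i $ l $ j) \<in> locally_integrable Reg" for i l j
      by (intro locally_integrableI loc)
    show "(LINT x|lebesgue. (G x $ i $ l $ j - G x $ j $ l $ i) * \<eta> x) = 0"
      using integrable_mult_C1c(1)[OF li e] weak(1)[OF e, of i l j] weak(2)[OF e, of j l i] by (simp add: left_diff_distrib)
  qed
  then have "AE x in lebesgue. \<forall>i l j. x \<in> Reg \<longrightarrow> G x $ i $ l $ j - G x $ j $ l $ i = 0"
    by (intro AE_all_countable[THEN iffD2] allI)
  then show ?thesis by eventually_elim auto
qed

end

lemma norm_le_sum_columns: "norm M \<le> (\<Sum>j\<in>UNIV. norm (column j M))" for M :: "real ^ 'n::finite ^ 'm::finite"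
proof -
  have sq: "(norm y)\<^sup>2 = (\<Sum>i\<in>UNIV. (y $ i)\<^sup>2)" for y :: "real ^ 'k::finite"
    by (simp add: norm_vec_def L2_set_def sum_nonneg)
  have "norm M = sqrt (\<Sum>l\<in>UNIV. (norm (M $ l))\<^sup>2)" by (simp add: norm_vec_def[of M] L2_set_def)
  also have "(\<Sum>l\<in>UNIV. (norm (M $ l))\<^sup>2) = (\<Sum>l\<in>UNIV. \<Sum>j\<in>UNIV. (M $ l $ j)\<^sup>2)" by (simp add: sq)
  also have "\<dots> = (\<Sum>j\<in>UNIV. (norm (column j M))\<^sup>2)" by (subst sum.swap) (simp add: sq column_def)
  also have "sqrt \<dots> = L2_set (\<lambda>j. norm (column j M)) UNIV" by (simp add: L2_set_def)
  also have "\<dots> \<le> (\<Sum>j\<in>UNIV. norm (column j M))" by (rule L2_set_le_sum) simp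
  finally show ?thesis .
qed

section \<open>The weighted estimate\<close>

text \<open>The sum is the integrand of the differentiated equation tested with \<open>\<psi>\<^sup>2 \<gamma> \<partial>\<^sub>i u\<close>, where
  \<open>\<gamma>\<close> is a radial function of \<open>P\<close> and \<open>slope = |P| \<gamma>'\<close>. Symmetry of \<open>G\<close> turns the term with \<open>\<gamma>'\<close> into
  a quadratic form in the gradient of \<open>|P|\<close>.\<close>

lemma structure_inequality:
  fixes P :: "real ^ 'n::finite ^ 'm::finite" and G :: "real ^ 'n ^ 'm ^ 'n" and \<xi> :: "real ^ 'n"
  assumes P: "P \<noteq> 0" and p: "p > 1" and \<alpha>: "0 \<le> \<alpha>" "\<alpha> < 1" "\<alpha> < p - 1"
    and sym: "\<And>i l j. G $ i $ l $ j = G $ j $ l $ i"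
    and \<gamma>: "\<gamma> \<ge> 0" and slope: "slope \<ge> - \<alpha> * \<gamma>"
    and c0: "c0 = min 1 (min ((p - 1) * (1 - \<alpha>)) (p - 1 - \<alpha>))"
  shows "norm P powr (p - 2) * ((c0 / 2) * \<psi>\<^sup>2 * \<gamma> * (norm G)\<^sup>2 - (2 / c0) * (1 + \<bar>p - 2\<bar>)\<^sup>2 * \<gamma> * (norm P)\<^sup>2 * (norm \<xi>)\<^sup>2)
    \<le> (\<Sum>i\<in>UNIV. dflux p P (G $ i) \<bullet> ((\<psi>\<^sup>2 * \<gamma>) *\<^sub>R G $ i + outer (column i P) 
          (\<psi>\<^sup>2 *\<^sub>R (\<chi> j. ((slope / (norm P)\<^sup>2) *\<^sub>R P) \<bullet> G $ j) + \<gamma> *\<^sub>R (2 * \<psi>) *\<^sub>R \<xi>)))"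
proof -
  define s where "s = norm P"
  define a where "a = s powr (p - 2)"
  \<comment> \<open>If \<open>G $ j\<close> is the j-th derivative of \<open>P\<close>, then
    \<sigma> is the gradient of |P|.\<close>
  define \<sigma> :: "real ^ 'n" where "\<sigma> = (\<chi> j. (P \<bullet> G $ j) / s)"
  define g where "g = (norm G)\<^sup>2"
  define v where "v = P *v \<sigma>"
  have s: "s > 0" using P by (simp add: s_def)
  have a: "a \<ge> 0" by (simp add: a_def)
  have a4: "s powr (p - 4) = a / s\<^sup>2"
    using norm_powr_minus_4[OF P, of p] s by (simp add: a_def s_def field_simps)
  have PG: "P \<bullet> G $ i = s * \<sigma> $ i" for i using s by (simp add: \<sigma>_def)
  have dfl: "dflux p P (G $ i) = a *\<^sub>R G $ i + ((p - 2) * a * \<sigma> $ i / s) *\<^sub>R P" for i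
    using s by (simp add: dflux_def a_def[symmetric] s_def[symmetric] a4 PG power2_eq_square)
  have c0pos: "c0 > 0" using c0 p \<alpha> by simp
  have gG: "(\<Sum>i\<in>UNIV. G $ i \<bullet> G $ i) = g"
    by (simp add: g_def power2_norm_eq_inner inner_vec_def[of G])
  have \<sigma>\<sigma>: "\<sigma> \<bullet> \<sigma> = (\<Sum>i\<in>UNIV. \<sigma> $ i * \<sigma> $ i)" by (simp add: inner_vec_def)
  have 1: "(\<Sum>i\<in>UNIV. dflux p P (G $ i) \<bullet> G $ i) = a * (g + (p - 2) * (\<sigma> \<bullet> \<sigma>))"
  proof -
    have "dflux p P (G $ i) \<bullet> G $ i = a * (G $ i \<bullet> G $ i) + (p - 2) * a * (\<sigma> $ i * \<sigma> $ i)" for i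
      using s by (simp add: dfl inner_add_left PG)
    then have "(\<Sum>i\<in>UNIV. dflux p P (G $ i) \<bullet> G $ i) = a * (\<Sum>i\<in>UNIV. G $ i \<bullet> G $ i) + (p - 2) * a * (\<Sum>i\<in>UNIV. \<sigma> $ i * \<sigma> $ i)"
      by (simp only: sum.distrib sum_distrib_left)
    then show ?thesis by (simp add: gG \<sigma>\<sigma> algebra_simps)
  qed
  have 2: "(\<Sum>i\<in>UNIV. dflux p P (G $ i) \<bullet> outer (column i P) b) = a * (s * (\<sigma> \<bullet> b) + (p - 2) / s * (v \<bullet> (P *v b)))" for b
  proof -
    \<comment> \<open>Symmetry enters here: it exchanges the direction of differentiation with the
      column index, so that contracting with the columns of \<open>P\<close> produces
      \<open>P \<bullet> G $ j\<close>.\<close>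
    have A: "(\<Sum>i\<in>UNIV. column i P \<bullet> (G $ i *v b)) = s * (\<sigma> \<bullet> b)"
    proof -
      have "(\<Sum>i\<in>UNIV. column i P \<bullet> (G $ i *v b)) = (\<Sum>i\<in>UNIV. \<Sum>l\<in>UNIV. \<Sum>j\<in>UNIV. P $ l $ i * (G $ i $ l $ j * b $ j))"
        by (simp add: inner_vec_def column_def matrix_vector_mult_def sum_distrib_left)
      also have "\<dots> = (\<Sum>i\<in>UNIV. \<Sum>l\<in>UNIV. \<Sum>j\<in>UNIV. P $ l $ i * (G $ j $ l $ i * b $ j))" 
        by (intro sum.cong refl) (simp add: sym[of _ _ ])
      also have "\<dots> = (\<Sum>i\<in>UNIV. \<Sum>j\<in>UNIV. \<Sum>l\<in>UNIV. P $ l $ i * (G $ j $ l $ i * b $ j))"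
        by (intro sum.cong refl sum.swap)
      also have "\<dots> = (\<Sum>j\<in>UNIV. \<Sum>i\<in>UNIV. \<Sum>l\<in>UNIV. P $ l $ i * (G $ j $ l $ i * b $ j))" by (rule sum.swap)
      also have "\<dots> = (\<Sum>j\<in>UNIV. \<Sum>l\<in>UNIV. \<Sum>i\<in>UNIV. P $ l $ i * (G $ j $ l $ i * b $ j))"
        by (intro sum.cong refl sum.swap)
      also have "\<dots> = (\<Sum>j\<in>UNIV. (P \<bullet> G $ j) * b $ j)"
        by (simp add: inner_vec_def sum_distrib_right mult.assoc)
      also have "\<dots> = s * (\<sigma> \<bullet> b)" by (simp add: PG inner_vec_def[of \<sigma>] sum_distrib_left mult.assoc)
      finally show ?thesis .
    qed
    have B: "(\<Sum>i\<in>UNIV. \<sigma> $ i *\<^sub>R column i P) = v"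
      by (simp add: v_def vec_eq_iff matrix_vector_mult_def column_def mult.commute)
    have "dflux p P (G $ i) \<bullet> outer (column i P) b 
        = a * (column i P \<bullet> (G $ i *v b)) + ((p - 2) * a / s) * ((\<sigma> $ i *\<^sub>R column i P) \<bullet> (P *v b))" for i
      by (simp add: inner_outer dfl matrix_vector_mult_add_rdistrib scaleR_matrix_vector_assoc[symmetric] inner_add_right)
    then have "(\<Sum>i\<in>UNIV. dflux p P (G $ i) \<bullet> outer (column i P) b) 
        = a * (\<Sum>i\<in>UNIV. column i P \<bullet> (G $ i *v b)) + ((p - 2) * a / s) * ((\<Sum>i\<in>UNIV. \<sigma> $ i *\<^sub>R column i P) \<bullet> (P *v b))"
      by (simp add: sum.distrib sum_distrib_left inner_sum_left)
    then show ?thesis unfolding A B by (simp add: algebra_simps)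
  qed
  define b where "b = (\<psi>\<^sup>2 * slope / s) *\<^sub>R \<sigma> + (2 * \<psi> * \<gamma>) *\<^sub>R \<xi>"
  have beq: "\<psi>\<^sup>2 *\<^sub>R (\<chi> j. ((slope / (norm P)\<^sup>2) *\<^sub>R P) \<bullet> G $ j) + \<gamma> *\<^sub>R (2 * \<psi>) *\<^sub>R \<xi> = b"
    using s by (simp add: b_def vec_eq_iff PG s_def[symmetric] power2_eq_square)
  define S2 where "S2 = \<sigma> \<bullet> \<sigma>"
  \<comment> \<open>The squared length of \<sigma> after application of \<open>P / norm P\<close>.
    It lies between 0 and \<open>S2\<close>; nothing more is known about it, so the estimate must
    hold for the whole range.\<close>
  define \<nu> where "\<nu> = (v \<bullet> v) / s\<^sup>2"
  define R where "R = s * (\<sigma> \<bullet> \<xi>) + (p - 2) / s * (v \<bullet> (P *v \<xi>))"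
  have T: "(\<Sum>i\<in>UNIV. dflux p P (G $ i) \<bullet> ((\<psi>\<^sup>2 * \<gamma>) *\<^sub>R G $ i + outer (column i P) b))
      = a * (\<psi>\<^sup>2 * \<gamma> * (g + (p - 2) * S2) + \<psi>\<^sup>2 * slope * (S2 + (p - 2) * \<nu>) + 2 * \<psi> * \<gamma> * R)"
  proof -
    have Z: "s * (\<sigma> \<bullet> b) + (p - 2) / s * (v \<bullet> (P *v b)) = \<psi>\<^sup>2 * slope * (S2 + (p - 2) * \<nu>) + 2 * \<psi> * \<gamma> * R"
      using s by (simp add: b_def R_def S2_def \<nu>_def inner_add_right matrix_vector_right_distrib matrix_vector_mult_scaleR
          v_def[symmetric] field_simps power2_eq_square)
    have "(\<Sum>i\<in>UNIV. dflux p P (G $ i) \<bullet> ((\<psi>\<^sup>2 * \<gamma>) *\<^sub>R G $ i + outer (column i P) b))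
      = \<psi>\<^sup>2 * \<gamma> * (\<Sum>i\<in>UNIV. dflux p P (G $ i) \<bullet> G $ i) + (\<Sum>i\<in>UNIV. dflux p P (G $ i) \<bullet> outer (column i P) b)"
      by (simp only: inner_add_right inner_scaleR_right sum.distrib sum_distrib_left)
    then show ?thesis unfolding 1 2 Z S2_def[symmetric] by (simp add: algebra_simps)
  qed
  have S0: "S2 \<ge> 0" by (simp add: S2_def)
  have Sg: "S2 \<le> g"
  proof -
    have "(s * \<sigma> $ i)\<^sup>2 \<le> s\<^sup>2 * (G $ i \<bullet> G $ i)" for i
      using Cauchy_Schwarz_ineq[of P "G $ i"] by (simp add: PG s_def power2_norm_eq_inner)
    then have "\<sigma> $ i * \<sigma> $ i \<le> G $ i \<bullet> G $ i" for i using s by (simp add: power_mult_distrib power2_eq_square)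
    then show ?thesis unfolding S2_def \<sigma>\<sigma> gG[symmetric] by (intro sum_mono)
  qed
  have \<nu>0: "\<nu> \<ge> 0" by (simp add: \<nu>_def)
  have \<nu>S: "\<nu> \<le> S2"
  proof -
    have "(norm v)\<^sup>2 \<le> (s * norm \<sigma>)\<^sup>2" unfolding v_def s_def by (intro power_mono norm_matrix_vector_le) auto
    then show ?thesis using s by (simp add: \<nu>_def S2_def power2_norm_eq_inner[symmetric] field_simps power_mult_distrib)
  qed
  \<comment> \<open>The sign is needed to insert the lower bound on \<open>slope\<close>. For p < 2
    it follows from \<nu> \<le> S2 and 2 - p \<le> 1.\<close>
  have q0: "S2 + (p - 2) * \<nu> \<ge> 0"
  proof (cases "p \<ge> 2")
    case False
    have "(2 - p) * \<nu> \<le> 1 * S2" using False p \<nu>0 \<nu>S by (intro mult_mono) auto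
    then show ?thesis by (simp add: algebra_simps)
  qed (use S0 \<nu>0 in simp)
  \<comment> \<open>The expression is affine in \<nu>. For p \<ge> 2 the worst case is \<nu> = S2,
    where the coefficient of \<open>S2\<close> is (p-1)(1-\<alpha>) - 1; for p < 2 it is \<nu> = 0,
    with coefficient p - 2 - \<alpha>. Since \<open>S2\<close> ranges from 0 to \<open>g\<close>, a
    coefficient k leaves min(1, 1+k) times \<open>g\<close>. These are the entries of
    \<open>c0\<close>.\<close>
  have e: "c0 * g \<le> g + (p - 2) * S2 - \<alpha> * (S2 + (p - 2) * \<nu>)"
  proof -
    have lin: "min 1 (1 + k) * g \<le> g + k * S2" for k
    proof (cases "k \<ge> 0")
      case False
      then have "k * g \<le> k * S2" using Sg by (intro mult_left_mono_neg) auto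
      then show ?thesis using False by (simp add: min_def algebra_simps)
    qed (use S0 in simp)
    have g0: "g \<ge> 0" by (simp add: g_def)
    show ?thesis
    proof (cases "p \<ge> 2")
      case True
      have "\<alpha> * ((p - 2) * \<nu>) \<le> \<alpha> * ((p - 2) * S2)" using True \<alpha> \<nu>S by (intro mult_left_mono) auto
      moreover have "c0 * g \<le> min 1 (1 + ((p - 1) * (1 - \<alpha>) - 1)) * g" using g0 by (intro mult_right_mono) (auto simp: c0)
      moreover note lin[of "(p - 1) * (1 - \<alpha>) - 1"]
      ultimately show ?thesis by (simp add: algebra_simps)
    next
      case False
      have "\<alpha> * ((p - 2) * \<nu>) \<le> 0" using False \<alpha> \<nu>0 by (intro mult_nonneg_nonpos mult_nonpos_nonneg) auto
      moreover have "c0 * g \<le> min 1 (1 + (p - 2 - \<alpha>)) * g" using g0 by (intro mult_right_mono) (auto simp: c0)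
      moreover note lin[of "p - 2 - \<alpha>"]
      ultimately show ?thesis by (simp add: algebra_simps)
    qed
  qed
  have I: "\<psi>\<^sup>2 * \<gamma> * (c0 * g) \<le> \<psi>\<^sup>2 * \<gamma> * (g + (p - 2) * S2) + \<psi>\<^sup>2 * slope * (S2 + (p - 2) * \<nu>)"
  proof -
    have "\<psi>\<^sup>2 * (- \<alpha> * \<gamma>) * (S2 + (p - 2) * \<nu>) \<le> \<psi>\<^sup>2 * slope * (S2 + (p - 2) * \<nu>)"
      using slope q0 by (intro mult_right_mono mult_left_mono) auto
    moreover have "\<psi>\<^sup>2 * \<gamma> * (c0 * g) \<le> \<psi>\<^sup>2 * \<gamma> * (g + (p - 2) * S2 - \<alpha> * (S2 + (p - 2) * \<nu>))"
      using e \<gamma> by (intro mult_left_mono) auto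
    ultimately show ?thesis by (simp add: algebra_simps)
  qed
  have RB: "\<bar>R\<bar> \<le> (1 + \<bar>p - 2\<bar>) * s * norm G * norm \<xi>"
  proof -
    have n\<sigma>: "norm \<sigma> \<le> norm G" using Sg by (simp add: S2_def g_def power2_norm_eq_inner[symmetric] abs_le_square_iff[symmetric])
    have "\<bar>v \<bullet> (P *v \<xi>)\<bar> \<le> norm v * norm (P *v \<xi>)" by (rule Cauchy_Schwarz_ineq2)
    also have "\<dots> \<le> (s * norm \<sigma>) * (s * norm \<xi>)"
      unfolding v_def s_def by (intro mult_mono norm_matrix_vector_le) auto
    finally have "\<bar>p - 2\<bar> / s * \<bar>v \<bullet> (P *v \<xi>)\<bar> \<le> \<bar>p - 2\<bar> / s * ((s * norm \<sigma>) * (s * norm \<xi>))"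
      using s by (intro mult_left_mono) auto
    also have "\<dots> = \<bar>p - 2\<bar> * (s * norm \<sigma> * norm \<xi>)" using s by simp
    finally have 1: "\<bar>(p - 2) / s * (v \<bullet> (P *v \<xi>))\<bar> \<le> \<bar>p - 2\<bar> * (s * norm \<sigma> * norm \<xi>)" using s by (simp add: abs_mult)
    have "\<bar>s * (\<sigma> \<bullet> \<xi>)\<bar> \<le> s * (norm \<sigma> * norm \<xi>)" using s Cauchy_Schwarz_ineq2[of \<sigma> \<xi>] by (simp add: abs_mult)
    with 1 have "\<bar>R\<bar> \<le> (1 + \<bar>p - 2\<bar>) * (s * norm \<sigma> * norm \<xi>)"
      unfolding R_def by (simp add: algebra_simps abs_triangle_ineq[THEN order_trans])
    also have "\<dots> \<le> (1 + \<bar>p - 2\<bar>) * (s * norm G * norm \<xi>)" using n\<sigma> s by (intro mult_left_mono mult_right_mono) auto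
    finally show ?thesis by (simp add: mult.assoc)
  qed
  \<comment> \<open>Young's inequality with parameter \<open>c0\<close> spends half of the coercive
    term on the gradient of the cutoff.\<close>
  have II: "- (2 * \<psi> * \<gamma> * R) \<le> \<gamma> * ((c0 / 2) * (\<psi>\<^sup>2 * g) + (2 / c0) * ((1 + \<bar>p - 2\<bar>)\<^sup>2 * s\<^sup>2 * (norm \<xi>)\<^sup>2))"
  proof -
    have "- (2 * \<psi> * \<gamma> * R) \<le> \<bar>2 * \<psi> * \<gamma> * R\<bar>" by simp
    also have "\<dots> = \<gamma> * (2 * \<bar>\<psi>\<bar> * \<bar>R\<bar>)" using \<gamma> by (simp add: abs_mult)
    also have "\<dots> \<le> \<gamma> * (2 * \<bar>\<psi>\<bar> * ((1 + \<bar>p - 2\<bar>) * s * norm G * norm \<xi>))" using RB \<gamma> by (intro mult_left_mono) auto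
    also have "2 * \<bar>\<psi>\<bar> * ((1 + \<bar>p - 2\<bar>) * s * norm G * norm \<xi>) = 2 * (\<bar>\<psi>\<bar> * norm G) * ((1 + \<bar>p - 2\<bar>) * s * norm \<xi>)" by simp
    also have "\<gamma> * \<dots> \<le> \<gamma> * ((c0 / 2) * (\<bar>\<psi>\<bar> * norm G)\<^sup>2 + (2 / c0) * ((1 + \<bar>p - 2\<bar>) * s * norm \<xi>)\<^sup>2)"
      by (intro mult_left_mono two_mult_le c0pos \<gamma>)
    finally show ?thesis by (simp add: power_mult_distrib g_def)
  qed
  have "(c0 / 2) * \<psi>\<^sup>2 * \<gamma> * g - (2 / c0) * (1 + \<bar>p - 2\<bar>)\<^sup>2 * \<gamma> * s\<^sup>2 * (norm \<xi>)\<^sup>2 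
     \<le> \<psi>\<^sup>2 * \<gamma> * (g + (p - 2) * S2) + \<psi>\<^sup>2 * slope * (S2 + (p - 2) * \<nu>) + 2 * \<psi> * \<gamma> * R"
    using I II by (simp add: algebra_simps)
  from mult_left_mono[OF this a] show ?thesis
    unfolding beq T by (simp only: a_def s_def g_def)
qed

section \<open>Weights composed with approximate gradients\<close>

context flux_limit
begin

text \<open>A C^1 substitute for \<open>P\<close>: its columns are the difference quotients of u,
  and the classical derivatives of these are quotients of \<open>P\<close>.\<close>

definition U :: "nat \<Rightarrow> real ^ 'n \<Rightarrow> real ^ 'n ^ 'm" where
  "U n x = (\<chi> l j. DQ n j u x $ l)"

text \<open>The j-th partial derivative of \<open>U n\<close>. The derivative produces the index j
  and the quotient the index k, the reverse of what happens in \<open>DQ n j P\<close>; in the limit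
  both agree by the symmetry of \<open>G\<close>.\<close>

definition dU :: "nat \<Rightarrow> 'n \<Rightarrow> real ^ 'n \<Rightarrow> real ^ 'n ^ 'm" where
  "dU n j x = (\<chi> l k. DQ n k P x $ l $ j)"

lemma column_U: "column j (U n x) = DQ n j u x"
  by (simp add: U_def column_def vec_eq_iff)

lemma has_derivative_U: "(U n has_derivative (\<lambda>v. \<chi> l k. DQ n k P x $ l \<bullet> v)) (at x)"
proof -
  have "U n x = (\<Sum>j\<in>UNIV. outer (DQ n j u x) (axis j 1))" for x
    by (simp add: U_def outer_def vec_eq_iff axis_def if_distrib cong: if_cong)
  then have "U n = (\<lambda>x. \<Sum>j\<in>UNIV. outer (DQ n j u x) (axis j 1))" by (rule ext)
  moreover have "((\<lambda>x. \<Sum>j\<in>UNIV. outer (DQ n j u x) (axis j 1)) has_derivative 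
      (\<lambda>v. \<Sum>j\<in>UNIV. outer (DQ n j P x *v v) (axis j 1))) (at x)"
    by (intro has_derivative_sum bounded_linear.has_derivative[OF bounded_bilinear.bounded_linear_left[OF bounded_bilinear_outer]]
        has_derivative_DQ du)
  moreover have "(\<lambda>v. \<Sum>j\<in>UNIV. outer (DQ n j P x *v v) (axis j 1)) = (\<lambda>v. \<chi> l k. DQ n k P x $ l \<bullet> v)"
    by (simp add: outer_def vec_eq_iff fun_eq_iff axis_def if_distrib matrix_vector_mul_component cong: if_cong)
  ultimately show ?thesis by simp
qed

lemma cU: "continuous_on UNIV (U n)"
  using has_derivative_U by (blast intro: continuous_at_imp_continuous_on has_derivative_continuous)

lemma cdU: "continuous_on UNIV (dU n j)"
  unfolding dU_def by (intro continuous_on_vec_lambda continuous_intros continuous_on_DQ cP)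

lemma U_conv:
  assumes "e > 0"
  shows "\<exists>N. \<forall>n\<ge>N. \<forall>x. norm (U n x - P x) \<le> e"
proof -
  have "e / CARD('n) > 0" using assms by simp
  then obtain N where N: "\<And>n i x. n \<ge> N \<Longrightarrow> norm (DQ n i u x - column i (P x)) \<le> e / CARD('n)"
    using DQu_conv by blast
  have "norm (U n x - P x) \<le> e" if "n \<ge> N" for n x
  proof -
    have "norm (U n x - P x) \<le> (\<Sum>j\<in>UNIV. norm (column j (U n x - P x)))" by (rule norm_le_sum_columns)
    also have "\<dots> \<le> (\<Sum>j\<in>(UNIV :: 'n set). e / CARD('n))"
    proof (rule sum_mono)
      fix j
      have "column j (U n x - P x) = DQ n j u x - column j (P x)" by (simp add: column_def U_def vec_eq_iff)
      then show "norm (column j (U n x - P x)) \<le> e / CARD('n)" using N[OF that] by simp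
    qed
    also have "\<dots> = e" by simp
    finally show ?thesis .
  qed
  then show ?thesis by blast
qed

lemma U_tendsto: "(\<lambda>k. U (r k) x) \<longlonglongrightarrow> P x"
proof -
  have "(\<lambda>n. U n x) \<longlonglongrightarrow> P x"
    unfolding LIMSEQ_def
  proof (intro allI impI)
    fix e :: real assume "e > 0"
    then obtain N where N: "\<And>n x. n \<ge> N \<Longrightarrow> norm (U n x - P x) \<le> e / 2" using U_conv[of "e / 2"] by auto
    have "dist (U n x) (P x) < e" if "n \<ge> N" for n
      using N[OF that, of x] \<open>e > 0\<close> by (simp add: dist_norm)
    then show "\<exists>no. \<forall>n\<ge>no. dist (U n x) (P x) < e" by blast
  qed
  from LIMSEQ_subseq_LIMSEQ[OF this r] show ?thesis by (simp add: o_def)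
qed

lemma U_bounded: obtains M where "M > 0" "\<And>n x. norm (U n x) \<le> M"
proof -
  obtain M where M: "M > 0" "\<And>n i x. norm (DQ n i u x) \<le> M" using DQu_bounded by metis
  have "norm (U n x) \<le> real CARD('n) * M" for n x
    using sum_mono[of UNIV "\<lambda>j. norm (column j (U n x))" "\<lambda>j. M"] norm_le_sum_columns[of "U n x"] M(2)
    by (simp add: column_U)
  moreover have "real CARD('n) * M > 0" using M(1) by simp
  ultimately show ?thesis using that by blast
qed

text \<open>The gradient of the product of \<psi> with the weight \<open>c\<close> at
  \<open>U n\<close>; \<open>climgrad\<close> is the gradient which the chain rule would give with
  \<open>P\<close> in place of \<open>U n\<close>.\<close>

definition cgrad :: "(real ^ 'n \<Rightarrow> real) \<Rightarrow> (real ^ 'n \<Rightarrow> real ^ 'n) \<Rightarrow> (real ^ 'n ^ 'm \<Rightarrow> real) \<Rightarrow> (real ^ 'n ^ 'm \<Rightarrow> real ^ 'n ^ 'm) \<Rightarrow> nat \<Rightarrow> real ^ 'n \<Rightarrow> real ^ 'n" where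
  "cgrad \<psi> \<psi>' c dc n x = \<psi> x *\<^sub>R (\<chi> j. dc (U n x) \<bullet> dU n j x) + c (U n x) *\<^sub>R \<psi>' x"

definition climgrad :: "(real ^ 'n \<Rightarrow> real) \<Rightarrow> (real ^ 'n \<Rightarrow> real ^ 'n) \<Rightarrow> (real ^ 'n ^ 'm \<Rightarrow> real) \<Rightarrow> (real ^ 'n ^ 'm \<Rightarrow> real ^ 'n ^ 'm) \<Rightarrow> real ^ 'n \<Rightarrow> real ^ 'n" where
  "climgrad \<psi> \<psi>' c dc x = \<psi> x *\<^sub>R (\<chi> j. dc (P x) \<bullet> G x $ j) + c (P x) *\<^sub>R \<psi>' x"

lemma composite_C1c:
  assumes c: "\<And>Q. (c has_derivative (\<lambda>Y. dc Q \<bullet> Y)) (at Q)" "continuous_on UNIV dc" and \<psi>: "C1c S \<psi> \<psi>'"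
  shows "C1c S (\<lambda>x. \<psi> x * c (U n x)) (cgrad \<psi> \<psi>' c dc n)"
  unfolding cgrad_def[abs_def]
proof (rule C1c_mult[OF \<psi>])
  fix x
  show "((\<lambda>x. c (U n x)) has_derivative (\<lambda>v. (\<chi> j. dc (U n x) \<bullet> dU n j x) \<bullet> v)) (at x)"
  proof (rule has_derivative_eq_rhs[OF has_derivative_compose[OF has_derivative_U c(1)]], rule ext)
    fix v
    have "dc (U n x) \<bullet> (\<chi> l k. DQ n k P x $ l \<bullet> v) 
       = (\<Sum>l\<in>UNIV. \<Sum>k\<in>UNIV. \<Sum>j\<in>UNIV. dc (U n x) $ l $ k * DQ n k P x $ l $ j * v $ j)"
      by (simp add: inner_vec_def sum_distrib_left mult.assoc)
    also have "\<dots> = (\<Sum>l\<in>UNIV. \<Sum>j\<in>UNIV. \<Sum>k\<in>UNIV. dc (U n x) $ l $ k * DQ n k P x $ l $ j * v $ j)"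
      by (intro sum.cong refl sum.swap)
    also have "\<dots> = (\<Sum>j\<in>UNIV. \<Sum>l\<in>UNIV. \<Sum>k\<in>UNIV. dc (U n x) $ l $ k * DQ n k P x $ l $ j * v $ j)"
      by (rule sum.swap)
    also have "\<dots> = (\<chi> j. dc (U n x) \<bullet> dU n j x) \<bullet> v"
      by (simp add: inner_vec_def dU_def sum_distrib_right)
    finally show "dc (U n x) \<bullet> (\<chi> l k. DQ n k P x $ l \<bullet> v) = (\<chi> j. dc (U n x) \<bullet> dU n j x) \<bullet> v" .
  qed
next
  show "continuous_on UNIV (\<lambda>x. \<chi> j. dc (U n x) \<bullet> dU n j x)"
    by (intro continuous_on_vec_lambda continuous_intros continuous_on_compose2[OF c(2)] cU cdU) auto
qed

text \<open>Prepares every passage to the limit in weighted test functions. Since \<open>c\<close>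
  vanishes on a ball about 0 and \<open>U n\<close> is uniformly close to \<open>P\<close>, the
  products are eventually supported in one compact subset of \<open>Reg\<close>, where the quotients
  converge almost everywhere below an L2 majorant.\<close>

lemma composite:
  assumes c: "\<And>Q. (c has_derivative (\<lambda>Y. dc Q \<bullet> Y)) (at Q)" "continuous_on UNIV dc"
    and \<epsilon>: "\<epsilon> > 0" "\<And>Q. norm Q \<le> \<epsilon> \<Longrightarrow> c Q = 0 \<and> dc Q = 0" and \<psi>: "C1c W \<psi> \<psi>'"
  obtains K k0 H B where "compact K" "K \<subseteq> Reg" "H \<in> borel_measurable lebesgue" "\<And>x. H x \<ge> 0"
    "integrable lebesgue (\<lambda>x. indicator K x * (H x)\<^sup>2)" "B \<ge> 0"
    "\<And>k. k \<ge> k0 \<Longrightarrow> C1c K (\<lambda>x. \<psi> x * c (U (r k) x)) (cgrad \<psi> \<psi>' c dc (r k))"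
    "\<And>n x. \<bar>\<psi> x * c (U n x)\<bar> \<le> B"
    "\<And>x. (\<lambda>k. \<psi> x * c (U (r k) x)) \<longlonglongrightarrow> \<psi> x * c (P x)"
    "\<And>x. x \<notin> K \<Longrightarrow> \<psi> x * c (P x) = 0 \<and> climgrad \<psi> \<psi>' c dc x = 0"
    "AE x in lebesgue. x \<in> K \<longrightarrow> (\<forall>i. (\<lambda>k. DQ (r k) i P x) \<longlonglongrightarrow> G x $ i) \<and> (\<lambda>k. cgrad \<psi> \<psi>' c dc (r k) x) \<longlonglongrightarrow> climgrad \<psi> \<psi>' c dc x \<and>
      (\<forall>k\<ge>k0. norm (cgrad \<psi> \<psi>' c dc (r k) x) \<le> H x \<and> (\<forall>i. norm (DQ (r k) i P x) \<le> H x)) \<and> norm (G x) \<le> H x"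
proof -
  obtain L where L: "compact L" "L \<subseteq> W" "\<And>x. x \<notin> L \<Longrightarrow> \<psi> x = 0" "\<And>x. x \<notin> L \<Longrightarrow> \<psi>' x = 0"
    using C1c_support[OF \<psi>] by blast
  \<comment> \<open>Where the norm of \<open>P\<close> is below \<epsilon>/2 and \<open>U n\<close>
    is within \<epsilon>/2 of it, the norm of \<open>U n\<close> is below \<epsilon> and the weight
    vanishes.\<close>
  define K where "K = L \<inter> {x. \<epsilon> / 2 \<le> norm (P x)}"
  have "closed {x. \<epsilon> / 2 \<le> norm (P x)}" by (intro closed_Collect_le continuous_intros cP)
  then have K: "compact K" unfolding K_def using L(1) by (rule compact_Int_closed[rotated])
  have KR: "K \<subseteq> Reg" using L(2) \<epsilon>(1) by (auto simp: K_def Reg_def)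
  obtain M where M: "M > 0" "\<And>n x. norm (U n x) \<le> M" using U_bounded by metis
  obtain B\<psi> where B\<psi>: "B\<psi> > 0" "\<And>x. \<bar>\<psi> x\<bar> \<le> B\<psi>" "\<And>x. norm (\<psi>' x) \<le> B\<psi>" using C1c_bounded[OF \<psi>] by metis
  have cc: "continuous_on UNIV c" using c(1) by (blast intro: continuous_at_imp_continuous_on has_derivative_continuous)
  have "compact ((\<lambda>Q. (c Q, dc Q)) ` cball 0 M)"
    by (intro compact_continuous_image continuous_intros compact_cball) (auto intro: continuous_on_subset c(2) cc)
  then have "\<exists>B>0. \<forall>Q\<in>cball 0 M. norm (c Q, dc Q) \<le> B" by (auto dest!: compact_imp_bounded simp: bounded_pos)
  then obtain Bc where Bc: "Bc > 0" "\<And>Q. Q \<in> cball 0 M \<Longrightarrow> norm (c Q, dc Q) \<le> Bc" by blast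
  have Bcc: "\<bar>c (U n x)\<bar> \<le> Bc" "norm (dc (U n x)) \<le> Bc" for n x
    using Bc(2)[of "U n x"] M(2)[of n x] norm_fst_le[of "c (U n x)" "dc (U n x)"] norm_snd_le[of "dc (U n x)" "c (U n x)"]
    by auto
  have "\<epsilon> / 2 > 0" using \<epsilon>(1) by simp
  then obtain N1 where N1: "\<And>n x. n \<ge> N1 \<Longrightarrow> norm (U n x - P x) \<le> \<epsilon> / 2" using U_conv by blast
  obtain H0 k1 where H0: "H0 \<in> borel_measurable lebesgue" "\<And>x. H0 x \<ge> 0" "integrable lebesgue (\<lambda>x. indicator K x * (H0 x)\<^sup>2)"
    "AE x in lebesgue. x \<in> K \<longrightarrow> (\<forall>i. (\<lambda>k. DQ (r k) i P x) \<longlonglongrightarrow> G x $ i) \<and> (\<forall>k\<ge>k1. \<forall>i. norm (DQ (r k) i P x) \<le> H0 x) \<and> norm (G x) \<le> H0 x"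
    by (rule G_limit[OF K KR], rule that)
  define nn where "nn = real CARD('n)"
  \<comment> \<open>One factor \<open>nn\<close> comes from the columns of \<open>dU\<close>, the
    other from the components of the gradient; \<open>Bc\<close> and \<open>B\<psi>\<close> bound
    the derivative of the weight and the cutoff. Adding 1 makes \<open>H\<close> dominate
    \<open>H0\<close>, hence also the quotients of \<open>P\<close>.\<close>
  define D where "D = B\<psi> * (nn * (Bc * nn)) + 1"
  have D: "D \<ge> 1" using B\<psi> Bc by (simp add: D_def nn_def)
  define H where "H x = D * H0 x + Bc * B\<psi>" for x
  have H0H: "H0 x \<le> H x" for x
    using mult_right_mono[OF D H0(2)[of x]] Bc B\<psi> by (simp add: H_def add_increasing2)
  show ?thesis
  proof (rule that[of K H "B\<psi> * Bc" "max k1 N1"])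
    show "H \<in> borel_measurable lebesgue" unfolding H_def using H0(1) by measurable
    show "H x \<ge> 0" for x using H0(2)[of x] H0H[of x] by linarith
    show "integrable lebesgue (\<lambda>x. indicator K x * (H x)\<^sup>2)"
    proof (rule Bochner_Integration.integrable_bound[where f="\<lambda>x. 2 * D\<^sup>2 * (indicator K x * (H0 x)\<^sup>2) + 2 * (indicator K x * (Bc * B\<psi>)\<^sup>2)"])
      show "integrable lebesgue (\<lambda>x. 2 * D\<^sup>2 * (indicator K x * (H0 x)\<^sup>2) + 2 * (indicator K x * (Bc * B\<psi>)\<^sup>2))"
        using H0(3) integrable_indicator_continuous[OF continuous_on_const K, of "(Bc * B\<psi>)\<^sup>2"]
        by (intro Bochner_Integration.integrable_add integrable_mult_right)
      have "H \<in> borel_measurable lebesgue" unfolding H_def using H0(1) by measurable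
      then show "(\<lambda>x. indicator K x * (H x)\<^sup>2) \<in> borel_measurable lebesgue"
        by (intro borel_measurable_times borel_measurable_indicator compact_sets_lebesgue K borel_measurable_power)
      show "AE x in lebesgue. norm (indicator K x * (H x)\<^sup>2) \<le> norm (2 * D\<^sup>2 * (indicator K x * (H0 x)\<^sup>2) + 2 * (indicator K x * (Bc * B\<psi>)\<^sup>2))"
      proof (rule AE_I2)
        fix x
        show "norm (indicator K x * (H x)\<^sup>2) \<le> norm (2 * D\<^sup>2 * (indicator K x * (H0 x)\<^sup>2) + 2 * (indicator K x * (Bc * B\<psi>)\<^sup>2))"
          using power2_sum_le[of "D * H0 x" "Bc * B\<psi>"] by (cases "x \<in> K") (auto simp: H_def power_mult_distrib)
      qed
    qed
    show "B\<psi> * Bc \<ge> 0" using B\<psi> Bc by simp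
    show "\<bar>\<psi> x * c (U n x)\<bar> \<le> B\<psi> * Bc" for n x
      unfolding abs_mult using B\<psi> Bcc by (intro mult_mono) auto
    show "(\<lambda>k. \<psi> x * c (U (r k) x)) \<longlonglongrightarrow> \<psi> x * c (P x)" for x
      by (intro tendsto_mult tendsto_const isCont_tendsto_compose[OF _ U_tendsto])
        (use cc in \<open>simp add: continuous_on_eq_continuous_at\<close>)
    show "\<psi> x * c (P x) = 0 \<and> climgrad \<psi> \<psi>' c dc x = 0" if "x \<notin> K" for x
    proof (cases "x \<in> L")
      case True
      then have "norm (P x) \<le> \<epsilon>" using that \<epsilon>(1) by (auto simp: K_def)
      then have "c (P x) = 0" "dc (P x) = 0" using \<epsilon>(2) by auto
      then show ?thesis by (simp add: climgrad_def zero_vec_def[symmetric])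
    next
      case False
      then show ?thesis using L(3,4) by (simp add: climgrad_def)
    qed
    show "C1c K (\<lambda>x. \<psi> x * c (U (r k) x)) (cgrad \<psi> \<psi>' c dc (r k))" if "k \<ge> max k1 N1" for k
    proof (rule C1cI[OF _ _ K order_refl])
      note C = composite_C1c[OF c \<psi>, of "r k"]
      show "((\<lambda>x. \<psi> x * c (U (r k) x)) has_derivative (\<lambda>v. cgrad \<psi> \<psi>' c dc (r k) x \<bullet> v)) (at x)" for x by (rule C1cD(1)[OF C])
      show "continuous_on UNIV (cgrad \<psi> \<psi>' c dc (r k))" by (rule C1cD(2)[OF C])
      have out: "\<psi> x * c (U (r k) x) = 0 \<and> cgrad \<psi> \<psi>' c dc (r k) x = 0" if xK: "x \<notin> K" for x
      proof (cases "x \<in> L")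
        case True
        then have "norm (P x) < \<epsilon> / 2" using xK by (auto simp: K_def)
        moreover have "r k \<ge> N1" using seq_suble[OF r, of k] \<open>k \<ge> max k1 N1\<close> by linarith
        ultimately have "norm (U (r k) x) \<le> \<epsilon>"
          using N1[of "r k" x] norm_triangle_sub[of "U (r k) x" "P x"] by linarith
        then have "c (U (r k) x) = 0" "dc (U (r k) x) = 0" using \<epsilon>(2) by auto
        then show ?thesis by (simp add: cgrad_def zero_vec_def[symmetric])
      next
        case False
        then show ?thesis using L(3,4) by (simp add: cgrad_def)
      qed
      show "x \<notin> K \<Longrightarrow> \<psi> x * c (U (r k) x) = 0" "x \<notin> K \<Longrightarrow> cgrad \<psi> \<psi>' c dc (r k) x = 0" for x
        using out by auto
    qed
    show "AE x in lebesgue. x \<in> K \<longrightarrow> (\<forall>i. (\<lambda>k. DQ (r k) i P x) \<longlonglongrightarrow> G x $ i) \<and> (\<lambda>k. cgrad \<psi> \<psi>' c dc (r k) x) \<longlonglongrightarrow> climgrad \<psi> \<psi>' c dc x \<and>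
      (\<forall>k\<ge>max k1 N1. norm (cgrad \<psi> \<psi>' c dc (r k) x) \<le> H x \<and> (\<forall>i. norm (DQ (r k) i P x) \<le> H x)) \<and> norm (G x) \<le> H x"
      using H0(4) G_symmetric
    proof eventually_elim
      case (elim x)
      show ?case
      proof (intro impI conjI allI)
        assume x: "x \<in> K"
        then have lim: "\<And>i. (\<lambda>k. DQ (r k) i P x) \<longlonglongrightarrow> G x $ i" and bd: "\<And>k i. k \<ge> k1 \<Longrightarrow> norm (DQ (r k) i P x) \<le> H0 x"
          and GH: "norm (G x) \<le> H0 x" using elim(1) by auto
        have sym: "G x $ i $ l $ j = G x $ j $ l $ i" for i l j using elim(2) x KR by blast
        show "(\<lambda>k. DQ (r k) i P x) \<longlonglongrightarrow> G x $ i" for i by (rule lim)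
        have "(\<lambda>k. dU (r k) j x) \<longlonglongrightarrow> (\<chi> l k. G x $ k $ l $ j)" for j
          unfolding dU_def by (intro tendsto_vec_lambda tendsto_vec_nth lim)
        moreover have "(\<chi> l k. G x $ k $ l $ j) = G x $ j" for j using sym by (simp add: vec_eq_iff)
        ultimately have "(\<lambda>k. dU (r k) j x) \<longlonglongrightarrow> G x $ j" for j by simp
        then show "(\<lambda>k. cgrad \<psi> \<psi>' c dc (r k) x) \<longlonglongrightarrow> climgrad \<psi> \<psi>' c dc x"
          unfolding cgrad_def climgrad_def
          by (intro tendsto_intros tendsto_vec_lambda isCont_tendsto_compose[OF _ U_tendsto])
            (use cc c(2) in \<open>simp_all add: continuous_on_eq_continuous_at\<close>)
        show "norm (G x) \<le> H x" using GH H0H[of x] by linarith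
        fix k assume k: "k \<ge> max k1 N1"
        show "norm (DQ (r k) i P x) \<le> H x" for i using bd[of k i] k H0H[of x] by simp
        have "norm (dU (r k) j x) \<le> nn * H0 x" for j
        proof -
          have "norm (dU (r k) j x) \<le> (\<Sum>i\<in>UNIV. norm (column i (dU (r k) j x)))" by (rule norm_le_sum_columns)
          also have "\<dots> \<le> (\<Sum>i\<in>(UNIV :: 'n set). H0 x)"
          proof (rule sum_mono)
            fix i
            have "column i (dU (r k) j x) = column j (DQ (r k) i P x)" by (simp add: dU_def column_def)
            then show "norm (column i (dU (r k) j x)) \<le> H0 x" using norm_column_le[of j "DQ (r k) i P x"] bd[of k i] k by simp
          qed
          finally show ?thesis by (simp add: nn_def)
        qed
        then have "\<bar>dc (U (r k) x) \<bullet> dU (r k) j x\<bar> \<le> Bc * (nn * H0 x)" for j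
          using Bcc(2)[of "r k" x] by (intro order_trans[OF Cauchy_Schwarz_ineq2] mult_mono) (auto intro: less_imp_le[OF Bc(1)])
        then have "(\<Sum>j\<in>UNIV. \<bar>(\<chi> j. dc (U (r k) x) \<bullet> dU (r k) j x) $ j\<bar>) \<le> (\<Sum>j\<in>(UNIV :: 'n set). Bc * (nn * H0 x))"
          by (intro sum_mono) simp
        then have 1: "norm (\<chi> j. dc (U (r k) x) \<bullet> dU (r k) j x) \<le> nn * (Bc * (nn * H0 x))"
          using norm_le_l1_cart[of "\<chi> j. dc (U (r k) x) \<bullet> dU (r k) j x"] by (simp add: nn_def)
        have "norm (cgrad \<psi> \<psi>' c dc (r k) x) \<le> B\<psi> * (nn * (Bc * (nn * H0 x))) + Bc * B\<psi>"
          unfolding cgrad_def using 1 B\<psi> Bcc(1)[of "r k" x]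
          by (intro norm_triangle_mono) (auto intro!: mult_mono less_imp_le[OF Bc(1)])
        also have "\<dots> \<le> H x" using H0(2)[of x] by (simp add: H_def D_def algebra_simps)
        finally show "norm (cgrad \<psi> \<psi>' c dc (r k) x) \<le> H x" .
      qed
    qed
  qed (use K KR in auto)
qed

end

text \<open>Measurability of \<open>T\<close> is deduced: it agrees almost everywhere with the
  pointwise \<open>lim\<close>, and Lebesgue measure is complete.\<close>

lemma dominated_convergence_lebesgue:
  fixes f :: "nat \<Rightarrow> 'a::euclidean_space \<Rightarrow> real"
  assumes "\<And>k. f k \<in> borel_measurable lebesgue" "integrable lebesgue w"
    "AE x in lebesgue. (\<lambda>k. f k x) \<longlonglongrightarrow> T x" "\<And>k. AE x in lebesgue. \<bar>f k x\<bar> \<le> w x"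
  shows "integrable lebesgue T" "(\<lambda>k. LINT x|lebesgue. f k x) \<longlonglongrightarrow> (LINT x|lebesgue. T x)"
proof -
  have "(\<lambda>x. lim (\<lambda>k. f k x)) \<in> borel_measurable lebesgue" by (intro borel_measurable_lim_metric assms(1))
  moreover have "AE x in lebesgue. lim (\<lambda>k. f k x) = T x"
    using assms(3) by eventually_elim (rule limI)
  ultimately have T: "T \<in> borel_measurable lebesgue" by (rule borel_measurable_AE)
  show "integrable lebesgue T" "(\<lambda>k. LINT x|lebesgue. f k x) \<longlonglongrightarrow> (LINT x|lebesgue. T x)"
    using integrable_dominated_convergence[OF T assms(1,2,3)] integral_dominated_convergence[OF T assms(1,2,3)] assms(4)
    by auto
qed

section \<open>The weighted bound on second derivatives\<close>

context flux_limit
begin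

text \<open>On the compact set \<open>{x}\<close> the flux quotient differs from
  \<open>dflux\<close> of the quotient of \<open>P\<close> by an arbitrarily small multiple of a
  convergent, hence bounded, sequence.\<close>

lemma DQ_flux_tendsto:
  assumes "x \<in> Reg" and lim: "(\<lambda>k. DQ (r k) i P x) \<longlonglongrightarrow> g"
  shows "(\<lambda>k. DQ (r k) i A x) \<longlonglongrightarrow> dflux p (P x) g"
proof -
  obtain c C where c: "c > 0" "C > 0" "\<And>y Y. y \<in> {x} \<Longrightarrow> dflux p (P y) Y \<bullet> Y \<ge> c * (norm Y)\<^sup>2"
    "\<And>y Y. y \<in> {x} \<Longrightarrow> norm (dflux p (P y) Y) \<le> C * norm Y"
    "\<And>\<kappa>. 0 < \<kappa> \<Longrightarrow> \<exists>N. \<forall>n\<ge>N. \<forall>i. \<forall>y\<in>{x}. norm (DQ n i A y - dflux p (P y) (DQ n i P y)) \<le> \<kappa> * norm (DQ n i P y)"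
    by (rule DQ_flux[of "{x}"]) (use assms(1) in auto)
  obtain R where R: "R > 0" "\<And>k. norm (DQ (r k) i P x) \<le> R"
    using convergent_imp_Bseq[OF convergentI[OF lim]] by (auto simp: Bseq_def)
  have "(\<lambda>k. DQ (r k) i A x - dflux p (P x) (DQ (r k) i P x)) \<longlonglongrightarrow> 0"
    unfolding LIMSEQ_def
  proof (intro allI impI)
    fix e :: real assume e: "e > 0"
    then have "e / (2 * R) > 0" using R by simp
    then obtain N where N: "\<And>n. n \<ge> N \<Longrightarrow> norm (DQ n i A x - dflux p (P x) (DQ n i P x)) \<le> e / (2 * R) * norm (DQ n i P x)"
      using c(5) by blast
    have "dist (DQ (r k) i A x - dflux p (P x) (DQ (r k) i P x)) 0 < e" if "k \<ge> N" for k
    proof -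
      have "r k \<ge> N" using seq_suble[OF r, of k] that by linarith
      then have "norm (DQ (r k) i A x - dflux p (P x) (DQ (r k) i P x)) \<le> e / (2 * R) * norm (DQ (r k) i P x)" by (rule N)
      also have "\<dots> \<le> e / (2 * R) * R" using R e by (intro mult_left_mono) auto
      also have "\<dots> < e" using R e by simp
      finally show ?thesis by simp
    qed
    then show "\<exists>no. \<forall>k\<ge>no. dist (DQ (r k) i A x - dflux p (P x) (DQ (r k) i P x)) 0 < e" by blast
  qed
  moreover have "(\<lambda>k. dflux p (P x) (DQ (r k) i P x)) \<longlonglongrightarrow> dflux p (P x) g"
    by (rule bounded_linear.tendsto[OF bounded_linear_dflux lim])
  ultimately show ?thesis by (drule_tac tendsto_add) auto
qed

lemma G_norm_measurable: "(\<lambda>x. norm (G x)) \<in> borel_measurable lebesgue"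
  by (rule measurable_compose[OF Gm borel_measurable_norm])

lemma P_measurable: "P \<in> borel_measurable lebesgue"
  by (rule measurable_lebesgue_continuous[OF cP])

lemma P_powr_measurable: "(\<lambda>x. norm (P x) powr a) \<in> borel_measurable lebesgue"
  using measurable_compose[OF P_measurable borel_measurable_norm] by measurable

lemma cut_measurable: "\<epsilon> > 0 \<Longrightarrow> (\<lambda>x. tcut a \<epsilon> (P x)) \<in> borel_measurable lebesgue"
proof -
  assume e: "\<epsilon> > 0"
  have "continuous_on UNIV (tcut a \<epsilon> :: real ^ 'n ^ 'm \<Rightarrow> real)"
    using has_derivative_cut[OF e] by (blast intro: continuous_at_imp_continuous_on has_derivative_continuous)
  then show ?thesis by (intro measurable_lebesgue_continuous continuous_on_compose2[OF _ cP]) auto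
qed

text \<open>What matters is that \<open>B\<close> is independent of \<epsilon>. For fixed \<epsilon>
  the differentiated equation is tested with weights at \<open>U (r k)\<close> and k tends to
  infinity; only the sup of the test field and the cutoff term remain on the right, and both are
  bounded using \<open>tcut \<alpha> \<epsilon> Q \<le> norm Q powr (- \<alpha>)\<close>.\<close>

lemma truncated_estimate:
  assumes \<alpha>: "0 \<le> \<alpha>" "\<alpha> < 1" "\<alpha> < p - 1" and \<psi>: "C1c W \<psi> \<psi>'"
  shows "\<exists>B. \<forall>\<epsilon>>0. integrable lebesgue (\<lambda>x. (\<psi> x)\<^sup>2 * (norm (P x) powr (p - 2) * tcut \<alpha> \<epsilon> (P x)) * (norm (G x))\<^sup>2) \<and>
    (LINT x|lebesgue. (\<psi> x)\<^sup>2 * (norm (P x) powr (p - 2) * tcut \<alpha> \<epsilon> (P x)) * (norm (G x))\<^sup>2) \<le> B"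
proof -
  obtain M where M: "M > 0" "\<And>x. norm (P x) \<le> M" using P_bounded by metis
  obtain MU where MU: "MU > 0" "\<And>n x. norm (U n x) \<le> MU" using U_bounded by metis
  obtain B\<psi> where B\<psi>: "B\<psi> > 0" "\<And>x. \<bar>\<psi> x\<bar> \<le> B\<psi>" "\<And>x. norm (\<psi>' x) \<le> B\<psi>" using C1c_bounded[OF \<psi>] by metis
  obtain L where L: "compact L" "L \<subseteq> W" "\<And>x. x \<notin> L \<Longrightarrow> \<psi> x = 0" "\<And>x. x \<notin> L \<Longrightarrow> \<psi>' x = 0"
    using C1c_support[OF \<psi>] by blast
  \<comment> \<open>A column of \<open>U\<close> is no longer than \<open>U\<close>, so the test
    field is at most the square of \<psi> times \<open>norm (U (r k) x) powr (1 - \<alpha>)\<close>;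
    \<alpha> < 1 keeps this bounded where \<open>U\<close> is small.\<close>
  define B' where "B' = B\<psi>\<^sup>2 * MU powr (1 - \<alpha>)"
  define c0 where "c0 = min 1 (min ((p - 1) * (1 - \<alpha>)) (p - 1 - \<alpha>))"
  have c0: "c0 > 0" using p \<alpha> by (simp add: c0_def)
  \<comment> \<open>In the cutoff term the powers s^(p-2), s^2 and s^(-\<alpha>) combine to
    s^(p-\<alpha>), with s at most \<open>M\<close>.\<close>
  define C1 where "C1 = (2 / c0) * (1 + \<bar>p - 2\<bar>)\<^sup>2 * M powr (p - \<alpha>)"
  have C1: "C1 \<ge> 0" using c0 by (simp add: C1_def)
  have i\<psi>: "integrable lebesgue (\<lambda>x. C1 * (norm (\<psi>' x))\<^sup>2)"
    by (rule integrable_lebesgue_cc[OF _ L(1)]) (auto simp: L(4) intro!: continuous_intros C1cD(2)[OF \<psi>])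
  define Bd where "Bd = (2 / c0) * (real CARD('n) * (B' * \<Gamma>) + (LINT x|lebesgue. C1 * (norm (\<psi>' x))\<^sup>2))"
  have "integrable lebesgue (\<lambda>x. (\<psi> x)\<^sup>2 * (norm (P x) powr (p - 2) * tcut \<alpha> \<epsilon> (P x)) * (norm (G x))\<^sup>2) \<and>
    (LINT x|lebesgue. (\<psi> x)\<^sup>2 * (norm (P x) powr (p - 2) * tcut \<alpha> \<epsilon> (P x)) * (norm (G x))\<^sup>2) \<le> Bd" if \<epsilon>: "\<epsilon> > 0" for \<epsilon>
  proof -
    let ?c = "tcut \<alpha> \<epsilon> :: real ^ 'n ^ 'm \<Rightarrow> real" and ?dc = "cut_grad \<alpha> \<epsilon> :: real ^ 'n ^ 'm \<Rightarrow> _"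
    have cz: "\<And>Q. norm Q \<le> \<epsilon> \<Longrightarrow> ?c Q = 0 \<and> ?dc Q = 0" using cut_zero[OF \<epsilon>] by blast
    define w where "w k x = (\<psi> x)\<^sup>2 * ?c (U (r k) x)" for k x
    define wl where "wl x = (\<psi> x)\<^sup>2 * ?c (P x)" for x
    define gr where "gr k x = cgrad (\<lambda>x. (\<psi> x)\<^sup>2) (\<lambda>x. (2 * \<psi> x) *\<^sub>R \<psi>' x) ?c ?dc (r k) x" for k x
    define gl where "gl x = climgrad (\<lambda>x. (\<psi> x)\<^sup>2) (\<lambda>x. (2 * \<psi> x) *\<^sub>R \<psi>' x) ?c ?dc x" for x
    obtain K k0 H B where K: "compact K" "K \<subseteq> Reg" and H: "H \<in> borel_measurable lebesgue" "\<And>x. H x \<ge> 0"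
      "integrable lebesgue (\<lambda>x. indicator K x * (H x)\<^sup>2)" and B: "B \<ge> 0"
      and C: "\<And>k. k \<ge> k0 \<Longrightarrow> C1c K (w k) (gr k)"
      and wB: "\<And>n x. \<bar>(\<psi> x)\<^sup>2 * ?c (U n x)\<bar> \<le> B"
      and wlim: "\<And>x. (\<lambda>k. w k x) \<longlonglongrightarrow> wl x"
      and out: "\<And>x. x \<notin> K \<Longrightarrow> wl x = 0 \<and> gl x = 0"
      and AE: "AE x in lebesgue. x \<in> K \<longrightarrow> (\<forall>i. (\<lambda>k. DQ (r k) i P x) \<longlonglongrightarrow> G x $ i) \<and> (\<lambda>k. gr k x) \<longlonglongrightarrow> gl x \<and>
      (\<forall>k\<ge>k0. norm (gr k x) \<le> H x \<and> (\<forall>i. norm (DQ (r k) i P x) \<le> H x)) \<and> norm (G x) \<le> H x"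
      by (rule composite[OF has_derivative_cut[OF \<epsilon>] continuous_on_cut_grad[OF \<epsilon>] \<epsilon> cz C1c_square[OF \<psi>]], assumption,
          rule that[unfolded w_def[abs_def] wl_def gr_def[abs_def] gl_def])
    obtain c C where cC: "c > 0" "C > 0" "\<And>x Y. x \<in> K \<Longrightarrow> dflux p (P x) Y \<bullet> Y \<ge> c * (norm Y)\<^sup>2"
      "\<And>x Y. x \<in> K \<Longrightarrow> norm (dflux p (P x) Y) \<le> C * norm Y"
      "\<And>\<kappa>. 0 < \<kappa> \<Longrightarrow> \<exists>N. \<forall>n\<ge>N. \<forall>i. \<forall>x\<in>K. norm (DQ n i A x - dflux p (P x) (DQ n i P x)) \<le> \<kappa> * norm (DQ n i P x)"
      by (rule DQ_flux[OF K], rule that)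
    obtain N1 where N1: "\<And>n i x. n \<ge> N1 \<Longrightarrow> x \<in> K \<Longrightarrow> norm (DQ n i A x - dflux p (P x) (DQ n i P x)) \<le> 1 * norm (DQ n i P x)"
      using cC(5)[of 1] by auto
    obtain N2 where N2: "\<And>n i \<Phi> \<Phi>' B. n \<ge> N2 \<Longrightarrow> C1cv K \<Phi> \<Phi>' \<Longrightarrow> (\<And>x. norm (\<Phi> x) \<le> B) \<Longrightarrow>
        \<bar>LINT x|lebesgue. DQ n i A x \<bullet> \<Phi>' x\<bar> \<le> B * \<Gamma>"
      using test_abs[OF K(1) order_trans[OF K(2) Reg(2)]] by blast
    \<comment> \<open>Starting the sequence at \<open>k1\<close> turns bounds that hold eventually
      into bounds for every index. Since \<open>r\<close> is strictly increasing, \<open>r k\<close>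
      is at least k.\<close>
    define k1 where "k1 = max k0 (max N1 N2)"
    have k1: "k + k1 \<ge> k0" "r (k + k1) \<ge> N1" "r (k + k1) \<ge> N2" for k
      using seq_suble[OF r, of "k + k1"] by (auto simp: k1_def)
    define \<Phi>' where "\<Phi>' k i x = w k x *\<^sub>R DQ (r k) i P x + outer (DQ (r k) i u x) (gr k x)" for k i x
    have C\<Phi>: "C1cv K (\<lambda>x. w k x *\<^sub>R DQ (r k) i u x) (\<Phi>' k i)" if "k \<ge> k0" for k i
      unfolding \<Phi>'_def by (rule C1cv_scaleR[OF C[OF that] has_derivative_DQ[OF du] continuous_on_DQ[OF cP]])
    have \<Phi>B: "norm (w k x *\<^sub>R DQ (r k) i u x) \<le> B'" for k i x
    proof -
      have "norm (DQ (r k) i u x) \<le> norm (U (r k) x)" using norm_column_le[of i "U (r k) x"] by (simp add: column_U)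
      then have "?c (U (r k) x) * norm (DQ (r k) i u x) \<le> norm (U (r k) x) powr (- \<alpha>) * norm (U (r k) x)"
        by (intro mult_mono cut_le[OF \<epsilon>]) auto
      also have "\<dots> = norm (U (r k) x) powr (1 - \<alpha>)"
        by (cases "U (r k) x = 0") (simp_all add: powr_diff powr_minus divide_inverse mult.commute)
      also have "\<dots> \<le> MU powr (1 - \<alpha>)" using MU \<alpha> by (intro powr_mono2) auto
      finally have "(\<psi> x)\<^sup>2 * (?c (U (r k) x) * norm (DQ (r k) i u x)) \<le> B\<psi>\<^sup>2 * MU powr (1 - \<alpha>)"
        using power_mono[OF B\<psi>(2)[of x] abs_ge_zero, of 2] by (intro mult_mono) (auto intro!: mult_nonneg_nonneg cut_nonneg)
      then show ?thesis by (simp add: w_def B'_def abs_mult cut_nonneg mult.assoc)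
    qed
    define T where "T x = (\<Sum>i\<in>UNIV. dflux p (P x) (G x $ i) \<bullet> (wl x *\<^sub>R G x $ i + outer (column i (P x)) (gl x)))" for x
    obtain Mu where Mu: "Mu > 0" "\<And>n i x. norm (DQ n i u x) \<le> Mu" using DQu_bounded by metis
    define f where "f k x = (\<Sum>i\<in>UNIV. DQ (r (k + k1)) i A x \<bullet> \<Phi>' (k + k1) i x)" for k x
    have fint: "integrable lebesgue (\<lambda>x. DQ (r (k + k1)) i A x \<bullet> \<Phi>' (k + k1) i x)" for k i
      by (rule integrable_lebesgue_cc[OF _ K(1)])
        (use C1cv_outside[OF C\<Phi>[OF k1(1)]] in \<open>auto intro!: continuous_intros continuous_on_DQ cA C1cv_continuous(2)[OF C\<Phi>[OF k1(1)]]\<close>)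
    \<comment> \<open>Flux quotient, quotient of \<open>P\<close> and gradient of the weight are
      each bounded by a multiple of \<open>H\<close>, and each summand pairs two of them with a
      bounded factor, \<open>B\<close> or \<open>Mu\<close>. So the square of \<open>H\<close> is an
      integrable majorant.\<close>
    define Q where "Q = real CARD('n) * ((C + 1) * (B + Mu))"
    have *: "integrable lebesgue T" "(\<lambda>k. LINT x|lebesgue. f k x) \<longlonglongrightarrow> (LINT x|lebesgue. T x)"
    proof -
      have m: "f k \<in> borel_measurable lebesgue" for k
        unfolding f_def by (intro borel_measurable_sum borel_measurable_integrable[OF fint])
      have w: "integrable lebesgue (\<lambda>x. Q * (indicator K x * (H x)\<^sup>2))" using H(3) by simp
      have lim: "AE x in lebesgue. (\<lambda>k. f k x) \<longlonglongrightarrow> T x"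
        using AE
      proof eventually_elim
        case (elim x)
        show ?case
        proof (cases "x \<in> K")
          case True
          then have 1: "\<And>i. (\<lambda>k. DQ (r k) i P x) \<longlonglongrightarrow> G x $ i" "(\<lambda>k. gr k x) \<longlonglongrightarrow> gl x" using elim by auto
          have xR: "x \<in> Reg" using True K by blast
          have du': "(\<lambda>k. DQ (r k) i u x) \<longlonglongrightarrow> column i (P x)" for i
            using LIMSEQ_subseq_LIMSEQ[OF DQ_tendsto[OF du] r, of i x] by (simp add: o_def column_matrix_axis)
          have "(\<lambda>k. \<Sum>i\<in>UNIV. DQ (r k) i A x \<bullet> \<Phi>' k i x) \<longlonglongrightarrow> T x"
            unfolding T_def \<Phi>'_def
            by (intro tendsto_sum tendsto_inner tendsto_add tendsto_scaleR tendsto_outer DQ_flux_tendsto[OF xR] 1 wlim du')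
          from LIMSEQ_ignore_initial_segment[OF this, of k1] show ?thesis by (simp add: f_def)
        next
          case False
          have "f k x = 0" for k using C1cv_outside[OF C\<Phi>[OF k1(1)] False] by (simp add: f_def)
          moreover have "T x = 0" using out[OF False] by (simp add: T_def outer_def zero_vec_def[symmetric])
          ultimately show ?thesis by simp
        qed
      qed
      have bd: "AE x in lebesgue. \<bar>f k x\<bar> \<le> Q * (indicator K x * (H x)\<^sup>2)" for k
        using AE
      proof eventually_elim
        case (elim x)
        show ?case
        proof (cases "x \<in> K")
          case True
          let ?k = "k + k1"
          have b1: "norm (gr ?k x) \<le> H x" "\<And>i. norm (DQ (r ?k) i P x) \<le> H x" using elim True k1(1)[of k] by auto
          have "\<bar>DQ (r ?k) i A x \<bullet> \<Phi>' ?k i x\<bar> \<le> (C + 1) * (B + Mu) * (H x)\<^sup>2" for i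
          proof -
            have "norm (DQ (r ?k) i A x) \<le> norm (dflux p (P x) (DQ (r ?k) i P x)) + norm (DQ (r ?k) i A x - dflux p (P x) (DQ (r ?k) i P x))"
              by (rule norm_triangle_sub)
            also have "\<dots> \<le> C * norm (DQ (r ?k) i P x) + 1 * norm (DQ (r ?k) i P x)"
              by (intro add_mono cC(4) N1 k1(2) True)
            also have "\<dots> \<le> (C + 1) * H x" using b1(2)[of i] cC(2) by (simp add: distrib_right add_mono mult_left_mono)
            finally have nA: "norm (DQ (r ?k) i A x) \<le> (C + 1) * H x" .
            have "\<bar>DQ (r ?k) i A x \<bullet> (w ?k x *\<^sub>R DQ (r ?k) i P x)\<bar> \<le> norm (DQ (r ?k) i A x) * norm (w ?k x *\<^sub>R DQ (r ?k) i P x)"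
              by (rule Cauchy_Schwarz_ineq2)
            also have "\<dots> \<le> ((C + 1) * H x) * (B * H x)"
              using nA b1(2)[of i] wB[of x "r ?k"] B H(2)[of x] cC(2) by (intro mult_mono) (auto simp: w_def intro!: mult_mono)
            finally have 2: "\<bar>DQ (r ?k) i A x \<bullet> (w ?k x *\<^sub>R DQ (r ?k) i P x)\<bar> \<le> ((C + 1) * H x) * (B * H x)" .
            have "\<bar>DQ (r ?k) i A x \<bullet> outer (DQ (r ?k) i u x) (gr ?k x)\<bar> \<le> norm (DQ (r ?k) i u x) * norm (DQ (r ?k) i A x) * norm (gr ?k x)"
              by (rule abs_inner_outer_le)
            also have "\<dots> \<le> Mu * ((C + 1) * H x) * H x"
              using nA b1(1) Mu H(2)[of x] cC(2) by (intro mult_mono) auto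
            finally have 3: "\<bar>DQ (r ?k) i A x \<bullet> outer (DQ (r ?k) i u x) (gr ?k x)\<bar> \<le> Mu * ((C + 1) * H x) * H x" .
            have "\<bar>DQ (r ?k) i A x \<bullet> \<Phi>' ?k i x\<bar> \<le> ((C + 1) * H x) * (B * H x) + Mu * ((C + 1) * H x) * H x"
              unfolding \<Phi>'_def inner_add_right using 2 3 by linarith
            then show ?thesis by (simp add: power2_eq_square algebra_simps)
          qed
          then have "\<bar>f k x\<bar> \<le> (\<Sum>i\<in>(UNIV :: 'n set). (C + 1) * (B + Mu) * (H x)\<^sup>2)"
            unfolding f_def by (intro order_trans[OF sum_abs] sum_mono)
          then show ?thesis using True by (simp add: Q_def mult.assoc)
        next
          case False
          then show ?thesis using C1cv_outside[OF C\<Phi>[OF k1(1)] False] by (simp add: f_def)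
        qed
      qed
      show "integrable lebesgue T" "(\<lambda>k. LINT x|lebesgue. f k x) \<longlonglongrightarrow> (LINT x|lebesgue. T x)"
        using dominated_convergence_lebesgue[OF m w lim bd] by auto
    qed
    have TB: "(LINT x|lebesgue. T x) \<le> real CARD('n) * (B' * \<Gamma>)"
    proof (rule LIMSEQ_le_const2[OF *(2)], intro exI allI impI)
      fix k
      have "(LINT x|lebesgue. f k x) = (\<Sum>i\<in>UNIV. LINT x|lebesgue. DQ (r (k + k1)) i A x \<bullet> \<Phi>' (k + k1) i x)"
        unfolding f_def by (intro Bochner_Integration.integral_sum fint)
      also have "\<dots> \<le> (\<Sum>i\<in>(UNIV :: 'n set). B' * \<Gamma>)"
        using N2[OF k1(3) C\<Phi>[OF k1(1)] \<Phi>B] by (intro sum_mono) (simp add: abs_le_iff)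
      finally show "(LINT x|lebesgue. f k x) \<le> real CARD('n) * (B' * \<Gamma>)" by simp
    qed
    define F where "F x = (\<psi> x)\<^sup>2 * (norm (P x) powr (p - 2) * ?c (P x)) * (norm (G x))\<^sup>2" for x
    have Fm: "F \<in> borel_measurable lebesgue"
      unfolding F_def using C1c_borel(1)[OF \<psi>] P_powr_measurable cut_measurable[OF \<epsilon>] G_norm_measurable
      by (intro borel_measurable_times borel_measurable_power)
    have F0: "F x \<ge> 0" for x unfolding F_def by (intro mult_nonneg_nonneg cut_nonneg) auto
    have FT: "AE x in lebesgue. F x \<le> (2 / c0) * (T x + C1 * (norm (\<psi>' x))\<^sup>2)"
      using G_symmetric
    proof eventually_elim
      case (elim x)
      show ?case
      proof (cases "x \<in> K")
        case True
        then have xR: "x \<in> Reg" using K by blast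
        then have P0: "P x \<noteq> 0" by (simp add: Reg_def)
        have sym: "\<And>i l j. G x $ i $ l $ j = G x $ j $ l $ i" using elim xR by blast
        define s where "s = norm (P x)"
        have s: "s > 0" "s \<le> M" using P0 M by (auto simp: s_def)
        have "s powr (p - 2) * ((c0 / 2) * (\<psi> x)\<^sup>2 * ?c (P x) * (norm (G x))\<^sup>2 - (2 / c0) * (1 + \<bar>p - 2\<bar>)\<^sup>2 * ?c (P x) * s\<^sup>2 * (norm (\<psi>' x))\<^sup>2) \<le> T x"
          using structure_inequality[OF P0 p \<alpha> sym cut_nonneg[of \<alpha> \<epsilon> "P x"] cut_slope_ge[OF \<epsilon>, of \<alpha> "P x"] c0_def,
              where \<psi>="\<psi> x" and \<xi>="\<psi>' x"]
          unfolding T_def wl_def gl_def climgrad_def cut_grad_def s_def by simp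
        then have 1: "(c0 / 2) * F x \<le> T x + (2 / c0) * (1 + \<bar>p - 2\<bar>)\<^sup>2 * (s powr (p - 2) * s\<^sup>2 * ?c (P x)) * (norm (\<psi>' x))\<^sup>2"
          by (simp add: F_def s_def algebra_simps)
        have "s powr (p - 2) * s\<^sup>2 = s powr p" using s by (simp add: powr_diff)
        then have "s powr (p - 2) * s\<^sup>2 * ?c (P x) \<le> s powr p * s powr (- \<alpha>)"
          using cut_le[OF \<epsilon>, of \<alpha> "P x"] by (simp add: s_def mult_left_mono)
        also have "\<dots> = s powr (p - \<alpha>)" by (simp add: powr_add[symmetric])
        also have "\<dots> \<le> M powr (p - \<alpha>)" using s \<alpha> by (intro powr_mono2) auto
        finally have "(2 / c0) * (1 + \<bar>p - 2\<bar>)\<^sup>2 * (s powr (p - 2) * s\<^sup>2 * ?c (P x)) * (norm (\<psi>' x))\<^sup>2 \<le> C1 * (norm (\<psi>' x))\<^sup>2"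
          unfolding C1_def using c0 by (intro mult_right_mono mult_left_mono) auto
        with 1 have "(c0 / 2) * F x \<le> T x + C1 * (norm (\<psi>' x))\<^sup>2" by linarith
        then have "(2 / c0) * ((c0 / 2) * F x) \<le> (2 / c0) * (T x + C1 * (norm (\<psi>' x))\<^sup>2)"
          using c0 by (intro mult_left_mono) auto
        then show ?thesis using c0 by simp
      next
        case False
        have "F x = wl x * norm (P x) powr (p - 2) * (norm (G x))\<^sup>2" by (simp add: F_def wl_def)
        then have "F x = 0" using out[OF False] by simp
        moreover have "T x = 0" using out[OF False] by (simp add: T_def outer_def zero_vec_def[symmetric])
        ultimately show ?thesis using c0 C1 by simp
      qed
    qed
    have Ri: "integrable lebesgue (\<lambda>x. (2 / c0) * (T x + C1 * (norm (\<psi>' x))\<^sup>2))"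
      by (rule integrable_mult_right) (rule Bochner_Integration.integrable_add[OF *(1) i\<psi>])
    have Fi: "integrable lebesgue F"
    proof (rule Bochner_Integration.integrable_bound[OF Ri Fm])
      show "AE x in lebesgue. norm (F x) \<le> norm ((2 / c0) * (T x + C1 * (norm (\<psi>' x))\<^sup>2))"
        using FT
      proof eventually_elim
        case (elim x)
        have "norm a \<le> norm b" if "0 \<le> a" "a \<le> b" for a b :: real using that by simp
        then show ?case using F0 elim by blast
      qed
    qed
    have "(LINT x|lebesgue. F x) \<le> (LINT x|lebesgue. (2 / c0) * (T x + C1 * (norm (\<psi>' x))\<^sup>2))"
      by (rule integral_mono_AE[OF Fi Ri FT])
    also have "\<dots> = (2 / c0) * ((LINT x|lebesgue. T x) + (LINT x|lebesgue. C1 * (norm (\<psi>' x))\<^sup>2))"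
      by (simp only: integral_mult_right_zero Bochner_Integration.integral_add[OF *(1) i\<psi>])
    also have "\<dots> \<le> Bd" unfolding Bd_def using TB c0 by (intro mult_left_mono add_right_mono) auto
    finally show ?thesis using Fi unfolding F_def by blast
  qed
  then show ?thesis by blast
qed

lemma weighted_estimate:
  assumes \<alpha>: "0 \<le> \<alpha>" "\<alpha> < 1" "\<alpha> < p - 1" and \<psi>: "C1c W \<psi> \<psi>'"
  shows "integrable lebesgue (\<lambda>x. indicator Reg x * ((\<psi> x)\<^sup>2 * norm (P x) powr (p - 2 - \<alpha>) * (norm (G x))\<^sup>2))"
proof -
  obtain B where B: "\<And>\<epsilon>. \<epsilon> > 0 \<Longrightarrow> integrable lebesgue (\<lambda>x. (\<psi> x)\<^sup>2 * (norm (P x) powr (p - 2) * tcut \<alpha> \<epsilon> (P x)) * (norm (G x))\<^sup>2)"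
    "\<And>\<epsilon>. \<epsilon> > 0 \<Longrightarrow> (LINT x|lebesgue. (\<psi> x)\<^sup>2 * (norm (P x) powr (p - 2) * tcut \<alpha> \<epsilon> (P x)) * (norm (G x))\<^sup>2) \<le> B"
    using truncated_estimate[OF assms] by blast
  define F where "F k x = (\<psi> x)\<^sup>2 * (norm (P x) powr (p - 2) * tcut \<alpha> (1 / real (Suc k)) (P x)) * (norm (G x))\<^sup>2" for k x
  show ?thesis
  proof (rule integrable_of_bounded_liminf[where F=F and B=B])
    show "integrable lebesgue (F k)" "(LINT x|lebesgue. F k x) \<le> B" for k unfolding F_def by (rule B, simp)+
    show "F k x \<ge> 0" for k x unfolding F_def by (intro mult_nonneg_nonneg cut_nonneg) auto
    show "(\<lambda>x. indicator Reg x * ((\<psi> x)\<^sup>2 * norm (P x) powr (p - 2 - \<alpha>) * (norm (G x))\<^sup>2)) \<in> borel_measurable lebesgue"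
      using C1c_borel(1)[OF \<psi>] P_powr_measurable G_norm_measurable Reg(1)
      by (intro borel_measurable_times borel_measurable_power borel_measurable_indicator) auto
    show "AE x in lebesgue. (\<lambda>k. F k x) \<longlonglongrightarrow> indicator Reg x * ((\<psi> x)\<^sup>2 * norm (P x) powr (p - 2 - \<alpha>) * (norm (G x))\<^sup>2)"
    proof (rule AE_I2)
      fix x
      show "(\<lambda>k. F k x) \<longlonglongrightarrow> indicator Reg x * ((\<psi> x)\<^sup>2 * norm (P x) powr (p - 2 - \<alpha>) * (norm (G x))\<^sup>2)"
      proof (cases "x \<in> Reg")
        case True
        then have P0: "P x \<noteq> 0" by (simp add: Reg_def)
        have "(\<lambda>k. F k x) \<longlonglongrightarrow> (\<psi> x)\<^sup>2 * (norm (P x) powr (p - 2) * norm (P x) powr (- \<alpha>)) * (norm (G x))\<^sup>2"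
          unfolding F_def by (intro tendsto_intros cut_tendsto P0)
        then show ?thesis using True by (simp add: powr_add[symmetric])
      next
        case False
        \<comment> \<open>Where \<open>P\<close> vanishes the truncated weight is 0, and so is the
          power of the norm, since \<open>0 powr a = 0\<close> for every a.\<close>
        then have "\<psi> x = 0 \<or> P x = 0" using C1c_outside(1)[OF \<psi>] by (auto simp: Reg_def)
        then show ?thesis using False by (auto simp: F_def tcut_def)
      qed
    qed
  qed
qed

end

section \<open>Integrability of negative powers of the gradient\<close>

lemma norm_inner_components_le:
  fixes G :: "'a::euclidean_space ^ 'n::finite"
  shows "norm ((\<chi> j. C \<bullet> G $ j) :: real ^ 'n) \<le> norm C * norm G"
proof -
  have "norm ((\<chi> j. C \<bullet> G $ j) :: real ^ 'n) = L2_set (\<lambda>j. \<bar>C \<bullet> G $ j\<bar>) UNIV" by (simp add: norm_vec_def)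
  also have "\<dots> \<le> L2_set (\<lambda>j. norm C * norm (G $ j)) UNIV" by (intro L2_set_mono Cauchy_Schwarz_ineq2) auto
  also have "\<dots> = norm C * norm G" by (simp add: L2_set_right_distrib norm_vec_def[of G])
  finally show ?thesis .
qed

context flux_limit
begin

text \<open>Here one row of the undifferentiated equation is tested. The lower bound on the source
  puts \<tau> times the integral of the truncated weight on the left. The flux paired with the
  gradient of the weight is split by Young's inequality into half of that integral and the weighted
  integral of the squared second derivatives, which is already known to be finite.\<close>

lemma inverse_power_estimate:
  fixes f :: "real ^ 'n \<Rightarrow> real"
  assumes eq: "\<And>\<phi> \<phi>'. C1c W \<phi> \<phi>' \<Longrightarrow> integrable lebesgue (\<lambda>x. f x * \<phi> x)"
      "\<And>\<phi> \<phi>'. C1c W \<phi> \<phi>' \<Longrightarrow> (LINT x|lebesgue. A x $ l \<bullet> \<phi>' x) = (LINT x|lebesgue. f x * \<phi> x)"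
    and \<tau>: "\<tau> > 0" "\<And>x. x \<in> W \<Longrightarrow> f x \<ge> \<tau>" and \<rho>: "p - 2 \<le> \<rho>" "\<rho> < p - 1" "p \<ge> 2" and \<psi>: "C1c W \<psi> \<psi>'"
  shows "integrable lebesgue (\<lambda>x. indicator Reg x * ((\<psi> x)\<^sup>2 * norm (P x) powr (- \<rho>)))"
proof -
  obtain M where M: "M > 0" "\<And>x. norm (P x) \<le> M" using P_bounded by metis
  obtain L where L: "compact L" "L \<subseteq> W" "\<And>x. x \<notin> L \<Longrightarrow> \<psi> x = 0" "\<And>x. x \<notin> L \<Longrightarrow> \<psi>' x = 0"
    using C1c_support[OF \<psi>] by blast
  \<comment> \<open>The second factor in Young's inequality has weight s^(2(p-2)-\<rho>), which must
    equal s^(p-2-\<alpha>). The hypotheses on \<rho> say that this \<alpha> lies in [0, 1).\<close>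
  define \<alpha> where "\<alpha> = \<rho> + 2 - p"
  have \<alpha>: "0 \<le> \<alpha>" "\<alpha> < 1" "\<alpha> < p - 1" using \<rho> by (auto simp: \<alpha>_def)
  define V where "V x = indicator Reg x * ((\<psi> x)\<^sup>2 * norm (P x) powr (p - 2 - \<alpha>) * (norm (G x))\<^sup>2)" for x
  have V: "integrable lebesgue V" unfolding V_def by (rule weighted_estimate[OF \<alpha> \<psi>])
  define Q where "Q = 8 + 2 * \<rho>\<^sup>2"
  have Q: "Q > 0" unfolding Q_def by (intro add_pos_nonneg) auto
  \<comment> \<open>The cutoff term contains s^(p-1) times a weight of at most s^(-\<rho>), which is
    bounded because \<rho> < p - 1.\<close>
  define E where "E x = M powr (p - 1 - \<rho>) * (2 * \<bar>\<psi> x\<bar> * norm (\<psi>' x))" for x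
  have E: "integrable lebesgue E" unfolding E_def
    by (rule integrable_lebesgue_cc[OF _ L(1)]) (auto simp: L(3) intro!: continuous_intros C1cD(2,3)[OF \<psi>])
  define Bd where "Bd = (2 / \<tau>) * ((Q / (2 * \<tau>)) * (LINT x|lebesgue. V x) + (LINT x|lebesgue. E x))"
  have main: "integrable lebesgue (\<lambda>x. (\<psi> x)\<^sup>2 * tcut \<rho> \<epsilon> (P x)) \<and> (LINT x|lebesgue. (\<psi> x)\<^sup>2 * tcut \<rho> \<epsilon> (P x)) \<le> Bd" if \<epsilon>: "\<epsilon> > 0" for \<epsilon>
  proof -
    let ?c = "tcut \<rho> \<epsilon> :: real ^ 'n ^ 'm \<Rightarrow> real" and ?dc = "cut_grad \<rho> \<epsilon> :: real ^ 'n ^ 'm \<Rightarrow> _"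
    have cz: "\<And>Q. norm Q \<le> \<epsilon> \<Longrightarrow> ?c Q = 0 \<and> ?dc Q = 0" using cut_zero[OF \<epsilon>] by blast
    define w where "w k x = (\<psi> x)\<^sup>2 * ?c (U (r k) x)" for k x
    define wl where "wl x = (\<psi> x)\<^sup>2 * ?c (P x)" for x
    define gr where "gr k x = cgrad (\<lambda>x. (\<psi> x)\<^sup>2) (\<lambda>x. (2 * \<psi> x) *\<^sub>R \<psi>' x) ?c ?dc (r k) x" for k x
    define gl where "gl x = climgrad (\<lambda>x. (\<psi> x)\<^sup>2) (\<lambda>x. (2 * \<psi> x) *\<^sub>R \<psi>' x) ?c ?dc x" for x
    obtain K k0 H B where K: "compact K" "K \<subseteq> Reg" and H: "H \<in> borel_measurable lebesgue" "\<And>x. H x \<ge> 0"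
      "integrable lebesgue (\<lambda>x. indicator K x * (H x)\<^sup>2)" and B: "B \<ge> 0"
      and C: "\<And>k. k \<ge> k0 \<Longrightarrow> C1c K (w k) (gr k)"
      and wB: "\<And>n x. \<bar>(\<psi> x)\<^sup>2 * ?c (U n x)\<bar> \<le> B"
      and wlim: "\<And>x. (\<lambda>k. w k x) \<longlonglongrightarrow> wl x"
      and out: "\<And>x. x \<notin> K \<Longrightarrow> wl x = 0 \<and> gl x = 0"
      and AE: "AE x in lebesgue. x \<in> K \<longrightarrow> (\<forall>i. (\<lambda>k. DQ (r k) i P x) \<longlonglongrightarrow> G x $ i) \<and> (\<lambda>k. gr k x) \<longlonglongrightarrow> gl x \<and>
      (\<forall>k\<ge>k0. norm (gr k x) \<le> H x \<and> (\<forall>i. norm (DQ (r k) i P x) \<le> H x)) \<and> norm (G x) \<le> H x"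
      by (rule composite[OF has_derivative_cut[OF \<epsilon>] continuous_on_cut_grad[OF \<epsilon>] \<epsilon> cz C1c_square[OF \<psi>]], assumption,
          rule that[unfolded w_def[abs_def] wl_def gr_def[abs_def] gl_def])
    have kk: "k + k0 \<ge> k0" for k by simp
    have CW: "C1c W (w (k + k0)) (gr (k + k0))" for k using C1c_mono[OF C[OF kk]] K Reg(2) by blast
    have nA: "norm (A x $ l) \<le> norm (P x) powr (p - 1)" for x
      using Finite_Cartesian_Product.norm_nth_le[of "A x" l] by (simp add: A_def norm_p_flux)
    have nAM: "norm (A x $ l) \<le> M powr (p - 1)" for x
      using nA[of x] powr_mono2[of "p - 1" "norm (P x)" M] M p by (auto intro: order_trans)
    have "integrable lebesgue (\<lambda>x. indicator K x * H x)"
      by (rule integrable_indicator_of_square[OF K(1) H(1)]) (use H in auto)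
    then have d1: "integrable lebesgue (\<lambda>x. M powr (p - 1) * (indicator K x * H x))" by simp
    have m1: "(\<lambda>x. A x $ l \<bullet> gr (k + k0) x) \<in> borel_measurable lebesgue" for k
      by (intro measurable_lebesgue_continuous continuous_intros cA C1cD(2)[OF CW])
    have l1: "AE x in lebesgue. (\<lambda>k. A x $ l \<bullet> gr (k + k0) x) \<longlonglongrightarrow> A x $ l \<bullet> gl x"
      using AE
    proof eventually_elim
      case (elim x)
      show ?case
      proof (cases "x \<in> K")
        case True
        then have "(\<lambda>k. gr k x) \<longlonglongrightarrow> gl x" using elim by blast
        from LIMSEQ_ignore_initial_segment[OF this] show ?thesis by (intro tendsto_intros)
      next
        case False
        then show ?thesis using C1c_outside(2)[OF C[OF kk] False] out[OF False] by simp
      qed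
    qed
    have b1: "AE x in lebesgue. \<bar>A x $ l \<bullet> gr (k + k0) x\<bar> \<le> M powr (p - 1) * (indicator K x * H x)" for k
      using AE
    proof eventually_elim
      case (elim x)
      show ?case
      proof (cases "x \<in> K")
        case True
        then have "norm (gr (k + k0) x) \<le> H x" using elim by simp
        then show ?thesis using True nAM[of x] H(2)[of x]
          by (intro order_trans[OF Cauchy_Schwarz_ineq2]) (auto intro!: mult_mono)
      qed (use C1c_outside(2)[OF C[OF kk]] in simp)
    qed
    note L1 = dominated_convergence_lebesgue[OF m1 d1 l1 b1]
    have d2: "integrable lebesgue (\<lambda>x. indicator K x * B)" by (rule integrable_indicator_continuous[OF continuous_on_const K(1)])
    have m2: "w (k + k0) \<in> borel_measurable lebesgue" for k by (rule C1c_borel(1)[OF CW])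
    have l2: "AE x in lebesgue. (\<lambda>k. w (k + k0) x) \<longlonglongrightarrow> wl x"
      by (intro AE_I2 LIMSEQ_ignore_initial_segment wlim)
    have b2: "AE x in lebesgue. \<bar>w (k + k0) x\<bar> \<le> indicator K x * B" for k
    proof (rule AE_I2)
      fix x show "\<bar>w (k + k0) x\<bar> \<le> indicator K x * B"
        using wB[of x "r (k + k0)"] C1c_outside(1)[OF C[OF kk]] by (cases "x \<in> K") (auto simp: w_def)
    qed
    note L2 = dominated_convergence_lebesgue[OF m2 d2 l2 b2]
    have "\<tau> * (LINT x|lebesgue. wl x) \<le> (LINT x|lebesgue. A x $ l \<bullet> gl x)"
    proof (rule LIMSEQ_le[OF tendsto_mult_left[OF L2(2)] L1(2)], intro exI allI impI)
      fix k
      have "\<tau> * (LINT x|lebesgue. w (k + k0) x) = (LINT x|lebesgue. \<tau> * w (k + k0) x)" by simp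
      also have "\<dots> \<le> (LINT x|lebesgue. f x * w (k + k0) x)"
      proof (rule integral_mono)
        show "integrable lebesgue (\<lambda>x. \<tau> * w (k + k0) x)" using C1c_integrable(1)[OF CW] by simp
        show "integrable lebesgue (\<lambda>x. f x * w (k + k0) x)" by (rule eq(1)[OF CW])
        fix x
        have "w (k + k0) x \<ge> 0" by (simp add: w_def cut_nonneg)
        then show "\<tau> * w (k + k0) x \<le> f x * w (k + k0) x"
          using \<tau>(2)[of x] C1c_outside(1)[OF CW, of x] by (cases "x \<in> W") (auto intro: mult_right_mono)
      qed
      also have "\<dots> = (LINT x|lebesgue. A x $ l \<bullet> gr (k + k0) x)" by (rule eq(2)[OF CW, symmetric])
      finally show "\<tau> * (LINT x|lebesgue. w (k + k0) x) \<le> (LINT x|lebesgue. A x $ l \<bullet> gr (k + k0) x)" .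
    qed
    also have "\<dots> \<le> (LINT x|lebesgue. (\<tau> / 2) * wl x + ((Q / (2 * \<tau>)) * V x + E x))"
    proof (rule integral_mono[OF L1(1)])
      show "integrable lebesgue (\<lambda>x. (\<tau> / 2) * wl x + ((Q / (2 * \<tau>)) * V x + E x))"
        using L2(1) V E by (intro Bochner_Integration.integrable_add integrable_mult_right)
      fix x
      show "A x $ l \<bullet> gl x \<le> (\<tau> / 2) * wl x + ((Q / (2 * \<tau>)) * V x + E x)"
      proof (cases "x \<in> K")
        case False
        have "V x \<ge> 0" by (simp add: V_def)
        then have "0 \<le> (Q / (2 * \<tau>)) * V x" "0 \<le> E x" using Q \<tau> by (auto simp: E_def)
        then show ?thesis using out[OF False] by simp
      next
        case True
        define s where "s = norm (P x)"
        define \<gamma> where "\<gamma> = ?c (P x)"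
        define sl where "sl = cut_slope \<rho> \<epsilon> (P x)"
        have xR: "x \<in> Reg" using True K by blast
        then have s: "s > 0" "s \<le> M" using M by (auto simp: Reg_def s_def)
        have \<gamma>0: "\<gamma> \<ge> 0" by (simp add: \<gamma>_def cut_nonneg)
        define cg where "cg = norm (?dc (P x))"
        have cgs: "cg * s = \<bar>sl\<bar>" unfolding cg_def s_def sl_def by (rule norm_cut_grad)
        have "norm (gl x) \<le> (\<psi> x)\<^sup>2 * (cg * norm (G x)) + \<gamma> * (2 * \<bar>\<psi> x\<bar> * norm (\<psi>' x))"
          unfolding gl_def climgrad_def
          by (rule norm_triangle_mono)
            (use norm_inner_components_le[of "?dc (P x)" "G x"] \<gamma>0 in \<open>auto simp: cg_def \<gamma>_def abs_mult intro!: mult_left_mono\<close>)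
        then have "A x $ l \<bullet> gl x \<le> s powr (p - 1) * ((\<psi> x)\<^sup>2 * (cg * norm (G x)) + \<gamma> * (2 * \<bar>\<psi> x\<bar> * norm (\<psi>' x)))"
          using nA[of x] by (intro order_trans[OF norm_cauchy_schwarz] mult_mono) (auto simp: s_def)
        also have "\<dots> = (\<psi> x)\<^sup>2 * (s powr (p - 1) * cg * norm (G x)) + s powr (p - 1) * \<gamma> * (2 * \<bar>\<psi> x\<bar> * norm (\<psi>' x))"
          by (simp add: algebra_simps)
        finally have a1: "A x $ l \<bullet> gl x \<le> (\<psi> x)\<^sup>2 * (s powr (p - 1) * cg * norm (G x)) + s powr (p - 1) * \<gamma> * (2 * \<bar>\<psi> x\<bar> * norm (\<psi>' x))" .
        \<comment> \<open>The factor s^(p-2) is divided between the two sides: s^(\<rho>/2) goes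
          with the slope, where it cancels against \<open>cut_slope_square\<close>, and the rest
          goes with the second derivatives.\<close>
        define y where "y = s powr (p - 2 - \<rho> / 2) * norm (G x) / 2"
        have "s powr (p - 1) * cg * norm (G x) = 2 * (\<bar>sl\<bar> * s powr (\<rho> / 2)) * y"
        proof -
          have "s powr (\<rho> / 2) * s powr (p - 2 - \<rho> / 2) = s powr (p - 2)" by (simp add: powr_add[symmetric])
          moreover have "s powr (p - 1) = s powr (p - 2) * s"
            using s powr_add[of s "p - 2" 1] by simp
          moreover have "2 * (\<bar>sl\<bar> * s powr (\<rho> / 2)) * y = \<bar>sl\<bar> * (s powr (\<rho> / 2) * s powr (p - 2 - \<rho> / 2)) * norm (G x)"
            by (simp add: y_def)
          ultimately show ?thesis by (auto simp: cgs[symmetric])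
        qed
        \<comment> \<open>With parameter \<tau>/Q and the bound \<open>Q * \<gamma>\<close> for the
          squared first factor, that term becomes (\<tau>/2) \<gamma>, half of what stands on the
          left.\<close>
        also have "\<dots> \<le> ((\<tau> / Q) / 2) * (\<bar>sl\<bar> * s powr (\<rho> / 2))\<^sup>2 + (2 / (\<tau> / Q)) * y\<^sup>2"
          using \<tau> Q by (intro two_mult_le) simp
        finally have a2: "s powr (p - 1) * cg * norm (G x) \<le> ((\<tau> / Q) / 2) * (\<bar>sl\<bar> * s powr (\<rho> / 2))\<^sup>2 + (2 / (\<tau> / Q)) * y\<^sup>2" .
        have a3: "(\<bar>sl\<bar> * s powr (\<rho> / 2))\<^sup>2 \<le> Q * \<gamma>"
        proof -
          have "(s powr (\<rho> / 2))\<^sup>2 = s powr \<rho>" by (simp add: power2_eq_square powr_add[symmetric])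
          then have "(\<bar>sl\<bar> * s powr (\<rho> / 2))\<^sup>2 = sl\<^sup>2 * s powr \<rho>" by (simp add: power_mult_distrib)
          also have "\<dots> \<le> (Q * s powr (- \<rho>) * \<gamma>) * s powr \<rho>"
            unfolding sl_def Q_def s_def \<gamma>_def by (intro mult_right_mono cut_slope_square \<epsilon>) auto
          also have "\<dots> = Q * \<gamma>" using s by (simp add: powr_minus)
          finally show ?thesis .
        qed
        have a4: "y\<^sup>2 = (s powr (p - 2 - \<alpha>) * (norm (G x))\<^sup>2) / 4"
        proof -
          have "(s powr (p - 2 - \<rho> / 2))\<^sup>2 = s powr (p - 2 - \<alpha>)"
            unfolding power2_eq_square powr_add[symmetric] by (rule arg_cong[where f="(powr) s"]) (simp add: \<alpha>_def)
          then show ?thesis by (simp add: y_def power_mult_distrib power_divide)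
        qed
        have a5: "s powr (p - 1) * \<gamma> \<le> M powr (p - 1 - \<rho>)"
        proof -
          have "s powr (p - 1) * \<gamma> \<le> s powr (p - 1) * s powr (- \<rho>)"
            unfolding \<gamma>_def s_def by (intro mult_left_mono cut_le \<epsilon>) auto
          also have "\<dots> = s powr (p - 1 - \<rho>)" by (simp add: powr_add[symmetric])
          also have "\<dots> \<le> M powr (p - 1 - \<rho>)" using s \<rho> by (intro powr_mono2) auto
          finally show ?thesis .
        qed
        have "((\<tau> / Q) / 2) * (\<bar>sl\<bar> * s powr (\<rho> / 2))\<^sup>2 \<le> ((\<tau> / Q) / 2) * (Q * \<gamma>)"
          using a3 \<tau> Q by (intro mult_left_mono) auto
        with a2 have "s powr (p - 1) * cg * norm (G x) \<le> ((\<tau> / Q) / 2) * (Q * \<gamma>) + (2 / (\<tau> / Q)) * ((s powr (p - 2 - \<alpha>) * (norm (G x))\<^sup>2) / 4)"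
          unfolding a4 by linarith
        then have "(\<psi> x)\<^sup>2 * (s powr (p - 1) * cg * norm (G x)) \<le> (\<psi> x)\<^sup>2 * (((\<tau> / Q) / 2) * (Q * \<gamma>) + (2 / (\<tau> / Q)) * ((s powr (p - 2 - \<alpha>) * (norm (G x))\<^sup>2) / 4))"
          by (intro mult_left_mono) auto
        moreover have "s powr (p - 1) * \<gamma> * (2 * \<bar>\<psi> x\<bar> * norm (\<psi>' x)) \<le> M powr (p - 1 - \<rho>) * (2 * \<bar>\<psi> x\<bar> * norm (\<psi>' x))"
          using a5 by (intro mult_right_mono) auto
        ultimately have "A x $ l \<bullet> gl x \<le> (\<psi> x)\<^sup>2 * ((\<tau> / Q) / 2 * (Q * \<gamma>) + (2 / (\<tau> / Q)) * ((s powr (p - 2 - \<alpha>) * (norm (G x))\<^sup>2) / 4))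
            + M powr (p - 1 - \<rho>) * (2 * \<bar>\<psi> x\<bar> * norm (\<psi>' x))"
          using a1 by linarith
        also have "\<dots> = (\<tau> / 2) * wl x + ((Q / (2 * \<tau>)) * V x + E x)"
          using xR Q \<tau> by (simp add: wl_def V_def E_def \<gamma>_def s_def field_simps)
        finally show ?thesis .
      qed
    qed
    also have "\<dots> = (\<tau> / 2) * (LINT x|lebesgue. wl x) + ((Q / (2 * \<tau>)) * (LINT x|lebesgue. V x) + (LINT x|lebesgue. E x))"
      using L2(1) V E by simp
    finally have "(\<tau> / 2) * (LINT x|lebesgue. wl x) \<le> (Q / (2 * \<tau>)) * (LINT x|lebesgue. V x) + (LINT x|lebesgue. E x)" by simp
    then have "(2 / \<tau>) * ((\<tau> / 2) * (LINT x|lebesgue. wl x)) \<le> Bd"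
      unfolding Bd_def using \<tau> by (intro mult_left_mono) auto
    then have "(LINT x|lebesgue. wl x) \<le> Bd" using \<tau> by simp
    then show ?thesis using L2(1) unfolding wl_def by blast
  qed
  define F where "F k x = (\<psi> x)\<^sup>2 * tcut \<rho> (1 / real (Suc k)) (P x)" for k x
  show ?thesis
  proof (rule integrable_of_bounded_liminf[where F=F and B=Bd])
    show "integrable lebesgue (F k)" "(LINT x|lebesgue. F k x) \<le> Bd" for k
      unfolding F_def using main[of "1 / real (Suc k)"] by auto
    show "F k x \<ge> 0" for k x unfolding F_def by (intro mult_nonneg_nonneg cut_nonneg) auto
    show "(\<lambda>x. indicator Reg x * ((\<psi> x)\<^sup>2 * norm (P x) powr (- \<rho>))) \<in> borel_measurable lebesgue"
      using C1c_borel(1)[OF \<psi>] P_powr_measurable Reg(1)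
      by (intro borel_measurable_times borel_measurable_power borel_measurable_indicator) auto
    show "AE x in lebesgue. (\<lambda>k. F k x) \<longlonglongrightarrow> indicator Reg x * ((\<psi> x)\<^sup>2 * norm (P x) powr (- \<rho>))"
    proof (rule AE_I2)
      fix x
      show "(\<lambda>k. F k x) \<longlonglongrightarrow> indicator Reg x * ((\<psi> x)\<^sup>2 * norm (P x) powr (- \<rho>))"
      proof (cases "x \<in> Reg")
        case True
        then have P0: "P x \<noteq> 0" by (simp add: Reg_def)
        have "(\<lambda>k. F k x) \<longlonglongrightarrow> (\<psi> x)\<^sup>2 * norm (P x) powr (- \<rho>)"
          unfolding F_def by (intro tendsto_intros cut_tendsto P0)
        then show ?thesis using True by simp
      next
        case False
        then have "\<psi> x = 0 \<or> P x = 0" using C1c_outside(1)[OF \<psi>] by (auto simp: Reg_def)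
        then show ?thesis using False by (auto simp: F_def tcut_def)
      qed
    qed
  qed
qed

section \<open>Weak derivatives across the critical set\<close>

text \<open>\<open>F\<close> may fail to be differentiable at 0. It is multiplied by a pure
  truncation, for which the chain rule follows from \<open>composite\<close>. The gradient of the
  truncation is at most 2 / norm P, while \<open>F\<close> is of order \<kappa> + 1, so the extra
  term is dominated by the integrable function of order \<kappa> and tends to 0 pointwise; the
  critical set contributes nothing since \<open>F\<close> vanishes at 0.\<close>

lemma weak_chain_rule:
  fixes F :: "real ^ 'n ^ 'm \<Rightarrow> real" and dF :: "real ^ 'n ^ 'm \<Rightarrow> real ^ 'n ^ 'm"
  assumes F: "\<And>Q. Q \<noteq> 0 \<Longrightarrow> (F has_derivative (\<lambda>Y. dF Q \<bullet> Y)) (at Q)" "continuous_on (- {0}) dF" "continuous_on UNIV F"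
      "\<And>Q. \<bar>F Q\<bar> \<le> C * norm Q powr (\<kappa> + 1)" "\<And>Q. Q \<noteq> 0 \<Longrightarrow> norm (dF Q) \<le> C * norm Q powr \<kappa>" "C \<ge> 0"
    and int: "\<And>K. compact K \<Longrightarrow> K \<subseteq> W \<Longrightarrow> integrable lebesgue (\<lambda>x. indicator K x * (indicator Reg x * (norm (P x) powr \<kappa> * norm (G x))))"
    and \<phi>: "C1c W \<phi> \<phi>'"
  shows "(LINT x|lebesgue. F (P x) * \<phi>' x $ j) = - (LINT x|lebesgue. (indicator Reg x * (dF (P x) \<bullet> G x $ j)) * \<phi> x)"
    "integrable lebesgue (\<lambda>x. (indicator Reg x * (dF (P x) \<bullet> G x $ j)) * \<phi> x)"
proof -
  obtain L where L: "compact L" "L \<subseteq> W" "\<And>x. x \<notin> L \<Longrightarrow> \<phi> x = 0" "\<And>x. x \<notin> L \<Longrightarrow> \<phi>' x = 0"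
    using C1c_support[OF \<phi>] by blast
  obtain B\<phi> where B\<phi>: "B\<phi> > 0" "\<And>x. \<bar>\<phi> x\<bar> \<le> B\<phi>" "\<And>x. norm (\<phi>' x) \<le> B\<phi>" using C1c_bounded[OF \<phi>] by metis
  \<comment> \<open>\<open>0 powr a\<close> is 0 for every a, so the growth bound forces the value
    at the origin.\<close>
  have F0: "F 0 = 0" using F(4)[of 0] by simp
  \<comment> \<open>With exponent 0 the truncated power is a plain cutoff near the origin, tending
    to 1 off it.\<close>
  define c where "c \<epsilon> Q = F Q * tcut 0 \<epsilon> Q" for \<epsilon> and Q :: "real ^ 'n ^ 'm"
  define dc where "dc \<epsilon> Q = tcut 0 \<epsilon> Q *\<^sub>R dF Q + F Q *\<^sub>R cut_grad 0 \<epsilon> Q" for \<epsilon> and Q :: "real ^ 'n ^ 'm"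
  have cz: "c \<epsilon> Q = 0 \<and> dc \<epsilon> Q = 0" if "\<epsilon> > 0" "norm Q \<le> \<epsilon>" for \<epsilon> Q
    using cut_zero[OF that] by (simp add: c_def dc_def)
  have dcd: "(c \<epsilon> has_derivative (\<lambda>Y. dc \<epsilon> Q \<bullet> Y)) (at Q)" if e: "\<epsilon> > 0" for \<epsilon> Q
  proof (cases "Q = 0")
    case True
    have "((\<lambda>Q. 0 :: real) has_derivative (\<lambda>Y. dc \<epsilon> Q \<bullet> Y)) (at Q)" using cz[OF e, of Q] e True by simp
    then show ?thesis
      by (rule has_derivative_transform_within_open[of _ _ _ _ "ball 0 \<epsilon>"])
        (use e True cz[OF e] in \<open>auto simp: less_imp_le\<close>)
  next
    case False
    show ?thesis
      unfolding c_def
      by (rule has_derivative_eq_rhs[OF has_derivative_mult[OF F(1)[OF False] has_derivative_cut[OF e]]])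
        (auto simp: dc_def inner_add_left algebra_simps)
  qed
  have cdc: "continuous_on UNIV (dc \<epsilon>)" if e: "\<epsilon> > 0" for \<epsilon>
  proof -
    have ct: "continuous_on UNIV (tcut 0 \<epsilon> :: real ^ 'n ^ 'm \<Rightarrow> real)"
      using has_derivative_cut[OF e] by (blast intro: continuous_at_imp_continuous_on has_derivative_continuous)
    have "continuous_on (- {0}) (dc \<epsilon>)"
      unfolding dc_def by (intro continuous_intros continuous_on_subset[OF ct] F(2) continuous_on_subset[OF F(3)]
           continuous_on_subset[OF continuous_on_cut_grad[OF e]]) auto
    moreover have "continuous_on (ball 0 \<epsilon>) (dc \<epsilon>)"
      by (rule continuous_on_eq[OF continuous_on_const[of _ 0]]) (use cz[OF e] in auto)
    ultimately have "continuous_on (- {0} \<union> ball 0 \<epsilon>) (dc \<epsilon>)" by (intro continuous_on_open_Un) auto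
    moreover have "- {0} \<union> ball 0 \<epsilon> = (UNIV :: (real ^ 'n ^ 'm) set)" using e by auto
    ultimately show ?thesis by simp
  qed
  have step: "integrable lebesgue (\<lambda>x. climgrad \<phi> \<phi>' (c \<epsilon>) (dc \<epsilon>) x $ j) \<and> (LINT x|lebesgue. climgrad \<phi> \<phi>' (c \<epsilon>) (dc \<epsilon>) x $ j) = 0" if e: "\<epsilon> > 0" for \<epsilon>
  proof -
    obtain K k0 H B where K: "compact K" "K \<subseteq> Reg" and H: "H \<in> borel_measurable lebesgue" "\<And>x. H x \<ge> 0"
      "integrable lebesgue (\<lambda>x. indicator K x * (H x)\<^sup>2)" and B: "B \<ge> 0"
      and C: "\<And>k. k \<ge> k0 \<Longrightarrow> C1c K (\<lambda>x. \<phi> x * c \<epsilon> (U (r k) x)) (cgrad \<phi> \<phi>' (c \<epsilon>) (dc \<epsilon>) (r k))"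
      and wB: "\<And>n x. \<bar>\<phi> x * c \<epsilon> (U n x)\<bar> \<le> B"
      and wlim: "\<And>x. (\<lambda>k. \<phi> x * c \<epsilon> (U (r k) x)) \<longlonglongrightarrow> \<phi> x * c \<epsilon> (P x)"
      and out: "\<And>x. x \<notin> K \<Longrightarrow> \<phi> x * c \<epsilon> (P x) = 0 \<and> climgrad \<phi> \<phi>' (c \<epsilon>) (dc \<epsilon>) x = 0"
      and AE: "AE x in lebesgue. x \<in> K \<longrightarrow> (\<forall>i. (\<lambda>k. DQ (r k) i P x) \<longlonglongrightarrow> G x $ i) \<and> (\<lambda>k. cgrad \<phi> \<phi>' (c \<epsilon>) (dc \<epsilon>) (r k) x) \<longlonglongrightarrow> climgrad \<phi> \<phi>' (c \<epsilon>) (dc \<epsilon>) x \<and>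
      (\<forall>k\<ge>k0. norm (cgrad \<phi> \<phi>' (c \<epsilon>) (dc \<epsilon>) (r k) x) \<le> H x \<and> (\<forall>i. norm (DQ (r k) i P x) \<le> H x)) \<and> norm (G x) \<le> H x"
      by (rule composite[OF dcd[OF e] cdc[OF e] e cz[OF e] \<phi>], assumption, rule that)
    have kk: "k + k0 \<ge> k0" for k by simp
    have d: "integrable lebesgue (\<lambda>x. indicator K x * H x)"
      by (rule integrable_indicator_of_square[OF K(1) H(1)]) (use H in auto)
    have m: "(\<lambda>x. cgrad \<phi> \<phi>' (c \<epsilon>) (dc \<epsilon>) (r (k + k0)) x $ j) \<in> borel_measurable lebesgue" for k
      by (rule C1c_borel(3)[OF C[OF kk]])
    have l: "AE x in lebesgue. (\<lambda>k. cgrad \<phi> \<phi>' (c \<epsilon>) (dc \<epsilon>) (r (k + k0)) x $ j) \<longlonglongrightarrow> climgrad \<phi> \<phi>' (c \<epsilon>) (dc \<epsilon>) x $ j"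
      using AE
    proof eventually_elim
      case (elim x)
      show ?case
      proof (cases "x \<in> K")
        case True
        then have "(\<lambda>k. cgrad \<phi> \<phi>' (c \<epsilon>) (dc \<epsilon>) (r k) x) \<longlonglongrightarrow> climgrad \<phi> \<phi>' (c \<epsilon>) (dc \<epsilon>) x" using elim by blast
        from LIMSEQ_ignore_initial_segment[OF this] show ?thesis by (intro tendsto_intros)
      next
        case False
        then show ?thesis using C1c_outside(2)[OF C[OF kk] False] out[OF False] by simp
      qed
    qed
    have b: "AE x in lebesgue. \<bar>cgrad \<phi> \<phi>' (c \<epsilon>) (dc \<epsilon>) (r (k + k0)) x $ j\<bar> \<le> indicator K x * H x" for k
      using AE
    proof eventually_elim
      case (elim x)
      show ?case
      proof (cases "x \<in> K")
        case True
        then have "norm (cgrad \<phi> \<phi>' (c \<epsilon>) (dc \<epsilon>) (r (k + k0)) x) \<le> H x" using elim by simp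
        then show ?thesis using True component_le_norm_cart[of "cgrad \<phi> \<phi>' (c \<epsilon>) (dc \<epsilon>) (r (k + k0)) x" j] by simp
      qed (use C1c_outside(2)[OF C[OF kk]] in simp)
    qed
    note L1 = dominated_convergence_lebesgue[OF m d l b]
    have "(LINT x|lebesgue. cgrad \<phi> \<phi>' (c \<epsilon>) (dc \<epsilon>) (r (k + k0)) x $ j) = 0" for k
      by (rule integral_partial_C1c[OF C[OF kk]])
    then show ?thesis using L1 by (simp add: LIMSEQ_const_iff)
  qed
  define e where "e k = 1 / real (Suc k)" for k
  have e: "e k > 0" for k by (simp add: e_def)
  define T where "T x = \<phi> x * (indicator Reg x * (dF (P x) \<bullet> G x $ j)) + F (P x) * \<phi>' x $ j" for x
  have iF: "integrable lebesgue (\<lambda>x. F (P x) * \<phi>' x $ j)"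
    by (rule integrable_lebesgue_cc[OF _ L(1)])
      (auto simp: L(4) intro!: continuous_intros C1cD(2)[OF \<phi>] continuous_on_compose2[OF F(3) cP])
  \<comment> \<open>The constant 3 C is C from the derivative of \<open>F\<close> and 2 C from
    \<open>F\<close> times the gradient of the truncation.\<close>
  define D where "D x = (3 * C * B\<phi>) * (indicator L x * (indicator Reg x * (norm (P x) powr \<kappa> * norm (G x)))) + \<bar>F (P x) * \<phi>' x $ j\<bar>" for x
  have Di: "integrable lebesgue D"
    unfolding D_def using int[OF L(1,2)] iF by (intro Bochner_Integration.integrable_add integrable_mult_right integrable_abs)
  have m: "(\<lambda>x. climgrad \<phi> \<phi>' (c (e k)) (dc (e k)) x $ j) \<in> borel_measurable lebesgue" for k
    using step[OF e] by (auto intro: borel_measurable_integrable)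
  have lim: "AE x in lebesgue. (\<lambda>k. climgrad \<phi> \<phi>' (c (e k)) (dc (e k)) x $ j) \<longlonglongrightarrow> T x"
  proof (rule AE_I2)
    fix x
    show "(\<lambda>k. climgrad \<phi> \<phi>' (c (e k)) (dc (e k)) x $ j) \<longlonglongrightarrow> T x"
    proof (cases "P x = 0")
      case True
      have "c (e k) (P x) = 0 \<and> dc (e k) (P x) = 0" for k using cz[OF e] e[of k] True by (simp add: less_imp_le)
      then have "climgrad \<phi> \<phi>' (c (e k)) (dc (e k)) x $ j = 0" for k by (simp add: climgrad_def)
      moreover have "T x = 0" using True F0 by (simp add: T_def Reg_def)
      ultimately show ?thesis by simp
    next
      case False
      have t1: "(\<lambda>k. tcut 0 (e k) (P x)) \<longlonglongrightarrow> 1" using cut_tendsto[OF False, of 0] False by (simp add: e_def)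
      have t2: "(\<lambda>k. cut_grad 0 (e k) (P x)) \<longlonglongrightarrow> 0"
      proof -
        have "(\<lambda>k. (norm (P x) powr (- 0) * (2 * max 0 (1 - e k / norm (P x)) * (e k / norm (P x)) - 0 * (max 0 (1 - e k / norm (P x)))\<^sup>2) / (norm (P x))\<^sup>2) *\<^sub>R P x)
          \<longlonglongrightarrow> (norm (P x) powr (- 0) * (2 * max 0 (1 - 0 / norm (P x)) * (0 / norm (P x)) - 0 * (max 0 (1 - 0 / norm (P x)))\<^sup>2) / (norm (P x))\<^sup>2) *\<^sub>R P x"
          unfolding e_def by (intro tendsto_intros tendsto_inverse_Suc) (use False in auto)
        then show ?thesis by (simp add: cut_grad_def cut_slope_def)
      qed
      have "(\<lambda>k. \<phi> x * ((tcut 0 (e k) (P x) *\<^sub>R dF (P x) + F (P x) *\<^sub>R cut_grad 0 (e k) (P x)) \<bullet> G x $ j) + (F (P x) * tcut 0 (e k) (P x)) * \<phi>' x $ j)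
        \<longlonglongrightarrow> \<phi> x * ((1 *\<^sub>R dF (P x) + F (P x) *\<^sub>R 0) \<bullet> G x $ j) + (F (P x) * 1) * \<phi>' x $ j"
        by (intro tendsto_intros t1 t2)
      moreover have "\<phi> x * (dF (P x) \<bullet> G x $ j) = \<phi> x * (indicator Reg x * (dF (P x) \<bullet> G x $ j))"
        using False C1c_outside(1)[OF \<phi>] by (auto simp: Reg_def indicator_def)
      ultimately show ?thesis by (simp add: climgrad_def c_def dc_def T_def)
    qed
  qed
  have bd: "AE x in lebesgue. \<bar>climgrad \<phi> \<phi>' (c (e k)) (dc (e k)) x $ j\<bar> \<le> D x" for k
  proof (rule AE_I2)
    fix x
    have D0: "0 \<le> (3 * C * B\<phi>) * (indicator L x * (indicator Reg x * (norm (P x) powr \<kappa> * norm (G x))))"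
      using F(6) B\<phi> by (intro mult_nonneg_nonneg) auto
    show "\<bar>climgrad \<phi> \<phi>' (c (e k)) (dc (e k)) x $ j\<bar> \<le> D x"
    proof (cases "P x = 0 \<or> x \<notin> L")
      case True
      then show ?thesis
      proof
        assume "P x = 0"
        then have "c (e k) (P x) = 0 \<and> dc (e k) (P x) = 0" using cz[OF e] e[of k] by (simp add: less_imp_le)
        then show ?thesis using D0 by (simp add: climgrad_def D_def)
      next
        assume "x \<notin> L"
        then show ?thesis using L(3,4) D0 by (simp add: climgrad_def D_def)
      qed
    next
      case False
      define s where "s = norm (P x)"
      have s: "s > 0" using False by (simp add: s_def)
      have xR: "x \<in> Reg" using False L(2) by (auto simp: Reg_def)
      have t: "0 \<le> tcut 0 (e k) (P x)" "tcut 0 (e k) (P x) \<le> 1"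
        using cut_nonneg[of 0 "e k" "P x"] cut_le[OF e[of k], of 0 "P x"] False by auto
      have sl: "norm (cut_grad 0 (e k) (P x)) * s \<le> 2"
        unfolding s_def norm_cut_grad using cut_slope_bound[OF e[of k], of 0 "P x"] False by simp
      have "norm (dc (e k) (P x)) \<le> 1 * (C * s powr \<kappa>) + C * s powr (\<kappa> + 1) * norm (cut_grad 0 (e k) (P x))"
        unfolding dc_def
      proof (rule norm_triangle_mono)
        have "norm (dF (P x)) \<le> C * s powr \<kappa>" using F(5)[of "P x"] False by (simp add: s_def)
        then show "norm (tcut 0 (e k) (P x) *\<^sub>R dF (P x)) \<le> 1 * (C * s powr \<kappa>)"
          unfolding norm_scaleR using t by (intro mult_mono) auto
        show "norm (F (P x) *\<^sub>R cut_grad 0 (e k) (P x)) \<le> C * s powr (\<kappa> + 1) * norm (cut_grad 0 (e k) (P x))"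
          unfolding norm_scaleR s_def using F(4)[of "P x"] by (intro mult_right_mono) auto
      qed
      also have "C * s powr (\<kappa> + 1) * norm (cut_grad 0 (e k) (P x)) = C * s powr \<kappa> * (norm (cut_grad 0 (e k) (P x)) * s)"
        using s by (simp add: powr_add)
      also have "\<dots> \<le> C * s powr \<kappa> * 2" using sl F(6) by (intro mult_left_mono) auto
      finally have ndc: "norm (dc (e k) (P x)) \<le> 3 * C * s powr \<kappa>" by simp
      have nG: "norm (G x $ j) \<le> norm (G x)" by (rule Finite_Cartesian_Product.norm_nth_le)
      have "\<bar>dc (e k) (P x) \<bullet> G x $ j\<bar> \<le> (3 * C * s powr \<kappa>) * norm (G x)"
        using ndc nG by (intro order_trans[OF Cauchy_Schwarz_ineq2] mult_mono) (auto simp: F(6))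
      then have 1: "\<bar>\<phi> x * (dc (e k) (P x) \<bullet> G x $ j)\<bar> \<le> B\<phi> * ((3 * C * s powr \<kappa>) * norm (G x))"
        unfolding abs_mult using B\<phi> by (intro mult_mono) auto
      have 2: "\<bar>c (e k) (P x) * \<phi>' x $ j\<bar> \<le> \<bar>F (P x) * \<phi>' x $ j\<bar>"
        using t by (simp add: c_def abs_mult mult_right_mono mult_left_le)
      have "\<bar>climgrad \<phi> \<phi>' (c (e k)) (dc (e k)) x $ j\<bar> \<le> \<bar>\<phi> x * (dc (e k) (P x) \<bullet> G x $ j)\<bar> + \<bar>c (e k) (P x) * \<phi>' x $ j\<bar>"
        by (simp add: climgrad_def)
      also have "\<dots> \<le> D x" using 1 2 False xR by (simp add: D_def s_def mult_ac)
      finally show ?thesis .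
    qed
  qed
  note L2 = dominated_convergence_lebesgue[OF m Di lim bd]
  have "(LINT x|lebesgue. T x) = 0"
    using L2(2) step[OF e] by (simp add: LIMSEQ_const_iff)
  have eqT: "(\<lambda>x. (indicator Reg x * (dF (P x) \<bullet> G x $ j)) * \<phi> x) = (\<lambda>x. T x - F (P x) * \<phi>' x $ j)"
    by (auto simp: T_def)
  show "integrable lebesgue (\<lambda>x. (indicator Reg x * (dF (P x) \<bullet> G x $ j)) * \<phi> x)"
    unfolding eqT by (intro Bochner_Integration.integrable_diff L2(1) iF)
  show "(LINT x|lebesgue. F (P x) * \<phi>' x $ j) = - (LINT x|lebesgue. (indicator Reg x * (dF (P x) \<bullet> G x $ j)) * \<phi> x)"
    unfolding eqT using L2(1) iF \<open>(LINT x|lebesgue. T x) = 0\<close> by simp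
qed

end

section \<open>The differentiated equation\<close>

text \<open>The derivative of the average along v is the finite difference of \<phi> over the
  segment from x - v to x. So a difference of test functions is itself the derivative of a test
  function, with the same sup bound.\<close>

lemma has_derivative_segment_average:
  fixes \<phi> :: "real ^ 'n::finite \<Rightarrow> real"
  assumes d: "\<And>x. (\<phi> has_derivative (\<lambda>v. \<phi>' x \<bullet> v)) (at x)" and c: "continuous_on UNIV \<phi>'"
  shows "((\<lambda>x. integral (cbox 0 (1::real)) (\<lambda>t. \<phi> (x - t *\<^sub>R v))) has_derivative
     (\<lambda>z. (\<chi> j. integral (cbox 0 1) (\<lambda>t. \<phi>' (x - t *\<^sub>R v) $ j)) \<bullet> z)) (at x)"
    "integral (cbox 0 1) (\<lambda>t. \<phi>' (x - t *\<^sub>R v) \<bullet> z) = (\<chi> j. integral (cbox 0 1) (\<lambda>t. \<phi>' (x - t *\<^sub>R v) $ j)) \<bullet> z"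
    "continuous_on UNIV (\<lambda>x. (\<chi> j. integral (cbox 0 (1::real)) (\<lambda>t. \<phi>' (x - t *\<^sub>R v) $ j)))"
proof -
  define D where "D x t = blinfun_inner_left (\<phi>' (x - t *\<^sub>R v))" for x and t :: real
  have cs: "continuous_on UNIV \<phi>" 
    using d by (blast intro: continuous_at_imp_continuous_on has_derivative_continuous)
  have cD: "continuous_on (UNIV \<times> cbox 0 1) (\<lambda>(x, t). D x t)"
    unfolding D_def split_beta by (intro continuous_intros continuous_on_compose2[OF c]) auto
  have eq: "integral (cbox 0 1) (\<lambda>t. \<phi>' (x - t *\<^sub>R v) \<bullet> z) = (\<chi> j. integral (cbox 0 1) (\<lambda>t. \<phi>' (x - t *\<^sub>R v) $ j)) \<bullet> z" for x z
  proof -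
    have "integral (cbox 0 1) (\<lambda>t. \<phi>' (x - t *\<^sub>R v) \<bullet> z) = integral (cbox 0 1) (\<lambda>t. \<Sum>j\<in>UNIV. \<phi>' (x - t *\<^sub>R v) $ j * z $ j)"
      by (simp add: inner_vec_def)
    also have "\<dots> = (\<Sum>j\<in>UNIV. integral (cbox 0 1) (\<lambda>t. \<phi>' (x - t *\<^sub>R v) $ j * z $ j))"
      by (intro Henstock_Kurzweil_Integration.integral_sum integrable_continuous continuous_intros continuous_on_compose2[OF c]) auto
    also have "\<dots> = (\<chi> j. integral (cbox 0 1) (\<lambda>t. \<phi>' (x - t *\<^sub>R v) $ j)) \<bullet> z"
      by (simp add: inner_vec_def)
    finally show ?thesis .
  qed
  then show "integral (cbox 0 1) (\<lambda>t. \<phi>' (x - t *\<^sub>R v) \<bullet> z) = (\<chi> j. integral (cbox 0 1) (\<lambda>t. \<phi>' (x - t *\<^sub>R v) $ j)) \<bullet> z" .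
  have "((\<lambda>x. integral (cbox 0 (1::real)) (\<lambda>t. \<phi> (x - t *\<^sub>R v))) has_derivative 
     blinfun_apply (integral (cbox 0 1) (D x))) (at x within UNIV)"
  proof (rule leibniz_rule[OF _ _ cD])
    fix x and t :: real
    have "((\<lambda>x. \<phi> (x - t *\<^sub>R v)) has_derivative (\<lambda>z. \<phi>' (x - t *\<^sub>R v) \<bullet> z)) (at x)"
      by (rule has_derivative_compose[where f="\<lambda>x. x - t *\<^sub>R v", OF _ d, simplified]) 
        (auto intro!: derivative_eq_intros)
    then show "((\<lambda>x. \<phi> (x - t *\<^sub>R v)) has_derivative blinfun_apply (D x t)) (at x within UNIV)"
      by (rule has_derivative_eq_rhs) (simp add: D_def fun_eq_iff inner_commute)
  next
    show "(\<lambda>t. \<phi> (x - t *\<^sub>R v)) integrable_on cbox 0 1" for x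
      by (intro integrable_continuous continuous_intros continuous_on_compose2[OF cs]) auto
  qed auto
  moreover have "blinfun_apply (integral (cbox 0 1) (D x)) = (\<lambda>z. (\<chi> j. integral (cbox 0 1) (\<lambda>t. \<phi>' (x - t *\<^sub>R v) $ j)) \<bullet> z)"
  proof (rule ext)
    fix z
    have i: "D x integrable_on cbox 0 1"
      unfolding D_def by (intro integrable_continuous continuous_intros continuous_on_compose2[OF c]) auto
    have "blinfun_apply (integral (cbox 0 1) (D x)) z = integral (cbox 0 1) (\<lambda>t. D x t z)"
      by (rule blinfun_apply_integral[OF i])
    also have "\<dots> = integral (cbox 0 1) (\<lambda>t. \<phi>' (x - t *\<^sub>R v) \<bullet> z)" by (simp add: D_def inner_commute)
    finally show "blinfun_apply (integral (cbox 0 1) (D x)) z = (\<chi> j. integral (cbox 0 1) (\<lambda>t. \<phi>' (x - t *\<^sub>R v) $ j)) \<bullet> z"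
      unfolding eq .
  qed
  ultimately show "((\<lambda>x. integral (cbox 0 (1::real)) (\<lambda>t. \<phi> (x - t *\<^sub>R v))) has_derivative
     (\<lambda>z. (\<chi> j. integral (cbox 0 1) (\<lambda>t. \<phi>' (x - t *\<^sub>R v) $ j)) \<bullet> z)) (at x)" by simp
  show "continuous_on UNIV (\<lambda>x. (\<chi> j. integral (cbox 0 (1::real)) (\<lambda>t. \<phi>' (x - t *\<^sub>R v) $ j)))"
  proof (intro continuous_on_vec_lambda integral_continuous_on_param)
    show "continuous_on (UNIV \<times> cbox 0 1) (\<lambda>(x, t). \<phi>' (x - t *\<^sub>R v) $ j)" for j
      unfolding split_beta by (intro continuous_intros continuous_on_compose2[OF c]) auto
  qed
qed

text \<open>A change of variables moves the quotient from \<open>a\<close> to the test function,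
  where it is the negative of the i-th derivative of the segment average \<zeta>. The equation
  followed by the weak derivative \<open>h\<close> of \<open>f\<close> turns the integral into that
  of \<open>h x * \<zeta> x\<close>, and \<zeta> obeys the same sup bound as \<phi>: neither the
  step nor the gradient of \<phi> enters.\<close>

lemma difference_test:
  fixes a :: "real ^ 'n::finite \<Rightarrow> real ^ 'n" and f h :: "real ^ 'n \<Rightarrow> real"
  assumes W: "open W" and ca: "continuous_on UNIV a"
    and E: "\<And>\<phi> \<phi>'. C1c W \<phi> \<phi>' \<Longrightarrow> (LINT x|lebesgue. a x \<bullet> \<phi>' x) = (LINT x|lebesgue. f x * \<phi> x)"
      "\<And>\<phi> \<phi>'. C1c W \<phi> \<phi>' \<Longrightarrow> integrable lebesgue (\<lambda>x. f x * \<phi> x)"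
    and D: "\<And>\<phi> \<phi>'. C1c W \<phi> \<phi>' \<Longrightarrow> (LINT x|lebesgue. f x * \<phi>' x $ i) = - (LINT x|lebesgue. h x * \<phi> x)"
    and h: "integrable lebesgue h" and K: "compact K" "K \<subseteq> W"
  shows "\<exists>N. \<forall>n\<ge>N. \<forall>\<phi> \<phi>' B. C1c K \<phi> \<phi>' \<longrightarrow> (\<forall>x. \<bar>\<phi> x\<bar> \<le> B) \<longrightarrow> \<bar>LINT x|lebesgue. DQ n i a x \<bullet> \<phi>' x\<bar> \<le> B * (LINT x|lebesgue. \<bar>h x\<bar>)"
proof -
  obtain e0 where e0: "e0 > 0" "(\<Union>x\<in>K. ball x e0) \<subseteq> W"
    using compact_subset_open_imp_ball_epsilon_subset[OF K(1) W K(2)] by metis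
  define e where "e = e0 / 2"
  \<comment> \<open>For steps below \<open>e\<close> both the translate and the segment average are
    supported in this compact subset of \<open>W\<close>, hence admissible.\<close>
  define L where "L = {x + y |x y. x \<in> K \<and> y \<in> cball 0 e}"
  have L: "compact L" unfolding L_def by (rule compact_thicken[OF K(1)])
  have LW: "L \<subseteq> W"
  proof
    fix z assume "z \<in> L"
    then obtain x y where xy: "z = x + y" "x \<in> K" "norm y \<le> e" by (auto simp: L_def)
    then have "z \<in> ball x e0" using e0(1) by (simp add: dist_norm e_def)
    then show "z \<in> W" using e0(2) xy(2) by blast
  qed
  have "e > 0" using e0 by (simp add: e_def)
  then obtain N where N: "\<And>n. n \<ge> N \<Longrightarrow> 1 / real (Suc n) < e"
    using order_tendstoD(2)[OF tendsto_inverse_Suc] by (auto simp: eventually_sequentially simp del: of_nat_Suc)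
  have "\<bar>LINT x|lebesgue. DQ n i a x \<bullet> \<phi>' x\<bar> \<le> B * (LINT x|lebesgue. \<bar>h x\<bar>)"
    if n: "n \<ge> N" and \<phi>: "C1c K \<phi> \<phi>'" and B: "\<And>x. \<bar>\<phi> x\<bar> \<le> B" for n \<phi> \<phi>' B
  proof -
    define t where "t = 1 / real (Suc n)"
    define v where "v = t *\<^sub>R (axis i 1 :: real ^ 'n)"
    have t: "t > 0" "t < e" "norm v = t" using N[OF n] by (auto simp: t_def v_def norm_axis_1)
    note c = C1cD(2,3)[OF \<phi>] ca
    have shiftL: "x \<notin> L \<Longrightarrow> x - s *\<^sub>R v \<notin> K" if "0 \<le> s" "s \<le> 1" for x s
    proof
      assume x: "x \<notin> L" "x - s *\<^sub>R v \<in> K"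
      have "s * t \<le> 1 * t" using that t by (intro mult_right_mono) auto
      moreover have "norm (s *\<^sub>R v) = s * t" using that t by simp
      ultimately have "norm (s *\<^sub>R v) \<le> e" using t by linarith
      then have "(x - s *\<^sub>R v) + s *\<^sub>R v \<in> L" unfolding L_def using x(2) by (intro CollectI exI[of _ "x - s *\<^sub>R v"] exI[of _ "s *\<^sub>R v"]) auto
      then show False using x(1) by simp
    qed
    have out: "\<phi> x = 0" "\<phi>' x = 0" if "x \<notin> K" for x using C1c_outside[OF \<phi> that] by auto
    have C\<phi>: "C1c W \<phi> \<phi>'" by (rule C1c_mono[OF \<phi> K(2)])
    have C\<phi>v: "C1c W (\<lambda>x. \<phi> (x - v)) (\<lambda>x. \<phi>' (x - v))"
    proof (rule C1cI[OF _ _ L LW])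
      show "((\<lambda>x. \<phi> (x - v)) has_derivative (\<lambda>z. \<phi>' (x - v) \<bullet> z)) (at x)" for x
        by (rule has_derivative_compose[where f="\<lambda>x. x - v", OF _ C1cD(1)[OF \<phi>], simplified]) (auto intro!: derivative_eq_intros)
      show "continuous_on UNIV (\<lambda>x. \<phi>' (x - v))" by (intro continuous_on_compose2[OF c(1)] continuous_intros) auto
    qed (use shiftL[of 1] out in auto)
    define \<zeta> where "\<zeta> x = integral (cbox 0 (1::real)) (\<lambda>t. \<phi> (x - t *\<^sub>R v))" for x
    define \<zeta>' where "\<zeta>' x = (\<chi> j. integral (cbox 0 (1::real)) (\<lambda>t. \<phi>' (x - t *\<^sub>R v) $ j))" for x
    note sa = has_derivative_segment_average[OF C1cD(1)[OF \<phi>] c(1), where v=v, folded \<zeta>_def \<zeta>'_def]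
    have C\<zeta>: "C1c W \<zeta> \<zeta>'"
    proof (rule C1cI[OF sa(1,3) L LW])
      fix x assume "x \<notin> L"
      then have z: "\<phi> (x - t *\<^sub>R v) = 0" "\<phi>' (x - t *\<^sub>R v) = 0" if "t \<in> cbox 0 1" for t
        using shiftL[of t x] out that by auto
      have "((\<lambda>t. \<phi> (x - t *\<^sub>R v)) has_integral 0) (cbox 0 1)"
        by (rule has_integral_is_0) (rule z(1))
      moreover have "((\<lambda>t. \<phi>' (x - t *\<^sub>R v) $ j) has_integral 0) (cbox 0 1)" for j
        by (rule has_integral_is_0) (simp only: z(2) zero_index)
      ultimately show "\<zeta> x = 0" "\<zeta>' x = 0" unfolding \<zeta>_def \<zeta>'_def vec_eq_iff by (simp_all add: integral_unique)
    qed
    have B0: "B \<ge> 0" using B[of undefined] abs_ge_zero order_trans by blast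
    have \<zeta>B: "\<bar>\<zeta> x\<bar> \<le> B" for x
    proof -
      have "(\<lambda>t. \<phi> (x - t *\<^sub>R v)) integrable_on cbox 0 (1::real)"
        by (intro integrable_continuous continuous_intros continuous_on_compose2[OF c(2)]) auto
      from has_integral_bound[OF B0 integrable_integral[OF this]]
      have "norm (integral (cbox 0 (1::real)) (\<lambda>t. \<phi> (x - t *\<^sub>R v))) \<le> B * measure lborel (cbox 0 (1::real))"
        using B by simp
      then show ?thesis by (simp add: \<zeta>_def)
    qed
    have ftc: "\<phi> (x - v) - \<phi> x = - (t * \<zeta>' x $ i)" for x
    proof -
      have "((\<lambda>s. - (\<phi>' (x - s *\<^sub>R v) \<bullet> v)) has_integral (\<phi> (x - 1 *\<^sub>R v) - \<phi> (x - 0 *\<^sub>R v))) {0..1}"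
      proof (rule fundamental_theorem_of_calculus)
        fix s :: real
        have "((\<lambda>s. \<phi> (x - s *\<^sub>R v)) has_derivative (\<lambda>z. \<phi>' (x - s *\<^sub>R v) \<bullet> (- (z *\<^sub>R v)))) (at s within {0..1})"
          by (rule has_derivative_compose[where f="\<lambda>s. x - s *\<^sub>R v", OF _ C1cD(1)[OF \<phi>]]) (auto intro!: derivative_eq_intros)
        then show "((\<lambda>s. \<phi> (x - s *\<^sub>R v)) has_vector_derivative - (\<phi>' (x - s *\<^sub>R v) \<bullet> v)) (at s within {0..1})"
          unfolding has_vector_derivative_def by (rule has_derivative_eq_rhs) auto
      qed simp
      then have "\<phi> (x - v) - \<phi> x = integral (cbox 0 1) (\<lambda>s. - (\<phi>' (x - s *\<^sub>R v) \<bullet> v))"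
        by (auto dest: integral_unique)
      also have "\<dots> = - (\<zeta>' x \<bullet> v)" by (simp only: sa(2) integral_neg)
      finally show ?thesis by (simp add: v_def inner_axis)
    qed
    have i1: "integrable lebesgue (\<lambda>x. a (v + x) \<bullet> \<phi>' x)" "integrable lebesgue (\<lambda>x. a x \<bullet> \<phi>' x)"
      by (rule integrable_lebesgue_cc[OF _ K(1)]; auto simp: out intro!: continuous_intros c continuous_on_compose2[OF ca])+
    have tr: "(LINT x|lebesgue. a (v + x) \<bullet> \<phi>' x) = (LINT x|lebesgue. a x \<bullet> \<phi>' (x - v))"
    proof -
      have "continuous_on UNIV (\<lambda>x. a x \<bullet> \<phi>' (x - v))" by (intro continuous_intros c continuous_on_compose2[OF c(1)]) auto
      from integral_lebesgue_translate[OF this, of v] show ?thesis by simp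
    qed
    have "(LINT x|lebesgue. DQ n i a x \<bullet> \<phi>' x) = (LINT x|lebesgue. real (Suc n) * (a (v + x) \<bullet> \<phi>' x - a x \<bullet> \<phi>' x))"
      by (simp add: DQ_def v_def t_def inner_diff_left del: of_nat_Suc)
    also have "\<dots> = real (Suc n) * ((LINT x|lebesgue. a (v + x) \<bullet> \<phi>' x) - (LINT x|lebesgue. a x \<bullet> \<phi>' x))"
      using i1 by (simp del: of_nat_Suc)
    also have "\<dots> = real (Suc n) * ((LINT x|lebesgue. f x * \<phi> (x - v)) - (LINT x|lebesgue. f x * \<phi> x))"
      unfolding tr using E(1)[OF C\<phi>] E(1)[OF C\<phi>v] by simp
    also have "\<dots> = real (Suc n) * (LINT x|lebesgue. f x * (\<phi> (x - v) - \<phi> x))"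
      using E(2)[OF C\<phi>] E(2)[OF C\<phi>v] by (simp add: right_diff_distrib del: of_nat_Suc)
    also have "\<dots> = real (Suc n) * (LINT x|lebesgue. (- t) * (f x * \<zeta>' x $ i))"
      unfolding ftc by (simp add: mult.left_commute)
    also have "\<dots> = - (LINT x|lebesgue. f x * \<zeta>' x $ i)" by (simp add: t_def)
    also have "\<dots> = (LINT x|lebesgue. h x * \<zeta> x)" using D[OF C\<zeta>] by simp
    also have "\<bar>\<dots>\<bar> \<le> (LINT x|lebesgue. B * \<bar>h x\<bar>)"
    proof (rule integral_abs_bound_integral)
      show "integrable lebesgue (\<lambda>x. h x * \<zeta> x)"
      proof (rule Bochner_Integration.integrable_bound[where f="\<lambda>x. B * h x"])
        show "integrable lebesgue (\<lambda>x. B * h x)" using h by simp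
        show "(\<lambda>x. h x * \<zeta> x) \<in> borel_measurable lebesgue"
          using borel_measurable_integrable[OF h] C1c_borel(1)[OF C\<zeta>] by (intro borel_measurable_times)
        show "AE x in lebesgue. norm (h x * \<zeta> x) \<le> norm (B * h x)"
          using \<zeta>B B0 by (intro AE_I2) (simp add: abs_mult mult.commute[of B] mult_left_mono)
      qed
      show "integrable lebesgue (\<lambda>x. B * \<bar>h x\<bar>)" using h by simp
      show "\<bar>h x * \<zeta> x\<bar> \<le> B * \<bar>h x\<bar>" for x using \<zeta>B[of x] by (simp add: abs_mult mult.commute[of B] mult_left_mono)
    qed
    also have "\<dots> = B * (LINT x|lebesgue. \<bar>h x\<bar>)" by simp
    finally show ?thesis .
  qed
  then show ?thesis by blast
qed

section \<open>From integral bounds to Sobolev membership\<close>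

lemma continuous_Lp:
  fixes g :: "real ^ 'n::finite \<Rightarrow> real"
  assumes "continuous_on \<Omega> g" "open \<Omega>'" "compact (closure \<Omega>')" "closure \<Omega>' \<subseteq> \<Omega>" "q > 0"
  shows "g \<in> Lp q \<Omega>'"
proof -
  have c: "continuous_on (closure \<Omega>') g" using assms(1,4) by (rule continuous_on_subset)
  have "continuous_on (closure \<Omega>') (\<lambda>x. \<bar>g x\<bar> powr q)"
    using assms(5) by (intro continuous_on_powr' continuous_intros c) auto
  then have "integrable lborel (\<lambda>x. indicator (closure \<Omega>') x *\<^sub>R (\<bar>g x\<bar> powr q))"
    by (rule borel_integrable_compact[OF assms(3)])
  then have "integrable lebesgue (\<lambda>x. indicator (closure \<Omega>') x *\<^sub>R (\<bar>g x\<bar> powr q))"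
    by (simp add: integrable_completion borel_measurable_integrable)
  from integrable_mult_indicator[OF open_lebesgue[OF assms(2)] this]
  have "integrable lebesgue (\<lambda>x. indicator \<Omega>' x *\<^sub>R (\<bar>g x\<bar> powr q))"
    by (rule back_subst[of "integrable lebesgue"]) (use closure_subset in \<open>auto simp: fun_eq_iff indicator_def\<close>)
  then have "integrable (lebesgue_on \<Omega>') (\<lambda>x. \<bar>g x\<bar> powr q)"
    using assms(2) by (subst integrable_restrict_space) auto
  moreover have "g \<in> borel_measurable (lebesgue_on \<Omega>')"
  proof -
    have "continuous_on \<Omega>' g" using c closure_subset by (rule continuous_on_subset)
    then show ?thesis using assms(2) by (intro continuous_imp_measurable_on_sets_lebesgue) auto
  qed
  ultimately show ?thesis by (simp add: Lp_def)
qed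

lemma le_1_plus_powr: "t \<le> 1 + t powr q" if "t \<ge> 0" "q \<ge> 1" for t q :: real
proof (cases "t \<le> 1")
  case True
  then show ?thesis by (simp add: add_increasing2)
next
  case False
  then have "t powr 1 \<le> t powr q" using that by (intro powr_mono) auto
  then show ?thesis using False by simp
qed

context flux_limit
begin

lemma Reg_measurable: "Reg \<in> sets lebesgue" using Reg(1) by auto

lemma indicator_Reg_measurable: "f \<in> borel_measurable lebesgue \<Longrightarrow> (\<lambda>x. indicator Reg x * f x) \<in> borel_measurable lebesgue"
  for f :: "real ^ 'n \<Rightarrow> real"
  by (intro borel_measurable_times borel_measurable_indicator Reg_measurable)

lemma integrable_of_cutoff:
  fixes f :: "real ^ 'n \<Rightarrow> real"
  assumes "\<And>\<psi> \<psi>'. C1c W \<psi> \<psi>' \<Longrightarrow> integrable lebesgue (\<lambda>x. indicator Reg x * ((\<psi> x)\<^sup>2 * f x))"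
    and K: "compact K" "K \<subseteq> W"
  shows "integrable lebesgue (\<lambda>x. indicator K x * (indicator Reg x * f x))"
proof -
  obtain \<psi> \<psi>' where \<psi>: "C1c W \<psi> \<psi>'" "\<And>x. x \<in> K \<Longrightarrow> \<psi> x = 1"
    using C1c_cutoff[OF K(1) W K(2)] by metis
  have eq: "(\<lambda>x. indicator K x * (indicator Reg x * f x)) = (\<lambda>x. indicator K x *\<^sub>R (indicator Reg x * ((\<psi> x)\<^sup>2 * f x)))"
    using \<psi>(2) by (auto simp: fun_eq_iff indicator_def)
  show ?thesis unfolding eq by (rule integrable_mult_indicator[OF compact_sets_lebesgue[OF K(1)] assms(1)[OF \<psi>(1)]])
qed

text \<open>The exponent \<kappa> = p - 2 measures the derivative of the flux, and \<kappa> = 0 that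
  of the gradient itself; on \<open>Reg\<close> the factor \<open>norm (P x) powr 0\<close> is
  1.\<close>

definition hessian_bound :: "real \<Rightarrow> real \<Rightarrow> bool" where
  "hessian_bound \<kappa> q \<longleftrightarrow> (\<forall>K. compact K \<and> K \<subseteq> W \<longrightarrow>
     integrable lebesgue (\<lambda>x. indicator K x * (indicator Reg x * (norm (P x) powr \<kappa> * norm (G x)) powr q)))"

lemma power_G_measurable: "(\<lambda>x. (norm (P x) powr \<kappa> * norm (G x)) powr q) \<in> borel_measurable lebesgue"
  using P_powr_measurable[of \<kappa>] G_norm_measurable by measurable

text \<open>The inequality between the exponents says that the weight wanted here exceeds the one of
  the weighted estimate by a nonnegative power of the bounded quantity
  \<open>norm (P x)\<close>.\<close>

lemma hessian_bound_square:
  assumes \<alpha>: "0 \<le> \<alpha>" "\<alpha> < 1" "\<alpha> < p - 1" and \<kappa>: "p - 2 - \<alpha> \<le> 2 * \<kappa>"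
  shows "hessian_bound \<kappa> 2"
  unfolding hessian_bound_def
proof (intro allI impI)
  fix K assume K: "compact K \<and> K \<subseteq> W"
  obtain M where M: "M > 0" "\<And>x. norm (P x) \<le> M" using P_bounded by metis
  define f where "f x = norm (P x) powr (p - 2 - \<alpha>) * (norm (G x))\<^sup>2" for x
  have i: "integrable lebesgue (\<lambda>x. indicator K x * (indicator Reg x * f x))"
    using integrable_of_cutoff[of f K] weighted_estimate[OF \<alpha>] K unfolding f_def by (simp add: mult.assoc)
  show "integrable lebesgue (\<lambda>x. indicator K x * (indicator Reg x * (norm (P x) powr \<kappa> * norm (G x)) powr 2))"
  proof (rule Bochner_Integration.integrable_bound[where f="\<lambda>x. M powr (2 * \<kappa> - (p - 2 - \<alpha>)) * (indicator K x * (indicator Reg x * f x))"])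
    show "integrable lebesgue (\<lambda>x. M powr (2 * \<kappa> - (p - 2 - \<alpha>)) * (indicator K x * (indicator Reg x * f x)))" using i by simp
    show "(\<lambda>x. indicator K x * (indicator Reg x * (norm (P x) powr \<kappa> * norm (G x)) powr 2)) \<in> borel_measurable lebesgue"
      using K by (intro borel_measurable_times borel_measurable_indicator indicator_Reg_measurable power_G_measurable compact_sets_lebesgue Reg_measurable) auto
    show "AE x in lebesgue. norm (indicator K x * (indicator Reg x * (norm (P x) powr \<kappa> * norm (G x)) powr 2))
       \<le> norm (M powr (2 * \<kappa> - (p - 2 - \<alpha>)) * (indicator K x * (indicator Reg x * f x)))"
    proof (rule AE_I2)
      fix x
      define s where "s = norm (P x)"
      have s: "0 \<le> s" "s \<le> M" using M by (auto simp: s_def)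
      have "(s powr \<kappa> * norm (G x)) powr 2 = s powr (2 * \<kappa>) * (norm (G x))\<^sup>2"
        by (simp add: powr_mult powr_powr powr_numeral[symmetric] mult.commute del: powr_numeral)
      also have "s powr (2 * \<kappa>) = s powr (2 * \<kappa> - (p - 2 - \<alpha>)) * s powr (p - 2 - \<alpha>)" by (simp add: powr_add[symmetric])
      also have "s powr (2 * \<kappa> - (p - 2 - \<alpha>)) * s powr (p - 2 - \<alpha>) * (norm (G x))\<^sup>2 \<le> M powr (2 * \<kappa> - (p - 2 - \<alpha>)) * s powr (p - 2 - \<alpha>) * (norm (G x))\<^sup>2"
        using s \<kappa> by (intro mult_right_mono powr_mono2) auto
      finally have "(s powr \<kappa> * norm (G x)) powr 2 \<le> M powr (2 * \<kappa> - (p - 2 - \<alpha>)) * f x" by (simp add: f_def s_def)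
      moreover have "f x \<ge> 0" by (simp add: f_def)
      ultimately show "norm (indicator K x * (indicator Reg x * (norm (P x) powr \<kappa> * norm (G x)) powr 2))
         \<le> norm (M powr (2 * \<kappa> - (p - 2 - \<alpha>)) * (indicator K x * (indicator Reg x * f x)))"
        by (auto simp: indicator_def s_def)
    qed
  qed
qed

text \<open>The power \<open>norm (G x) powr q\<close> is a geometric mean, with exponents q/2 and 1
  - q/2, of two functions known to be integrable, and hence is at most their sum.\<close>

lemma hessian_bound_inverse:
  fixes f :: "real ^ 'n \<Rightarrow> real"
  assumes eq: "\<And>\<phi> \<phi>'. C1c W \<phi> \<phi>' \<Longrightarrow> integrable lebesgue (\<lambda>x. f x * \<phi> x)"
      "\<And>\<phi> \<phi>'. C1c W \<phi> \<phi>' \<Longrightarrow> (LINT x|lebesgue. A x $ l \<bullet> \<phi>' x) = (LINT x|lebesgue. f x * \<phi> x)"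
    and \<tau>: "\<tau> > 0" "\<And>x. x \<in> W \<Longrightarrow> f x \<ge> \<tau>" and q: "p \<ge> 3" "1 \<le> q" "q < (p - 1) / (p - 2)"
  shows "hessian_bound 0 q"
  unfolding hessian_bound_def
proof (intro allI impI)
  fix K assume K: "compact K \<and> K \<subseteq> W"
  define \<rho> where "\<rho> = (p - 2) * q"
  have q1: "(p - 2) * q < p - 1" using q by (simp add: pos_less_divide_eq mult.commute)
  \<comment> \<open>The bound on \<open>q\<close> says (p-2)(q-1) < 1, and p - 2 \<ge> 1 then gives
    q < 2, which the exponent 1 - q/2 requires.\<close>
  have "1 * (q - 1) \<le> (p - 2) * (q - 1)" using q by (intro mult_right_mono) auto
  then have q2: "q < 2" using q1 by (simp add: algebra_simps)
  have "(p - 2) * 1 \<le> (p - 2) * q" using q by (intro mult_left_mono) auto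
  then have \<rho>: "p - 2 \<le> \<rho>" "\<rho> < p - 1" "p \<ge> 2" using q1 q by (auto simp: \<rho>_def)
  define \<alpha> where "\<alpha> = \<rho> + 2 - p"
  have \<alpha>: "0 \<le> \<alpha>" "\<alpha> < 1" "\<alpha> < p - 1" using \<rho> by (auto simp: \<alpha>_def)
  define f1 where "f1 x = norm (P x) powr (p - 2 - \<alpha>) * (norm (G x))\<^sup>2" for x
  define f2 where "f2 x = norm (P x) powr (- \<rho>)" for x
  have i1: "integrable lebesgue (\<lambda>x. indicator K x * (indicator Reg x * f1 x))"
    using integrable_of_cutoff[of f1 K] weighted_estimate[OF \<alpha>] K unfolding f1_def by (simp add: mult.assoc)
  have i2: "integrable lebesgue (\<lambda>x. indicator K x * (indicator Reg x * f2 x))"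
    using integrable_of_cutoff[of f2 K] inverse_power_estimate[OF eq \<tau> \<rho>] K unfolding f2_def by simp
  show "integrable lebesgue (\<lambda>x. indicator K x * (indicator Reg x * (norm (P x) powr 0 * norm (G x)) powr q))"
  proof (rule Bochner_Integration.integrable_bound[OF Bochner_Integration.integrable_add[OF i1 i2]])
    show "(\<lambda>x. indicator K x * (indicator Reg x * (norm (P x) powr 0 * norm (G x)) powr q)) \<in> borel_measurable lebesgue"
      using K by (intro borel_measurable_times borel_measurable_indicator indicator_Reg_measurable power_G_measurable compact_sets_lebesgue Reg_measurable) auto
    show "AE x in lebesgue. norm (indicator K x * (indicator Reg x * (norm (P x) powr 0 * norm (G x)) powr q))
       \<le> norm (indicator K x * (indicator Reg x * f1 x) + indicator K x * (indicator Reg x * f2 x))"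
    proof (rule AE_I2)
      fix x
      show "norm (indicator K x * (indicator Reg x * (norm (P x) powr 0 * norm (G x)) powr q))
       \<le> norm (indicator K x * (indicator Reg x * f1 x) + indicator K x * (indicator Reg x * f2 x))"
      proof (cases "x \<in> K \<inter> Reg")
        case True
        define s where "s = norm (P x)"
        have s: "s > 0" using True by (auto simp: s_def Reg_def)
        have f0: "f1 x \<ge> 0" "f2 x \<ge> 0" by (auto simp: f1_def f2_def)
        define m where "m = max (f1 x) (f2 x)"
        have "norm (G x) powr q = (f1 x) powr (q / 2) * (f2 x) powr (1 - q / 2)"
        proof -
          have a1: "(f1 x) powr (q / 2) = s powr ((p - 2 - \<alpha>) * (q / 2)) * norm (G x) powr q"
            by (simp add: f1_def s_def powr_mult powr_powr powr_numeral[symmetric] del: powr_numeral)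
          have a2: "(f2 x) powr (1 - q / 2) = s powr (- \<rho> * (1 - q / 2))" by (simp add: f2_def s_def powr_powr)
          \<comment> \<open>By the choice of \<rho> and \<alpha> the weights in \<open>f1\<close>
            and \<open>f2\<close> are s^((p-2)(2-q)) and s^(-(p-2)q), so the powers of s cancel in
            the geometric mean.\<close>
          have "(p - 2 - \<alpha>) * (q / 2) + (- \<rho> * (1 - q / 2)) = 0"
            by (simp add: \<alpha>_def \<rho>_def algebra_simps)
          then have "s powr ((p - 2 - \<alpha>) * (q / 2)) * s powr (- \<rho> * (1 - q / 2)) = 1"
            by (simp only: powr_add[symmetric]) (use s in simp)
          then have "norm (G x) powr q = (s powr ((p - 2 - \<alpha>) * (q / 2)) * s powr (- \<rho> * (1 - q / 2))) * norm (G x) powr q"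
            by (simp only: mult_1_left)
          then show ?thesis unfolding a1 a2 by (simp only: mult_ac)
        qed
        also have "\<dots> \<le> m powr (q / 2) * m powr (1 - q / 2)"
          using f0 q q2 by (intro mult_mono powr_mono2) (auto simp: m_def)
        also have "\<dots> = m powr 1" by (subst powr_add[symmetric]) simp
        also have "\<dots> \<le> f1 x + f2 x" using f0 by (auto simp: m_def max_def)
        finally show ?thesis using True s f0 by (auto simp: s_def)
      qed (auto simp: indicator_def)
    qed
  qed
qed

lemma hessian_bound_first_power:
  assumes "hessian_bound \<kappa> q" "q \<ge> 1" "compact K" "K \<subseteq> W"
  shows "integrable lebesgue (\<lambda>x. indicator K x * (indicator Reg x * (norm (P x) powr \<kappa> * norm (G x))))"
proof (rule Bochner_Integration.integrable_bound[where f="\<lambda>x. indicator K x * 1 + indicator K x * (indicator Reg x * (norm (P x) powr \<kappa> * norm (G x)) powr q)"])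
  show "integrable lebesgue (\<lambda>x. indicator K x * 1 + indicator K x * (indicator Reg x * (norm (P x) powr \<kappa> * norm (G x)) powr q))"
    using assms(1,3,4) integrable_indicator_continuous[OF continuous_on_const assms(3)]
    by (intro Bochner_Integration.integrable_add) (auto simp: hessian_bound_def)
  show "(\<lambda>x. indicator K x * (indicator Reg x * (norm (P x) powr \<kappa> * norm (G x)))) \<in> borel_measurable lebesgue"
    using assms(3) by (intro borel_measurable_times borel_measurable_indicator P_powr_measurable G_norm_measurable compact_sets_lebesgue Reg_measurable)
  show "AE x in lebesgue. norm (indicator K x * (indicator Reg x * (norm (P x) powr \<kappa> * norm (G x))))
    \<le> norm (indicator K x * 1 + indicator K x * (indicator Reg x * (norm (P x) powr \<kappa> * norm (G x)) powr q))"
  proof (rule AE_I2)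
    fix x
    have "norm (P x) powr \<kappa> * norm (G x) \<le> 1 + (norm (P x) powr \<kappa> * norm (G x)) powr q"
      using assms(2) by (intro le_1_plus_powr) auto
    then show "norm (indicator K x * (indicator Reg x * (norm (P x) powr \<kappa> * norm (G x))))
    \<le> norm (indicator K x * 1 + indicator K x * (indicator Reg x * (norm (P x) powr \<kappa> * norm (G x)) powr q))"
      by (auto simp: indicator_def)
  qed
qed

text \<open>\<open>F\<close> will be an entry of the flux or of the matrix itself. The last
  conclusion keeps the identity for C^1 test functions on \<open>W\<close>, which allows it to serve
  as the second of two successive integrations by parts.\<close>

lemma weak_derivative_composition:
  fixes F :: "real ^ 'n ^ 'm \<Rightarrow> real" and dF :: "real ^ 'n ^ 'm \<Rightarrow> real ^ 'n ^ 'm"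
  assumes F: "\<And>Q. Q \<noteq> 0 \<Longrightarrow> (F has_derivative (\<lambda>Y. dF Q \<bullet> Y)) (at Q)" "continuous_on (- {0}) dF" "continuous_on UNIV F"
      "\<And>Q. \<bar>F Q\<bar> \<le> C * norm Q powr (\<kappa> + 1)" "\<And>Q. Q \<noteq> 0 \<Longrightarrow> norm (dF Q) \<le> C * norm Q powr \<kappa>" "C \<ge> 0"
    and hb: "hessian_bound \<kappa> q" "q \<ge> 1" and \<Omega>': "open \<Omega>'" "compact (closure \<Omega>')" "closure \<Omega>' \<subseteq> W"
    and g: "\<And>x. x \<in> W \<Longrightarrow> g x = F (P x)"
  defines "h \<equiv> \<lambda>j x. indicator Reg x * (dF (P x) \<bullet> G x $ j)"
  shows "has_weak_deriv \<Omega>' [j] g (h j)" "h j \<in> Lp q \<Omega>'" "g \<in> Lp q \<Omega>'" "g \<in> locally_integrable \<Omega>'"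
    "\<And>\<phi> \<phi>'. C1c W \<phi> \<phi>' \<Longrightarrow> (LINT x|lebesgue. g x * \<phi>' x $ j) = - (LINT x|lebesgue. h j x * \<phi> x)"
proof -
  have sub: "\<Omega>' \<subseteq> W" using \<Omega>'(3) closure_subset by blast
  have cF: "continuous_on UNIV (\<lambda>x. F (P x))" by (intro continuous_on_compose2[OF F(3) cP]) auto
  have cg: "continuous_on W g" by (rule continuous_on_eq[OF continuous_on_subset[OF cF subset_UNIV]]) (simp add: g)
  show gl: "g \<in> locally_integrable \<Omega>'" by (rule continuous_locally_integrable[OF continuous_on_subset[OF cg sub]])
  show "g \<in> Lp q \<Omega>'" by (rule continuous_Lp[OF cg \<Omega>']) (use hb(2) in simp)
  have hm: "h j \<in> borel_measurable lebesgue"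
  proof -
    have "continuous_on Reg (\<lambda>x. dF (P x))"
      by (rule continuous_on_compose2[OF F(2) continuous_on_subset[OF cP subset_UNIV]]) (auto simp: Reg_def)
    then have "(\<lambda>x. indicator Reg x *\<^sub>R dF (P x)) \<in> borel_measurable borel"
      using Reg(1) by (intro borel_measurable_continuous_on_indicator) auto
    then have 1: "(\<lambda>x. indicator Reg x *\<^sub>R dF (P x)) \<in> borel_measurable lebesgue"
      by (intro measurable_completion) simp
    have "(\<lambda>M :: real ^ 'n ^ 'm ^ 'n. M $ j) \<in> borel_measurable borel" by (intro borel_measurable_continuous_onI continuous_intros)
    from measurable_compose[OF Gm this] have 2: "(\<lambda>x. G x $ j) \<in> borel_measurable lebesgue" .
    have "(\<lambda>x. (indicator Reg x *\<^sub>R dF (P x)) \<bullet> G x $ j) \<in> borel_measurable lebesgue" by (rule borel_measurable_inner[OF 1 2])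
    then show ?thesis by (simp add: h_def)
  qed
  have hle: "\<bar>h j x\<bar> \<le> C * (indicator Reg x * (norm (P x) powr \<kappa> * norm (G x)))" for x
  proof (cases "x \<in> Reg")
    case True
    have "\<bar>dF (P x) \<bullet> G x $ j\<bar> \<le> (C * norm (P x) powr \<kappa>) * norm (G x)"
      using F(5)[of "P x"] True F(6) Finite_Cartesian_Product.norm_nth_le[of "G x" j]
      by (intro order_trans[OF Cauchy_Schwarz_ineq2] mult_mono) (auto simp: Reg_def)
    then show ?thesis using True by (simp add: h_def mult.assoc)
  qed (simp add: h_def)
  have hl: "h j \<in> locally_integrable W"
  proof (rule locally_integrableI)
    fix K assume K: "compact K" "K \<subseteq> W"
    show "integrable lebesgue (\<lambda>x. indicator K x * h j x)"
    proof (rule Bochner_Integration.integrable_bound[where f="\<lambda>x. C * (indicator K x * (indicator Reg x * (norm (P x) powr \<kappa> * norm (G x))))"])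
      show "integrable lebesgue (\<lambda>x. C * (indicator K x * (indicator Reg x * (norm (P x) powr \<kappa> * norm (G x)))))"
        using hessian_bound_first_power[OF hb K] by simp
      show "(\<lambda>x. indicator K x * h j x) \<in> borel_measurable lebesgue"
        by (intro borel_measurable_times borel_measurable_indicator compact_sets_lebesgue K hm)
      show "AE x in lebesgue. norm (indicator K x * h j x) \<le> norm (C * (indicator K x * (indicator Reg x * (norm (P x) powr \<kappa> * norm (G x)))))"
      proof (rule AE_I2)
        fix x show "norm (indicator K x * h j x) \<le> norm (C * (indicator K x * (indicator Reg x * (norm (P x) powr \<kappa> * norm (G x)))))"
          using hle[of x] F(6) by (cases "x \<in> K") (auto simp: abs_mult)
      qed
    qed
  qed
  show "h j \<in> Lp q \<Omega>'"
  proof -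
    have "integrable lebesgue (\<lambda>x. indicator \<Omega>' x *\<^sub>R \<bar>h j x\<bar> powr q)"
    proof (rule Bochner_Integration.integrable_bound[where f="\<lambda>x. C powr q * (indicator (closure \<Omega>') x * (indicator Reg x * (norm (P x) powr \<kappa> * norm (G x)) powr q))"])
      show "integrable lebesgue (\<lambda>x. C powr q * (indicator (closure \<Omega>') x * (indicator Reg x * (norm (P x) powr \<kappa> * norm (G x)) powr q)))"
        using hb(1) \<Omega>' by (simp add: hessian_bound_def)
      show "(\<lambda>x. indicator \<Omega>' x *\<^sub>R \<bar>h j x\<bar> powr q) \<in> borel_measurable lebesgue"
        using hm \<Omega>'(1) by (intro borel_measurable_scaleR borel_measurable_indicator open_lebesgue powr_real_measurable borel_measurable_abs) auto
      show "AE x in lebesgue. norm (indicator \<Omega>' x *\<^sub>R \<bar>h j x\<bar> powr q) \<le> 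
         norm (C powr q * (indicator (closure \<Omega>') x * (indicator Reg x * (norm (P x) powr \<kappa> * norm (G x)) powr q)))"
      proof (rule AE_I2)
        fix x
        have "\<bar>h j x\<bar> powr q \<le> (C * (indicator Reg x * (norm (P x) powr \<kappa> * norm (G x)))) powr q"
          using hle hb(2) by (intro powr_mono2) auto
        also have "\<dots> = C powr q * (indicator Reg x * (norm (P x) powr \<kappa> * norm (G x)) powr q)"
          using F(6) hb(2) by (cases "x \<in> Reg") (auto simp: powr_mult)
        finally show "norm (indicator \<Omega>' x *\<^sub>R \<bar>h j x\<bar> powr q) \<le> 
         norm (C powr q * (indicator (closure \<Omega>') x * (indicator Reg x * (norm (P x) powr \<kappa> * norm (G x)) powr q)))"
          using closure_subset[of \<Omega>'] by (cases "x \<in> \<Omega>'") auto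
      qed
    qed
    then have "integrable (lebesgue_on \<Omega>') (\<lambda>x. \<bar>h j x\<bar> powr q)"
      using \<Omega>'(1) by (subst integrable_restrict_space) auto
    then show ?thesis unfolding Lp_def using hm by (auto intro: measurable_restrict_space1)
  qed
  show ibp: "(LINT x|lebesgue. g x * \<phi>' x $ j) = - (LINT x|lebesgue. h j x * \<phi> x)" if \<phi>: "C1c W \<phi> \<phi>'" for \<phi> \<phi>'
  proof -
    have "(\<lambda>x. g x * \<phi>' x $ j) = (\<lambda>x. F (P x) * \<phi>' x $ j)"
    proof (rule ext)
      fix x show "g x * \<phi>' x $ j = F (P x) * \<phi>' x $ j"
        using g[of x] C1c_outside(2)[OF \<phi>, of x] by (cases "x \<in> W") auto
    qed
    moreover have "(LINT x|lebesgue. F (P x) * \<phi>' x $ j) = - (LINT x|lebesgue. (indicator Reg x * (dF (P x) \<bullet> G x $ j)) * \<phi> x)"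
      by (rule weak_chain_rule(1)[OF F(1,2,3,4,5,6) _ \<phi>]) (assumption | rule hessian_bound_first_power[OF hb])+
    ultimately show ?thesis unfolding h_def by metis
  qed
  show "has_weak_deriv \<Omega>' [j] g (h j)"
    unfolding has_weak_deriv_def
  proof (intro conjI ballI gl)
    show "h j \<in> locally_integrable \<Omega>'"
      by (rule locally_integrableI) (use locally_integrableD[OF hl] sub in blast)
    fix \<phi> assume t: "\<phi> \<in> test_functions \<Omega>'"
    note c = test_function_C1c[OF t]
    have "partial_deriv j \<phi> x = 0" if "x \<notin> \<Omega>'" for x
      using C1c_outside(2)[OF c that] by (simp add: vec_eq_iff)
    then show "(LINT x|lebesgue_on \<Omega>'. g x * iter_deriv [j] \<phi> x) = (- 1) ^ length [j] * (LINT x|lebesgue_on \<Omega>'. h j x * \<phi> x)"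
      using ibp[OF C1c_mono[OF c sub]] C1c_outside(1)[OF c] \<Omega>'(1) by (simp add: integral_lebesgue_on_eq)
  qed
qed

end

context flux_limit
begin

lemma flux_component_sobolev:
  assumes p32: "p > 3 / 2" and \<Omega>': "open \<Omega>'" "compact (closure \<Omega>')" "closure \<Omega>' \<subseteq> W"
    and g: "\<And>x. x \<in> W \<Longrightarrow> g x = p_flux p (P x) $ l $ k"
  shows "g \<in> sobolev 1 2 \<Omega>'"
proof -
  define E where "E = (axis l (axis k 1) :: real ^ 'n ^ 'm)"
  have E: "Q \<bullet> E = Q $ l $ k" for Q by (simp add: E_def inner_axis)
  have nE: "norm E = 1" by (simp add: E_def)
  have F1: "((\<lambda>Q. p_flux p Q $ l $ k) has_derivative (\<lambda>Y. dflux p Q E \<bullet> Y)) (at Q)" if "Q \<noteq> 0" for Q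
  proof -
    have "((\<lambda>Q. p_flux p Q \<bullet> E) has_derivative (\<lambda>Y. dflux p Q Y \<bullet> E)) (at Q)"
      by (rule bounded_linear.has_derivative[OF bounded_linear_inner_left has_derivative_p_flux[OF that]])
    \<comment> \<open>The differential of the flux is self-adjoint, being the Hessian of a power of
      the norm; this exhibits the derivative of one entry as an inner product with a fixed matrix
      field.\<close>
    moreover have "dflux p Q Y \<bullet> E = dflux p Q E \<bullet> Y" for Y
      by (simp add: dflux_def inner_add_left inner_add_right inner_commute)
    ultimately show ?thesis by (simp only: E)
  qed
  have F2: "continuous_on (- {0}) (\<lambda>Q. dflux p Q E)"
    using continuous_on_compose2[OF continuous_on_dflux[of p], of "- {0}" "\<lambda>Q. (Q, E)"] by (simp add: continuous_on_Pair image_subset_iff)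
  have F3: "continuous_on UNIV (\<lambda>Q :: real ^ 'n ^ 'm. p_flux p Q $ l $ k)"
    by (intro continuous_on_component continuous_on_p_flux p)
  have F4: "\<bar>p_flux p Q $ l $ k\<bar> \<le> (1 + \<bar>p - 2\<bar>) * norm Q powr ((p - 2) + 1)" for Q :: "real ^ 'n ^ 'm"
  proof -
    have "\<bar>p_flux p Q $ l $ k\<bar> \<le> norm (p_flux p Q)"
      using Cauchy_Schwarz_ineq2[of "p_flux p Q" E] nE by (simp add: E)
    also have "\<dots> = 1 * norm Q powr ((p - 2) + 1)" by (simp add: norm_p_flux)
    also have "\<dots> \<le> (1 + \<bar>p - 2\<bar>) * norm Q powr ((p - 2) + 1)" by (intro mult_right_mono) auto
    finally show ?thesis .
  qed
  have F5: "norm (dflux p Q E) \<le> (1 + \<bar>p - 2\<bar>) * norm Q powr (p - 2)" if "Q \<noteq> 0" for Q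
    using norm_dflux[of p Q E] by (simp add: nE)
  \<comment> \<open>For p < 2 the choice \<alpha> = 2 - p makes the exponent condition an equality,
    and \<alpha> < p - 1 is the hypothesis p > 3/2.\<close>
  have hb: "hessian_bound (p - 2) 2"
    by (rule hessian_bound_square[of "max 0 (2 - p)"]) (use p p32 in auto)
  note wd = weak_derivative_composition[where F="\<lambda>Q. p_flux p Q $ l $ k" and dF="\<lambda>Q. dflux p Q E",
      OF F1 F2 F3 F4 F5 _ hb _ \<Omega>' g, simplified]
  show ?thesis
    unfolding sobolev_def
  proof (intro CollectI allI impI)
    fix \<alpha> :: "'n list" assume "length \<alpha> \<le> 1"
    then consider "\<alpha> = []" | j where "\<alpha> = [j]" by (rule length_le_1_cases)
    then show "\<exists>h\<in>Lp 2 \<Omega>'. has_weak_deriv \<Omega>' \<alpha> g h"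
    proof cases
      case 1
      then show ?thesis using 1 wd(3) has_weak_deriv_self[OF wd(4)] by blast
    next
      case 2
      then show ?thesis using 2 wd(1)[of j] wd(2)[of j] by blast
    qed
  qed
qed

text \<open>Derivatives up to first order are classical. A second derivative is obtained by
  integrating by parts classically once, which leaves an entry of \<open>P\<close>, and then weakly
  for that entry.\<close>

lemma component_sobolev2:
  assumes hb: "hessian_bound 0 q" "q \<ge> 1" and \<Omega>': "open \<Omega>'" "compact (closure \<Omega>')" "closure \<Omega>' \<subseteq> W"
    and g: "\<And>x. x \<in> W \<Longrightarrow> (g has_derivative (\<lambda>v. P x $ l \<bullet> v)) (at x)"
  shows "g \<in> sobolev 2 q \<Omega>'"
  unfolding sobolev_def
proof (intro CollectI allI impI)
  have sub: "\<Omega>' \<subseteq> W" using \<Omega>'(3) closure_subset by blast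
  have cg: "continuous_on W g"
    using g W by (intro continuous_at_imp_continuous_on ballI has_derivative_continuous)
  have cPl: "continuous_on S (\<lambda>x. P x $ l)" for S
    by (intro continuous_on_component continuous_on_subset[OF cP]) auto
  fix \<alpha> :: "'n list" assume "length \<alpha> \<le> 2"
  then consider "\<alpha> = []" | j where "\<alpha> = [j]" | i j where "\<alpha> = [i, j]"
    by (auto simp: numeral_2_eq_2 le_Suc_eq length_Suc_conv)
  then show "\<exists>h\<in>Lp q \<Omega>'. has_weak_deriv \<Omega>' \<alpha> g h"
  proof cases
    case 1
    have "g \<in> Lp q \<Omega>'" by (rule continuous_Lp[OF cg \<Omega>']) (use hb in simp)
    then show ?thesis
      using 1 has_weak_deriv_self[OF continuous_locally_integrable[OF continuous_on_subset[OF cg sub]]] by blast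
  next
    case 2
    have "continuous_on W (\<lambda>x. P x $ l $ j)" by (intro continuous_on_component cPl)
    then have "(\<lambda>x. P x $ l $ j) \<in> Lp q \<Omega>'" by (rule continuous_Lp[OF _ \<Omega>']) (use hb in simp)
    moreover have "has_weak_deriv \<Omega>' [j] g (\<lambda>x. P x $ l $ j)"
      by (rule has_weak_deriv_C1[OF \<Omega>'(1) g cPl]) (use sub in auto)
    ultimately show ?thesis using 2 by blast
  next
    case 3
    define E where "E = (axis l (axis i 1) :: real ^ 'n ^ 'm)"
    have E: "E \<bullet> Q = Q $ l $ i" for Q by (simp add: E_def inner_axis')
    have nE: "norm E = 1" by (simp add: E_def)
    have F1: "((\<lambda>Q. Q $ l $ i) has_derivative (\<lambda>Y. E \<bullet> Y)) (at Q)" for Q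
      unfolding E[symmetric] by (auto intro!: derivative_eq_intros)
    have F3: "continuous_on UNIV (\<lambda>Q :: real ^ 'n ^ 'm. Q $ l $ i)" by (intro continuous_intros)
    have F4: "\<bar>Q $ l $ i\<bar> \<le> 1 * norm Q powr (0 + 1)" for Q :: "real ^ 'n ^ 'm"
      using Cauchy_Schwarz_ineq2[of E Q] nE by (simp add: E)
    \<comment> \<open>\<open>0 powr 0\<close> is 0, so with \<kappa> = 0 the bound can hold only off
      the origin.\<close>
    have F5: "norm E \<le> 1 * norm Q powr 0" if "Q \<noteq> 0" for Q :: "real ^ 'n ^ 'm"
      using that by (simp add: nE)
    define h where "h j x = indicator Reg x * (E \<bullet> G x $ j)" for j x
    note wd = weak_derivative_composition[where F="\<lambda>Q. Q $ l $ i" and dF="\<lambda>Q. E" and g="\<lambda>x. P x $ l $ i",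
        OF F1 continuous_on_const F3 F4 F5 _ hb \<Omega>' refl, folded h_def, simplified]
    have "has_weak_deriv \<Omega>' [i, j] g (h j)"
      unfolding has_weak_deriv_def
    proof (intro conjI ballI)
      show "g \<in> locally_integrable \<Omega>'"
        by (rule continuous_locally_integrable[OF continuous_on_subset[OF cg sub]])
      show "h j \<in> locally_integrable \<Omega>'" using wd(1)[of j] by (simp add: has_weak_deriv_def)
      fix \<phi> assume t: "\<phi> \<in> test_functions \<Omega>'"
      \<comment> \<open>In \<open>iter_deriv [i, j]\<close> the derivative in direction j acts
        first. Treating it as a new test function leaves the direction i for the classical step; the
        two signs cancel.\<close>
      define \<psi> where "\<psi> = partial_deriv j \<phi>"
      have t': "\<psi> \<in> test_functions \<Omega>'" unfolding \<psi>_def by (rule test_function_partial[OF t])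
      note c = test_function_C1c[OF t] and c' = test_function_C1c[OF t']
      have "partial_deriv i \<psi> x = 0" if "x \<notin> \<Omega>'" for x
        using C1c_outside(2)[OF c' that] by (simp add: vec_eq_iff)
      then have "(LINT x|lebesgue_on \<Omega>'. g x * iter_deriv [i, j] \<phi> x) = (LINT x|lebesgue. g x * partial_deriv i \<psi> x)"
        using \<Omega>'(1) by (simp add: integral_lebesgue_on_eq \<psi>_def)
      also have "\<dots> = - (LINT x|lebesgue. P x $ l $ i * \<psi> x)"
        using integral_by_parts_C1c[OF c' \<Omega>'(1) g cPl, of i] sub by (auto simp: subset_iff)
      also have "\<dots> = (LINT x|lebesgue. h j x * \<phi> x)"
        using wd(5)[OF C1c_mono[OF c sub], of j] by (simp add: \<psi>_def)
      also have "\<dots> = (LINT x|lebesgue_on \<Omega>'. h j x * \<phi> x)"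
        using C1c_outside(1)[OF c] \<Omega>'(1) by (simp add: integral_lebesgue_on_eq)
      finally show "(LINT x|lebesgue_on \<Omega>'. g x * iter_deriv [i, j] \<phi> x)
          = (- 1) ^ length [i, j] * (LINT x|lebesgue_on \<Omega>'. h j x * \<phi> x)" by simp
    qed
    then show ?thesis using wd(2)[of j] 3 by blast
  qed
qed

end

section \<open>Localization and conclusion\<close>

text \<open>u is replaced by \<eta> u, which is C^1 on the whole space and compactly supported, so
  that difference quotients are defined everywhere. The equation survives only on \<open>W\<close>,
  where \<eta> = 1, and all test fields are kept there.\<close>

lemma interior_flux_core:
  fixes u f :: "real ^ 'n::finite \<Rightarrow> real ^ 'm::finite"
  assumes \<Omega>: "open \<Omega>" and p: "p > 1" and f: "f \<in> componentwise (sobolev_loc 1 1 \<Omega>)"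
    and u: "u \<in> Ck_on 1 \<Omega>" and weak: "weak_solution p \<Omega> f u"
    and K0: "compact K0" "K0 \<subseteq> \<Omega>"
  obtains W Ku ut P \<Gamma> where "flux_core p W Ku ut P \<Gamma>" "K0 \<subseteq> W" "W \<subseteq> \<Omega>"
    "\<And>x. x \<in> W \<Longrightarrow> P x = jacobian u (at x)"
    "\<And>l \<phi> \<phi>'. C1c W \<phi> \<phi>' \<Longrightarrow> integrable lebesgue (\<lambda>x. f x $ l * \<phi> x)"
    "\<And>l \<phi> \<phi>'. C1c W \<phi> \<phi>' \<Longrightarrow> (LINT x|lebesgue. p_flux p (P x) $ l \<bullet> \<phi>' x) = (LINT x|lebesgue. f x $ l * \<phi> x)"
proof -
  obtain \<psi> \<psi>' where \<psi>: "C1c \<Omega> \<psi> \<psi>'" "\<And>x. x \<in> K0 \<Longrightarrow> \<psi> x = 1"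
    using C1c_cutoff[OF K0(1) \<Omega> K0(2)] by metis
  obtain S where S: "compact S" "S \<subseteq> \<Omega>" "\<And>x. x \<notin> S \<Longrightarrow> \<psi> x = 0"
    using C1c_support[OF \<psi>(1)] by metis
  \<comment> \<open>Level sets of the first cutoff give an open set with compact closure inside
    \<Omega>, and the closed set \<open>K1\<close> around it on which the second cutoff \<eta>
    equals 1.\<close>
  define W where "W = {x. \<psi> x > 1 / 2}"
  define K1 where "K1 = {x. \<psi> x \<ge> 1 / 2}"
  have W: "open W" unfolding W_def by (intro open_Collect_less C1cD(3)[OF \<psi>(1)] continuous_intros)
  have "closed K1" unfolding K1_def by (intro closed_Collect_le C1cD(3)[OF \<psi>(1)] continuous_intros)
  moreover have K1S: "K1 \<subseteq> S" using S(3) by (force simp: K1_def)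
  ultimately have K1: "compact K1" using S(1) by (meson compact_if_closed_subset)
  have WK1: "W \<subseteq> K1" by (auto simp: W_def K1_def)
  have "closure W \<subseteq> K1" using WK1 \<open>closed K1\<close> by (rule closure_minimal)
  then have cW: "compact (closure W)" "closure W \<subseteq> \<Omega>"
    using compact_if_closed_subset[OF K1 closed_closure] K1S S(2) by blast+
  have W\<Omega>: "W \<subseteq> \<Omega>" using cW(2) closure_subset by blast
  obtain \<eta> \<eta>' where \<eta>: "C1c \<Omega> \<eta> \<eta>'" "\<And>x. x \<in> K1 \<Longrightarrow> \<eta> x = 1"
    using C1c_cutoff[OF K1 \<Omega>] K1S S(2) by (metis order_trans)
  obtain Ku where Ku: "compact Ku" "Ku \<subseteq> \<Omega>" "\<And>x. x \<notin> Ku \<Longrightarrow> \<eta> x = 0" "\<And>x. x \<notin> Ku \<Longrightarrow> \<eta>' x = 0"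
    using C1c_support[OF \<eta>(1)] by metis
  define J where "J x = jacobian u (at x)" for x
  note J = Ck_on_1_jacobian[OF u, folded J_def]
  define ut where "ut x = \<eta> x *\<^sub>R u x" for x
  define P where "P x = \<eta> x *\<^sub>R J x + outer (u x) (\<eta>' x)" for x
  have row: "C1c \<Omega> (\<lambda>x. ut x $ l) (\<lambda>x. P x $ l)" for l
  proof -
    have "C1c \<Omega> (\<lambda>x. \<eta> x * u x $ l) (\<lambda>x. \<eta> x *\<^sub>R J x $ l + u x $ l *\<^sub>R \<eta>' x)"
      by (rule C1c_mult_local[OF \<eta>(1) \<Omega> order_refl]) (auto intro: has_derivative_matrix_row J continuous_on_component)
    then show ?thesis by (simp add: ut_def P_def outer_def)
  qed
  have du: "(ut has_derivative (\<lambda>v. P x *v v)) (at x)" for x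
    unfolding has_derivative_componentwise_within[of ut]
    using C1cD(1)[OF row] by (auto simp: Basis_vec_def inner_axis matrix_vector_mul_component)
  have cP: "continuous_on UNIV P"
  proof -
    have "continuous_on UNIV (\<lambda>x. \<chi> l. P x $ l)" by (intro continuous_on_vec_lambda C1cD(2)[OF row])
    then show ?thesis by simp
  qed
  have P0: "P x = 0" if "x \<notin> Ku" for x using Ku(3,4)[OF that] by (simp add: P_def outer_def vec_eq_iff)
  have PJ: "P x = J x" if "x \<in> W" for x
  proof -
    have "(u has_derivative (\<lambda>v. P x *v v)) (at x)"
      by (rule has_derivative_transform_within_open[OF du W that]) (use \<eta>(2) WK1 in \<open>auto simp: ut_def\<close>)
    then have "(\<lambda>v. P x *v v) = (\<lambda>v. J x *v v)" using J(1) that W\<Omega> by (blast intro: has_derivative_unique)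
    then show ?thesis by (simp add: matrix_eq fun_eq_iff)
  qed
  have E: "integrable lebesgue (\<lambda>x. f x $ l * \<phi> x)"
      "(LINT x|lebesgue. p_flux p (P x) $ l \<bullet> \<phi>' x) = (LINT x|lebesgue. f x $ l * \<phi> x)" if \<phi>: "C1c W \<phi> \<phi>'" for l \<phi> \<phi>'
  proof -
    note w = weak_solution_C1c[OF \<Omega> u weak p C1c_mono[OF \<phi> W\<Omega>], of l, folded J_def]
    show "integrable lebesgue (\<lambda>x. f x $ l * \<phi> x)" by (rule w(1))
    have "(\<lambda>x. p_flux p (P x) $ l \<bullet> \<phi>' x) = (\<lambda>x. p_flux p (J x) $ l \<bullet> \<phi>' x)"
    proof (rule ext)
      fix x show "p_flux p (P x) $ l \<bullet> \<phi>' x = p_flux p (J x) $ l \<bullet> \<phi>' x"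
        using PJ[of x] C1c_outside(2)[OF \<phi>, of x] by (cases "x \<in> W") auto
    qed
    then show "(LINT x|lebesgue. p_flux p (P x) $ l \<bullet> \<phi>' x) = (LINT x|lebesgue. f x $ l * \<phi> x)" using w(2) by simp
  qed
  define h where "h l i = (SOME h. h \<in> Lp 1 W \<and> has_weak_deriv W [i] (\<lambda>x. f x $ l) h)" for l i
  have h: "h l i \<in> Lp 1 W" "has_weak_deriv W [i] (\<lambda>x. f x $ l) (h l i)" for l i
  proof -
    have "(\<lambda>x. f x $ l) \<in> sobolev 1 1 W" using f W cW by (auto simp: componentwise_vec sobolev_loc_def)
    then have "\<forall>\<alpha>. length \<alpha> \<le> 1 \<longrightarrow> (\<exists>h\<in>Lp 1 W. has_weak_deriv W \<alpha> (\<lambda>x. f x $ l) h)"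
      unfolding sobolev_def by (rule CollectD)
    from this[rule_format, of "[i]"] have "\<exists>h. h \<in> Lp 1 W \<and> has_weak_deriv W [i] (\<lambda>x. f x $ l) h" by auto
    from someI_ex[OF this] show "h l i \<in> Lp 1 W" "has_weak_deriv W [i] (\<lambda>x. f x $ l) (h l i)"
      unfolding h_def by blast+
  qed
  \<comment> \<open>Extension by zero makes the weak derivative integrable on the whole space;
    against test functions supported in \<open>W\<close> nothing changes.\<close>
  define H where "H l i x = indicator W x * h l i x" for l i x
  have H: "integrable lebesgue (H l i)" for l i
  proof -
    have "integrable (lebesgue_on W) (\<lambda>x. \<bar>h l i x\<bar>)" "h l i \<in> borel_measurable (lebesgue_on W)"
      using h(1)[of l i] by (auto simp: Lp_def)
    then have "integrable (lebesgue_on W) (h l i)" by (simp add: integrable_abs_iff)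
    then show ?thesis using W by (subst (asm) integrable_restrict_space) (auto simp: H_def[abs_def])
  qed
  have D: "(LINT x|lebesgue. f x $ l * \<phi>' x $ i) = - (LINT x|lebesgue. H l i x * \<phi> x)" if \<phi>: "C1c W \<phi> \<phi>'" for l i \<phi> \<phi>'
  proof -
    have "(\<lambda>x. H l i x * \<phi> x) = (\<lambda>x. h l i x * \<phi> x)"
      using C1c_outside(1)[OF \<phi>] by (auto simp: fun_eq_iff H_def indicator_def)
    then show ?thesis using has_weak_deriv_C1c[OF W h(2) \<phi>] by simp
  qed
  \<comment> \<open>Summing over all rows and directions gives one constant for every direction of
    the quotient; adding further nonnegative terms does no harm.\<close>
  define \<Gamma> where "\<Gamma> = (\<Sum>l\<in>UNIV. \<Sum>i\<in>UNIV. LINT x|lebesgue. \<bar>H l i x\<bar>)"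
  have cA: "continuous_on UNIV (\<lambda>x. p_flux p (P x))" by (rule continuous_on_compose2[OF continuous_on_p_flux[OF p] cP]) auto
  have core: "flux_core p W Ku ut P \<Gamma>"
  proof (rule flux_core.intro[OF p W du cP Ku(1) P0])
    show "\<Gamma> \<ge> 0" unfolding \<Gamma>_def by (intro sum_nonneg integral_nonneg_AE) auto
    fix K assume K: "compact K" "K \<subseteq> W"
    define good where "good l i n \<longleftrightarrow> (\<forall>\<phi> \<phi>' B. C1c K \<phi> \<phi>' \<longrightarrow> (\<forall>x. \<bar>\<phi> x\<bar> \<le> B) \<longrightarrow>
       \<bar>LINT x|lebesgue. DQ n i (\<lambda>x. p_flux p (P x) $ l) x \<bullet> \<phi>' x\<bar> \<le> B * (LINT x|lebesgue. \<bar>H l i x\<bar>))" for l i n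
    have "\<exists>N. \<forall>n\<ge>N. good l i n" for l i
      unfolding good_def by (rule difference_test[OF W _ E(2) E(1) D H K]) (rule continuous_on_component[OF cA])
    then obtain N where N: "\<And>l i n. n \<ge> N l i \<Longrightarrow> good l i n" by metis
    \<comment> \<open>The threshold for the step depends on row and direction, of which there are
      finitely many.\<close>
    define N0 where "N0 = Max (range (\<lambda>z. N (fst z) (snd z)))"
    have N0: "N l i \<le> N0" for l i unfolding N0_def using rangeI[of "\<lambda>z. N (fst z) (snd z)" "(l, i)"] by (intro Max_ge) auto
    show "\<exists>N. \<forall>n\<ge>N. \<forall>i \<Phi> \<Phi>' B. C1cv K \<Phi> \<Phi>' \<longrightarrow> (\<forall>x. norm (\<Phi> x) \<le> B) \<longrightarrow>
        (LINT x|lebesgue. DQ n i (\<lambda>x. p_flux p (P x)) x \<bullet> \<Phi>' x) \<le> B * \<Gamma>"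
    proof (intro exI[of _ N0] allI impI)
      fix n i \<Phi> \<Phi>' B assume n: "N0 \<le> n" and \<Phi>: "C1cv K \<Phi> \<Phi>'" and B: "\<forall>x. norm (\<Phi> x :: real ^ 'm) \<le> B"
      have B0: "B \<ge> 0" using B norm_ge_zero order_trans by blast
      have \<Phi>l: "C1c K (\<lambda>x. \<Phi> x $ l) (\<lambda>x. \<Phi>' x $ l)" for l using \<Phi> by (simp add: C1cv_def)
      define a where "a l = DQ n i (\<lambda>x. p_flux p (P x) $ l)" for l
      have int: "integrable lebesgue (\<lambda>x. a l x \<bullet> \<Phi>' x $ l)" for l
      proof (rule integrable_lebesgue_cc[OF _ K(1)])
        show "continuous_on UNIV (\<lambda>x. a l x \<bullet> \<Phi>' x $ l)"
          unfolding a_def by (intro continuous_on_inner C1cD(2)[OF \<Phi>l] continuous_on_DQ continuous_on_component[OF cA])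
      qed (use C1c_outside(2)[OF \<Phi>l] in auto)
      have "(LINT x|lebesgue. DQ n i (\<lambda>x. p_flux p (P x)) x \<bullet> \<Phi>' x) = (LINT x|lebesgue. (\<Sum>l\<in>UNIV. a l x \<bullet> \<Phi>' x $ l))"
        by (simp add: inner_vec_def[where 'a="real ^ 'n"] a_def DQ_def del: of_nat_Suc)
      also have "\<dots> = (\<Sum>l\<in>UNIV. LINT x|lebesgue. a l x \<bullet> \<Phi>' x $ l)" using int by simp
      also have "\<dots> \<le> (\<Sum>l\<in>UNIV. B * (\<Sum>i\<in>UNIV. LINT x|lebesgue. \<bar>H l i x\<bar>))"
      proof (rule sum_mono)
        fix l
        have "\<bar>\<Phi> x $ l\<bar> \<le> B" for x using B component_le_norm_cart[of "\<Phi> x" l] order_trans by blast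
        then have "(LINT x|lebesgue. a l x \<bullet> \<Phi>' x $ l) \<le> B * (LINT x|lebesgue. \<bar>H l i x\<bar>)"
          using N[OF order_trans[OF N0 n], of l i, unfolded good_def] \<Phi>l unfolding a_def by (meson abs_le_D1)
        also have "\<dots> \<le> B * (\<Sum>i\<in>UNIV. LINT x|lebesgue. \<bar>H l i x\<bar>)"
          using B0 by (intro mult_left_mono member_le_sum) auto
        finally show "(LINT x|lebesgue. a l x \<bullet> \<Phi>' x $ l) \<le> B * (\<Sum>i\<in>UNIV. LINT x|lebesgue. \<bar>H l i x\<bar>)" .
      qed
      also have "\<dots> = B * \<Gamma>" by (simp add: \<Gamma>_def sum_distrib_left)
      finally show "(LINT x|lebesgue. DQ n i (\<lambda>x. p_flux p (P x)) x \<bullet> \<Phi>' x) \<le> B * \<Gamma>" .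
    qed
  qed
  have "K0 \<subseteq> W" using \<psi>(2) by (auto simp: W_def)
  from that[OF core this W\<Omega> PJ[unfolded J_def] E] show thesis .
qed

theorem theorem2p1:
  fixes \<Omega> :: "(real ^ 'n::finite) set"
    and f u :: "real ^ 'n \<Rightarrow> real ^ 'm::finite"
    and p \<beta> :: real
  assumes "CARD('n) \<ge> 2" and "CARD('m) \<ge> 2"
    and "bounded_smooth_domain \<Omega>"
    and "p > 1" and "0 < \<beta>" and "\<beta> < 1"
    and "f \<in> componentwise (sobolev_loc 1 1 \<Omega>)"
    and "f \<in> componentwise (holder_loc \<beta> \<Omega>)"
    and "u \<in> Ck_on 1 \<Omega>"
    and "weak_solution p \<Omega> f u"
  shows "(p > 3 / 2 \<longrightarrow>
            (\<lambda>x. p_flux p (jacobian u (at x))) \<in> componentwise (sobolev_loc 1 2 \<Omega>))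
       \<and> (p < 3 \<longrightarrow> u \<in> componentwise (sobolev_loc 2 2 \<Omega>))
       \<and> (p \<ge> 3 \<and> (\<exists>i \<tau>. \<tau> > 0 \<and> (\<forall>x\<in>\<Omega>. f x $ i \<ge> \<tau>)) \<longrightarrow>
            (\<forall>q. 1 \<le> q \<and> q < (p - 1) / (p - 2) \<longrightarrow> u \<in> componentwise (sobolev_loc 2 q \<Omega>)))"
proof -
  have \<Omega>: "open \<Omega>" using assms(3) by (simp add: bounded_smooth_domain_def)
  \<comment> \<open>Local membership is tested on one subdomain at a time; its compact closure is
    the set around which the solution is localized.\<close>
  have local: "(p > 3 / 2 \<longrightarrow> (\<forall>l k. (\<lambda>x. p_flux p (jacobian u (at x)) $ l $ k) \<in> sobolev 1 2 \<Omega>'))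
       \<and> (p < 3 \<longrightarrow> (\<forall>l. (\<lambda>x. u x $ l) \<in> sobolev 2 2 \<Omega>'))
       \<and> (p \<ge> 3 \<and> (\<exists>i \<tau>. \<tau> > 0 \<and> (\<forall>x\<in>\<Omega>. f x $ i \<ge> \<tau>)) \<longrightarrow>
            (\<forall>q. 1 \<le> q \<and> q < (p - 1) / (p - 2) \<longrightarrow> (\<forall>l. (\<lambda>x. u x $ l) \<in> sobolev 2 q \<Omega>')))"
    if \<Omega>': "open \<Omega>'" "compact (closure \<Omega>')" "closure \<Omega>' \<subseteq> \<Omega>" for \<Omega>'
  proof -
    obtain W Ku ut P \<Gamma> where core: "flux_core p W Ku ut P \<Gamma>" and sub: "closure \<Omega>' \<subseteq> W" "W \<subseteq> \<Omega>"
      and PJ: "\<And>x. x \<in> W \<Longrightarrow> P x = jacobian u (at x)"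
      and E: "\<And>l \<phi> \<phi>'. C1c W \<phi> \<phi>' \<Longrightarrow> integrable lebesgue (\<lambda>x. f x $ l * \<phi> x)"
        "\<And>l \<phi> \<phi>'. C1c W \<phi> \<phi>' \<Longrightarrow> (LINT x|lebesgue. p_flux p (P x) $ l \<bullet> \<phi>' x) = (LINT x|lebesgue. f x $ l * \<phi> x)"
      by (rule interior_flux_core[OF \<Omega> assms(4,7,9,10) \<Omega>'(2,3)], rule that)
    interpret flux_core p W Ku ut P \<Gamma> by (rule core)
    obtain r G where "flux_limit p W Ku ut P \<Gamma> r G" using flux_limit_exists by blast
    then interpret flux_limit p W Ku ut P \<Gamma> r G .
    have ul: "((\<lambda>x. u x $ l) has_derivative (\<lambda>v. P x $ l \<bullet> v)) (at x)" if "x \<in> W" for x l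
      using that sub(2) Ck_on_1_jacobian(1)[OF assms(9)] unfolding PJ[OF that] by (intro has_derivative_matrix_row) auto
    note comp = component_sobolev2[OF _ _ \<Omega>'(1,2) sub(1) ul]
    show ?thesis
    proof (intro conjI impI allI)
      fix l k assume "p > 3 / 2"
      then show "(\<lambda>x. p_flux p (jacobian u (at x)) $ l $ k) \<in> sobolev 1 2 \<Omega>'"
        by (rule flux_component_sobolev[OF _ \<Omega>'(1,2) sub(1)]) (simp add: PJ)
    next
      fix l assume "p < 3"
      \<comment> \<open>For p \<ge> 2 the choice \<alpha> = p - 2 removes the weight altogether, and
        p < 3 is the condition \<alpha> < 1; for p < 2 the weight of exponent p - 2 is already
        bounded below.\<close>
      then have "hessian_bound 0 2" by (intro hessian_bound_square[of "max 0 (p - 2)"]) (use p in auto)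
      then show "(\<lambda>x. u x $ l) \<in> sobolev 2 2 \<Omega>'" by (rule comp) simp
    next
      fix q l assume *: "p \<ge> 3 \<and> (\<exists>i \<tau>. \<tau> > 0 \<and> (\<forall>x\<in>\<Omega>. f x $ i \<ge> \<tau>))" "1 \<le> q \<and> q < (p - 1) / (p - 2)"
      then obtain i \<tau> where \<tau>: "\<tau> > 0" "\<And>x. x \<in> \<Omega> \<Longrightarrow> f x $ i \<ge> \<tau>" by blast
      have "hessian_bound 0 q"
        by (rule hessian_bound_inverse[OF E(1)[of _ _ i] E(2)[of _ _ i, folded A_def] \<tau>(1)]) (use * \<tau>(2) sub(2) in auto)
      then show "(\<lambda>x. u x $ l) \<in> sobolev 2 q \<Omega>'" by (rule comp) (use * in simp)
    qed
  qed
  then show ?thesis unfolding componentwise_vec componentwise_matrix sobolev_loc_def by blast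
qed

end
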